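(* For each $n$, let $\gamma_n>0$ and let $I_n\subset[0,2\pi)$ be an interval. Let $\mathcal{G}_n$ be the random variable which counts the number of pairs of $CUE_n$ eigenvalues whose average is in $I_n$ and whose difference is at most $\gamma_n$. Let $G_{\mu_n}$ be a Poisson random variable with mean $$\mu_n=\frac{|I_n|\gamma_n^3n^4}{144\pi^2}.$$ Then for all integers $k\ge1$, as $n\to\infty$, $$E(\mathcal{G}_n^k)=E(G_{\mu_n}^k)\left(1+O\left(n^{-1}+\gamma_n^2n^2+(\gamma_n^2n^2)^3+(n|I_n|)^{-2/3}\right)\right),$$ where the constant implied by $O$ depends only on $k$.
   Context: $CUE_n$ (circular unitary ensemble) is the compact group $U(n)$ of $n\times n$ unitary matrices with normalized Haar measure. Its eigenvalues $e^{i t_1},\dots,e^{i t_n}$ are identified with their angles $t_1,\dots,t_n\in[0,2\pi)$. $\mathcal{G}_n$ counts unordered pairs $\{i,j\}$, $i\neq j$, with $\frac{t_i+t_j}{2}\in I_n$ and $|t_i-t_j|\le\gamma_n$. $|I_n|$ denotes the length of $I_n$. *)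

theory Defs
  imports
    "HOL-Probability.Probability"
    "Jordan_Normal_Form.Char_Poly"
    "Jordan_Normal_Form.Schur_Decomposition"
begin

definition unitary_group :: "nat \<Rightarrow> complex mat set" where
  "unitary_group n = {A \<in> carrier_mat n n. mat_adjoint A * A = 1\<^sub>m n \<and> A * mat_adjoint A = 1\<^sub>m n}"

text \<open>
  The Borel sigma-algebra of \<open>U(n)\<close> as a subspace of the \<open>n \<times> n\<close> complex matrices. That space is
  second countable, so its Borel sets are generated by the preimages of open sets under the entries.
\<close>

definition unitary_borel :: "nat \<Rightarrow> complex mat measure" where
  "unitary_borel n = sigma (unitary_group n)
     {{A \<in> unitary_group n. A $$ (i, j) \<in> S} | i j S. i < n \<and> j < n \<and> open S}"

text \<open>
  Normalized Haar measure of the compact group \<open>U(n)\<close>: the Borel probability measure invariant under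
  left translations. These properties determine it uniquely, and it is then also right invariant.
\<close>

definition normalized_haar :: "nat \<Rightarrow> complex mat measure \<Rightarrow> bool" where
  "normalized_haar n M \<longleftrightarrow>
     prob_space M \<and> space M = unitary_group n \<and> sets M = sets (unitary_borel n) \<and>
     (\<forall>U \<in> unitary_group n. \<forall>B \<in> sets M. measure M ((\<lambda>A. U * A) ` B) = measure M B)"

text \<open>
  The angles in \<open>[0, 2\<pi>)\<close> of all eigenvalues, listed with algebraic multiplicity. The order of the
  list is immaterial below.
\<close>

definition eigenangles :: "complex mat \<Rightarrow> real list" where
  "eigenangles A = sorted_list_of_multiset (image_mset Arg2pi (proots (char_poly A)))"

definition close_pairs :: "real set \<Rightarrow> real \<Rightarrow> complex mat \<Rightarrow> nat" where
  "close_pairs I \<gamma> A = (let t = eigenangles A in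
     card {{i, j} | i j. i < length t \<and> j < length t \<and> i \<noteq> j \<and>
                         (t ! i + t ! j) / 2 \<in> I \<and> \<bar>t ! i - t ! j\<bar> \<le> \<gamma>})"

end

theory Submission
  imports Defs "HOL-Combinatorics.Stirling"
begin

text \<open>
  Invariance of Haar measure under rotation of one direction gives, by differentiation, loop equations for
  the mixed power sums of the eigenvalues. They determine all mixed moments recursively, and the density
  \<open>\<bar>\<Delta>(z)\<bar>\<^sup>2\<close> on the torus satisfies the same equations, so the eigenvalues have
  the correlation functions \<open>\<rho>\<^sub>r = det (\<Sum>l<n. (z\<^sub>i / z\<^sub>j)\<^sup>l)\<close>. These are Gram
  determinants: subtracting from each vector a neighbouring one makes \<open>\<rho>\<^sub>r\<close> small when points
  cluster, and far apart clusters nearly decouple.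

  The \<open>k\<close>-th power of the number of close pairs is, with Stirling numbers as coefficients, a
  combination of counts of \<open>c\<close> disjoint close pairs up to counts of configurations in which two
  pairs share a point. The latter are of smaller order by clustering; the former have expectation
  close to \<open>\<mu>\<^sup>c\<close> by decoupling and the explicit two point function, and the factorial moments of the
  Poisson distribution are exactly \<open>\<mu>\<^sup>c\<close>.
\<close>

text \<open>Haar measure enters only through left invariance: no coordinates on U(n) and no Weyl
  integration formula are used. The recursion closes because a loop equation moves two exponents
  towards each other, which lowers the sum of their squares; all moments with n exponents are thus
  fixed by the one with all exponents zero.

  The exponent -2/3 comes from a cutoff L between near and far pairs. At distance at least L/n
  decoupling costs L^(-2), since a permutation that crosses two blocks uses two small entries;
  nearer pairs contribute, relative to the mean, a multiple of L/(n|I|). The choice L = (n|I|)^(1/3)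
  makes both equal. The constant 144 pi^2 is 2, for unordered pairs, times 72 pi^2, which results
  from the density 1/(4 pi^2), the two point function n^4 d^2/12 near the diagonal and the integral
  of d^2 over [-\<gamma>, \<gamma>].

  The error has to be relative although the mean may tend to 0 or to infinity. Hence every error is
  bounded by powers mu^j with 1 \<le> j \<le> k, all of which are dominated by the Poisson
  moment.\<close>

declare index_mult_mat(1) [simp del]

section \<open>Unitary matrices and translation invariance of Haar measure\<close>

lemma mat_adjoint_index:
  assumes "A \<in> carrier_mat n m" "i < m" "j < n"
  shows "mat_adjoint A $$ (i, j) = cnj ((A :: complex mat) $$ (j, i))"
  using assms by (auto simp: mat_adjoint_def mat_of_rows_def)

lemma mat_adjoint_carrier: "A \<in> carrier_mat n n \<Longrightarrow> mat_adjoint (A :: complex mat) \<in> carrier_mat n n"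
  by (auto simp: mat_adjoint_def)

lemma mult_mat_index:
  fixes A B :: "'a :: comm_semiring_0 mat"
  assumes "A \<in> carrier_mat n m" "B \<in> carrier_mat m l" "i < n" "j < l"
  shows "(A * B) $$ (i, j) = (\<Sum>k<m. A $$ (i, k) * B $$ (k, j))"
  using assms by (simp add: index_mult_mat(1) scalar_prod_def lessThan_atLeast0)

lemma unitary_group_iff:
  "A \<in> unitary_group n \<longleftrightarrow> A \<in> carrier_mat n n \<and>
     (\<forall>i<n. \<forall>j<n. (\<Sum>k<n. cnj (A $$ (k, i)) * A $$ (k, j)) = of_bool (i = j)) \<and>
     (\<forall>i<n. \<forall>j<n. (\<Sum>k<n. A $$ (i, k) * cnj (A $$ (j, k))) = of_bool (i = j))"
proof (cases "A \<in> carrier_mat n n")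
  case A: True
  have 1: "(mat_adjoint A * A) $$ (i, j) = (\<Sum>k<n. cnj (A $$ (k, i)) * A $$ (k, j))"
    "(A * mat_adjoint A) $$ (i, j) = (\<Sum>k<n. A $$ (i, k) * cnj (A $$ (j, k)))"
    if "i < n" "j < n" for i j
    using that A mat_adjoint_carrier[OF A] mat_adjoint_index[OF A]
    by (simp_all add: mult_mat_index[of _ n n _ n])
  have "X = 1\<^sub>m n \<longleftrightarrow> (\<forall>i<n. \<forall>j<n. X $$ (i,j) = of_bool (i = j))" if "X \<in> carrier_mat n n" for X :: "complex mat"
    using that by (auto simp: mat_eq_iff)
  from this[of "mat_adjoint A * A"] this[of "A * mat_adjoint A"] show ?thesis
    using A mat_adjoint_carrier[OF A] 1 by (auto simp: unitary_group_def)
qed (auto simp: unitary_group_def)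

lemma unitary_carrier: "A \<in> unitary_group n \<Longrightarrow> A \<in> carrier_mat n n"
  by (simp add: unitary_group_def)

lemma mat_adjoint_mult:
  assumes "A \<in> carrier_mat n n" "B \<in> carrier_mat n n"
  shows "mat_adjoint (A * B :: complex mat) = mat_adjoint B * mat_adjoint A"
proof (rule eq_matI)
  fix i j assume *: "i < dim_row (mat_adjoint B * mat_adjoint A)" "j < dim_col (mat_adjoint B * mat_adjoint A)"
  then have ij: "i < n" "j < n" using assms mat_adjoint_carrier by (auto simp: mat_adjoint_def)
  show "mat_adjoint (A * B) $$ (i, j) = (mat_adjoint B * mat_adjoint A) $$ (i, j)"
    using assms ij mat_adjoint_carrier[OF assms(1)] mat_adjoint_carrier[OF assms(2)]
    by (auto simp: mult_mat_index[of _ n n _ n] mat_adjoint_index[of _ n n] mult.commute intro!: sum.cong)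
qed (use assms in \<open>auto simp: mat_adjoint_def\<close>)

lemma unitary_mult:
  assumes "A \<in> unitary_group n" "B \<in> unitary_group n"
  shows "A * B \<in> unitary_group n"
proof -
  have c: "A \<in> carrier_mat n n" "B \<in> carrier_mat n n" using assms unitary_carrier by auto
  let ?A = "mat_adjoint A" and ?B = "mat_adjoint B"
  have d: "?A \<in> carrier_mat n n" "?B \<in> carrier_mat n n" using c mat_adjoint_carrier by auto
  have 1: "?A * A = 1\<^sub>m n" "B * ?B = 1\<^sub>m n" using assms by (auto simp: unitary_group_def)
  have "?A * (A * B) = (?A * A) * B" "B * (?B * ?A) = (B * ?B) * ?A"
    using assoc_mult_mat[of ?A n n A n B n] assoc_mult_mat[of B n n ?B n ?A n] c d by simp_all
  then have "?A * (A * B) = B" "B * (?B * ?A) = ?A" unfolding 1 using c d by auto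
  then have "?B * ?A * (A * B) = ?B * B" "A * B * (?B * ?A) = A * ?A"
    using c d by (simp_all add: assoc_mult_mat[of _ n n _ n _ n])
  then show ?thesis using assms c d by (auto simp: unitary_group_def mat_adjoint_mult[OF c])
qed

lemma mat_adjoint_adjoint: "A \<in> carrier_mat n n \<Longrightarrow> mat_adjoint (mat_adjoint A) = (A :: complex mat)"
  using mat_adjoint_carrier[of A n] mat_adjoint_carrier[of "mat_adjoint A" n]
  by (intro eq_matI) (auto simp: mat_adjoint_index[of _ n n])

lemma unitary_adjoint: "A \<in> unitary_group n \<Longrightarrow> mat_adjoint A \<in> unitary_group n"
  by (auto simp: unitary_group_def mat_adjoint_carrier mat_adjoint_adjoint)

lemma unitary_entry_norm:
  assumes "A \<in> unitary_group n" "i < n" "j < n"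
  shows "norm (A $$ (i, j)) \<le> 1"
proof -
  have "(\<Sum>k<n. A $$ (i, k) * cnj (A $$ (i, k))) = 1" using assms by (auto simp: unitary_group_iff)
  then have "of_real (\<Sum>k<n. (norm (A $$ (i, k)))\<^sup>2) = (1::complex)"
    unfolding of_real_sum complex_norm_square .
  then have "(\<Sum>k<n. (norm (A $$ (i, k)))\<^sup>2) = 1" using of_real_eq_1_iff by blast
  moreover have "(norm (A $$ (i, j)))\<^sup>2 \<le> (\<Sum>k<n. (norm (A $$ (i, k)))\<^sup>2)"
    using assms by (intro member_le_sum) auto
  ultimately show ?thesis using power2_le_imp_le[of "norm (A $$ (i,j))" 1] by simp
qed

lemma haarD:
  assumes "normalized_haar n M"
  shows "prob_space M" "space M = unitary_group n" "sets M = sets (unitary_borel n)"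
  using assms by (auto simp: normalized_haar_def)

lemma measurable_unitary_entry [measurable]:
  assumes "normalized_haar n M" "i < n" "j < n"
  shows "(\<lambda>A. A $$ (i, j)) \<in> borel_measurable M"
proof (rule borel_measurableI)
  fix S :: "complex set" assume "open S"
  have "{A \<in> unitary_group n. A $$ (i, j) \<in> S} \<in> sets (unitary_borel n)"
    unfolding unitary_borel_def using assms \<open>open S\<close> by (intro in_measure_of) auto
  then show "(\<lambda>A. A $$ (i, j)) -` S \<inter> space M \<in> sets M"
    using haarD[OF assms(1)] by (simp add: vimage_def Int_def conj_commute)
qed

lemma measurable_translate:
  assumes "normalized_haar n M" "U \<in> unitary_group n"
  shows "(\<lambda>A. U * A) \<in> measurable M M"
proof -
  have "(\<lambda>A. U * A) \<in> measurable M (unitary_borel n)"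
    unfolding unitary_borel_def
  proof (rule measurable_measure_of)
    show "(\<lambda>A. U * A) \<in> space M \<rightarrow> unitary_group n"
      using haarD[OF assms(1)] unitary_mult assms by auto
    fix y assume "y \<in> {{A \<in> unitary_group n. A $$ (i, j) \<in> S} |i j S. i < n \<and> j < n \<and> open S}"
    then obtain i j S where y: "y = {A \<in> unitary_group n. A $$ (i, j) \<in> S}" "i < n" "j < n" "open S" by auto
    have [measurable]: "S \<in> sets borel" using y by auto
    have [measurable]: "(\<lambda>A. A $$ (k, j)) \<in> borel_measurable M" if "k < n" for k
      using measurable_unitary_entry[OF assms(1)] that y by auto
    have "(\<lambda>A. \<Sum>k<n. U $$ (i, k) * A $$ (k, j)) \<in> borel_measurable M"
      by (intro borel_measurable_sum) auto
    then have "(\<lambda>A. \<Sum>k<n. U $$ (i, k) * A $$ (k, j)) -` S \<inter> space M \<in> sets M" by measurable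
    moreover have "(\<lambda>A. U * A) -` y \<inter> space M = (\<lambda>A. \<Sum>k<n. U $$ (i, k) * A $$ (k, j)) -` S \<inter> space M"
      using haarD[OF assms(1)] unitary_mult[OF assms(2)] y
      by (auto simp: mult_mat_index[OF unitary_carrier[OF assms(2)] unitary_carrier y(2,3)])
    ultimately show "(\<lambda>A. U * A) -` y \<inter> space M \<in> sets M" by simp
  qed auto
  then show ?thesis using haarD[OF assms(1)] measurable_cong_sets[OF refl haarD(3)[OF assms(1)]] by auto
qed

text \<open>Invariance is given for images of sets while the push-forward needs preimages: the
  preimage of \<open>B\<close> under left multiplication by \<open>U\<close> is the image of
  \<open>B\<close> under left multiplication by the adjoint of \<open>U\<close>.\<close>

lemma distr_translate:
  assumes H: "normalized_haar n M" and U: "U \<in> unitary_group n"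
  shows "distr M M (\<lambda>A. U * A) = M"
proof (rule measure_eqI)
  interpret prob_space M using haarD[OF H] by simp
  note sp = haarD(2)[OF H]
  let ?V = "mat_adjoint U"
  have V: "?V \<in> unitary_group n" using unitary_adjoint U by auto
  have c: "U \<in> carrier_mat n n" "?V \<in> carrier_mat n n" using U V unitary_carrier by auto
  have VU: "?V * (U * A) = A" "U * (?V * A) = A" if "A \<in> unitary_group n" for A
  proof -
    have A: "A \<in> carrier_mat n n" using that unitary_carrier by auto
    show "?V * (U * A) = A" using assoc_mult_mat[OF c(2,1) A] U A by (simp add: unitary_group_def)
    show "U * (?V * A) = A" using assoc_mult_mat[OF c(1,2) A] U A by (simp add: unitary_group_def)
  qed
  fix B assume "B \<in> sets (distr M M (\<lambda>A. U * A))"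
  then have B: "B \<in> sets M" by simp
  then have Bs: "B \<subseteq> unitary_group n" using sets.sets_into_space sp by blast
  have "(\<lambda>A. U * A) -` B \<inter> space M = (\<lambda>A. ?V * A) ` B"
  proof (intro equalityI subsetI)
    fix A assume "A \<in> (\<lambda>A. U * A) -` B \<inter> space M"
    then show "A \<in> (\<lambda>A. ?V * A) ` B" using VU(1)[of A] sp by (intro image_eqI[of _ _ "U * A"]) auto
  next
    fix A assume "A \<in> (\<lambda>A. ?V * A) ` B"
    then show "A \<in> (\<lambda>A. U * A) -` B \<inter> space M" using VU(2) Bs sp unitary_mult[OF V] by auto
  qed
  moreover have "measure M ((\<lambda>A. ?V * A) ` B) = measure M B"
    using H V B by (auto simp: normalized_haar_def)
  ultimately show "emeasure (distr M M (\<lambda>A. U * A)) B = emeasure M B"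
    using B by (simp add: emeasure_distr measurable_translate[OF H U] emeasure_eq_measure)
qed simp

lemma integral_translate:
  fixes F :: "complex mat \<Rightarrow> complex"
  assumes "normalized_haar n M" "U \<in> unitary_group n" "F \<in> borel_measurable M"
  shows "(\<integral>A. F (U * A) \<partial>M) = (\<integral>A. F A \<partial>M)"
  using integral_distr[OF measurable_translate[OF assms(1,2)] assms(3)] distr_translate[OF assms(1,2)] by simp

section \<open>Power sums of eigenvalues as traces of powers\<close>

definition ev :: "complex mat \<Rightarrow> nat \<Rightarrow> complex" where
  "ev A i = cis (eigenangles A ! i)"

definition psum :: "nat \<Rightarrow> (nat \<Rightarrow> complex) \<Rightarrow> int \<Rightarrow> complex" where
  "psum n z l = (\<Sum>i<n. z i powi l)"

definition mtrace :: "complex mat \<Rightarrow> complex" where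
  "mtrace A = (\<Sum>i<dim_row A. A $$ (i, i))"

lemma mtrace_mult_commute:
  assumes "A \<in> carrier_mat n n" "B \<in> carrier_mat n n"
  shows "mtrace (A * B) = mtrace (B * A)"
proof -
  have "mtrace (A * B) = (\<Sum>i<n. \<Sum>k<n. A $$ (i, k) * B $$ (k, i))"
    using assms by (simp add: mtrace_def mult_mat_index[of _ n n _ n])
  also have "\<dots> = (\<Sum>k<n. \<Sum>i<n. B $$ (k, i) * A $$ (i, k))"
    by (subst sum.swap) (simp add: mult.commute)
  also have "\<dots> = mtrace (B * A)"
    using assms by (simp add: mtrace_def mult_mat_index[of _ n n _ n])
  finally show ?thesis .
qed

lemma mtrace_similar:
  assumes "similar_mat_wit A B P Q" "A \<in> carrier_mat n n"
  shows "mtrace A = mtrace B"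
proof -
  note d = similar_mat_witD2[OF assms(2,1)]
  have "mtrace A = mtrace ((P * B) * Q)" using d by simp
  also have "\<dots> = mtrace (Q * (P * B))" using d by (intro mtrace_mult_commute[of _ n]) auto
  also have "Q * (P * B) = (Q * P) * B" using assoc_mult_mat[of Q n n P n B n] d by simp
  finally show ?thesis unfolding d(2) using d by simp
qed

lemma upper_triangular_pow:
  assumes "B \<in> carrier_mat n n" "upper_triangular (B :: complex mat)"
  shows "(\<forall>i<n. \<forall>j<i. (B ^\<^sub>m k) $$ (i, j) = 0) \<and> (\<forall>i<n. (B ^\<^sub>m k) $$ (i, i) = (B $$ (i, i)) ^ k)"
proof (induction k)
  case 0
  then show ?case using assms by auto
next
  case (Suc k)
  have c: "B ^\<^sub>m k \<in> carrier_mat n n" using assms by auto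
  have *: "(B ^\<^sub>m Suc k) $$ (i, j) = (\<Sum>l<n. (B ^\<^sub>m k) $$ (i, l) * B $$ (l, j))" if "i < n" "j < n" for i j
    using that c assms by (simp add: mult_mat_index[of _ n n _ n])
  have z: "(B ^\<^sub>m k) $$ (i, l) * B $$ (l, j) = 0" if "i < n" "l < n" "l < i \<or> j < l" for i j l
    using that Suc assms by (auto simp: upper_triangular_def)
  have "(B ^\<^sub>m Suc k) $$ (i, j) = 0" if "i < n" "j < i" for i j
    using that by (subst *) (auto intro!: sum.neutral z)
  moreover have "(B ^\<^sub>m Suc k) $$ (i, i) = (B $$ (i, i)) ^ Suc k" if "i < n" for i
  proof -
    have "(B ^\<^sub>m Suc k) $$ (i, i) = (\<Sum>l\<in>{i}. (B ^\<^sub>m k) $$ (i, l) * B $$ (l, i))"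
      unfolding *[OF that that]
    proof (rule sum.mono_neutral_right)
      show "\<forall>l\<in>{..<n} - {i}. (B ^\<^sub>m k) $$ (i, l) * B $$ (l, i) = 0"
      proof
        fix l assume "l \<in> {..<n} - {i}"
        then show "(B ^\<^sub>m k) $$ (i, l) * B $$ (l, i) = 0" using z[of i l i] that by (cases "l < i") auto
      qed
    qed (use that in auto)
    then show ?thesis using Suc that by simp
  qed
  ultimately show ?case by auto
qed

text \<open>The squared norms of \<open>U *\<^sub>v v\<close> and \<open>v\<close> agree for an
  eigenvector \<open>v\<close>, because orthonormality of the columns collapses the double
  sum.\<close>

lemma unitary_eigenvalue_norm:
  assumes U: "U \<in> unitary_group n" and e: "eigenvalue U e"
  shows "norm e = 1"
proof -
  have c: "U \<in> carrier_mat n n" using U unitary_carrier by auto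
  obtain v where v: "v \<in> carrier_vec n" "v \<noteq> 0\<^sub>v n" "U *\<^sub>v v = e \<cdot>\<^sub>v v"
    using e c by (auto simp: eigenvalue_def eigenvector_def)
  have ix: "(\<Sum>j<n. U $$ (i, j) * v $ j) = e * v $ i" if "i < n" for i
  proof -
    have "(U *\<^sub>v v) $ i = e * v $ i" using v that by simp
    moreover have "(U *\<^sub>v v) $ i = (\<Sum>j<n. U $$ (i, j) * v $ j)"
      using that c v(1) by (simp add: scalar_prod_def lessThan_atLeast0)
    ultimately show ?thesis by simp
  qed
  have "(\<Sum>i<n. (e * v $ i) * cnj (e * v $ i)) = (\<Sum>i<n. (\<Sum>j<n. U $$ (i, j) * v $ j) * cnj (\<Sum>k<n. U $$ (i, k) * v $ k))"
    using ix by (intro sum.cong) auto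
  also have "\<dots> = (\<Sum>i<n. \<Sum>j<n. \<Sum>k<n. v $ j * cnj (v $ k) * (cnj (U $$ (i, k)) * U $$ (i, j)))"
    by (simp add: sum_product mult_ac)
  also have "\<dots> = (\<Sum>j<n. \<Sum>k<n. \<Sum>i<n. v $ j * cnj (v $ k) * (cnj (U $$ (i, k)) * U $$ (i, j)))"
    by (rule trans[OF sum.swap]) (rule sum.cong[OF refl], rule sum.swap)
  also have "\<dots> = (\<Sum>j<n. \<Sum>k<n. v $ j * cnj (v $ k) * of_bool (k = j))"
    using U by (simp add: sum_distrib_left[symmetric] unitary_group_iff)
  also have "\<dots> = (\<Sum>j<n. v $ j * cnj (v $ j))"
    by (intro sum.cong refl) (simp add: of_bool_def if_distrib sum.delta cong: if_cong)
  finally have "(\<Sum>i<n. (e * v $ i) * cnj (e * v $ i)) = (\<Sum>j<n. v $ j * cnj (v $ j))" .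
  then have "complex_of_real (\<Sum>i<n. (norm (e * v $ i))\<^sup>2) = of_real (\<Sum>i<n. (norm (v $ i))\<^sup>2)"
    unfolding of_real_sum complex_norm_square .
  then have eq: "(norm e)\<^sup>2 * (\<Sum>i<n. (norm (v $ i))\<^sup>2) = (\<Sum>i<n. (norm (v $ i))\<^sup>2)"
    unfolding of_real_eq_iff by (simp add: norm_mult power_mult_distrib sum_distrib_left)
  obtain i where i: "i < n" "v $ i \<noteq> 0" using v by (metis carrier_vecD eq_vecI index_zero_vec)
  have "0 < (norm (v $ i))\<^sup>2" using i by simp
  also have "\<dots> \<le> (\<Sum>i<n. (norm (v $ i))\<^sup>2)" using i by (intro member_le_sum) auto
  finally have "(norm e)\<^sup>2 = 1" using eq by simp
  then show ?thesis by (simp add: power2_eq_1_iff) (metis abs_norm_cancel norm_ge_zero le_minus_one_simps(3))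
qed

text \<open>The roots \<open>es\<close> of the characteristic polynomial are both the source of
  \<open>eigenangles\<close> and the diagonal of a Schur form of \<open>U\<close>. The third claim
  links the two descriptions: power sums of eigenvalues are traces of powers, hence polynomials in
  the entries, which can be measured and differentiated.\<close>

lemma eigenangles_props:
  assumes U: "U \<in> unitary_group n"
  shows "length (eigenangles U) = n"
    and "set (eigenangles U) \<subseteq> {0..<2*pi}"
    and "(\<Sum>i<n. ev U i ^ l) = mtrace (U ^\<^sub>m l)"
proof -
  have c: "U \<in> carrier_mat n n" using U unitary_carrier by auto
  obtain es where es: "char_poly U = (\<Prod>a\<leftarrow>es. [:- a, 1:])" "length es = n"
    using char_poly_factorized[OF c] by auto
  have "proots (char_poly U) = (\<Sum>a\<leftarrow>es. proots [:- a, 1:])"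
    unfolding es using proots_prod_list[of "map (\<lambda>a. [:- a, 1:]) es"] by (simp add: o_def image_iff)
  also have "\<dots> = mset es"
    by (induction es) auto
  finally have pr: "proots (char_poly U) = mset es" .
  have len: "mset (eigenangles U) = image_mset Arg2pi (mset es)"
    by (simp add: eigenangles_def pr)
  from arg_cong[OF this, of size] es show 1: "length (eigenangles U) = n" by simp
  from arg_cong[OF len, of set_mset] have set: "set (eigenangles U) = Arg2pi ` set es" by simp
  then show "set (eigenangles U) \<subseteq> {0..<2*pi}" using Arg2pi_ge_0 Arg2pi_lt_2pi by auto
  have n1: "norm a = 1" if "a \<in> set es" for a
  proof -
    have "poly (char_poly U) a = 0" using that unfolding es by (auto simp: poly_prod_list prod_list_zero_iff)
    then show ?thesis using eigenvalue_root_char_poly[OF c] unitary_eigenvalue_norm[OF U] by blast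
  qed
  have cisA: "cis (Arg2pi a) = a" if "a \<in> set es" for a
    using Arg2pi_eq[of a] n1[OF that] by (simp add: cis_conv_exp)
  have "image_mset cis (mset (eigenangles U)) = mset es"
    unfolding len multiset.map_comp o_def using image_mset_cong[of "mset es" "\<lambda>a. cis (Arg2pi a)" "\<lambda>a. a"] cisA by simp
  then have m: "mset (map cis (eigenangles U)) = mset es" by simp
  obtain B P Q where schur: "schur_decomposition U es = (B, P, Q)" by (cases "schur_decomposition U es") auto
  from schur_decomposition[OF c es(1) this]
  have B: "similar_mat_wit U B P Q" "upper_triangular B" "diag_mat B = es" by auto
  have Bc: "B \<in> carrier_mat n n" using similar_mat_witD2[OF c B(1)] by auto
  have "mtrace (U ^\<^sub>m l) = mtrace (B ^\<^sub>m l)"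
    using similar_mat_wit_pow[OF B(1)] c by (intro mtrace_similar) auto
  also have "\<dots> = (\<Sum>i<n. (B $$ (i, i)) ^ l)"
    using upper_triangular_pow[OF Bc B(2), of l] Bc by (simp add: mtrace_def)
  also have "\<dots> = (\<Sum>i<n. (es ! i) ^ l)"
    using Bc by (intro sum.cong refl) (auto simp: B(3)[symmetric] diag_mat_def)
  also have "\<dots> = sum_mset (image_mset (\<lambda>a. a ^ l) (mset es))"
    using es by (simp add: sum_mset_sum_list sum_list_sum_nth lessThan_atLeast0 flip: mset_map)
  also have "\<dots> = (\<Sum>i<n. ev U i ^ l)"
    unfolding m[symmetric] using 1
    by (simp add: sum_mset_sum_list sum_list_sum_nth lessThan_atLeast0 ev_def del: mset_map flip: mset_map)
  finally show "(\<Sum>i<n. ev U i ^ l) = mtrace (U ^\<^sub>m l)" by simp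
qed

lemma norm_ev [simp]: "norm (ev U i) = 1" "ev U i \<noteq> 0"
  by (simp_all add: ev_def)

lemma cnj_powi_unit:
  assumes "norm z = 1"
  shows "cnj (z powi l) = z powi (-l)"
proof -
  have "z * cnj z = 1" using assms by (simp add: complex_norm_square[symmetric])
  then have "cnj z = inverse z" by (metis inverse_unique)
  then show ?thesis by (simp add: power_int_minus power_int_inverse complex_cnj_power_int)
qed

subsection \<open>Loop equations for Haar measure\<close>

definition hermitian_proj :: "nat \<Rightarrow> complex mat \<Rightarrow> bool" where
  "hermitian_proj n P \<longleftrightarrow> P \<in> carrier_mat n n \<and>
     (\<forall>i<n. \<forall>j<n. cnj (P $$ (j, i)) = P $$ (i, j)) \<and>
     (\<forall>i<n. \<forall>j<n. (\<Sum>k<n. P $$ (i, k) * P $$ (k, j)) = P $$ (i, j))"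

text \<open>For a projection \<open>P\<close> and \<open>w = cis t\<close> this is the unitary
  one-parameter group exp(i t P) in closed form: multiplication by \<open>w\<close> on the range of
  \<open>P\<close>, the identity on its orthogonal complement.\<close>

definition twist :: "nat \<Rightarrow> complex mat \<Rightarrow> complex \<Rightarrow> complex mat" where
  "twist n P w = mat n n (\<lambda>(i, j). of_bool (i = j) + (w - 1) * P $$ (i, j))"

lemma sum_of_bool_mult:
  assumes "i < (n :: nat)"
  shows "(\<Sum>k<n. of_bool (i = k) * f k) = (f i :: complex)"
    "(\<Sum>k<n. of_bool (k = i) * f k) = f i"
    "(\<Sum>k<n. f k * of_bool (i = k)) = f i"
    "(\<Sum>k<n. f k * of_bool (k = i)) = f i"
proof -
  have "(\<Sum>k<n. f k * of_bool (k = i)) = (\<Sum>k\<in>{i}. f k * of_bool (k = i))"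
    using assms by (intro sum.mono_neutral_right) auto
  then show *: "(\<Sum>k<n. f k * of_bool (k = i)) = f i" by simp
  then show "(\<Sum>k<n. f k * of_bool (i = k)) = f i" by (simp only: eq_commute[of i])
  from * show "(\<Sum>k<n. of_bool (k = i) * f k) = f i" by (simp only: mult.commute)
  then show "(\<Sum>k<n. of_bool (i = k) * f k) = f i" by (simp only: eq_commute[of i])
qed

lemma unit_sq: "norm w = 1 \<Longrightarrow> w * cnj w = 1"
  by (simp add: complex_norm_square[symmetric])

lemma twist_unitary:
  assumes P: "hermitian_proj n P" and w: "norm w = 1"
  shows "twist n P w \<in> unitary_group n"
proof -
  have h: "cnj (P $$ (j, i)) = P $$ (i, j)" if "i < n" "j < n" for i j
    using P that by (auto simp: hermitian_proj_def)
  have id: "(\<Sum>k<n. P $$ (i, k) * P $$ (k, j)) = P $$ (i, j)" if "i < n" "j < n" for i j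
    using P that by (auto simp: hermitian_proj_def)
  have *: "(\<Sum>k<n. (of_bool (k = i) + (u - 1) * P $$ (i, k)) * (of_bool (k = j) + (v - 1) * P $$ (k, j))) = of_bool (i = j)"
    if "i < n" "j < n" "u * v = 1" for i j u v
  proof -
    have "(\<Sum>k<n. (of_bool (k = i) + (u - 1) * P $$ (i, k)) * (of_bool (k = j) + (v - 1) * P $$ (k, j)))
      = (\<Sum>k<n. of_bool (k = i) * of_bool (k = j)) + (v - 1) * (\<Sum>k<n. of_bool (k = i) * P $$ (k, j))
        + (u - 1) * (\<Sum>k<n. P $$ (i, k) * of_bool (k = j)) + (u - 1) * (v - 1) * (\<Sum>k<n. P $$ (i, k) * P $$ (k, j))"
    proof -
      have "(a + (u - 1) * p) * (b + (v - 1) * q) = a * b + (v - 1) * (a * q) + (u - 1) * (p * b) + (u - 1) * (v - 1) * (p * q)"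
        for a b p q by (simp add: algebra_simps)
      then show ?thesis by (simp only: sum.distrib sum_distrib_left)
    qed
    also have "\<dots> = of_bool (i = j) + ((v - 1) + (u - 1) + (u - 1) * (v - 1)) * P $$ (i, j)"
      using that(1,2) by (simp only: sum_of_bool_mult id) (simp add: algebra_simps eq_commute)
    also have "(v - 1) + (u - 1) + (u - 1) * (v - 1) = 0" using that(3) by (simp add: algebra_simps)
    finally show ?thesis by simp
  qed
  have c: "cnj w * w = 1" "w * cnj w = 1" using unit_sq[OF w] by (simp_all add: mult.commute)
  have [simp]: "cnj (of_bool b) = of_bool b" for b by (cases b) auto
  show ?thesis
    unfolding unitary_group_iff
  proof (intro conjI allI impI)
    fix i j assume ij: "i < n" "j < n"
    have "(\<Sum>k<n. cnj (twist n P w $$ (k, i)) * twist n P w $$ (k, j))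
      = (\<Sum>k<n. (of_bool (k = i) + (cnj w - 1) * P $$ (i, k)) * (of_bool (k = j) + (w - 1) * P $$ (k, j)))"
      using ij h by (intro sum.cong refl) (simp add: twist_def)
    then show "(\<Sum>k<n. cnj (twist n P w $$ (k, i)) * twist n P w $$ (k, j)) = of_bool (i = j)"
      using *[OF ij c(1)] by simp
    have "(\<Sum>k<n. twist n P w $$ (i, k) * cnj (twist n P w $$ (j, k)))
      = (\<Sum>k<n. (of_bool (k = i) + (w - 1) * P $$ (i, k)) * (of_bool (k = j) + (cnj w - 1) * P $$ (k, j)))"
      using ij h by (intro sum.cong refl) (simp add: twist_def eq_commute[of i] eq_commute[of j])
    then show "(\<Sum>k<n. twist n P w $$ (i, k) * cnj (twist n P w $$ (j, k))) = of_bool (i = j)"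
      using *[OF ij c(2)] by simp
  qed (simp add: twist_def)
qed

text \<open>First order expansion in \<^term>\<open>w - 1\<close> along \<^term>\<open>twist n P w * U\<close>, uniform in \<^term>\<open>U\<close>; the
  uniformity is what allows differentiating under the Haar integral.\<close>

definition twist_deriv :: "nat \<Rightarrow> complex mat \<Rightarrow> (complex mat \<Rightarrow> complex) \<Rightarrow> (complex mat \<Rightarrow> complex) \<Rightarrow> bool" where
  "twist_deriv n P F F' \<longleftrightarrow> (\<exists>C. \<forall>U\<in>unitary_group n. \<forall>w. norm w = 1 \<longrightarrow>
     norm (F U) \<le> C \<and> norm (F' U) \<le> C \<and>
     norm (F (twist n P w * U) - F U - (w - 1) * F' U) \<le> C * (norm (w - 1))\<^sup>2)"

lemma twist_deriv_cong:
  assumes "twist_deriv n P F F'" "hermitian_proj n P"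
    "\<And>U. U \<in> unitary_group n \<Longrightarrow> F U = G U" "\<And>U. U \<in> unitary_group n \<Longrightarrow> F' U = G' U"
  shows "twist_deriv n P G G'"
proof -
  have "twist n P w * U \<in> unitary_group n" if "U \<in> unitary_group n" "norm w = 1" for U w
    using that twist_unitary[OF assms(2)] unitary_mult by auto
  then show ?thesis using assms(1) unfolding twist_deriv_def by (simp add: assms(3,4))
qed

lemma twist_deriv_const: "twist_deriv n P (\<lambda>_. c) (\<lambda>_. 0)"
  unfolding twist_deriv_def by (intro exI[of _ "norm c"]) auto

lemma twist_deriv_add:
  assumes "twist_deriv n P F F'" "twist_deriv n P G G'"
  shows "twist_deriv n P (\<lambda>U. F U + G U) (\<lambda>U. F' U + G' U)"
proof -
  from assms obtain C D where
    C: "\<forall>U\<in>unitary_group n. \<forall>w. norm w = 1 \<longrightarrow> norm (F U) \<le> C \<and> norm (F' U) \<le> C \<and>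
     norm (F (twist n P w * U) - F U - (w - 1) * F' U) \<le> C * (norm (w - 1))\<^sup>2" and
    D: "\<forall>U\<in>unitary_group n. \<forall>w. norm w = 1 \<longrightarrow> norm (G U) \<le> D \<and> norm (G' U) \<le> D \<and>
     norm (G (twist n P w * U) - G U - (w - 1) * G' U) \<le> D * (norm (w - 1))\<^sup>2"
    unfolding twist_deriv_def by auto
  show ?thesis unfolding twist_deriv_def
  proof (intro exI[of _ "C + D"] ballI allI impI conjI)
    fix U w assume U: "U \<in> unitary_group n" and w: "norm (w::complex) = 1"
    note c = C[rule_format, OF U w] and d = D[rule_format, OF U w]
    show "norm (F U + G U) \<le> C + D" "norm (F' U + G' U) \<le> C + D"
      using c d by (auto intro!: norm_triangle_mono)
    have "F (twist n P w * U) + G (twist n P w * U) - (F U + G U) - (w - 1) * (F' U + G' U)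
      = (F (twist n P w * U) - F U - (w - 1) * F' U) + (G (twist n P w * U) - G U - (w - 1) * G' U)"
      by (simp add: algebra_simps)
    then show "norm (F (twist n P w * U) + G (twist n P w * U) - (F U + G U) - (w - 1) * (F' U + G' U)) \<le> (C + D) * (norm (w - 1))\<^sup>2"
      unfolding distrib_right[of C] using c d by (simp only:) (intro norm_triangle_mono; simp)
  qed
qed

lemma twist_deriv_sum:
  assumes "finite A" "\<And>a. a \<in> A \<Longrightarrow> twist_deriv n P (F a) (F' a)"
  shows "twist_deriv n P (\<lambda>U. \<Sum>a\<in>A. F a U) (\<lambda>U. \<Sum>a\<in>A. F' a U)"
  using assms by (induction A rule: finite_induct) (simp_all add: twist_deriv_const twist_deriv_add)

lemma twist_deriv_mult:
  assumes P: "hermitian_proj n P" and "twist_deriv n P F F'" "twist_deriv n P G G'"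
  shows "twist_deriv n P (\<lambda>U. F U * G U) (\<lambda>U. F' U * G U + F U * G' U)"
proof -
  from assms obtain C D where
    C: "\<forall>U\<in>unitary_group n. \<forall>w. norm w = 1 \<longrightarrow> norm (F U) \<le> C \<and> norm (F' U) \<le> C \<and>
     norm (F (twist n P w * U) - F U - (w - 1) * F' U) \<le> C * (norm (w - 1))\<^sup>2" and
    D: "\<forall>U\<in>unitary_group n. \<forall>w. norm w = 1 \<longrightarrow> norm (G U) \<le> D \<and> norm (G' U) \<le> D \<and>
     norm (G (twist n P w * U) - G U - (w - 1) * G' U) \<le> D * (norm (w - 1))\<^sup>2"
    unfolding twist_deriv_def by auto
  show ?thesis unfolding twist_deriv_def
  \<comment> \<open>The factor 5 adds up the three remainder terms: 1 from \<open>r * G\<close>, 3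
    from \<open>(F + e * F') * s\<close>, where \<open>norm e \<le> 2\<close> is used, and 1 from
    \<open>e\<^sup>2 * (F' * G')\<close>.\<close>
  proof (intro exI[of _ "5 * (C * D)"] ballI allI impI conjI)
    fix U w assume U: "U \<in> unitary_group n" and w: "norm (w::complex) = 1"
    note c = C[rule_format, OF U w] and d = D[rule_format, OF U w]
    have VU: "twist n P w * U \<in> unitary_group n" using unitary_mult twist_unitary[OF P w] U by auto
    have C0: "C \<ge> 0" "D \<ge> 0" using c d norm_ge_zero[of "F U"] norm_ge_zero[of "G U"] by linarith+
    have CD: "C * D \<ge> 0" using C0 by simp
    from c d have c1: "norm (F U) \<le> C" "norm (F' U) \<le> C" "norm (G U) \<le> D" "norm (G' U) \<le> D" by blast+
    have b: "norm (F U * G U) \<le> C * D" "norm (F' U * G U) \<le> C * D" "norm (F U * G' U) \<le> C * D" "norm (F' U * G' U) \<le> C * D"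
      unfolding norm_mult by (intro mult_mono c1 C0 norm_ge_zero)+
    show "norm (F U * G U) \<le> 5 * (C * D)" using b CD by linarith
    have "norm (F' U * G U + F U * G' U) \<le> C * D + C * D" using b by (intro norm_triangle_mono)
    then show "norm (F' U * G U + F U * G' U) \<le> 5 * (C * D)" using CD by linarith
    define e where "e = w - 1"
    have e: "norm e \<le> 2" using norm_triangle_ineq4[of w 1] w by (simp add: e_def)
    define r where "r = F (twist n P w * U) - F U - e * F' U"
    define s where "s = G (twist n P w * U) - G U - e * G' U"
    have F1: "F (twist n P w * U) = F U + e * F' U + r" and G1: "G (twist n P w * U) = G U + e * G' U + s"
      by (simp_all add: r_def s_def)
    have rs: "norm r \<le> C * (norm e)\<^sup>2" "norm s \<le> D * (norm e)\<^sup>2" using c d by (simp_all add: r_def s_def e_def)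
    have "norm (e * F' U) \<le> 2 * C" unfolding norm_mult using c e by (intro mult_mono) auto
    then have t: "norm (F U + e * F' U) \<le> C + 2 * C" using c by (intro norm_triangle_mono) auto
    have "norm (G (twist n P w * U)) \<le> D" using D VU w by blast
    then have b1: "norm (r * G (twist n P w * U)) \<le> (C * (norm e)\<^sup>2) * D"
      unfolding norm_mult using rs C0 by (intro mult_mono) auto
    have b2: "norm ((F U + e * F' U) * s) \<le> (C + 2 * C) * (D * (norm e)\<^sup>2)"
      unfolding norm_mult using rs t C0 by (intro mult_mono) auto
    have b3: "norm (e\<^sup>2 * (F' U * G' U)) \<le> (norm e)\<^sup>2 * (C * D)"
      unfolding norm_mult[of "e\<^sup>2"] norm_power using b by (intro mult_mono) auto
    have "F (twist n P w * U) * G (twist n P w * U) - F U * G U - e * (F' U * G U + F U * G' U)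
      = r * G (twist n P w * U) + (F U + e * F' U) * s + e\<^sup>2 * (F' U * G' U)"
      unfolding F1 G1 by (simp add: algebra_simps power2_eq_square)
    then have "norm (F (twist n P w * U) * G (twist n P w * U) - F U * G U - e * (F' U * G U + F U * G' U))
      \<le> (C * (norm e)\<^sup>2) * D + (C + 2 * C) * (D * (norm e)\<^sup>2) + (norm e)\<^sup>2 * (C * D)"
      by (simp only:) (intro norm_triangle_mono b1 b2 b3)
    also have "\<dots> = 5 * (C * D) * (norm e)\<^sup>2" by (simp add: algebra_simps)
    finally show "norm (F (twist n P w * U) * G (twist n P w * U) - F U * G U - (w - 1) * (F' U * G U + F U * G' U))
      \<le> 5 * (C * D) * (norm (w - 1))\<^sup>2" by (simp add: e_def)
  qed
qed

text \<open>On the unit circle \<open>cnj (w - 1)\<close> equals \<open>- (w - 1)\<close> up to the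
  second order term \<open>- (norm (w - 1))\<^sup>2\<close>; this is where the sign of the
  derivative comes from.\<close>

lemma twist_deriv_cnj:
  assumes "twist_deriv n P F F'"
  shows "twist_deriv n P (\<lambda>U. cnj (F U)) (\<lambda>U. - cnj (F' U))"
proof -
  from assms obtain C where
    C: "\<forall>U\<in>unitary_group n. \<forall>w. norm w = 1 \<longrightarrow> norm (F U) \<le> C \<and> norm (F' U) \<le> C \<and>
     norm (F (twist n P w * U) - F U - (w - 1) * F' U) \<le> C * (norm (w - 1))\<^sup>2"
    unfolding twist_deriv_def by auto
  show ?thesis unfolding twist_deriv_def
  proof (intro exI[of _ "2 * C"] ballI allI impI conjI)
    fix U w assume U: "U \<in> unitary_group n" and w: "norm (w::complex) = 1"
    note c = C[rule_format, OF U w]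
    have C0: "C \<ge> 0" using c norm_ge_zero[of "F U"] by linarith
    show "norm (cnj (F U)) \<le> 2 * C" "norm (- cnj (F' U)) \<le> 2 * C" using c C0 by auto
    have "cnj (w - 1) + (w - 1) = - ((w - 1) * cnj (w - 1))" using unit_sq[OF w] by (simp add: algebra_simps)
    then have e: "norm (cnj (w - 1) + (w - 1)) = (norm (w - 1))\<^sup>2"
      by (simp only: norm_minus_cancel norm_mult complex_mod_cnj power2_eq_square)
    have "cnj (F (twist n P w * U)) - cnj (F U) - (w - 1) * - cnj (F' U)
      = cnj (F (twist n P w * U) - F U - (w - 1) * F' U) + (cnj (w - 1) + (w - 1)) * cnj (F' U)"
      by (simp add: algebra_simps)
    then have "norm (cnj (F (twist n P w * U)) - cnj (F U) - (w - 1) * - cnj (F' U))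
      \<le> norm (cnj (F (twist n P w * U) - F U - (w - 1) * F' U)) + norm ((cnj (w - 1) + (w - 1)) * cnj (F' U))"
      by (simp only:) (rule norm_triangle_ineq)
    also have "\<dots> \<le> C * (norm (w - 1))\<^sup>2 + (norm (w - 1))\<^sup>2 * C"
      unfolding norm_mult e complex_mod_cnj using c by (intro add_mono mult_mono) auto
    finally show "norm (cnj (F (twist n P w * U)) - cnj (F U) - (w - 1) * - cnj (F' U)) \<le> 2 * C * (norm (w - 1))\<^sup>2"
      by (simp add: algebra_simps)
  qed
qed

text \<open>Along the twist an entry is an affine function of \<open>w\<close>, so the second order
  remainder vanishes and the constant only has to bound the entry and its derivative.\<close>

lemma twist_deriv_entry:
  assumes P: "hermitian_proj n P" and "i < n" "j < n"
  shows "twist_deriv n P (\<lambda>U. U $$ (i, j)) (\<lambda>U. \<Sum>k<n. P $$ (i, k) * U $$ (k, j))"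
  unfolding twist_deriv_def
proof (intro exI[of _ "1 + (\<Sum>k<n. norm (P $$ (i, k)))"] ballI allI impI conjI)
  fix U w assume U: "U \<in> unitary_group n" and w: "norm (w::complex) = 1"
  have p0: "0 \<le> (\<Sum>k<n. norm (P $$ (i, k)))" by (intro sum_nonneg) auto
  show "norm (U $$ (i, j)) \<le> 1 + (\<Sum>k<n. norm (P $$ (i, k)))"
    using unitary_entry_norm[OF U assms(2,3)] p0 by linarith
  have "norm (\<Sum>k<n. P $$ (i, k) * U $$ (k, j)) \<le> (\<Sum>k<n. norm (P $$ (i, k)))"
    using unitary_entry_norm[OF U _ assms(3)] by (intro sum_norm_le) (auto simp: norm_mult mult_left_le)
  then show "norm (\<Sum>k<n. P $$ (i, k) * U $$ (k, j)) \<le> 1 + (\<Sum>k<n. norm (P $$ (i, k)))" by simp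
  have "(twist n P w * U) $$ (i, j) = (\<Sum>k<n. (of_bool (i = k) + (w - 1) * P $$ (i, k)) * U $$ (k, j))"
    using assms unitary_carrier[OF U] by (subst mult_mat_index[of _ n n _ n]) (auto simp: twist_def)
  also have "\<dots> = (\<Sum>k<n. of_bool (i = k) * U $$ (k, j)) + (w - 1) * (\<Sum>k<n. P $$ (i, k) * U $$ (k, j))"
    by (simp only: ring_distribs sum.distrib sum_distrib_left mult.assoc)
  finally show "norm ((twist n P w * U) $$ (i, j) - U $$ (i, j) - (w - 1) * (\<Sum>k<n. P $$ (i, k) * U $$ (k, j)))
      \<le> (1 + (\<Sum>k<n. norm (P $$ (i, k)))) * (norm (w - 1))\<^sup>2"
    using assms p0 by (simp add: sum_of_bool_mult)
qed

lemma haar_integrable_bounded: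
  assumes "normalized_haar n M" "F \<in> borel_measurable M" "\<And>U. U \<in> unitary_group n \<Longrightarrow> norm (F U :: complex) \<le> C"
  shows "integrable M F"
proof -
  interpret prob_space M using haarD[OF assms(1)] by simp
  show ?thesis using assms haarD(2)[OF assms(1)] by (intro integrable_const_bound[of _ C] AE_I2) auto
qed

text \<open>By invariance \<open>F\<close> has the same integral at \<open>twist n P w * U\<close>
  as at \<open>U\<close>. So \<open>norm (w - 1)\<close> times the modulus of the integral of
  \<open>F'\<close> is at most \<open>C * (norm (w - 1))\<^sup>2\<close>; dividing and letting
  \<open>w\<close> tend to 1 along the circle forces it to vanish.\<close>

lemma twist_deriv_integral_0:
  assumes H: "normalized_haar n M" and P: "hermitian_proj n P" and d: "twist_deriv n P F F'"
    and m: "F \<in> borel_measurable M" "F' \<in> borel_measurable M"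
  shows "(\<integral>U. F' U \<partial>M) = 0"
proof -
  interpret prob_space M using haarD[OF H] by simp
  from d obtain C where
    C: "\<forall>U\<in>unitary_group n. \<forall>w. norm w = 1 \<longrightarrow> norm (F U) \<le> C \<and> norm (F' U) \<le> C \<and>
     norm (F (twist n P w * U) - F U - (w - 1) * F' U) \<le> C * (norm (w - 1))\<^sup>2"
    unfolding twist_deriv_def by auto
  have "norm (F U) \<le> C \<and> norm (F' U) \<le> C" if "U \<in> unitary_group n" for U
    using C that norm_one by blast
  then have iF: "integrable M F" "integrable M F'"
    by (auto intro!: haar_integrable_bounded[OF H, where C = C] m)
  define a where "a = norm (\<integral>U. F' U \<partial>M)"
  have main: "norm (w - 1) * a \<le> C * (norm (w - 1))\<^sup>2" if w: "norm w = 1" for w :: complex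
  proof -
    have V: "twist n P w \<in> unitary_group n" using twist_unitary[OF P w] .
    have mV: "(\<lambda>U. F (twist n P w * U)) \<in> borel_measurable M"
      using measurable_compose[OF measurable_translate[OF H V] m(1)] .
    have iV: "integrable M (\<lambda>U. F (twist n P w * U))"
      using C unitary_mult[OF V] w by (intro haar_integrable_bounded[OF H mV, where C = C]) auto
    have "(\<integral>U. F (twist n P w * U) - F U - (w - 1) * F' U \<partial>M) = - (w - 1) * (\<integral>U. F' U \<partial>M)"
      using iF iV integral_translate[OF H V m(1)] by (simp add: left_diff_distrib)
    then have "norm (w - 1) * a = norm (\<integral>U. F (twist n P w * U) - F U - (w - 1) * F' U \<partial>M)"
      by (simp add: a_def norm_mult norm_minus_commute)
    also have "\<dots> \<le> (\<integral>U. norm (F (twist n P w * U) - F U - (w - 1) * F' U) \<partial>M)"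
      by (rule integral_norm_bound)
    also have "\<dots> \<le> (\<integral>U. C * (norm (w - 1))\<^sup>2 \<partial>M)"
      using iF iV C w haarD(2)[OF H] by (intro integral_mono integrable_norm) auto
    also have "\<dots> = C * (norm (w - 1))\<^sup>2" using prob_space by simp
    finally show ?thesis .
  qed
  have b: "a \<le> C * norm (cis t - 1)" if "0 < t" "t < pi" for t
  proof -
    have "cos t < 1" using that cos_monotone_0_pi[of 0 t] by auto
    then have "cis t \<noteq> 1" by (auto simp: complex_eq_iff)
    then show ?thesis using main[of "cis t"] by (simp add: power2_eq_square)
  qed
  have "((\<lambda>t. C * norm (cis t - 1)) \<longlongrightarrow> C * norm (cis 0 - 1)) (at_right 0)"
    by (intro tendsto_intros)
  moreover have "eventually (\<lambda>t. a \<le> C * norm (cis t - 1)) (at_right (0::real))"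
    unfolding eventually_at_right_field using b pi_gt_zero by blast
  ultimately have "a \<le> C * norm (cis 0 - 1)"
    using tendsto_lowerbound trivial_limit_at_right_real by blast
  then show ?thesis by (simp add: a_def)
qed

lemma pow_mat_add:
  assumes "(A :: complex mat) \<in> carrier_mat n n"
  shows "A ^\<^sub>m (k + l) = A ^\<^sub>m k * A ^\<^sub>m l"
proof (induction l)
  case (Suc l)
  have c: "A ^\<^sub>m k \<in> carrier_mat n n" "A ^\<^sub>m l \<in> carrier_mat n n" using assms by auto
  show ?case using Suc assoc_mult_mat[OF c assms] by simp
qed (use assms in auto)

lemma unitary_one: "1\<^sub>m n \<in> unitary_group n"
proof -
  have "mat_adjoint (1\<^sub>m n :: complex mat) = 1\<^sub>m n"
    using mat_adjoint_carrier[of "1\<^sub>m n" n] by (intro eq_matI) (auto simp: mat_adjoint_index[of _ n n])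
  then show ?thesis by (simp add: unitary_group_def)
qed

lemma unitary_pow: "U \<in> unitary_group n \<Longrightarrow> U ^\<^sub>m k \<in> unitary_group n"
  by (induction k) (auto simp: unitary_mult unitary_one dest: unitary_carrier)

text \<open>\<open>K\<close> is the matrix gradient of \<open>F\<close>: one kernel that yields the
  derivative in the direction of every projection \<open>P\<close> by a pairing linear in
  \<open>P\<close>. The linearity is what later allows the passage from projections to single matrix
  entries.\<close>

definition grad :: "nat \<Rightarrow> (complex mat \<Rightarrow> complex) \<Rightarrow> (complex mat \<Rightarrow> nat \<Rightarrow> nat \<Rightarrow> complex) \<Rightarrow> bool" where
  "grad n F K \<longleftrightarrow> (\<forall>P. hermitian_proj n P \<longrightarrow> twist_deriv n P F (\<lambda>U. \<Sum>x<n. \<Sum>y<n. P $$ (x, y) * K U x y))"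

lemma grad_cong:
  assumes "grad n F K" "\<And>U. U \<in> unitary_group n \<Longrightarrow> F U = G U"
    "\<And>U x y. U \<in> unitary_group n \<Longrightarrow> x < n \<Longrightarrow> y < n \<Longrightarrow> K U x y = L U x y"
  shows "grad n G L"
  unfolding grad_def
proof (intro allI impI)
  fix P assume P: "hermitian_proj n P"
  have "twist_deriv n P F (\<lambda>U. \<Sum>x<n. \<Sum>y<n. P $$ (x, y) * K U x y)"
    using assms(1) P by (simp add: grad_def)
  then show "twist_deriv n P G (\<lambda>U. \<Sum>x<n. \<Sum>y<n. P $$ (x, y) * L U x y)"
    by (rule twist_deriv_cong[OF _ P]) (simp_all add: assms(2,3))
qed

lemma grad_const: "grad n (\<lambda>_. c) (\<lambda>_ _ _. 0)"
  by (simp add: grad_def twist_deriv_const)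

lemma grad_sum:
  assumes "finite A" "\<And>a. a \<in> A \<Longrightarrow> grad n (F a) (K a)"
  shows "grad n (\<lambda>U. \<Sum>a\<in>A. F a U) (\<lambda>U x y. \<Sum>a\<in>A. K a U x y)"
  unfolding grad_def
proof (intro allI impI)
  fix P assume P: "hermitian_proj n P"
  have "(\<Sum>x<n. \<Sum>y<n. P $$ (x, y) * (\<Sum>a\<in>A. K a U x y)) = (\<Sum>a\<in>A. \<Sum>x<n. \<Sum>y<n. P $$ (x, y) * K a U x y)" for U
    unfolding sum_distrib_left by (subst (2) sum.swap, subst (1) sum.swap) simp
  then show "twist_deriv n P (\<lambda>U. \<Sum>a\<in>A. F a U) (\<lambda>U. \<Sum>x<n. \<Sum>y<n. P $$ (x, y) * (\<Sum>a\<in>A. K a U x y))"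
    using twist_deriv_sum[OF assms(1), of n P F] assms(2) P by (simp add: grad_def)
qed

lemma grad_mult:
  assumes "grad n F K" "grad n G L"
  shows "grad n (\<lambda>U. F U * G U) (\<lambda>U x y. K U x y * G U + F U * L U x y)"
  unfolding grad_def
proof (intro allI impI)
  fix P assume P: "hermitian_proj n P"
  have "(\<Sum>x<n. \<Sum>y<n. P $$ (x, y) * (K U x y * G U + F U * L U x y)) =
    (\<Sum>x<n. \<Sum>y<n. P $$ (x, y) * K U x y) * G U + F U * (\<Sum>x<n. \<Sum>y<n. P $$ (x, y) * L U x y)" for U
    by (simp add: sum_distrib_left sum_distrib_right sum.distrib algebra_simps)
  then show "twist_deriv n P (\<lambda>U. F U * G U) (\<lambda>U. \<Sum>x<n. \<Sum>y<n. P $$ (x, y) * (K U x y * G U + F U * L U x y))"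
    using twist_deriv_mult[OF P] assms P by (simp add: grad_def)
qed

lemma grad_cnj:
  assumes "grad n F K"
  shows "grad n (\<lambda>U. cnj (F U)) (\<lambda>U x y. - cnj (K U y x))"
  unfolding grad_def
proof (intro allI impI)
  fix P assume P: "hermitian_proj n P"
  have "(\<Sum>x<n. \<Sum>y<n. P $$ (x, y) * - cnj (K U y x)) = (\<Sum>x<n. \<Sum>y<n. - cnj (P $$ (y, x) * K U y x))" for U
    using P by (intro sum.cong refl) (simp add: hermitian_proj_def)
  also have "(\<Sum>x<n. \<Sum>y<n. - cnj (P $$ (y, x) * K U y x)) = - cnj (\<Sum>x<n. \<Sum>y<n. P $$ (x, y) * K U x y)" for U
    by (subst sum.swap) (simp add: sum_negf)
  finally have eq: "(\<Sum>x<n. \<Sum>y<n. P $$ (x, y) * - cnj (K U y x)) = - cnj (\<Sum>x<n. \<Sum>y<n. P $$ (x, y) * K U x y)" for U .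
  show "twist_deriv n P (\<lambda>U. cnj (F U)) (\<lambda>U. \<Sum>x<n. \<Sum>y<n. P $$ (x, y) * - cnj (K U y x))"
    unfolding eq using assms P by (intro twist_deriv_cnj) (simp add: grad_def)
qed

lemma grad_entry:
  assumes "i < n" "j < n"
  shows "grad n (\<lambda>U. U $$ (i, j)) (\<lambda>U x y. of_bool (x = i) * U $$ (y, j))"
  unfolding grad_def
proof (intro allI impI)
  fix P assume P: "hermitian_proj n P"
  have "(\<Sum>x<n. \<Sum>y<n. P $$ (x, y) * (of_bool (x = i) * U $$ (y, j))) = (\<Sum>y<n. P $$ (i, y) * U $$ (y, j))" for U :: "complex mat"
  proof -
    have "(\<Sum>x<n. \<Sum>y<n. P $$ (x, y) * (of_bool (x = i) * U $$ (y, j))) = (\<Sum>x<n. of_bool (x = i) * (\<Sum>y<n. P $$ (x, y) * U $$ (y, j)))"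
      by (simp add: sum_distrib_left mult_ac del: sum_mult_of_bool_eq sum_of_bool_mult_eq)
    then show ?thesis using sum_of_bool_mult[OF assms(1)] by simp
  qed
  then show "twist_deriv n P (\<lambda>U. U $$ (i, j)) (\<lambda>U. \<Sum>x<n. \<Sum>y<n. P $$ (x, y) * (of_bool (x = i) * U $$ (y, j)))"
    using twist_deriv_entry[OF P assms] by simp
qed

lemma rank_one_proj:
  assumes "(\<Sum>i<n. v i * cnj (v i)) = 1"
  shows "hermitian_proj n (mat n n (\<lambda>(i, j). v i * cnj (v j)))"
proof -
  have "(\<Sum>k<n. (v i * cnj (v k)) * (v k * cnj (v j))) = v i * cnj (v j)" for i j
  proof -
    have "(\<Sum>k<n. (v i * cnj (v k)) * (v k * cnj (v j))) = v i * cnj (v j) * (\<Sum>k<n. v k * cnj (v k))"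
      by (simp add: sum_distrib_left mult_ac)
    then show ?thesis using assms by simp
  qed
  then show ?thesis by (auto simp: hermitian_proj_def)
qed

text \<open>The projection onto a unit vector \<open>v\<close> shows that the integral of
  \<open>K\<close>, read as a sesquilinear form, vanishes at \<open>v\<close>. Polarization isolates
  each entry, which amounts to differentiating in the direction of a matrix unit, an element of the
  complexified tangent space only.\<close>

lemma grad_integral_0:
  assumes H: "normalized_haar n M" and g: "grad n F K" and m: "F \<in> borel_measurable M"
    and mK: "\<And>x y. x < n \<Longrightarrow> y < n \<Longrightarrow> (\<lambda>U. K U x y) \<in> borel_measurable M"
    and ab: "a < n" "b < n"
  shows "has_bochner_integral M (\<lambda>U. K U a b) 0"
proof -
  have hb: "has_bochner_integral M (\<lambda>U. \<Sum>x<n. \<Sum>y<n. v x * cnj (v y) * K U x y) 0"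
    if v: "(\<Sum>i<n. v i * cnj (v i)) = 1" for v
  proof -
    define P where "P = mat n n (\<lambda>(i, j). v i * cnj (v j))"
    have P: "hermitian_proj n P" using rank_one_proj[OF v] by (simp add: P_def)
    have eq: "(\<Sum>x<n. \<Sum>y<n. P $$ (x, y) * K U x y) = (\<Sum>x<n. \<Sum>y<n. v x * cnj (v y) * K U x y)" for U
      by (intro sum.cong refl) (auto simp: P_def)
    have d: "twist_deriv n P F (\<lambda>U. \<Sum>x<n. \<Sum>y<n. v x * cnj (v y) * K U x y)"
      using g P by (simp add: grad_def eq[symmetric])
    have ms: "(\<lambda>U. \<Sum>x<n. \<Sum>y<n. v x * cnj (v y) * K U x y) \<in> borel_measurable M"
      by (intro borel_measurable_sum borel_measurable_times measurable_const mK) auto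
    obtain C where "\<forall>U\<in>unitary_group n. \<forall>w::complex. norm w = 1 \<longrightarrow> norm (\<Sum>x<n. \<Sum>y<n. v x * cnj (v y) * K U x y) \<le> C"
      using d unfolding twist_deriv_def by blast
    then have "integrable M (\<lambda>U. \<Sum>x<n. \<Sum>y<n. v x * cnj (v y) * K U x y)"
      by (intro haar_integrable_bounded[OF H ms, of C]) (use norm_one in blast)
    then show ?thesis using twist_deriv_integral_0[OF H P d m ms] by (simp add: has_bochner_integral_iff)
  qed
  have exp: "(\<Sum>x<n. (\<alpha> * of_bool (x = a) + \<beta> * of_bool (x = b)) * h x) = \<alpha> * h a + \<beta> * h b" for \<alpha> \<beta> and h :: "nat \<Rightarrow> complex"
  proof -
    have "(\<Sum>x<n. (\<alpha> * of_bool (x = a) + \<beta> * of_bool (x = b)) * h x)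
       = \<alpha> * (\<Sum>x<n. of_bool (x = a) * h x) + \<beta> * (\<Sum>x<n. of_bool (x = b) * h x)"
      by (simp only: sum_distrib_left sum.distrib ring_distribs mult.assoc)
    then show ?thesis using ab by (simp add: sum_of_bool_mult)
  qed
  have cb: "cnj (\<alpha> * of_bool p + \<beta> * of_bool q) = cnj \<alpha> * of_bool p + cnj \<beta> * of_bool q" for \<alpha> \<beta> p q
    by (cases p; cases q) auto
  have two: "has_bochner_integral M (\<lambda>U. \<alpha> * (cnj \<alpha> * K U a a + cnj \<beta> * K U a b) + \<beta> * (cnj \<alpha> * K U b a + cnj \<beta> * K U b b)) 0"
    if "\<alpha> * cnj \<alpha> + \<beta> * cnj \<beta> = 1" "a \<noteq> b \<or> \<beta> = 0" for \<alpha> \<beta>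
  proof -
    let ?v = "\<lambda>x. \<alpha> * of_bool (x = a) + \<beta> * of_bool (x = b) :: complex"
    have 1: "(\<Sum>i<n. ?v i * cnj (?v i)) = 1"
      unfolding exp cb using that by auto
    have "(\<Sum>x<n. \<Sum>y<n. ?v x * cnj (?v y) * K U x y) = (\<Sum>x<n. ?v x * (\<Sum>y<n. cnj (?v y) * K U x y))" for U
      by (simp only: sum_distrib_left mult.assoc)
    also have "(\<Sum>x<n. ?v x * (\<Sum>y<n. cnj (?v y) * K U x y)) = \<alpha> * (cnj \<alpha> * K U a a + cnj \<beta> * K U a b) + \<beta> * (cnj \<alpha> * K U b a + cnj \<beta> * K U b b)" for U
      by (simp only: exp cb)
    finally show ?thesis using hb[OF 1] by simp
  qed
  have diag: "has_bochner_integral M (\<lambda>U. K U a a) 0" using two[of 1 0] by simp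
  show ?thesis
  proof (cases "a = b")
    case False
    \<comment> \<open>The two unit vectors are (e_a + e_b) / sqrt 2 and (e_a + i e_b) / sqrt 2. The
      form at the first plus \<open>\<i>\<close> times the form at the second is
      \<open>K U a b\<close> plus \<open>(1 + \<i>) / 2\<close> times the two diagonal entries,
      whose integrals vanish already.\<close>
    define s :: complex where "s = of_real (1 / sqrt 2)"
    have s: "s * s = 1 / 2" "cnj s = s"
      by (simp_all add: s_def flip: of_real_mult)
    have e: "s * cnj s + s * cnj s = 1" unfolding s by simp
    have "(\<i> * s) * cnj (\<i> * s) = (\<i> * cnj \<i>) * (s * cnj s)"
      by (simp only: complex_cnj_mult mult_ac)
    then have e': "s * cnj s + (\<i> * s) * cnj (\<i> * s) = 1" using e by simp
    have "has_bochner_integral M (\<lambda>U. K U a a) 0" "has_bochner_integral M (\<lambda>U. K U b b) 0"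
      using diag two[of 0 1] False by simp_all
    note I = this two[OF e] two[OF e']
    have "has_bochner_integral M (\<lambda>U. (s * (cnj s * K U a a + cnj s * K U a b) + s * (cnj s * K U b a + cnj s * K U b b))
      + \<i> * (s * (cnj s * K U a a + cnj (\<i> * s) * K U a b) + (\<i> * s) * (cnj s * K U b a + cnj (\<i> * s) * K U b b))
      - ((1 + \<i>) / 2) * K U a a - ((1 + \<i>) / 2) * K U b b) (0 + \<i> * 0 - ((1 + \<i>) / 2) * 0 - ((1 + \<i>) / 2) * 0)"
      using False by (intro has_bochner_integral_add has_bochner_integral_diff has_bochner_integral_mult_right I) auto
    moreover have "(s * (cnj s * p + cnj s * q) + s * (cnj s * r + cnj s * t))
      + \<i> * (s * (cnj s * p + cnj (\<i> * s) * q) + (\<i> * s) * (cnj s * r + cnj (\<i> * s) * t))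
      - ((1 + \<i>) / 2) * p - ((1 + \<i>) / 2) * t = q" for p q r t
    proof -
      have X: "(s * (cnj s * p + cnj s * q) + s * (cnj s * r + cnj s * t))
      + \<i> * (s * (cnj s * p + cnj (\<i> * s) * q) + (\<i> * s) * (cnj s * r + cnj (\<i> * s) * t))
       = (s * s) * (p + q + r + t + \<i> * (p + t) + q - r)"
        by (simp add: s(2) algebra_simps)
      show ?thesis unfolding X unfolding s(1) by (simp add: field_simps)
    qed
    ultimately show ?thesis by simp
  qed (use diag in simp)
qed

text \<open>The Leibniz rule for \<open>l\<close> copies of \<open>U\<close>: the differentiated
  copy becomes \<open>P * U\<close>, so \<open>q\<close> copies stand to the left of
  \<open>P\<close> and \<open>l - q\<close> to its right.\<close>

lemma grad_pow:
  assumes "i < n" "j < n"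
  shows "grad n (\<lambda>U. (U ^\<^sub>m l) $$ (i, j)) (\<lambda>U x y. \<Sum>q<l. (U ^\<^sub>m q) $$ (i, x) * (U ^\<^sub>m (l - q)) $$ (y, j))"
  using assms(2)
proof (induction l arbitrary: j)
  case 0
  show ?case
    using assms(1) 0 by (intro grad_cong[OF grad_const[of n "of_bool (i = j)"]]) (auto dest: unitary_carrier)
next
  case (Suc l)
  let ?K = "\<lambda>k U x y. \<Sum>q<l. (U ^\<^sub>m q) $$ (i, x) * (U ^\<^sub>m (l - q)) $$ (y, k)"
  have g: "grad n (\<lambda>U. \<Sum>k<n. (U ^\<^sub>m l) $$ (i, k) * U $$ (k, j))
    (\<lambda>U x y. \<Sum>k<n. ?K k U x y * U $$ (k, j) + (U ^\<^sub>m l) $$ (i, k) * (of_bool (x = k) * U $$ (y, j)))"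
    using Suc by (intro grad_sum grad_mult grad_entry) auto
  show ?case
  proof (rule grad_cong[OF g])
    fix U assume "U \<in> unitary_group n"
    then have c: "U \<in> carrier_mat n n" "U ^\<^sub>m l \<in> carrier_mat n n" using unitary_carrier by auto
    then show "(\<Sum>k<n. (U ^\<^sub>m l) $$ (i, k) * U $$ (k, j)) = (U ^\<^sub>m Suc l) $$ (i, j)"
      using assms(1) Suc.prems by (simp add: mult_mat_index[of _ n n _ n])
    fix x y assume xy: "x < n" "y < n"
    have 1: "(U ^\<^sub>m (Suc l - q)) $$ (y, j) = (\<Sum>k<n. (U ^\<^sub>m (l - q)) $$ (y, k) * U $$ (k, j))" if "q < l" for q
    proof -
      have "U ^\<^sub>m (l - q) \<in> carrier_mat n n" using c by auto
      then show ?thesis using that xy c Suc.prems by (simp add: Suc_diff_le mult_mat_index[of _ n n _ n])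
    qed
    have "(\<Sum>k<n. ?K k U x y * U $$ (k, j)) = (\<Sum>q<l. (U ^\<^sub>m q) $$ (i, x) * (U ^\<^sub>m (Suc l - q)) $$ (y, j))"
      unfolding sum_distrib_right by (subst sum.swap) (intro sum.cong refl, simp add: 1 sum_distrib_left mult.assoc)
    moreover have "(\<Sum>k<n. (U ^\<^sub>m l) $$ (i, k) * (of_bool (x = k) * U $$ (y, j))) = (U ^\<^sub>m l) $$ (i, x) * U $$ (y, j)"
    proof -
      have "(\<Sum>k<n. (U ^\<^sub>m l) $$ (i, k) * (of_bool (x = k) * U $$ (y, j)))
        = (\<Sum>k<n. of_bool (x = k) * ((U ^\<^sub>m l) $$ (i, k) * U $$ (y, j)))" by (simp only: mult_ac)
      then show ?thesis using sum_of_bool_mult(1)[OF xy(1)] by simp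
    qed
    moreover have "U ^\<^sub>m (Suc l - l) = U" using c by simp
    ultimately show "(\<Sum>k<n. ?K k U x y * U $$ (k, j) + (U ^\<^sub>m l) $$ (i, k) * (of_bool (x = k) * U $$ (y, j)))
      = (\<Sum>q<Suc l. (U ^\<^sub>m q) $$ (i, x) * (U ^\<^sub>m (Suc l - q)) $$ (y, j))"
      by (simp only: sum.distrib sum.lessThan_Suc)
  qed
qed

text \<open>By cyclicity of the trace all \<open>l\<close> terms of the Leibniz rule
  coincide.\<close>

lemma grad_mtrace_pow:
  "grad n (\<lambda>U. mtrace (U ^\<^sub>m l)) (\<lambda>U x y. of_nat l * (U ^\<^sub>m l) $$ (y, x))"
proof (rule grad_cong[OF grad_sum[of "{..<n}" n "\<lambda>i U. (U ^\<^sub>m l) $$ (i, i)", OF _ grad_pow]])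
  fix U assume U: "U \<in> unitary_group n"
  then have c: "U \<in> carrier_mat n n" using unitary_carrier by auto
  then show "(\<Sum>i<n. (U ^\<^sub>m l) $$ (i, i)) = mtrace (U ^\<^sub>m l)" by (simp add: mtrace_def)
  fix x y assume xy: "x < n" "y < n"
  have "(\<Sum>i<n. \<Sum>q<l. (U ^\<^sub>m q) $$ (i, x) * (U ^\<^sub>m (l - q)) $$ (y, i))
     = (\<Sum>q<l. \<Sum>i<n. (U ^\<^sub>m (l - q)) $$ (y, i) * (U ^\<^sub>m q) $$ (i, x))"
    by (subst sum.swap) (simp add: mult.commute)
  also have "\<dots> = (\<Sum>q<l. (U ^\<^sub>m l) $$ (y, x))"
  proof (rule sum.cong[OF refl])
    fix q assume q: "q \<in> {..<l}"
    have "U ^\<^sub>m l = U ^\<^sub>m (l - q) * U ^\<^sub>m q" using pow_mat_add[OF c, of "l - q" q] q by simp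
    moreover have "U ^\<^sub>m (l - q) \<in> carrier_mat n n" "U ^\<^sub>m q \<in> carrier_mat n n" using c by auto
    ultimately show "(\<Sum>i<n. (U ^\<^sub>m (l - q)) $$ (y, i) * (U ^\<^sub>m q) $$ (i, x)) = (U ^\<^sub>m l) $$ (y, x)"
      using xy by (simp add: mult_mat_index[of _ n n _ n])
  qed
  finally show "(\<Sum>i<n. \<Sum>q<l. (U ^\<^sub>m q) $$ (i, x) * (U ^\<^sub>m (l - q)) $$ (y, i)) = of_nat l * (U ^\<^sub>m l) $$ (y, x)"
    by simp
qed auto

definition utr :: "complex mat \<Rightarrow> int \<Rightarrow> complex" where
  "utr U l = (if l \<ge> 0 then mtrace (U ^\<^sub>m nat l) else cnj (mtrace (U ^\<^sub>m nat (- l))))"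

definition uent :: "complex mat \<Rightarrow> int \<Rightarrow> nat \<Rightarrow> nat \<Rightarrow> complex" where
  "uent U l y x = (if l \<ge> 0 then (U ^\<^sub>m nat l) $$ (y, x) else cnj ((U ^\<^sub>m nat (- l)) $$ (x, y)))"

lemma grad_utr: "grad n (\<lambda>U. utr U l) (\<lambda>U x y. of_int l * uent U l y x)"
proof (cases "l \<ge> 0")
  case True
  then show ?thesis using grad_mtrace_pow[of n "nat l"] by (simp add: utr_def uent_def)
next
  case False
  then show ?thesis using grad_cnj[OF grad_mtrace_pow[of n "nat (-l)"]] by (simp add: utr_def uent_def)
qed

lemma utr_int: "utr U (int k) = mtrace (U ^\<^sub>m k)"
  by (simp add: utr_def)

lemma utr_eq_psum:
  assumes U: "U \<in> unitary_group n"
  shows "utr U l = psum n (ev U) l"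
proof (cases "l \<ge> 0")
  case True
  then show ?thesis using eigenangles_props(3)[OF U, of "nat l"] by (simp add: utr_def psum_def power_int_def)
next
  case False
  have "utr U l = cnj (\<Sum>i<n. ev U i powi int (nat (- l)))"
    using False eigenangles_props(3)[OF U, of "nat (-l)", symmetric] by (simp add: utr_def power_int_def)
  also have "\<dots> = (\<Sum>i<n. ev U i powi - int (nat (- l)))"
    unfolding cnj_sum by (intro sum.cong refl cnj_powi_unit) simp
  finally show ?thesis using False by (simp add: psum_def)
qed

definition pprod :: "nat \<Rightarrow> (nat \<Rightarrow> complex) \<Rightarrow> int list \<Rightarrow> complex" where
  "pprod n z ls = prod_list (map (psum n z) ls)"

text \<open>The logarithmic derivative \<open>z\<^sub>i \<partial>\<^sub>i\<close> of a product of power sums.\<close>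

fun dpprod :: "nat \<Rightarrow> (nat \<Rightarrow> complex) \<Rightarrow> int list \<Rightarrow> nat \<Rightarrow> complex" where
  "dpprod n z [] i = 0"
| "dpprod n z (l # ls) i = of_int l * z i powi l * pprod n z ls + psum n z l * dpprod n z ls i"

definition uprod :: "complex mat \<Rightarrow> int list \<Rightarrow> complex" where
  "uprod U ls = prod_list (map (utr U) ls)"

fun kprod :: "complex mat \<Rightarrow> int list \<Rightarrow> nat \<Rightarrow> nat \<Rightarrow> complex" where
  "kprod U [] x y = 0"
| "kprod U (l # ls) x y = of_int l * uent U l y x * uprod U ls + utr U l * kprod U ls x y"

lemma grad_uprod: "grad n (\<lambda>U. uprod U ls) (\<lambda>U. kprod U ls)"
proof (induction ls)
  case Nil
  then show ?case using grad_const[of n 1] by (simp add: uprod_def)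
next
  case (Cons l ls)
  from grad_mult[OF grad_utr[of n l] Cons] show ?case by (simp add: uprod_def)
qed

lemma uprod_eq_pprod: "U \<in> unitary_group n \<Longrightarrow> uprod U ls = pprod n (ev U) ls"
  by (simp add: uprod_def pprod_def utr_eq_psum cong: map_cong)

lemma unitary_pow_contract:
  assumes U: "U \<in> unitary_group n"
  shows "(\<Sum>a<n. \<Sum>b<n. (U ^\<^sub>m m) $$ (b, a) * cnj ((U ^\<^sub>m k) $$ (b, a))) = psum n (ev U) (int m - int k)"
proof -
  have c: "U \<in> carrier_mat n n" using U unitary_carrier by auto
  have *: "(\<Sum>a<n. \<Sum>b<n. (U ^\<^sub>m m) $$ (b, a) * cnj ((U ^\<^sub>m k) $$ (b, a))) = psum n (ev U) (int (m - k))"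
    if "k \<le> m" for m k
  proof -
    have ck: "U ^\<^sub>m k \<in> carrier_mat n n" "U ^\<^sub>m (m - k) \<in> carrier_mat n n" using c by auto
    have Um: "U ^\<^sub>m m = U ^\<^sub>m (m - k) * U ^\<^sub>m k" using pow_mat_add[OF c, of "m - k" k] that by simp
    have "(\<Sum>a<n. \<Sum>b<n. (U ^\<^sub>m m) $$ (b, a) * cnj ((U ^\<^sub>m k) $$ (b, a)))
      = (\<Sum>a<n. \<Sum>b<n. \<Sum>d<n. (U ^\<^sub>m (m - k)) $$ (b, d) * ((U ^\<^sub>m k) $$ (d, a) * cnj ((U ^\<^sub>m k) $$ (b, a))))"
      unfolding Um using ck by (intro sum.cong refl) (simp add: mult_mat_index[of _ n n _ n] sum_distrib_right mult.assoc)
    also have "\<dots> = (\<Sum>b<n. \<Sum>d<n. \<Sum>a<n. (U ^\<^sub>m (m - k)) $$ (b, d) * ((U ^\<^sub>m k) $$ (d, a) * cnj ((U ^\<^sub>m k) $$ (b, a))))"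
      by (rule trans[OF sum.swap]) (rule sum.cong[OF refl], rule sum.swap)
    also have "\<dots> = (\<Sum>b<n. \<Sum>d<n. (U ^\<^sub>m (m - k)) $$ (b, d) * of_bool (d = b))"
      using unitary_pow[OF U, of k] unfolding sum_distrib_left[symmetric] unitary_group_iff
      by (intro sum.cong refl arg_cong2[of _ _ _ _ "(*)"]) auto
    also have "\<dots> = (\<Sum>b<n. (U ^\<^sub>m (m - k)) $$ (b, b))"
      by (intro sum.cong refl) (use sum_of_bool_mult(4) in auto)
    also have "\<dots> = utr U (int (m - k))" using ck c by (simp only: utr_int) (simp add: mtrace_def)
    finally show ?thesis using utr_eq_psum[OF U] by simp
  qed
  show ?thesis
  proof (cases "k \<le> m")
    case True
    then show ?thesis using *[OF True] by (simp add: of_nat_diff)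
  next
    case False
    have "(\<Sum>a<n. \<Sum>b<n. (U ^\<^sub>m m) $$ (b, a) * cnj ((U ^\<^sub>m k) $$ (b, a)))
      = cnj (\<Sum>a<n. \<Sum>b<n. (U ^\<^sub>m k) $$ (b, a) * cnj ((U ^\<^sub>m m) $$ (b, a)))"
      by (simp add: mult.commute)
    also have "\<dots> = cnj (psum n (ev U) (int (k - m)))" using *[of m k] False by simp
    also have "\<dots> = psum n (ev U) (- int (k - m))"
      unfolding psum_def cnj_sum by (intro sum.cong refl cnj_powi_unit) simp
    finally show ?thesis using False by (simp add: of_nat_diff)
  qed
qed

lemma uent_contract:
  assumes U: "U \<in> unitary_group n"
  shows "(\<Sum>a<n. \<Sum>b<n. (U ^\<^sub>m m) $$ (b, a) * uent U l a b) = psum n (ev U) (int m + l)"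
proof (cases "l \<ge> 0")
  case True
  have c: "U \<in> carrier_mat n n" "U ^\<^sub>m m \<in> carrier_mat n n" "U ^\<^sub>m nat l \<in> carrier_mat n n" using U unitary_carrier by auto
  have "(\<Sum>a<n. \<Sum>b<n. (U ^\<^sub>m m) $$ (b, a) * uent U l a b) = (\<Sum>b<n. \<Sum>a<n. (U ^\<^sub>m m) $$ (b, a) * (U ^\<^sub>m nat l) $$ (a, b))"
    using True by (subst sum.swap) (simp add: uent_def)
  also have "\<dots> = mtrace (U ^\<^sub>m (m + nat l))"
    unfolding pow_mat_add[OF c(1)] mtrace_def using c by (simp add: mult_mat_index[of _ n n _ n])
  also have "\<dots> = utr U (int m + l)" using True by (simp add: utr_def nat_add_distrib)
  finally show ?thesis using utr_eq_psum[OF U] by simp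
next
  case False
  then show ?thesis using unitary_pow_contract[OF U, of m "nat (-l)"] by (simp add: uent_def)
qed

lemma measurable_pow [measurable]:
  assumes H: "normalized_haar n M" and "i < n" "j < n"
  shows "(\<lambda>U. (U ^\<^sub>m l) $$ (i, j)) \<in> borel_measurable M"
  using assms(3)
proof (induction l arbitrary: j)
  case 0
  have "(\<lambda>U. (U ^\<^sub>m 0) $$ (i, j)) \<in> borel_measurable M \<longleftrightarrow> (\<lambda>U. of_bool (i = j) :: complex) \<in> borel_measurable M"
    using haarD(2)[OF H] assms 0 by (intro measurable_cong) (auto dest: unitary_carrier)
  then show ?case by simp
next
  case (Suc l)
  have "(\<lambda>U. (U ^\<^sub>m Suc l) $$ (i, j)) \<in> borel_measurable M \<longleftrightarrow> (\<lambda>U. \<Sum>k<n. (U ^\<^sub>m l) $$ (i, k) * U $$ (k, j)) \<in> borel_measurable M"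
    using haarD(2)[OF H] assms Suc.prems
    by (intro measurable_cong) (auto simp: mult_mat_index[of _ n n _ n] dest: unitary_carrier)
  then show ?case using Suc measurable_unitary_entry[OF H] by simp
qed

lemma measurable_cnj [measurable]:
  "f \<in> borel_measurable M \<Longrightarrow> (\<lambda>x. cnj (f x)) \<in> borel_measurable M"
  by (rule measurable_compose[OF _ borel_measurable_continuous_onI]) (auto intro: continuous_intros)

lemma measurable_uent:
  assumes "normalized_haar n M" "i < n" "j < n"
  shows "(\<lambda>U. uent U l i j) \<in> borel_measurable M"
  using measurable_pow[OF assms] measurable_pow[OF assms(1,3,2)] by (cases "l \<ge> 0") (simp_all add: uent_def)

lemma measurable_utr:
  assumes H: "normalized_haar n M"
  shows "(\<lambda>U. utr U l) \<in> borel_measurable M"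
proof -
  have "(\<lambda>U. utr U l) \<in> borel_measurable M \<longleftrightarrow> (\<lambda>U. \<Sum>i<n. uent U l i i) \<in> borel_measurable M"
    using haarD(2)[OF H] by (intro measurable_cong) (auto simp: utr_def uent_def mtrace_def dest!: unitary_carrier)
  then show ?thesis using measurable_uent[OF H] by auto
qed

lemma measurable_uprod: "normalized_haar n M \<Longrightarrow> (\<lambda>U. uprod U ls) \<in> borel_measurable M"
  unfolding uprod_def by (induction ls) (auto intro: borel_measurable_times measurable_utr)

lemma measurable_kprod:
  assumes "normalized_haar n M" "x < n" "y < n"
  shows "(\<lambda>U. kprod U ls x y) \<in> borel_measurable M"
  by (induction ls)
     (auto intro!: borel_measurable_times borel_measurable_add measurable_utr[OF assms(1)] measurable_uprod[OF assms(1)] measurable_uent[OF assms(1)] assms)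

lemma kprod_contract:
  assumes U: "U \<in> unitary_group n"
  shows "(\<Sum>a<n. \<Sum>b<n. (U ^\<^sub>m m) $$ (b, a) * kprod U ls b a) = (\<Sum>i<n. ev U i ^ m * dpprod n (ev U) ls i)"
proof (induction ls)
  case (Cons l ls)
  have "(\<Sum>a<n. \<Sum>b<n. (U ^\<^sub>m m) $$ (b, a) * kprod U (l # ls) b a)
    = of_int l * uprod U ls * (\<Sum>a<n. \<Sum>b<n. (U ^\<^sub>m m) $$ (b, a) * uent U l a b)
      + utr U l * (\<Sum>a<n. \<Sum>b<n. (U ^\<^sub>m m) $$ (b, a) * kprod U ls b a)"
    by (simp add: sum_distrib_left sum.distrib algebra_simps)
  also have "\<dots> = of_int l * pprod n (ev U) ls * psum n (ev U) (int m + l) + psum n (ev U) l * (\<Sum>i<n. ev U i ^ m * dpprod n (ev U) ls i)"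
    unfolding Cons uent_contract[OF U] utr_eq_psum[OF U] uprod_eq_pprod[OF U] by simp
  also have "\<dots> = (\<Sum>i<n. ev U i ^ m * dpprod n (ev U) (l # ls) i)"
    by (simp add: psum_def sum_distrib_left sum.distrib algebra_simps power_int_add)
  finally show ?case .
qed simp

text \<open>The test functions are the entries \<open>(b, a)\<close> of \<open>U ^\<^sub>m m\<close>
  times a product of power sums. Each is differentiated in the direction \<open>(b, a)\<close>, and
  the results are summed over \<open>a\<close> and \<open>b\<close>. Differentiating the power
  splits one trace into products of two; differentiating the other factors joins traces
  (\<open>kprod_contract\<close>).\<close>

theorem haar_loop_equation:
  assumes H: "normalized_haar n M"
  shows "has_bochner_integral M (\<lambda>U. (\<Sum>q<m. psum n (ev U) (int q) * psum n (ev U) (int (m - q))) * pprod n (ev U) ls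
      + (\<Sum>i<n. ev U i ^ m * dpprod n (ev U) ls i)) 0"
proof -
  let ?K = "\<lambda>b a U x y. (\<Sum>q<m. (U ^\<^sub>m q) $$ (b, x) * (U ^\<^sub>m (m - q)) $$ (y, a)) * uprod U ls + (U ^\<^sub>m m) $$ (b, a) * kprod U ls x y"
  have g: "grad n (\<lambda>U. (U ^\<^sub>m m) $$ (b, a) * uprod U ls) (?K b a)" if "a < n" "b < n" for a b
    by (intro grad_mult grad_pow grad_uprod that)
  have I: "has_bochner_integral M (\<lambda>U. ?K b a U b a) 0" if "a < n" "b < n" for a b
    using that by (intro grad_integral_0[OF H g[OF that]] borel_measurable_times borel_measurable_add borel_measurable_sum
        measurable_pow[OF H] measurable_uprod[OF H] measurable_kprod[OF H]) auto
  have "has_bochner_integral M (\<lambda>U. \<Sum>a<n. \<Sum>b<n. ?K b a U b a) (\<Sum>a<n. \<Sum>b<n. 0)"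
    by (intro has_bochner_integral_sum I) auto
  moreover have "(\<Sum>a<n. \<Sum>b<n. ?K b a U b a) = (\<Sum>q<m. psum n (ev U) (int q) * psum n (ev U) (int (m - q))) * pprod n (ev U) ls
      + (\<Sum>i<n. ev U i ^ m * dpprod n (ev U) ls i)" if U: "U \<in> unitary_group n" for U
  proof -
    have "(\<Sum>a<n. \<Sum>b<n. \<Sum>q<m. (U ^\<^sub>m q) $$ (b, b) * (U ^\<^sub>m (m - q)) $$ (a, a)) = (\<Sum>q<m. utr U (int q) * utr U (int (m - q)))"
    proof -
      have "(\<Sum>a<n. \<Sum>b<n. \<Sum>q<m. (U ^\<^sub>m q) $$ (b, b) * (U ^\<^sub>m (m - q)) $$ (a, a))
        = (\<Sum>a<n. \<Sum>q<m. \<Sum>b<n. (U ^\<^sub>m q) $$ (b, b) * (U ^\<^sub>m (m - q)) $$ (a, a))"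
        by (rule sum.cong[OF refl], rule sum.swap)
      also have "\<dots> = (\<Sum>q<m. \<Sum>a<n. \<Sum>b<n. (U ^\<^sub>m q) $$ (b, b) * (U ^\<^sub>m (m - q)) $$ (a, a))" by (rule sum.swap)
      also have "\<dots> = (\<Sum>q<m. (\<Sum>b<n. (U ^\<^sub>m q) $$ (b, b)) * (\<Sum>a<n. (U ^\<^sub>m (m - q)) $$ (a, a)))"
        unfolding sum_product by (rule sum.cong[OF refl], rule sum.swap)
      finally show ?thesis using unitary_carrier[OF U] unfolding utr_int by (simp add: mtrace_def)
    qed
    then show ?thesis
      by (simp add: sum.distrib kprod_contract[OF U] sum_distrib_right[symmetric] utr_eq_psum[OF U] uprod_eq_pprod[OF U])
  qed
  ultimately show ?thesis
    using haarD(2)[OF H] by (subst has_bochner_integral_cong) auto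
qed

lemma integrable_pprod:
  assumes H: "normalized_haar n M"
  shows "integrable M (\<lambda>U. pprod n (ev U) ls)"
proof -
  interpret prob_space M using haarD[OF H] by simp
  have "norm (psum n z l) \<le> of_nat n" if "\<And>i. norm (z i) = 1" for z l
    unfolding psum_def by (rule order_trans[OF norm_sum]) (simp add: norm_power_int that)
  then have "norm (pprod n (ev U) ls) \<le> of_nat n ^ length ls" for U
    unfolding pprod_def by (induction ls) (auto simp: norm_mult intro!: mult_mono)
  moreover have "(\<lambda>U. pprod n (ev U) ls) \<in> borel_measurable M"
    using measurable_uprod[OF H, of ls] haarD(2)[OF H] uprod_eq_pprod[of _ n ls]
    by (subst measurable_cong[where g = "\<lambda>U. uprod U ls"]) auto
  ultimately show ?thesis by (intro integrable_const_bound) auto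
qed

section \<open>Sums of monomials over distinct indices\<close>

fun dsum :: "nat \<Rightarrow> (nat \<Rightarrow> complex) \<Rightarrow> int list \<Rightarrow> nat set \<Rightarrow> complex" where
  "dsum n z [] S = 1"
| "dsum n z (b # a) S = (\<Sum>j\<in>{..<n} - S. z j powi b * dsum n z a (insert j S))"

lemma dsum_swap: "dsum n z (b # c # a) S = dsum n z (c # b # a) S"
proof -
  have 1: "(\<Sum>k\<in>{..<n} - insert j S. h k) = (\<Sum>k\<in>{..<n} - S. if j \<noteq> k then h k else 0)" for j and h :: "nat \<Rightarrow> complex"
    by (rule sum.mono_neutral_cong_left) auto
  let ?h = "\<lambda>b c j k. if j \<noteq> k then z j powi b * (z k powi c * dsum n z a (insert k (insert j S))) else 0"
  have e: "dsum n z (b # c # a) S = (\<Sum>j\<in>{..<n} - S. \<Sum>k\<in>{..<n} - S. ?h b c j k)" for b c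
    unfolding dsum.simps unfolding sum_distrib_left unfolding 1 ..
  have "(\<Sum>j\<in>{..<n} - S. \<Sum>k\<in>{..<n} - S. ?h b c j k) = (\<Sum>k\<in>{..<n} - S. \<Sum>j\<in>{..<n} - S. ?h b c j k)"
    by (rule sum.swap)
  also have "\<dots> = (\<Sum>k\<in>{..<n} - S. \<Sum>j\<in>{..<n} - S. ?h c b k j)"
    by (intro sum.cong refl) (auto simp: insert_commute mult_ac)
  finally show ?thesis unfolding e .
qed

lemma dsum_Cons_cong: "(\<And>S. dsum n z a S = dsum n z a' S) \<Longrightarrow> dsum n z (b # a) S = dsum n z (b # a') S"
  by simp

lemma dsum_move: "dsum n z (us @ x # vs) S = dsum n z (x # us @ vs) S"
proof (induction us arbitrary: S)
  case (Cons u us)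
  have "dsum n z (u # (us @ x # vs)) S = dsum n z (u # (x # us @ vs)) S"
    by (rule dsum_Cons_cong) (rule Cons)
  then show ?case by (simp only: append_Cons dsum_swap[of n z u x])
qed simp

lemma dsum_perm: "mset a = mset b \<Longrightarrow> dsum n z a S = dsum n z b S"
proof (induction a arbitrary: b S)
  case (Cons x a)
  then have "x \<in> set b" by (metis list.set_intros(1) set_mset_mset)
  then obtain us vs where b: "b = us @ x # vs" by (meson split_list)
  with Cons have m: "mset a = mset (us @ vs)" by simp
  show ?case unfolding b dsum_move by (rule dsum_Cons_cong) (rule Cons.IH[OF m])
qed simp

text \<open>The additional index either differs from all those in use or coincides with exactly one
  of them, whose exponent then absorbs \<open>b\<close>. Read backwards, this reduces sums over
  distinct indices to power sums.\<close>

lemma dsum_extend: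
  assumes z: "\<And>i. z i \<noteq> 0"
  shows "(\<Sum>j\<in>{..<n} - S. z j powi b) * dsum n z a S = dsum n z (b # a) S + (\<Sum>s<length a. dsum n z (a[s := a ! s + b]) S)"
proof (induction a arbitrary: S)
  case (Cons c a)
  have "(\<Sum>j\<in>{..<n} - S. z j powi b) * dsum n z (c # a) S
    = (\<Sum>k\<in>{..<n} - S. z k powi c * ((\<Sum>j\<in>{..<n} - S. z j powi b) * dsum n z a (insert k S)))"
    by (simp add: sum_distrib_left sum_distrib_right mult_ac)
  also have "\<dots> = (\<Sum>k\<in>{..<n} - S. z k powi c * (z k powi b * dsum n z a (insert k S) + dsum n z (b # a) (insert k S)
      + (\<Sum>s<length a. dsum n z (a[s := a ! s + b]) (insert k S))))"
  proof (rule sum.cong[OF refl])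
    fix k assume k: "k \<in> {..<n} - S"
    have "(\<Sum>j\<in>{..<n} - S. z j powi b) = z k powi b + (\<Sum>j\<in>{..<n} - S - {k}. z j powi b)"
      using k by (intro sum.remove) auto
    also have "{..<n} - S - {k} = {..<n} - insert k S" by auto
    finally show "z k powi c * ((\<Sum>j\<in>{..<n} - S. z j powi b) * dsum n z a (insert k S)) = z k powi c * (z k powi b * dsum n z a (insert k S) + dsum n z (b # a) (insert k S)
      + (\<Sum>s<length a. dsum n z (a[s := a ! s + b]) (insert k S)))"
      using Cons[of "insert k S"] by (simp add: distrib_right del: dsum.simps)
  qed
  also have "\<dots> = dsum n z ((c + b) # a) S + dsum n z (c # b # a) S + (\<Sum>s<length a. dsum n z (c # a[s := a ! s + b]) S)"
  proof -
    have "(\<Sum>k\<in>{..<n} - S. z k powi c * (\<Sum>s<length a. dsum n z (a[s := a ! s + b]) (insert k S)))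
      = (\<Sum>s<length a. dsum n z (c # a[s := a ! s + b]) S)"
      unfolding sum_distrib_left dsum.simps by (rule sum.swap)
    moreover have "(\<Sum>k\<in>{..<n} - S. z k powi c * (z k powi b * dsum n z a (insert k S))) = dsum n z ((c + b) # a) S"
      using z by (simp add: power_int_add mult.assoc)
    moreover have "(\<Sum>k\<in>{..<n} - S. z k powi c * dsum n z (b # a) (insert k S)) = dsum n z (c # b # a) S"
      by simp
    ultimately show ?thesis by (simp only: distrib_left sum.distrib)
  qed
  also have "dsum n z (c # b # a) S = dsum n z (b # c # a) S" by (rule dsum_swap)
  also have "dsum n z ((c + b) # a) S + dsum n z (b # c # a) S + (\<Sum>s<length a. dsum n z (c # a[s := a ! s + b]) S)
    = dsum n z (b # c # a) S + (\<Sum>s<length (c # a). dsum n z ((c # a)[s := (c # a) ! s + b]) S)"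
    by (simp add: sum.lessThan_Suc_shift del: dsum.simps sum.lessThan_Suc)
  finally show ?case .
qed simp

definition remove_nth :: "nat \<Rightarrow> 'a list \<Rightarrow> 'a list" where
  "remove_nth s a = take s a @ drop (Suc s) a"

lemma remove_nth_simps [simp]: "remove_nth 0 (c # a) = a" "remove_nth (Suc s) (c # a) = c # remove_nth s a"
  by (simp_all add: remove_nth_def)

lemma mset_remove_nth: "s < length a \<Longrightarrow> mset (a ! s # remove_nth s a) = mset a"
  by (subst (3) id_take_nth_drop[of s a]) (auto simp: remove_nth_def)

lemma length_remove_nth: "s < length a \<Longrightarrow> Suc (length (remove_nth s a)) = length a"
  by (simp add: remove_nth_def)

text \<open>With as many exponents as available indices every index is used, so \<open>k\<close>
  carries exactly one of the exponents.\<close>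

lemma dsum_full:
  assumes "card ({..<n} - S) = length a" "k \<in> {..<n} - S"
  shows "dsum n z a S = (\<Sum>s<length a. z k powi (a ! s) * dsum n z (remove_nth s a) (insert k S))"
  using assms
proof (induction a arbitrary: S)
  case Nil
  then show ?case by (simp add: card_eq_0_iff) blast
next
  case (Cons c a)
  let ?A = "{..<n} - S"
  have A': "{..<n} - insert k S = ?A - {k}" by auto
  have IH: "dsum n z a (insert j S) = (\<Sum>s<length a. z k powi (a ! s) * dsum n z (remove_nth s a) (insert k (insert j S)))"
    if "j \<in> ?A - {k}" for j
  proof (rule Cons.IH)
    have "{..<n} - insert j S = ?A - {j}" by auto
    then show "card ({..<n} - insert j S) = length a" using Cons.prems that by simp
    show "k \<in> {..<n} - insert j S" using Cons.prems that by auto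
  qed
  have "dsum n z (c # a) S = z k powi c * dsum n z a (insert k S) + (\<Sum>j\<in>?A - {k}. z j powi c * dsum n z a (insert j S))"
    using Cons.prems by (simp add: sum.remove)
  also have "(\<Sum>j\<in>?A - {k}. z j powi c * dsum n z a (insert j S))
     = (\<Sum>j\<in>?A - {k}. \<Sum>s<length a. z k powi (a ! s) * (z j powi c * dsum n z (remove_nth s a) (insert j (insert k S))))"
    by (intro sum.cong refl) (simp add: IH sum_distrib_left mult_ac insert_commute)
  also have "\<dots> = (\<Sum>s<length a. z k powi (a ! s) * dsum n z (c # remove_nth s a) (insert k S))"
    by (subst sum.swap) (simp add: A' sum_distrib_left)
  finally show ?case by (simp add: sum.lessThan_Suc_shift del: dsum.simps sum.lessThan_Suc)
qed

section \<open>Loop equations in terms of the eigenvalues\<close>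

definition torus :: "(nat \<Rightarrow> complex) set" where
  "torus = {z. \<forall>i. norm (z i) = 1}"

lemma torus_nz: "z \<in> torus \<Longrightarrow> z i \<noteq> 0" and torus_norm: "z \<in> torus \<Longrightarrow> norm (z i) = 1"
  by (auto simp: torus_def) (metis norm_zero zero_neq_one)

lemma ev_torus: "ev U \<in> torus"
  by (simp add: torus_def)

text \<open>On the torus \<open>(z i + z k) / (z i - z k)\<close> is the logarithmic derivative
  \<open>z\<^sub>i \<partial>\<^sub>i\<close> of the squared distance of \<open>z i\<close> and
  \<open>z k\<close>. This is the resulting interaction term of eigenvalue dynamics, symmetrized in
  \<open>i\<close> and \<open>k\<close> so that the pole becomes a divided difference.\<close>

definition pairsum :: "nat \<Rightarrow> (nat \<Rightarrow> complex) \<Rightarrow> (nat \<Rightarrow> complex) \<Rightarrow> complex" where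
  "pairsum n z f = (\<Sum>i<n. \<Sum>k\<in>{..<n} - {i}. (z i + z k) / (2 * (z i - z k)) * (f i - f k))"

text \<open>\<open>sqz m c h\<close> is the sum of \<open>h\<close> over the exponent pairs obtained from \<open>(m, c)\<close> by moving the two exponents
  towards each other, with the sign of \<open>m - c\<close>; it arises from
  \<open>(x + y) (x^m y^c - x^c y^m) / (x - y)\<close>.\<close>

definition sqz :: "int \<Rightarrow> int \<Rightarrow> (int \<Rightarrow> int \<Rightarrow> complex) \<Rightarrow> complex" where
  "sqz m c h = (\<Sum>q<nat (m - c). h (m - int q) (c + int q)) - (\<Sum>q<nat (c - m). h (m + int q) (c - int q))"

text \<open>After a common monomial is factored out, the quotient by \<open>x - y\<close> is a
  geometric sum. Multiplying it by \<open>x + y\<close>, written once in each order of summation,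
  produces the two symmetric halves.\<close>

lemma pair_quotient:
  assumes "x \<noteq> y" "x \<noteq> 0" "y \<noteq> (0 :: complex)"
  shows "(x + y) / (x - y) * (x powi m * y powi c - y powi m * x powi c)
    = sqz m c (\<lambda>a b. x powi a * y powi b) + sqz m c (\<lambda>a b. y powi a * x powi b)"
proof -
  have gt: "(x + y) / (x - y) * (x powi m * y powi c - y powi m * x powi c)
    = (\<Sum>q<nat (m - c). x powi (m - int q) * y powi (c + int q) + y powi (m - int q) * x powi (c + int q))"
    if mc: "c \<le> m" and xy: "x \<noteq> y" "x \<noteq> 0" "y \<noteq> 0" for m c and x y :: complex
  proof -
    define d where "d = nat (m - c)"
    have m: "m = c + int d" using mc by (simp add: d_def)
    have "x ^ d - y ^ d = (x - y) * (\<Sum>q<d. y ^ (d - Suc q) * x ^ q)" by (rule power_diff_sumr2)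
    then have D: "(x ^ d - y ^ d) / (x - y) = (\<Sum>q<d. y ^ (d - Suc q) * x ^ q)" using xy by simp
    have D': "(\<Sum>q<d. y ^ (d - Suc q) * x ^ q) = (\<Sum>q<d. x ^ (d - Suc q) * y ^ q)"
      by (subst sum.nat_diff_reindex[symmetric]) (auto intro!: sum.cong simp: mult.commute)
    have e: "x powi m * y powi c - y powi m * x powi c = x powi c * y powi c * (x ^ d - y ^ d)"
      using xy by (simp add: m power_int_add algebra_simps)
    have "(x + y) / (x - y) * (x powi m * y powi c - y powi m * x powi c)
      = x powi c * y powi c * ((x + y) * ((x ^ d - y ^ d) / (x - y)))"
      unfolding e by simp
    also have "(x + y) * ((x ^ d - y ^ d) / (x - y)) = x * (\<Sum>q<d. x ^ (d - Suc q) * y ^ q) + y * (\<Sum>q<d. y ^ (d - Suc q) * x ^ q)"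
      unfolding D by (simp only: distrib_right D'[symmetric])
    also have "\<dots> = (\<Sum>q<d. x ^ (d - q) * y ^ q + y ^ (d - q) * x ^ q)"
      unfolding sum_distrib_left sum.distrib
      by (intro arg_cong2[of _ _ _ _ "(+)"] sum.cong refl) (auto simp: Suc_diff_Suc simp flip: power_Suc mult.assoc)
    also have "x powi c * y powi c * \<dots> = (\<Sum>q<d. x powi (m - int q) * y powi (c + int q) + y powi (m - int q) * x powi (c + int q))"
      unfolding sum_distrib_left
    proof (rule sum.cong[OF refl])
      fix q assume "q \<in> {..<d}"
      then have "m - int q = c + int (d - q)" by (simp add: m of_nat_diff)
      then show "x powi c * y powi c * (x ^ (d - q) * y ^ q + y ^ (d - q) * x ^ q)
        = x powi (m - int q) * y powi (c + int q) + y powi (m - int q) * x powi (c + int q)"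
        using xy by (simp add: power_int_add algebra_simps)
    qed
    finally show ?thesis by (simp add: d_def)
  qed
  show ?thesis
  proof (cases "c \<le> m")
    case True
    then show ?thesis using gt[OF True assms] by (simp add: sqz_def sum.distrib)
  next
    case False
    have "(x + y) / (x - y) * (x powi m * y powi c - y powi m * x powi c)
      = - ((x + y) / (x - y) * (x powi c * y powi m - y powi c * x powi m))"
      by (simp add: algebra_simps)
    also have "\<dots> = - (\<Sum>q<nat (c - m). x powi (c - int q) * y powi (m + int q) + y powi (c - int q) * x powi (m + int q))"
      using gt[of m c x y] assms False by simp
    finally show ?thesis using False by (simp add: sqz_def sum.distrib mult.commute add.commute)
  qed
qed

lemma sqz_sum: "finite A \<Longrightarrow> (\<Sum>a\<in>A. sqz m c (h a)) = sqz m c (\<lambda>x y. \<Sum>a\<in>A. h a x y)"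
  unfolding sqz_def sum_subtractf by (intro arg_cong2[of _ _ _ _ "(-)"] sum.swap)

lemma sqz_mult: "sqz m c h * w = sqz m c (\<lambda>x y. h x y * w)"
  by (simp add: sqz_def sum_distrib_right left_diff_distrib)

text \<open>Beside the marked exponent there are \<open>n - 1\<close> others, so
  \<open>dsum_full\<close> shows how each term depends on \<open>z k\<close>. Every summand of the
  difference is then an antisymmetrized monomial in \<open>z i\<close> and \<open>z k\<close>, to
  which \<open>pair_quotient\<close> applies.\<close>

lemma pairsum_marked:
  assumes z: "z \<in> torus" "inj_on z {..<n}" and len: "Suc (length a) = n"
  shows "pairsum n z (\<lambda>i. z i powi m * dsum n z a {i})
    = (\<Sum>s<length a. sqz m (a ! s) (\<lambda>x y. dsum n z (x # y # remove_nth s a) {}))"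
proof -
  note nz = torus_nz[OF z(1)]
  have *: "(z i + z k) / (2 * (z i - z k)) * (z i powi m * dsum n z a {i} - z k powi m * dsum n z a {k})
    = (\<Sum>s<length a. (sqz m (a ! s) (\<lambda>x y. z i powi x * z k powi y) + sqz m (a ! s) (\<lambda>x y. z k powi x * z i powi y)) / 2
        * dsum n z (remove_nth s a) {k, i})" if ik: "i < n" "k < n" "i \<noteq> k" for i k
  proof -
    have ne: "z i \<noteq> z k" using z(2) ik by (auto simp: inj_on_def)
    have ai: "dsum n z a {i} = (\<Sum>s<length a. z k powi (a ! s) * dsum n z (remove_nth s a) {k, i})"
      using dsum_full[of n "{i}" a k z] ik len by auto
    have ak: "dsum n z a {k} = (\<Sum>s<length a. z i powi (a ! s) * dsum n z (remove_nth s a) {k, i})"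
      using dsum_full[of n "{k}" a i z] ik len by (auto simp: insert_commute)
    have "(z i + z k) / (2 * (z i - z k)) * (z i powi m * dsum n z a {i} - z k powi m * dsum n z a {k})
      = (\<Sum>s<length a. ((z i + z k) / (z i - z k) * (z i powi m * z k powi (a ! s) - z k powi m * z i powi (a ! s))) / 2
        * dsum n z (remove_nth s a) {k, i})"
    proof -
      define Q where "Q = (z i + z k) / (z i - z k)"
      have h: "(z i + z k) / (2 * (z i - z k)) = Q / 2" by (simp add: Q_def)
      show ?thesis
        unfolding h ai ak Q_def[symmetric]
        by (simp add: sum_distrib_left sum_subtractf[symmetric] algebra_simps diff_divide_distrib)
    qed
    then show ?thesis unfolding pair_quotient[OF ne nz nz] .
  qed
  have D: "dsum n z (x # y # r) {} = (\<Sum>i<n. \<Sum>k\<in>{..<n} - {i}. z i powi x * z k powi y * dsum n z r {k, i})" for x y r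
    by (simp add: sum_distrib_left mult.assoc)
  have D': "dsum n z (x # y # r) {} = (\<Sum>i<n. \<Sum>k\<in>{..<n} - {i}. z k powi x * z i powi y * dsum n z r {k, i})" for x y r
    by (subst dsum_swap, subst D) (simp add: mult_ac)
  have "pairsum n z (\<lambda>i. z i powi m * dsum n z a {i})
    = (\<Sum>i<n. \<Sum>k\<in>{..<n} - {i}. \<Sum>s<length a. (sqz m (a ! s) (\<lambda>x y. z i powi x * z k powi y) + sqz m (a ! s) (\<lambda>x y. z k powi x * z i powi y)) / 2
        * dsum n z (remove_nth s a) {k, i})"
    unfolding pairsum_def by (intro sum.cong refl *) auto
  also have "\<dots> = (\<Sum>s<length a. \<Sum>i<n. \<Sum>k\<in>{..<n} - {i}. (sqz m (a ! s) (\<lambda>x y. z i powi x * z k powi y) + sqz m (a ! s) (\<lambda>x y. z k powi x * z i powi y)) / 2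
        * dsum n z (remove_nth s a) {k, i})"
    by (subst sum.swap[of _ "{..<length a}"]) (rule sum.swap)
  also have "\<dots> = (\<Sum>s<length a. sqz m (a ! s) (\<lambda>x y. dsum n z (x # y # remove_nth s a) {}))"
  proof (rule sum.cong[OF refl])
    fix s
    let ?r = "remove_nth s a"
    have "(\<Sum>i<n. \<Sum>k\<in>{..<n} - {i}. (sqz m (a ! s) (\<lambda>x y. z i powi x * z k powi y) + sqz m (a ! s) (\<lambda>x y. z k powi x * z i powi y)) / 2 * dsum n z ?r {k, i})
      = (sqz m (a ! s) (\<lambda>x y. \<Sum>i<n. \<Sum>k\<in>{..<n} - {i}. z i powi x * z k powi y * dsum n z ?r {k, i})
       + sqz m (a ! s) (\<lambda>x y. \<Sum>i<n. \<Sum>k\<in>{..<n} - {i}. z k powi x * z i powi y * dsum n z ?r {k, i})) / 2"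
    proof -
      have e: "sqz m c (\<lambda>x y. \<Sum>i<n. \<Sum>k\<in>{..<n} - {i}. h i k x y * w i k) = (\<Sum>i<n. \<Sum>k\<in>{..<n} - {i}. sqz m c (h i k) * w i k)"
        for c h and w :: "nat \<Rightarrow> nat \<Rightarrow> complex"
        by (simp add: sqz_sum sqz_mult)
      show ?thesis unfolding e sum.distrib[symmetric] sum_divide_distrib
        by (intro sum.cong refl) (simp add: field_simps)
    qed
    then show "(\<Sum>i<n. \<Sum>k\<in>{..<n} - {i}. (sqz m (a ! s) (\<lambda>x y. z i powi x * z k powi y) + sqz m (a ! s) (\<lambda>x y. z k powi x * z i powi y)) / 2 * dsum n z ?r {k, i})
      = sqz m (a ! s) (\<lambda>x y. dsum n z (x # y # ?r) {})"
      unfolding D[symmetric] D'[symmetric] by simp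
  qed
  finally show ?thesis .
qed

text \<open>\<open>f\<close> is a function of a marked eigenvalue and \<open>d\<close> stands for \<open>z\<^sub>i \<partial>\<^sub>i f\<^sub>i\<close>. The divided differences in
  \<^const>\<open>pairsum\<close> only make sense for distinct eigenvalues, so the loop equation is stated for the
  continuous extension \<open>g\<close> of the resulting symmetric function.\<close>

definition loop_eq :: "nat \<Rightarrow> complex mat measure \<Rightarrow> (nat \<Rightarrow> (nat \<Rightarrow> complex) \<Rightarrow> complex) \<Rightarrow>
    (nat \<Rightarrow> (nat \<Rightarrow> complex) \<Rightarrow> complex) \<Rightarrow> bool" where
  "loop_eq n M f d \<longleftrightarrow> (\<exists>g.
     (\<forall>z\<in>torus. inj_on z {..<n} \<longrightarrow> g z = (\<Sum>i<n. d i z) + pairsum n z (\<lambda>i. f i z)) \<and>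
     (\<forall>z\<in>torus. isCont (\<lambda>e. g (\<lambda>i. z i * cis (e * real i))) 0) \<and>
     has_bochner_integral M (\<lambda>U. g (ev U)) 0)"

lemma loop_eq_cong:
  assumes "loop_eq n M f d" "\<And>i z. i < n \<Longrightarrow> z \<in> torus \<Longrightarrow> f i z = f' i z" "\<And>i z. i < n \<Longrightarrow> z \<in> torus \<Longrightarrow> d i z = d' i z"
  shows "loop_eq n M f' d'"
proof -
  have "pairsum n z (\<lambda>i. f i z) = pairsum n z (\<lambda>i. f' i z)" if "z \<in> torus" for z
    using assms(2) that by (auto simp: pairsum_def intro!: sum.cong)
  then show ?thesis using assms unfolding loop_eq_def by simp
qed

lemma loop_eq_diff:
  assumes "loop_eq n M f d" "loop_eq n M f' d'"
  shows "loop_eq n M (\<lambda>i z. f i z - f' i z) (\<lambda>i z. d i z - d' i z)"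
proof -
  have *: "pairsum n z (\<lambda>i. f i z - f' i z) = pairsum n z (\<lambda>i. f i z) - pairsum n z (\<lambda>i. f' i z)" for z
    unfolding pairsum_def sum_subtractf[symmetric] by (intro sum.cong refl) (simp only: algebra_simps)
  from assms obtain g g' where g:
     "\<forall>z\<in>torus. inj_on z {..<n} \<longrightarrow> g z = (\<Sum>i<n. d i z) + pairsum n z (\<lambda>i. f i z)"
     "\<forall>z\<in>torus. isCont (\<lambda>e. g (\<lambda>i. z i * cis (e * real i))) 0"
     "has_bochner_integral M (\<lambda>U. g (ev U)) 0"
     "\<forall>z\<in>torus. inj_on z {..<n} \<longrightarrow> g' z = (\<Sum>i<n. d' i z) + pairsum n z (\<lambda>i. f' i z)"
     "\<forall>z\<in>torus. isCont (\<lambda>e. g' (\<lambda>i. z i * cis (e * real i))) 0"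
     "has_bochner_integral M (\<lambda>U. g' (ev U)) 0"
    unfolding loop_eq_def by blast
  show ?thesis unfolding loop_eq_def
    using g has_bochner_integral_diff[OF g(3,6)]
    by (intro exI[of _ "\<lambda>z. g z - g' z"]) (auto simp: * sum_subtractf)
qed

lemma loop_eq_zero: "loop_eq n M (\<lambda>i z. 0) (\<lambda>i z. 0)"
  unfolding loop_eq_def by (intro exI[of _ "\<lambda>z. 0"]) (auto simp: pairsum_def has_bochner_integral_zero)

lemma loop_eq_add:
  assumes "loop_eq n M f d" "loop_eq n M f' d'"
  shows "loop_eq n M (\<lambda>i z. f i z + f' i z) (\<lambda>i z. d i z + d' i z)"
  using loop_eq_diff[OF assms(1) loop_eq_diff[OF loop_eq_zero assms(2)]] by simp

lemma loop_eq_sum: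
  assumes "finite A" "\<And>a. a \<in> A \<Longrightarrow> loop_eq n M (f a) (d a)"
  shows "loop_eq n M (\<lambda>i z. \<Sum>a\<in>A. f a i z) (\<lambda>i z. \<Sum>a\<in>A. d a i z)"
  using assms by (induction A rule: finite_induct) (simp_all add: loop_eq_zero loop_eq_add)

lemma isCont_cnj: "isCont g x \<Longrightarrow> isCont (\<lambda>x. cnj (g x)) x"
  by (rule continuous_cnj)

text \<open>The factor \<open>(z i + z k) / (z i - z k)\<close> is purely imaginary on the torus, so
  conjugation changes the sign of the pair term just as it changes that of the derivative.\<close>

lemma loop_eq_cnj:
  assumes "loop_eq n M f d"
  shows "loop_eq n M (\<lambda>i z. cnj (f i z)) (\<lambda>i z. - cnj (d i z))"
proof -
  have *: "pairsum n z (\<lambda>i. cnj (f i z)) = - cnj (pairsum n z (\<lambda>i. f i z))" if "z \<in> torus" "inj_on z {..<n}" for z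
  proof -
    have q: "(z i + z k) / (2 * (z i - z k)) = - cnj ((z i + z k) / (2 * (z i - z k)))" if "i < n" "k \<in> {..<n} - {i}" for i k
    proof -
      have ne: "z i \<noteq> z k" using that \<open>inj_on z _\<close> by (auto simp: inj_on_def)
      have c: "cnj (z i) = inverse (z i)" for i
        using cnj_powi_unit[of "z i" 1] torus_norm[OF \<open>z \<in> torus\<close>] by (simp add: power_int_minus)
      show ?thesis using ne torus_nz[OF \<open>z \<in> torus\<close>] unfolding complex_cnj_divide complex_cnj_add complex_cnj_mult complex_cnj_diff c
        by (simp add: divide_simps) (simp add: algebra_simps)
    qed
    show ?thesis unfolding pairsum_def cnj_sum sum_negf[symmetric]
      by (intro sum.cong refl, subst q) (simp_all only: lessThan_iff complex_cnj_mult complex_cnj_diff mult_minus_left)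
  qed
  from assms obtain g where g:
     "\<forall>z\<in>torus. inj_on z {..<n} \<longrightarrow> g z = (\<Sum>i<n. d i z) + pairsum n z (\<lambda>i. f i z)"
     "\<forall>z\<in>torus. isCont (\<lambda>e. g (\<lambda>i. z i * cis (e * real i))) 0"
     "has_bochner_integral M (\<lambda>U. g (ev U)) 0"
    unfolding loop_eq_def by blast
  have "has_bochner_integral M (\<lambda>U. - cnj (g (ev U))) (- cnj 0)"
    by (intro has_bochner_integral_minus has_bochner_integral_cnj g)
  then show ?thesis unfolding loop_eq_def
    using g by (intro exI[of _ "\<lambda>z. - cnj (g z)"]) (auto simp: * sum_negf intro!: isCont_cnj)
qed

lemma isCont_path_powi:
  assumes "z \<in> torus"
  shows "isCont (\<lambda>e. (z i * cis (e * real i)) powi l) 0"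
  using torus_nz[OF assms] unfolding cis_conv_exp by (intro continuous_intros) auto

lemma isCont_path_psum: "z \<in> torus \<Longrightarrow> isCont (\<lambda>e. psum n (\<lambda>i. z i * cis (e * real i)) l) 0"
  unfolding psum_def by (intro continuous_intros isCont_path_powi)

lemma isCont_path_pprod: "z \<in> torus \<Longrightarrow> isCont (\<lambda>e. pprod n (\<lambda>i. z i * cis (e * real i)) ls) 0"
  unfolding pprod_def by (induction ls) (auto intro!: continuous_intros isCont_path_psum)

lemma isCont_path_dpprod: "z \<in> torus \<Longrightarrow> isCont (\<lambda>e. dpprod n (\<lambda>i. z i * cis (e * real i)) ls j) 0"
  by (induction ls) (auto intro!: continuous_intros isCont_path_psum isCont_path_pprod isCont_path_powi)

lemma isCont_path_dsum: "z \<in> torus \<Longrightarrow> isCont (\<lambda>e. dsum n (\<lambda>i. z i * cis (e * real i)) a S) 0"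
  by (induction a arbitrary: S) (auto intro!: continuous_intros isCont_path_powi)

text \<open>In the double sum over eigenvalues the diagonal gives the derivative of the
  \<open>m\<close>-th power, and the rest, symmetrized in \<open>i\<close> and \<open>k\<close>,
  gives the divided difference.\<close>

lemma divided_power_sum:
  assumes "inj_on z {..<n}"
  shows "(\<Sum>q<m. psum n z (int q) * psum n z (int (m - q))) = (\<Sum>i<n. of_nat m * z i ^ m) + pairsum n z (\<lambda>i. z i ^ m)"
proof -
  define D where "D i k = (\<Sum>q<m. z i ^ q * z k ^ (m - q))" for i k
  have sym: "D i k + D k i = (z i + z k) / (z i - z k) * (z i ^ m - z k ^ m)" if "i < n" "k \<in> {..<n} - {i}" for i k
  proof -
    have ne: "z i \<noteq> z k" using that assms by (auto simp: inj_on_def)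
    have E: "(z i ^ m - z k ^ m) = (z i - z k) * (\<Sum>q<m. z k ^ (m - Suc q) * z i ^ q)" by (rule power_diff_sumr2)
    have E': "(\<Sum>q<m. z k ^ (m - Suc q) * z i ^ q) = (\<Sum>q<m. z i ^ (m - Suc q) * z k ^ q)"
      by (subst sum.nat_diff_reindex[symmetric]) (auto intro!: sum.cong simp: mult.commute)
    have 1: "D i k = z k * (\<Sum>q<m. z k ^ (m - Suc q) * z i ^ q)" for i k
      unfolding D_def sum_distrib_left
      by (intro sum.cong refl) (auto simp: Suc_diff_Suc simp flip: power_Suc mult.assoc)
    have "D i k + D k i = (z i + z k) * (\<Sum>q<m. z k ^ (m - Suc q) * z i ^ q)"
      unfolding 1[of i k] 1[of k i] E'[symmetric] by (simp add: algebra_simps)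
    moreover have "(\<Sum>q<m. z k ^ (m - Suc q) * z i ^ q) = (z i ^ m - z k ^ m) / (z i - z k)" using ne E by simp
    ultimately show ?thesis by simp
  qed
  have "(\<Sum>q<m. psum n z (int q) * psum n z (int (m - q))) = (\<Sum>i<n. \<Sum>k<n. D i k)"
    unfolding psum_def power_int_of_nat sum_product D_def
    by (rule trans[OF sum.swap]) (rule sum.cong[OF refl], rule sum.swap)
  also have "\<dots> = (\<Sum>i<n. D i i + (\<Sum>k\<in>{..<n} - {i}. D i k))"
    by (intro sum.cong refl sum.remove) auto
  also have "\<dots> = (\<Sum>i<n. D i i) + (\<Sum>i<n. \<Sum>k\<in>{..<n} - {i}. D i k)" by (simp add: sum.distrib)
  also have "(\<Sum>i<n. D i i) = (\<Sum>i<n. of_nat m * z i ^ m)"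
    unfolding D_def by (intro sum.cong refl) (simp flip: power_add)
  also have "(\<Sum>i<n. \<Sum>k\<in>{..<n} - {i}. D i k) = pairsum n z (\<lambda>i. z i ^ m)"
  proof -
    have sw: "(\<Sum>i<n. \<Sum>k\<in>{..<n} - {i}. D i k) = (\<Sum>i<n. \<Sum>k\<in>{..<n} - {i}. D k i)"
    proof -
      have "(\<Sum>i<n. \<Sum>k\<in>{..<n} - {i}. D i k) = (\<Sum>i<n. \<Sum>k<n. if i \<noteq> k then D i k else 0)" for D :: "nat \<Rightarrow> nat \<Rightarrow> complex"
        by (intro sum.cong refl sum.mono_neutral_cong_left) auto
      note e = this
      show ?thesis unfolding e by (subst sum.swap) (auto intro!: sum.cong)
    qed
    have "2 * (\<Sum>i<n. \<Sum>k\<in>{..<n} - {i}. D i k) = (\<Sum>i<n. \<Sum>k\<in>{..<n} - {i}. D i k + D k i)"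
      using sw by (simp add: sum.distrib)
    also have "\<dots> = (\<Sum>i<n. \<Sum>k\<in>{..<n} - {i}. 2 * ((z i + z k) / (2 * (z i - z k)) * (z i ^ m - z k ^ m)))"
    proof (intro sum.cong refl)
      fix i k assume ik: "i \<in> {..<n}" "k \<in> {..<n} - {i}"
      have h: "2 * (p / (2 * r) * w) = p / r * w" for p r w :: complex by simp
      show "D i k + D k i = 2 * ((z i + z k) / (2 * (z i - z k)) * (z i ^ m - z k ^ m))"
        unfolding h using ik by (intro sym) auto
    qed
    also have "\<dots> = 2 * pairsum n z (\<lambda>i. z i ^ m)" by (simp add: pairsum_def sum_distrib_left)
    finally show ?thesis by simp
  qed
  finally show ?thesis .
qed

lemma pairsum_mult: "pairsum n z f * c = pairsum n z (\<lambda>i. f i * c)"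
  by (simp add: pairsum_def sum_distrib_right left_diff_distrib right_diff_distrib mult.assoc)

lemma loop_eq_base_nat:
  assumes H: "normalized_haar n M"
  shows "loop_eq n M (\<lambda>i z. z i powi (int m) * pprod n z ls)
     (\<lambda>i z. of_nat m * z i powi (int m) * pprod n z ls + z i powi (int m) * dpprod n z ls i)"
  unfolding loop_eq_def
proof (intro exI[of _ "\<lambda>z. (\<Sum>q<m. psum n z (int q) * psum n z (int (m - q))) * pprod n z ls + (\<Sum>i<n. z i powi int m * dpprod n z ls i)"] conjI ballI impI)
  fix z assume "z \<in> torus"
  show "isCont (\<lambda>e. (\<Sum>q<m. psum n (\<lambda>i. z i * cis (e * real i)) (int q) * psum n (\<lambda>i. z i * cis (e * real i)) (int (m - q))) * pprod n (\<lambda>i. z i * cis (e * real i)) ls +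
     (\<Sum>i<n. (z i * cis (e * real i)) powi int m * dpprod n (\<lambda>i. z i * cis (e * real i)) ls i)) 0"
    using \<open>z \<in> torus\<close>
    by (intro continuous_intros isCont_path_psum isCont_path_pprod isCont_path_dpprod isCont_path_powi)
  assume "inj_on z {..<n}"
  then show "(\<Sum>q<m. psum n z (int q) * psum n z (int (m - q))) * pprod n z ls + (\<Sum>i<n. z i powi int m * dpprod n z ls i)
    = (\<Sum>i<n. of_nat m * z i powi int m * pprod n z ls + z i powi int m * dpprod n z ls i) + pairsum n z (\<lambda>i. z i powi int m * pprod n z ls)"
    by (simp only: divided_power_sum) (simp add: pairsum_mult[symmetric] sum.distrib sum_distrib_right[symmetric] distrib_right)
next
  show "has_bochner_integral M (\<lambda>U. (\<Sum>q<m. psum n (ev U) (int q) * psum n (ev U) (int (m - q))) * pprod n (ev U) ls + (\<Sum>i<n. ev U i powi int m * dpprod n (ev U) ls i)) 0"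
    using haar_loop_equation[OF H, of m ls] by simp
qed

lemma cnj_pprod:
  assumes "z \<in> torus"
  shows "cnj (pprod n z ls) = pprod n z (map uminus ls)" "- cnj (dpprod n z ls i) = dpprod n z (map uminus ls) i"
proof -
  have p: "cnj (psum n z l) = psum n z (- l)" for l
    unfolding psum_def cnj_sum using torus_norm[OF assms] by (intro sum.cong refl cnj_powi_unit)
  show 1: "cnj (pprod n z ls) = pprod n z (map uminus ls)" for ls
    by (induction ls) (auto simp: pprod_def p)
  show "- cnj (dpprod n z ls i) = dpprod n z (map uminus ls) i"
  proof (induction ls)
    case (Cons l ls)
    have "- cnj (dpprod n z (l # ls) i) = - (of_int l * cnj (z i powi l) * pprod n z (map uminus ls)) + psum n z (- l) * (- cnj (dpprod n z ls i))"
      by (simp add: 1 p del: complex_cnj_power_int)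
    then show ?case unfolding cnj_powi_unit[OF torus_norm[OF assms]] Cons by simp
  qed simp
qed

text \<open>Negative exponents are reached by conjugating the equation for \<open>- m\<close> and
  \<open>map uminus ls\<close>.\<close>

lemma loop_eq_base:
  assumes H: "normalized_haar n M"
  shows "loop_eq n M (\<lambda>i z. z i powi m * pprod n z ls)
     (\<lambda>i z. of_int m * z i powi m * pprod n z ls + z i powi m * dpprod n z ls i)"
proof (cases "m \<ge> 0")
  case True
  then show ?thesis using loop_eq_base_nat[OF H, of "nat m" ls] by simp
next
  case False
  have mm: "map uminus (map uminus ls) = ls" by (induction ls) auto
  have "loop_eq n M (\<lambda>i z. cnj (z i powi int (nat (- m)) * pprod n z (map uminus ls)))
     (\<lambda>i z. - cnj (of_nat (nat (- m)) * z i powi int (nat (- m)) * pprod n z (map uminus ls) + z i powi int (nat (- m)) * dpprod n z (map uminus ls) i))"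
    by (rule loop_eq_cnj[OF loop_eq_base_nat[OF H]])
  then show ?thesis
  proof (rule loop_eq_cong)
    fix i :: nat and z :: "nat \<Rightarrow> complex" assume z: "z \<in> torus"
    have c: "cnj (z i powi (- m)) = z i powi m" using cnj_powi_unit[OF torus_norm[OF z], of i "-m"] by simp
    show "cnj (z i powi int (nat (- m)) * pprod n z (map uminus ls)) = z i powi m * pprod n z ls"
      unfolding complex_cnj_mult cnj_pprod[OF z] mm using False c by simp
    have "- cnj (of_nat (nat (- m)) * z i powi int (nat (- m)) * pprod n z (map uminus ls) + z i powi int (nat (- m)) * dpprod n z (map uminus ls) i)
      = - (of_nat (nat (- m)) * cnj (z i powi (- m)) * cnj (pprod n z (map uminus ls))) + cnj (z i powi (- m)) * (- cnj (dpprod n z (map uminus ls) i))"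
      using False by simp
    then show "- cnj (of_nat (nat (- m)) * z i powi int (nat (- m)) * pprod n z (map uminus ls) + z i powi int (nat (- m)) * dpprod n z (map uminus ls) i)
      = of_int m * z i powi m * pprod n z ls + z i powi m * dpprod n z ls i"
      unfolding c cnj_pprod[OF z] mm using False by simp
  qed
qed

text \<open>The sum over the other indices avoids \<open>i\<close>, so
  \<open>z\<^sub>i \<partial>\<^sub>i\<close> only acts on the marked power and on the power sums.
  The induction removes one exponent of \<open>a\<close> by \<open>dsum_extend\<close>: it moves
  into \<open>ls\<close> as a power sum, minus the cases where it falls on the marked index or on
  another exponent.\<close>

lemma loop_eq_marked:
  assumes H: "normalized_haar n M"
  shows "loop_eq n M (\<lambda>i z. z i powi m * dsum n z a {i} * pprod n z ls)
     (\<lambda>i z. of_int m * (z i powi m * dsum n z a {i}) * pprod n z ls + z i powi m * dsum n z a {i} * dpprod n z ls i)"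
proof (induction "length a" arbitrary: a m ls)
  case 0
  then show ?case using loop_eq_base[OF H, of m ls] by simp
next
  case (Suc k)
  then obtain b a' where a: "a = b # a'" "length a' = k" by (cases a) auto
  let ?a = "\<lambda>s. a'[s := a' ! s + b]"
  note IH = Suc(1)
  have rec: "dsum n z a {i} = psum n z b * dsum n z a' {i} - z i powi b * dsum n z a' {i} - (\<Sum>s<k. dsum n z (?a s) {i})"
    if "z \<in> torus" "i < n" for z i
  proof -
    have "psum n z b = z i powi b + (\<Sum>j\<in>{..<n} - {i}. z j powi b)"
      unfolding psum_def using that by (intro sum.remove) auto
    then show ?thesis using dsum_extend[OF torus_nz[OF that(1)], where S = "{i}" and n = n and b = b and a = a'] a
      by (simp add: algebra_simps del: dsum.simps)
  qed
  have "loop_eq n M (\<lambda>i z. z i powi m * dsum n z a' {i} * pprod n z (b # ls) - z i powi (m + b) * dsum n z a' {i} * pprod n z ls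
        - (\<Sum>s<k. z i powi m * dsum n z (?a s) {i} * pprod n z ls))
     (\<lambda>i z. (of_int m * (z i powi m * dsum n z a' {i}) * pprod n z (b # ls) + z i powi m * dsum n z a' {i} * dpprod n z (b # ls) i)
       - (of_int (m + b) * (z i powi (m + b) * dsum n z a' {i}) * pprod n z ls + z i powi (m + b) * dsum n z a' {i} * dpprod n z ls i)
       - (\<Sum>s<k. of_int m * (z i powi m * dsum n z (?a s) {i}) * pprod n z ls + z i powi m * dsum n z (?a s) {i} * dpprod n z ls i))"
    using a by (intro loop_eq_diff loop_eq_sum IH) auto
  then show ?case
  proof (rule loop_eq_cong)
    fix i :: nat and z :: "nat \<Rightarrow> complex" assume i: "i < n" and z: "z \<in> torus"
    have pw: "z i powi (m + b) = z i powi m * z i powi b" using torus_nz[OF z] by (simp add: power_int_add)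
    have pp: "pprod n z (b # ls) = psum n z b * pprod n z ls" by (simp add: pprod_def)
    show "z i powi m * dsum n z a' {i} * pprod n z (b # ls) - z i powi (m + b) * dsum n z a' {i} * pprod n z ls
        - (\<Sum>s<k. z i powi m * dsum n z (?a s) {i} * pprod n z ls) = z i powi m * dsum n z a {i} * pprod n z ls"
      unfolding rec[OF z i] pw pp sum_distrib_right[symmetric] sum_distrib_left[symmetric] by (simp add: algebra_simps)
    show "(of_int m * (z i powi m * dsum n z a' {i}) * pprod n z (b # ls) + z i powi m * dsum n z a' {i} * dpprod n z (b # ls) i)
       - (of_int (m + b) * (z i powi (m + b) * dsum n z a' {i}) * pprod n z ls + z i powi (m + b) * dsum n z a' {i} * dpprod n z ls i)
       - (\<Sum>s<k. of_int m * (z i powi m * dsum n z (?a s) {i}) * pprod n z ls + z i powi m * dsum n z (?a s) {i} * dpprod n z ls i)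
      = of_int m * (z i powi m * dsum n z a {i}) * pprod n z ls + z i powi m * dsum n z a {i} * dpprod n z ls i"
      unfolding rec[OF z i] pw pp sum.distrib sum_distrib_right[symmetric] sum_distrib_left[symmetric] dpprod.simps
      by (simp add: algebra_simps)
  qed
qed

subsection \<open>Identification with the Weyl density\<close>

text \<open>Rotating the point with index \<open>i\<close> by the angle \<open>e * real i\<close>
  separates coinciding points for all small \<open>e \<noteq> 0\<close>, while different points stay
  apart by continuity. Identities between functions that are continuous along such paths thus only
  have to be checked at distinct points.\<close>

lemma eventually_inj_path:
  assumes z: "z \<in> torus"
  shows "eventually (\<lambda>e. inj_on (\<lambda>i. z i * cis (e * real i)) {..<n}) (at 0)"
proof -
  have "eventually (\<lambda>e. z i * cis (e * real i) \<noteq> z k * cis (e * real k)) (at 0)" if "i \<noteq> k" for i k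
  proof (cases "z i = z k")
    case False
    have c: "((\<lambda>e. z i * cis (e * real i) - z k * cis (e * real k)) \<longlongrightarrow> z i * cis (0 * real i) - z k * cis (0 * real k)) (at 0)"
      unfolding cis_conv_exp by (intro tendsto_intros)
    have "eventually (\<lambda>e. z i * cis (e * real i) - z k * cis (e * real k) \<noteq> 0) (at 0)"
      by (rule tendsto_imp_eventually_ne[OF c]) (use False in simp)
    then show ?thesis by eventually_elim auto
  next
    case True
    have "eventually (\<lambda>e. \<bar>e\<bar> < 2 * pi / (real i + real k + 1)) (at (0::real))"
      using eventually_at_ball[of "2 * pi / (real i + real k + 1)" 0 UNIV]
      by (auto simp: dist_real_def elim!: eventually_mono)
    moreover have "eventually (\<lambda>e. e \<noteq> 0) (at (0::real))" by (simp add: eventually_neq_at_within)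
    ultimately show ?thesis
    proof eventually_elim
      case (elim e)
      show ?case
      proof
        assume "z i * cis (e * real i) = z k * cis (e * real k)"
        then have "cis (e * real i) = cis (e * real k)" using True torus_nz[OF z] by auto
        then have "cis (e * real i) * cis (- (e * real k)) = 1" by (simp add: cis_mult)
        then have "cis (e * (real i - real k)) = 1" by (simp add: cis_mult algebra_simps)
        then have "cos (e * (real i - real k)) = 1" by (simp add: complex_eq_iff)
        then obtain j :: int where j: "e * (real i - real k) = of_int j * (2 * pi)" using cos_one_2pi_int by auto
        have "\<bar>e * (real i - real k)\<bar> \<le> \<bar>e\<bar> * (real i + real k + 1)"
          unfolding abs_mult by (intro mult_left_mono) auto
        also have "\<dots> < 2 * pi" using elim by (simp add: field_simps)
        finally have "\<bar>of_int j\<bar> * (2 * pi) < 2 * pi" unfolding j abs_mult by simp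
        then have "j = 0" by simp
        then show False using j elim that by simp
      qed
    qed
  qed
  then have "eventually (\<lambda>e. \<forall>i\<in>{..<n}. \<forall>k\<in>{..<n} - {i}. z i * cis (e * real i) \<noteq> z k * cis (e * real k)) (at 0)"
    by (auto simp: eventually_ball_finite_distrib)
  then show ?thesis by eventually_elim (auto simp: inj_on_def)
qed

lemma torus_path: "z \<in> torus \<Longrightarrow> (\<lambda>i. z i * cis (e * real i)) \<in> torus"
  by (simp add: torus_def norm_mult)

lemma torus_eqI_path:
  assumes eq: "\<And>z. z \<in> torus \<Longrightarrow> inj_on z {..<n} \<Longrightarrow> f z = (g z :: complex)" and z: "z \<in> torus"
    and "isCont (\<lambda>e. f (\<lambda>i. z i * cis (e * real i))) 0" "isCont (\<lambda>e. g (\<lambda>i. z i * cis (e * real i))) 0"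
  shows "f z = g z"
proof -
  have ev: "eventually (\<lambda>e. f (\<lambda>i. z i * cis (e * real i)) = g (\<lambda>i. z i * cis (e * real i))) (at 0)"
    using eventually_inj_path[OF z, of n] by eventually_elim (auto intro: eq torus_path z)
  have F: "(\<lambda>e. f (\<lambda>i. z i * cis (e * real i))) \<midarrow>0\<rightarrow> f z" "(\<lambda>e. g (\<lambda>i. z i * cis (e * real i))) \<midarrow>0\<rightarrow> g z"
    using assms(3,4) by (simp_all add: isCont_def)
  show ?thesis by (rule LIM_unique[OF Lim_transform_eventually[OF F(1) ev] F(2)])
qed

section \<open>The recursion for moments and its uniqueness\<close>

definition sqz_rec :: "nat \<Rightarrow> (int list \<Rightarrow> complex) \<Rightarrow> bool" where
  "sqz_rec n c \<longleftrightarrow> (\<forall>m a. Suc (length a) = n \<longrightarrow>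
     of_int m * c (m # a) + (\<Sum>s<length a. sqz m (a ! s) (\<lambda>x y. c (x # y # remove_nth s a))) = 0)"

lemma integrable_dsum_pprod:
  assumes H: "normalized_haar n M"
  shows "integrable M (\<lambda>U. dsum n (ev U) a {} * pprod n (ev U) ls)"
proof (induction "length a" arbitrary: a ls)
  case 0
  then show ?case using integrable_pprod[OF H] by simp
next
  case (Suc k)
  then obtain b a' where a: "a = b # a'" "length a' = k" by (cases a) auto
  have "dsum n (ev U) a {} * pprod n (ev U) ls = dsum n (ev U) a' {} * pprod n (ev U) (b # ls)
     - (\<Sum>s<k. dsum n (ev U) (a'[s := a' ! s + b]) {} * pprod n (ev U) ls)" for U
  proof -
    have X: "dsum n (ev U) a {} = psum n (ev U) b * dsum n (ev U) a' {} - (\<Sum>s<k. dsum n (ev U) (a'[s := a' ! s + b]) {})"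
      using dsum_extend[of "ev U", where S = "{}" and n = n and b = b and a = a'] a
      by (simp add: psum_def del: dsum.simps)
    have Y: "pprod n (ev U) (b # ls) = psum n (ev U) b * pprod n (ev U) ls" by (simp add: pprod_def)
    show ?thesis unfolding X Y sum_distrib_right[symmetric] by (simp add: algebra_simps)
  qed
  moreover have "integrable M (\<lambda>U. dsum n (ev U) a' {} * pprod n (ev U) (b # ls)
     - (\<Sum>s<k. dsum n (ev U) (a'[s := a' ! s + b]) {} * pprod n (ev U) ls))"
    using a by (intro Bochner_Integration.integrable_diff Bochner_Integration.integrable_sum Suc(1)) auto
  ultimately show ?case by simp
qed

lemma integrable_dsum: "normalized_haar n M \<Longrightarrow> integrable M (\<lambda>U. dsum n (ev U) a {})"
  using integrable_dsum_pprod[of n M a "[]"] by (simp add: pprod_def)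

lemma isCont_path_sqz:
  assumes "\<And>x y. isCont (\<lambda>e. h e x y) 0"
  shows "isCont (\<lambda>e. sqz m c (h e)) 0"
  unfolding sqz_def by (intro continuous_intros assms)

lemma has_bochner_integral_sqz:
  fixes h :: "'a \<Rightarrow> int \<Rightarrow> int \<Rightarrow> complex"
  assumes "\<And>x y. has_bochner_integral M (\<lambda>U. h U x y) (v x y)"
  shows "has_bochner_integral M (\<lambda>U. sqz m c (h U)) (sqz m c v)"
  unfolding sqz_def by (intro has_bochner_integral_diff has_bochner_integral_sum assms)

lemma sqz_rec_haar:
  assumes H: "normalized_haar n M"
  shows "sqz_rec n (\<lambda>b. \<integral>U. dsum n (ev U) b {} \<partial>M)"
  unfolding sqz_rec_def
proof (intro allI impI)
  fix m :: int and a :: "int list" assume len: "Suc (length a) = n"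
  let ?E = "\<lambda>z. of_int m * dsum n z (m # a) {} + (\<Sum>s<length a. sqz m (a ! s) (\<lambda>x y. dsum n z (x # y # remove_nth s a) {}))"
  have hb: "has_bochner_integral M (\<lambda>U. dsum n (ev U) b {}) (\<integral>U. dsum n (ev U) b {} \<partial>M)" for b
    using integrable_dsum[OF H] by (simp add: has_bochner_integral_integrable)
  from loop_eq_marked[OF H, of m a "[]"] obtain g where g:
     "\<And>z. z \<in> torus \<Longrightarrow> inj_on z {..<n} \<Longrightarrow> g z = (\<Sum>i<n. of_int m * (z i powi m * dsum n z a {i})) + pairsum n z (\<lambda>i. z i powi m * dsum n z a {i})"
     "\<And>z. z \<in> torus \<Longrightarrow> isCont (\<lambda>e. g (\<lambda>i. z i * cis (e * real i))) 0"
     "has_bochner_integral M (\<lambda>U. g (ev U)) 0"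
    unfolding loop_eq_def by (auto simp: pprod_def)
  have "g z = ?E z" if "z \<in> torus" for z
  proof (rule torus_eqI_path[of n g ?E, OF _ that g(2)[OF that]])
    fix z assume z: "z \<in> torus" "inj_on z {..<n}"
    show "g z = ?E z"
      unfolding g(1)[OF z] pairsum_marked[OF z len] by (simp add: sum_distrib_left)
  next
    show "isCont (\<lambda>e. ?E (\<lambda>i. z i * cis (e * real i))) 0"
      by (intro continuous_intros isCont_path_sqz isCont_path_dsum that)
  qed
  then have "has_bochner_integral M (\<lambda>U. ?E (ev U)) 0" using g(3) ev_torus by simp
  moreover have "has_bochner_integral M (\<lambda>U. ?E (ev U)) (of_int m * (\<integral>U. dsum n (ev U) (m # a) {} \<partial>M)
     + (\<Sum>s<length a. sqz m (a ! s) (\<lambda>x y. \<integral>U. dsum n (ev U) (x # y # remove_nth s a) {} \<partial>M)))"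
    by (intro has_bochner_integral_add has_bochner_integral_mult_right has_bochner_integral_sum has_bochner_integral_sqz hb)
  ultimately show "of_int m * (\<integral>U. dsum n (ev U) (m # a) {} \<partial>M)
     + (\<Sum>s<length a. sqz m (a ! s) (\<lambda>x y. \<integral>U. dsum n (ev U) (x # y # remove_nth s a) {} \<partial>M)) = 0"
    by (rule has_bochner_integral_eq[symmetric])
qed

text \<open>Induction on the sum of squares of the exponents. The recursion is applied with
  \<open>m\<close> a positive maximum of \<open>b\<close> or, if no exponent is positive, a negative
  minimum. All moments in it with smaller sum of squares vanish, and what remains is a multiple of
  the moment of \<open>b\<close> itself.\<close>

lemma sqz_rec_zero:
  assumes rec: "sqz_rec n \<delta>" and perm: "\<And>a b. mset a = mset b \<Longrightarrow> \<delta> a = \<delta> b" and zero: "\<delta> (replicate n 0) = 0"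
  shows "length b = n \<Longrightarrow> \<delta> b = 0"
proof (induction "nat (\<Sum>x\<leftarrow>b. x * x)" arbitrary: b rule: less_induct)
  case less
  have sq0: "(\<Sum>x\<leftarrow>c. x * x) \<ge> 0" for c :: "int list" by (induction c) auto
  have key: "\<delta> b = 0" if m: "mset b = mset (m # a)" and ne: "m \<noteq> 0"
    and sg: "(m > 0 \<and> (\<forall>c\<in>set a. c \<le> m)) \<or> (m < 0 \<and> (\<forall>c\<in>set a. m \<le> c))" for m a
  proof -
    have len: "Suc (length a) = n" using arg_cong[OF m, of size] less.prems by simp
    have sb: "(\<Sum>x\<leftarrow>b. x * x) = m * m + (\<Sum>x\<leftarrow>a. x * x)"
      using arg_cong[OF m, of "\<lambda>M. sum_mset (image_mset (\<lambda>x. x * x) M)"] by (simp add: sum_mset_sum_list flip: mset_map)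
    have small: "\<delta> (x # y # remove_nth s a) = 0" if s: "s < length a" and xy: "x + y = m + a ! s" "x * x + y * y < m * m + a ! s * a ! s" for s x y
    proof (rule less.hyps)
      have "(\<Sum>x\<leftarrow>a. x * x) = a ! s * a ! s + (\<Sum>x\<leftarrow>remove_nth s a. x * x)"
        using arg_cong[OF mset_remove_nth[OF s], of "\<lambda>M. sum_mset (image_mset (\<lambda>x. x * x) M)"] by (simp add: sum_mset_sum_list flip: mset_map)
      then have "(\<Sum>x\<leftarrow>x # y # remove_nth s a. x * x) < (\<Sum>x\<leftarrow>b. x * x)" using xy sb by simp
      then show "nat (\<Sum>x\<leftarrow>x # y # remove_nth s a. x * x) < nat (\<Sum>x\<leftarrow>b. x * x)"
        using sq0[of "x # y # remove_nth s a"] by linarith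
      show "length (x # y # remove_nth s a) = n" using length_remove_nth[OF s] len by simp
    qed
    have same: "\<delta> (m # a ! s # remove_nth s a) = \<delta> b" if "s < length a" for s
      using mset_remove_nth[OF that] m by (intro perm) simp
    \<comment> \<open>Only the term \<open>q = 0\<close> keeps the multiset of exponents; later
      terms have a strictly smaller sum of squares. The range of \<open>q\<close> ends before the
      two exponents have changed places, which would reproduce the same multiset a second
      time.\<close>
    have T: "sqz m (a ! s) (\<lambda>x y. \<delta> (x # y # remove_nth s a)) = of_int (sgn (m - a ! s)) * \<delta> b" if s: "s < length a" for s
    proof -
      define c where "c = a ! s"
      consider "c = m" | "c < m" | "c > m" by linarith
      then show ?thesis
      proof cases
        case 1 then show ?thesis by (simp add: sqz_def c_def)
      next
        case 2
        then obtain d where d: "nat (m - c) = Suc d" by (metis Suc_pred zero_less_nat_eq diff_gt_0_iff_gt)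
        have "\<delta> ((m - int (Suc q)) # (c + int (Suc q)) # remove_nth s a) = 0" if "q < d" for q
        proof (rule small[OF s])
          define p where "p = int (Suc q)"
          have p: "p > 0" "m - c - p > 0" using that d by (auto simp: p_def)
          have "m * m + c * c - ((m - p) * (m - p) + (c + p) * (c + p)) = 2 * (p * (m - c - p))" by (simp add: algebra_simps)
          moreover have "p * (m - c - p) > 0" using p by simp
          ultimately show "(m - int (Suc q)) * (m - int (Suc q)) + (c + int (Suc q)) * (c + int (Suc q)) < m * m + a ! s * a ! s"
            unfolding p_def[symmetric] c_def[symmetric] by linarith
        qed (simp add: c_def)
        then have "(\<Sum>q<nat (m - c). \<delta> ((m - int q) # (c + int q) # remove_nth s a)) = \<delta> b"
          unfolding d sum.lessThan_Suc_shift using same[OF s] by (simp add: c_def)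
        then show ?thesis using 2 by (simp add: sqz_def flip: c_def)
      next
        case 3
        then obtain d where d: "nat (c - m) = Suc d" by (metis Suc_pred zero_less_nat_eq diff_gt_0_iff_gt)
        have "\<delta> ((m + int (Suc q)) # (c - int (Suc q)) # remove_nth s a) = 0" if "q < d" for q
        proof (rule small[OF s])
          define p where "p = int (Suc q)"
          have p: "p > 0" "c - m - p > 0" using that d by (auto simp: p_def)
          have "m * m + c * c - ((m + p) * (m + p) + (c - p) * (c - p)) = 2 * (p * (c - m - p))" by (simp add: algebra_simps)
          moreover have "p * (c - m - p) > 0" using p by simp
          ultimately show "(m + int (Suc q)) * (m + int (Suc q)) + (c - int (Suc q)) * (c - int (Suc q)) < m * m + a ! s * a ! s"
            unfolding p_def[symmetric] c_def[symmetric] by linarith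
        qed (simp add: c_def)
        then have "(\<Sum>q<nat (c - m). \<delta> ((m + int q) # (c - int q) # remove_nth s a)) = \<delta> b"
          unfolding d sum.lessThan_Suc_shift using same[OF s] by (simp add: c_def)
        then show ?thesis using 3 by (simp add: sqz_def flip: c_def)
      qed
    qed
    have "of_int m * \<delta> (m # a) + (\<Sum>s<length a. sqz m (a ! s) (\<lambda>x y. \<delta> (x # y # remove_nth s a))) = 0"
      using rec len by (auto simp: sqz_rec_def)
    moreover have "\<delta> (m # a) = \<delta> b" using m by (intro perm) simp
    ultimately have "of_int m * \<delta> b + (\<Sum>s<length a. of_int (sgn (m - a ! s)) * \<delta> b) = 0"
      using T by simp
    then have "of_int (m + (\<Sum>s<length a. sgn (m - a ! s))) * \<delta> b = 0"
      by (simp add: sum_distrib_right distrib_right)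
    \<comment> \<open>For an extremal \<open>m\<close> no sign in the sum is opposite to that of
      \<open>m\<close>, so nothing can cancel it.\<close>
    moreover have "m + (\<Sum>s<length a. sgn (m - a ! s)) \<noteq> 0"
      using sg
    proof
      assume A: "m > 0 \<and> (\<forall>c\<in>set a. c \<le> m)"
      have "0 \<le> sgn (m - a ! s)" if "s < length a" for s
      proof -
        have "a ! s \<le> m" using A that by simp
        then show ?thesis by (auto simp: sgn_if)
      qed
      then have "(\<Sum>s<length a. sgn (m - a ! s)) \<ge> 0" by (intro sum_nonneg) simp
      with A show ?thesis by linarith
    next
      assume A: "m < 0 \<and> (\<forall>c\<in>set a. m \<le> c)"
      have "sgn (m - a ! s) \<le> 0" if "s < length a" for s
      proof -
        have "m \<le> a ! s" using A that by simp
        then show ?thesis by (auto simp: sgn_if)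
      qed
      then have "(\<Sum>s<length a. sgn (m - a ! s)) \<le> 0" by (intro sum_nonpos) simp
      with A show ?thesis by linarith
    qed
    ultimately show ?thesis by (simp only: mult_eq_0_iff of_int_eq_0_iff) simp
  qed
  have rem: "mset b = mset (x # remove1 x b)" if "x \<in> set b" for x using that by simp
  show ?case
  proof (cases "\<forall>x\<in>set b. x = 0")
    case True
    then have "b = replicate n 0" using less.prems by (metis replicate_eqI)
    then show ?thesis using zero by simp
  next
    case False
    then have ne: "set b \<noteq> {}" by auto
    show ?thesis
    proof (cases "\<exists>x\<in>set b. x > 0")
      case True
      define m where "m = Max (set b)"
      have m: "m \<in> set b" "\<forall>c\<in>set b. c \<le> m" using ne by (auto simp: m_def)
      then have "m > 0" using True by force
      then show ?thesis using m set_remove1_subset[of m b] by (intro key[OF rem[OF m(1)]]) auto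
    next
      case F: False
      define m where "m = Min (set b)"
      have m: "m \<in> set b" "\<forall>c\<in>set b. m \<le> c" using ne by (auto simp: m_def)
      then have "m < 0" using F False by force
      then show ?thesis using m set_remove1_subset[of m b] by (intro key[OF rem[OF m(1)]]) auto
    qed
  qed
qed

lemma sqz_rec_unique:
  assumes "sqz_rec n c" "sqz_rec n c'" and "\<And>a b. mset a = mset b \<Longrightarrow> c a = c b" "\<And>a b. mset a = mset b \<Longrightarrow> c' a = c' b"
    and "c (replicate n 0) = c' (replicate n 0)" "length b = n"
  shows "c b = c' b"
proof -
  have d: "sqz m x (\<lambda>x y. c (f x y) - c' (f x y)) = sqz m x (\<lambda>x y. c (f x y)) - sqz m x (\<lambda>x y. c' (f x y))" for m x f
    by (simp add: sqz_def sum_subtractf)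
  have "c b - c' b = 0"
  proof (rule sqz_rec_zero[of n "\<lambda>b. c b - c' b"])
    show "sqz_rec n (\<lambda>b. c b - c' b)"
      unfolding sqz_rec_def
    proof (intro allI impI)
      fix m :: int and a :: "int list" assume l: "Suc (length a) = n"
      have "of_int m * c (m # a) + (\<Sum>s<length a. sqz m (a ! s) (\<lambda>x y. c (x # y # remove_nth s a))) = 0"
        "of_int m * c' (m # a) + (\<Sum>s<length a. sqz m (a ! s) (\<lambda>x y. c' (x # y # remove_nth s a))) = 0"
        using assms(1,2) l by (auto simp: sqz_rec_def)
      then show "of_int m * (c (m # a) - c' (m # a)) + (\<Sum>s<length a. sqz m (a ! s) (\<lambda>x y. c (x # y # remove_nth s a) - c' (x # y # remove_nth s a))) = 0"
        unfolding d sum_subtractf right_diff_distrib by (metis (no_types, lifting) add_diff_add diff_zero)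
    qed
  next
    fix a b :: "int list" assume m: "mset a = mset b"
    show "c a - c' a = c b - c' b" unfolding assms(3)[OF m] assms(4)[OF m] ..
  qed (simp_all add: assms(5,6))
  then show ?thesis by simp
qed

section \<open>The Vandermonde density and its loop equation\<close>

definition Vdm :: "nat \<Rightarrow> (nat \<Rightarrow> complex) \<Rightarrow> complex" where
  "Vdm n z = det (mat n n (\<lambda>(i, j). z i ^ j))"

text \<open>The derivative \<open>z\<^sub>i \<partial>\<^sub>i\<close> of the Vandermonde
  determinant, taken term by term in its Leibniz expansion.\<close>

definition dVdm :: "nat \<Rightarrow> (nat \<Rightarrow> complex) \<Rightarrow> nat \<Rightarrow> complex" where
  "dVdm n z i = (\<Sum>p | p permutes {0..<n}. signof p * of_nat (p i) * (\<Prod>j = 0..<n. z j ^ p j))"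

lemma Vdm_expand: "Vdm n z = (\<Sum>p | p permutes {0..<n}. signof p * (\<Prod>j = 0..<n. z j ^ p j))"
proof -
  have "mat n n (\<lambda>(i, j). z i ^ j) $$ (j, p j) = z j ^ p j" if "p permutes {0..<n}" "j \<in> {0..<n}" for p j
    using that permutes_in_image[OF that(1), of j] by auto
  then show ?thesis unfolding Vdm_def by (subst det_def'[of _ n]) (auto intro!: sum.cong prod.cong)
qed

lemma Vdm_eq_0:
  assumes "i < n" "k < n" "i \<noteq> k" "z i = z k"
  shows "Vdm n z = 0"
  unfolding Vdm_def using assms
  by (intro det_identical_rows[of _ n i k]) (auto intro!: eq_vecI)

lemma Vdm_cong: "(\<And>i. i < n \<Longrightarrow> z i = z' i) \<Longrightarrow> Vdm n z = Vdm n z'"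
  unfolding Vdm_def by (intro arg_cong[of _ _ det] eq_matI) auto

text \<open>As a polynomial in the variable \<open>z i\<close> alone the determinant has degree
  below \<open>n\<close> and vanishes at the \<open>n - 1\<close> other points. So it is a constant
  times the product of the corresponding linear factors, whose logarithmic derivative is the sum on
  the right.\<close>

lemma theta_Vdm:
  assumes inj: "inj_on z {..<n}" and i: "i < n"
  shows "dVdm n z i = Vdm n z * (\<Sum>k\<in>{..<n} - {i}. z i / (z i - z k))"
proof -
  define p where "p = (\<Sum>\<sigma> | \<sigma> permutes {0..<n}. monom (signof \<sigma> * (\<Prod>j\<in>{0..<n} - {i}. z j ^ \<sigma> j)) (\<sigma> i))"
  have split: "(\<Prod>j = 0..<n. w j ^ \<sigma> j) = w i ^ \<sigma> i * (\<Prod>j\<in>{0..<n} - {i}. w j ^ \<sigma> j)" for w :: "nat \<Rightarrow> complex" and \<sigma>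
    using i by (intro prod.remove) auto
  have poly_p: "poly p x = Vdm n (z(i := x))" for x
    unfolding p_def Vdm_expand split by (simp add: poly_sum poly_monom mult_ac)
  have "z i * poly (pderiv (monom c k)) (z i) = c * of_nat k * z i ^ k" for c k
    by (cases k) (simp_all add: pderiv_monom poly_monom mult_ac)
  then have dp: "z i * poly (pderiv p) (z i) = dVdm n z i"
    unfolding p_def dVdm_def split by (simp add: pderiv_sum poly_sum sum_distrib_left mult_ac)
  have cp: "coeff p k = 0" if "k \<ge> n" for k
  proof -
    have "\<sigma> i \<noteq> k" if "\<sigma> permutes {0..<n}" for \<sigma> using permutes_in_image[OF that, of i] i \<open>k \<ge> n\<close> by auto
    then show ?thesis unfolding p_def coeff_sum by (intro sum.neutral) auto
  qed
  define A where "A = {..<n} - {i}"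
  have A: "finite A" "card A = n - 1" using i by (auto simp: A_def)
  define q where "q = (\<Prod>k\<in>A. [:- z k, 1:])"
  have dq: "degree q = n - 1" unfolding q_def using A by (subst degree_prod_eq_sum_degree) auto
  have lq: "coeff q (n - 1) = 1"
  proof -
    have "lead_coeff q = 1" unfolding q_def lead_coeff_prod by simp
    then show ?thesis using dq by simp
  qed
  define c where "c = coeff p (n - 1)"
  have p: "p = Polynomial.smult c q"
  proof (rule ccontr)
    assume "p \<noteq> Polynomial.smult c q"
    define r where "r = p - Polynomial.smult c q"
    have r0: "r \<noteq> 0" using \<open>p \<noteq> Polynomial.smult c q\<close> by (simp add: r_def)
    have cr: "coeff r k = 0" if "k \<ge> n - 1" for k
    proof (cases "k = n - 1")
      case True then show ?thesis unfolding r_def c_def coeff_diff coeff_smult by (simp only: lq) simp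
    next
      case False
      then have "k \<ge> n" using that by simp
      moreover have "degree q < k" using False that dq i by simp
      ultimately show ?thesis using cp by (simp add: r_def coeff_eq_0)
    qed
    have "z ` A \<subseteq> {x. poly r x = 0}"
    proof (rule image_subsetI)
      fix k assume k: "k \<in> A"
      have "poly p (z k) = 0" unfolding poly_p using k i by (intro Vdm_eq_0[of i n k]) (auto simp: A_def)
      moreover have "poly q (z k) = 0" unfolding q_def poly_prod using k A by (intro prod_zero) auto
      ultimately show "z k \<in> {x. poly r x = 0}" by (simp add: r_def)
    qed
    then have "card (z ` A) \<le> card {x. poly r x = 0}" using poly_roots_finite[OF r0] by (intro card_mono) auto
    moreover have "card (z ` A) = n - 1" using A inj by (subst card_image) (auto simp: A_def intro: inj_on_subset)
    ultimately have "degree r \<ge> n - 1" using card_poly_roots_bound[OF r0] by simp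
    then show False using cr r0 leading_coeff_0_iff by blast
  qed
  have ne: "z i - z k \<noteq> 0" if "k \<in> A" for k using that inj i by (auto simp: A_def inj_on_def)
  have "poly (pderiv q) (z i) = (\<Sum>a\<in>A. \<Prod>k\<in>A - {a}. z i - z k)"
    unfolding q_def pderiv_prod by (simp add: poly_sum poly_prod pderiv_pCons)
  also have "\<dots> = (\<Sum>a\<in>A. poly q (z i) / (z i - z a))"
  proof (rule sum.cong[OF refl])
    fix a assume a: "a \<in> A"
    have "poly q (z i) = (z i - z a) * (\<Prod>k\<in>A - {a}. z i - z k)"
      unfolding q_def poly_prod using A a by (subst prod.remove[of _ a]) auto
    then show "(\<Prod>k\<in>A - {a}. z i - z k) = poly q (z i) / (z i - z a)" using ne[OF a] by simp
  qed
  finally have "z i * poly (pderiv p) (z i) = poly p (z i) * (\<Sum>a\<in>A. z i / (z i - z a))"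
    unfolding p pderiv_smult by (simp add: sum_distrib_left mult_ac)
  then show ?thesis unfolding dp poly_p A_def by simp
qed

text \<open>Renaming \<open>i\<close> and \<open>k\<close> in the part with \<open>f k\<close> flips
  the sign of the antisymmetric factor, which undoes the symmetrization.\<close>

lemma pairsum_antisym: "pairsum n z f = (\<Sum>i<n. f i * (\<Sum>k\<in>{..<n} - {i}. (z i + z k) / (z i - z k)))"
proof -
  have e: "(\<Sum>i<n. \<Sum>k\<in>{..<n} - {i}. D i k) = (\<Sum>i<n. \<Sum>k<n. if i \<noteq> k then D i k else 0)" for D :: "nat \<Rightarrow> nat \<Rightarrow> complex"
    by (intro sum.cong refl sum.mono_neutral_cong_left) auto
  have sw: "(\<Sum>i<n. \<Sum>k\<in>{..<n} - {i}. D i k) = (\<Sum>i<n. \<Sum>k\<in>{..<n} - {i}. D k i)" for D :: "nat \<Rightarrow> nat \<Rightarrow> complex"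
    unfolding e by (subst sum.swap) (auto intro!: sum.cong)
  let ?c = "\<lambda>i k. (z i + z k) / (2 * (z i - z k))"
  have "pairsum n z f = (\<Sum>i<n. \<Sum>k\<in>{..<n} - {i}. ?c i k * f i) - (\<Sum>i<n. \<Sum>k\<in>{..<n} - {i}. ?c i k * f k)"
    unfolding pairsum_def right_diff_distrib sum_subtractf ..
  also have "(\<Sum>i<n. \<Sum>k\<in>{..<n} - {i}. ?c i k * f k) = (\<Sum>i<n. \<Sum>k\<in>{..<n} - {i}. ?c k i * f i)" by (rule sw)
  also have "(\<Sum>i<n. \<Sum>k\<in>{..<n} - {i}. ?c i k * f i) - (\<Sum>i<n. \<Sum>k\<in>{..<n} - {i}. ?c k i * f i)
    = (\<Sum>i<n. \<Sum>k\<in>{..<n} - {i}. f i * ((z i + z k) / (z i - z k)))"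
    unfolding sum_subtractf[symmetric]
  proof (intro sum.cong refl)
    fix i k
    have "?c k i = - ?c i k" by (simp add: add.commute minus_divide_right)
    moreover have "2 * ?c i k = (z i + z k) / (z i - z k)" by (metis mult_divide_mult_cancel_left times_divide_eq_right zero_neq_numeral)
    ultimately show "?c i k * f i - ?c k i * f i = f i * ((z i + z k) / (z i - z k))"
      by (metis diff_minus_eq_add mult.commute mult_2 distrib_right mult_minus_left)
  qed
  finally show ?thesis by (simp only: sum_distrib_left)
qed

text \<open>The derivative \<open>z\<^sub>i \<partial>\<^sub>i\<close> of
  \<open>Vdm n z * cnj (Vdm n z)\<close> on the torus; the minus sign arises because
  \<open>cnj (z i)\<close> is the inverse of \<open>z i\<close> there.\<close>

definition dVsq :: "nat \<Rightarrow> (nat \<Rightarrow> complex) \<Rightarrow> nat \<Rightarrow> complex" where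
  "dVsq n z i = dVdm n z i * cnj (Vdm n z) - Vdm n z * cnj (dVdm n z i)"

lemma theta_Vsq:
  assumes z: "z \<in> torus" "inj_on z {..<n}" and i: "i < n"
  shows "dVsq n z i = Vdm n z * cnj (Vdm n z) * (\<Sum>k\<in>{..<n} - {i}. (z i + z k) / (z i - z k))"
proof -
  have "z i / (z i - z k) - cnj (z i / (z i - z k)) = (z i + z k) / (z i - z k)" if "k \<in> {..<n} - {i}" for k
  proof -
    have ne: "z i \<noteq> z k" using that z i by (auto simp: inj_on_def)
    have c: "cnj (z i) = inverse (z i)" for i
      using cnj_powi_unit[of "z i" 1] torus_norm[OF z(1)] by (simp add: power_int_minus)
    have "cnj (z i / (z i - z k)) = - z k / (z i - z k)"
      unfolding complex_cnj_divide complex_cnj_diff c using ne torus_nz[OF z(1)] by (simp add: divide_simps) (simp add: algebra_simps)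
    then show ?thesis by (simp add: add_divide_distrib)
  qed
  then have S: "(\<Sum>k\<in>{..<n} - {i}. (z i + z k) / (z i - z k)) = (\<Sum>k\<in>{..<n} - {i}. z i / (z i - z k)) - cnj (\<Sum>k\<in>{..<n} - {i}. z i / (z i - z k))"
    by (simp add: sum_subtractf[symmetric])
  show ?thesis unfolding S dVsq_def theta_Vdm[OF z(2) i] by (simp only: complex_cnj_mult right_diff_distrib mult_ac)
qed

text \<open>The right-hand side is the divergence, with respect to the derivatives
  \<open>z\<^sub>i \<partial>\<^sub>i\<close>, of the field with components
  \<open>z i powi m * dsum n z a {i}\<close> times the density. At coinciding points both sides
  vanish together with the determinant.\<close>

lemma weighted_loop_identity:
  assumes z: "z \<in> torus" and len: "Suc (length a) = n"
  shows "(of_int m * dsum n z (m # a) {} + (\<Sum>s<length a. sqz m (a ! s) (\<lambda>x y. dsum n z (x # y # remove_nth s a) {})))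
      * (Vdm n z * cnj (Vdm n z))
    = (\<Sum>i<n. z i powi m * dsum n z a {i} * (of_int m * (Vdm n z * cnj (Vdm n z)) + dVsq n z i))"
proof (cases "inj_on z {..<n}")
  case True
  show ?thesis
    unfolding pairsum_marked[OF z True len, symmetric] pairsum_antisym
    by (simp add: theta_Vsq[OF z True] sum_distrib_left sum_distrib_right sum.distrib algebra_simps)
next
  case False
  then obtain i k where "i < n" "k < n" "i \<noteq> k" "z i = z k" by (auto simp: inj_on_def)
  then have "Vdm n z = 0" by (rule Vdm_eq_0)
  then show ?thesis by (simp add: dVsq_def)
qed

section \<open>Fourier integrals over the torus\<close>

definition unif :: "real measure" where
  "unif = density lborel (\<lambda>x. ennreal (indicator {0..<2*pi} x / (2*pi)))"

lemma sets_unif [simp, measurable_cong]: "sets unif = sets borel" and space_unif [simp]: "space unif = UNIV"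
  by (simp_all add: unif_def)

lemma prob_space_unif: "prob_space unif"
proof
  have "emeasure unif UNIV = (\<integral>\<^sup>+ x. ennreal (1 / (2*pi)) * indicator {0..<2*pi} x \<partial>lborel)"
    unfolding unif_def by (subst emeasure_density) (auto intro!: nn_integral_cong split: split_indicator)
  also have "\<dots> = ennreal (1 / (2*pi)) * ennreal (2*pi)" by (subst nn_integral_cmult_indicator) auto
  also have "\<dots> = 1" by (simp flip: ennreal_mult)
  finally show "emeasure unif (space unif) = 1" by simp
qed

lemma borel_measurable_cis [measurable]: "f \<in> borel_measurable M \<Longrightarrow> (\<lambda>x. cis (f x)) \<in> borel_measurable M"
  unfolding cis_conv_exp by (rule measurable_compose[OF _ borel_measurable_continuous_onI]) (auto intro!: continuous_intros)

lemma integral_unif_cis: "(\<integral>t. cis t powi e \<partial>unif) = of_bool (e = 0)"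
proof (cases "e = 0")
  case True
  interpret prob_space unif by (rule prob_space_unif)
  show ?thesis using True prob_space by simp
next
  case False
  define F where "F t = cis (of_int e * t) / (\<i> * of_int e)" for t :: real
  have "has_bochner_integral lborel (\<lambda>t. indicator {0..2*pi} t *\<^sub>R cis (of_int e * t)) (F (2*pi) - F 0)"
  proof (rule has_bochner_integral_FTC_Icc)
    fix x :: real
    have "((\<lambda>w. exp (\<i> * (of_int e * w)) / (\<i> * of_int e)) has_field_derivative exp (\<i> * (of_int e * complex_of_real x))) (at (complex_of_real x))"
      using False by (auto intro!: derivative_eq_intros simp: mult.commute[of _ \<i>])
    from has_vector_derivative_real_field[OF this] show "(F has_vector_derivative cis (of_int e * x)) (at x within {0..2*pi})"
      by (simp add: F_def[abs_def] cis_conv_exp)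
  next
    show "continuous_on {0..2*pi} (\<lambda>t. cis (of_int e * t))" unfolding cis_conv_exp by (intro continuous_intros)
  qed simp
  moreover have "F (2*pi) = F 0"
  proof -
    have "cis (of_int e * (2 * pi)) = 1" using cis_multiple_2pi[of "of_int e"] by (simp add: mult_ac)
    then show ?thesis by (simp add: F_def)
  qed
  ultimately have I: "(\<integral>t. indicator {0..2*pi} t *\<^sub>R cis (of_int e * t) \<partial>lborel) = 0"
    by (simp add: has_bochner_integral_iff)
  have "(\<integral>t. cis t powi e \<partial>unif) = (\<integral>t. (indicator {0..<2*pi} t / (2*pi)) *\<^sub>R cis (of_int e * t) \<partial>lborel)"
    unfolding unif_def cis_power_int by (subst integral_density) auto
  also have "\<dots> = (\<integral>t. (1 / (2*pi)) *\<^sub>R (indicator {0..2*pi} t *\<^sub>R cis (of_int e * t)) \<partial>lborel)"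
  proof (rule integral_cong_AE)
    have "AE t in lborel. t \<noteq> 2 * pi" by (rule AE_lborel_singleton)
    then show "AE t in lborel. (indicator {0..<2*pi} t / (2*pi)) *\<^sub>R cis (of_int e * t) = (1 / (2*pi)) *\<^sub>R (indicator {0..2*pi} t *\<^sub>R cis (of_int e * t))"
      by eventually_elim (auto split: split_indicator)
  qed auto
  also have "\<dots> = 0" unfolding integral_scaleR_right I by simp
  finally show ?thesis using False by simp
qed

definition UP :: "nat \<Rightarrow> (nat \<Rightarrow> real) measure" where
  "UP r = PiM {..<r} (\<lambda>_. unif)"

lemma sets_UP [simp, measurable_cong]: "sets (UP r) = sets (PiM {..<r} (\<lambda>_. borel))"
  unfolding UP_def by (intro sets_PiM_cong) auto

lemma prob_space_UP: "prob_space (UP r)"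
  unfolding UP_def by (intro prob_space_PiM prob_space_unif)

lemma product_sigma_finite_unif: "product_sigma_finite (\<lambda>_::nat. unif)"
  by (simp add: product_sigma_finite_def prob_space_imp_sigma_finite prob_space_unif)

lemma measurable_UP_component [measurable]: "i < r \<Longrightarrow> (\<lambda>t. t i) \<in> borel_measurable (UP r)"
  by (subst measurable_cong_sets[OF sets_UP refl]) (auto intro!: measurable_component_singleton)

abbreviation zc :: "(nat \<Rightarrow> real) \<Rightarrow> nat \<Rightarrow> complex" where
  "zc t \<equiv> \<lambda>i. cis (t i)"

lemma zc_torus: "zc t \<in> torus"
  by (simp add: torus_def)

lemma integrable_unif_bounded:
  fixes f :: "real \<Rightarrow> complex"
  assumes "f \<in> borel_measurable borel" "\<And>x. norm (f x) \<le> C"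
  shows "integrable unif f"
proof -
  interpret prob_space unif by (rule prob_space_unif)
  show ?thesis using assms by (intro integrable_const_bound[of _ C]) (auto simp: measurable_cong_sets[OF sets_unif refl])
qed

lemma integrable_UP_bounded:
  fixes f :: "(nat \<Rightarrow> real) \<Rightarrow> 'a :: {banach, second_countable_topology}"
  assumes "f \<in> borel_measurable (UP r)" "\<And>x. norm (f x) \<le> C"
  shows "integrable (UP r) f"
proof -
  interpret prob_space "UP r" by (rule prob_space_UP)
  show ?thesis using assms by (intro integrable_const_bound[of _ C]) auto
qed

lemma integral_UP_monomial:
  "(\<integral>t. (\<Prod>i<r. cis (t i) powi e i) \<partial>UP r) = of_bool (\<forall>i<r. e i = 0)"
proof -
  interpret product_sigma_finite "\<lambda>_::nat. unif" by (rule product_sigma_finite_unif)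
  have "(\<integral>t. (\<Prod>i<r. cis (t i) powi e i) \<partial>UP r) = (\<Prod>i<r. \<integral>t. cis t powi e i \<partial>unif)"
    unfolding UP_def
    by (rule product_integral_prod) (auto intro!: integrable_unif_bounded[of _ 1] simp: cis_power_int)
  also have "\<dots> = of_bool (\<forall>i<r. e i = 0)" by (auto simp: integral_unif_cis)
  finally show ?thesis .
qed

lemma integral_UP_0:
  assumes i: "i < r" and e: "e \<noteq> 0" and h: "h \<in> borel_measurable (UP r)" "\<And>t. norm (h t) \<le> C" "\<And>t x. h (t(i := x)) = h t"
  shows "(\<integral>t. cis (t i) powi e * h t \<partial>UP r) = 0"
proof -
  interpret product_sigma_finite "\<lambda>_::nat. unif" by (rule product_sigma_finite_unif)
  have ins: "insert i ({..<r} - {i}) = {..<r}" using i by auto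
  have int: "integrable (UP r) (\<lambda>t. cis (t i) powi e * h t)"
    using i h by (intro integrable_UP_bounded[of _ _ C]) (auto simp: norm_mult cis_power_int)
  have "(\<integral>t. cis (t i) powi e * h t \<partial>UP r)
    = (\<integral>x. (\<integral>y. cis ((x(i := y)) i) powi e * h (x(i := y)) \<partial>unif) \<partial>PiM ({..<r} - {i}) (\<lambda>_. unif))"
    using product_integral_insert[of "{..<r} - {i}" i "\<lambda>t. cis (t i) powi e * h t"] int unfolding ins UP_def by simp
  also have "\<dots> = (\<integral>x. 0 \<partial>PiM ({..<r} - {i}) (\<lambda>_. unif))"
    using e by (simp add: h(3) integral_unif_cis)
  finally show ?thesis by simp
qed

lemma measurable_dsum_zc: "(\<lambda>t. dsum n (zc t) a S) \<in> borel_measurable (UP n)"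
proof (induction a arbitrary: S)
  case (Cons b a)
  show ?case unfolding dsum.simps cis_power_int
    by (intro borel_measurable_sum borel_measurable_times Cons borel_measurable_cis borel_measurable_const measurable_UP_component) auto
qed simp

lemma norm_dsum_le: "z \<in> torus \<Longrightarrow> norm (dsum n z a S) \<le> real n ^ length a"
proof (induction a arbitrary: S)
  case (Cons b a)
  have "norm (dsum n z (b # a) S) \<le> (\<Sum>j\<in>{..<n} - S. norm (z j powi b * dsum n z a (insert j S)))"
    unfolding dsum.simps by (rule norm_sum)
  also have "\<dots> \<le> (\<Sum>j\<in>{..<n} - S. real n ^ length a)"
    using Cons torus_norm by (intro sum_mono) (auto simp: norm_mult norm_power_int)
  also have "\<dots> \<le> (\<Sum>j\<in>{..<n}. real n ^ length a)" by (intro sum_mono2) auto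
  finally show ?case by simp
qed simp

lemma dsum_upd: "i \<in> S \<Longrightarrow> dsum n (z(i := x)) a S = dsum n z a S"
  by (induction a arbitrary: S) (auto intro!: sum.cong)

lemma VV_expand:
  assumes "z \<in> torus"
  shows "Vdm n z * cnj (Vdm n z) = (\<Sum>p | p permutes {0..<n}. \<Sum>q | q permutes {0..<n}.
     signof p * signof q * (\<Prod>j<n. z j powi (int (p j) - int (q j))))"
    "dVsq n z i = (\<Sum>p | p permutes {0..<n}. \<Sum>q | q permutes {0..<n}.
     of_int (int (p i) - int (q i)) * (signof p * signof q * (\<Prod>j<n. z j powi (int (p j) - int (q j)))))"
proof -
  have sg: "cnj (signof q) = signof q" for q :: "nat \<Rightarrow> nat" by (simp add: sign_def)
  have c: "cnj (z j ^ k) = z j powi - int k" for j k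
    using cnj_powi_unit[OF torus_norm[OF assms], of j "int k"] by simp
  have pq: "(\<Prod>j = 0..<n. z j ^ p j) * cnj (\<Prod>j = 0..<n. z j ^ q j) = (\<Prod>j<n. z j powi (int (p j) - int (q j)))" for p q :: "nat \<Rightarrow> nat"
    unfolding cnj_prod c prod.distrib[symmetric] lessThan_atLeast0
    by (intro prod.cong refl) (use torus_nz[OF assms] in \<open>simp add: power_int_diff power_int_minus divide_inverse\<close>)
  have *: "(\<Sum>p | p permutes {0..<n}. signof p * f p * (\<Prod>j = 0..<n. z j ^ p j)) * cnj (\<Sum>q | q permutes {0..<n}. signof q * g q * (\<Prod>j = 0..<n. z j ^ q j))
     = (\<Sum>p | p permutes {0..<n}. \<Sum>q | q permutes {0..<n}. f p * cnj (g q) * (signof p * signof q * (\<Prod>j<n. z j powi (int (p j) - int (q j)))))" for f g :: "(nat \<Rightarrow> nat) \<Rightarrow> complex"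
    unfolding cnj_sum sum_product complex_cnj_mult sg pq[symmetric] by (intro sum.cong refl) (simp only: mult_ac)
  show "Vdm n z * cnj (Vdm n z) = (\<Sum>p | p permutes {0..<n}. \<Sum>q | q permutes {0..<n}.
     signof p * signof q * (\<Prod>j<n. z j powi (int (p j) - int (q j))))"
    using *[of "\<lambda>_. 1" "\<lambda>_. 1"] unfolding Vdm_expand by simp
  have "dVsq n z i = (\<Sum>p | p permutes {0..<n}. \<Sum>q | q permutes {0..<n}. of_nat (p i) * (signof p * signof q * (\<Prod>j<n. z j powi (int (p j) - int (q j)))))
    - (\<Sum>p | p permutes {0..<n}. \<Sum>q | q permutes {0..<n}. of_nat (q i) * (signof p * signof q * (\<Prod>j<n. z j powi (int (p j) - int (q j)))))"
    using *[of "\<lambda>p. of_nat (p i)" "\<lambda>_. 1"] *[of "\<lambda>_. 1" "\<lambda>p. of_nat (p i)"] unfolding dVsq_def Vdm_expand dVdm_def by simp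
  then show "dVsq n z i = (\<Sum>p | p permutes {0..<n}. \<Sum>q | q permutes {0..<n}.
     of_int (int (p i) - int (q i)) * (signof p * signof q * (\<Prod>j<n. z j powi (int (p j) - int (q j)))))"
    by (simp add: sum_subtractf[symmetric] left_diff_distrib)
qed

text \<open>A total derivative integrates to zero. Concretely, every term of the expansion has the
  factor \<open>of_int (e p q)\<close>, where \<open>e p q\<close> is its exponent in variable
  \<open>i\<close>: the factor is zero if the exponent is, and otherwise the integral over that
  variable vanishes.\<close>

lemma marked_weight_integral:
  assumes i: "i < n"
  shows "(\<integral>t. zc t i powi m * dsum n (zc t) a {i} * (of_int m * (Vdm n (zc t) * cnj (Vdm n (zc t))) + dVsq n (zc t) i) \<partial>UP n) = 0"
    and "integrable (UP n) (\<lambda>t. zc t i powi m * dsum n (zc t) a {i} * (of_int m * (Vdm n (zc t) * cnj (Vdm n (zc t))) + dVsq n (zc t) i))"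
proof -
  define h where "h p q t = dsum n (zc t) a {i} * (\<Prod>j\<in>{..<n} - {i}. zc t j powi (int (p j) - int (q j)))" for p q :: "nat \<Rightarrow> nat" and t
  define e where "e p q = m + (int (p i) - int (q i))" for p q :: "nat \<Rightarrow> nat"
  have hm: "h p q \<in> borel_measurable (UP n)" for p q
    unfolding h_def cis_power_int
    by (intro borel_measurable_times borel_measurable_prod measurable_dsum_zc borel_measurable_cis borel_measurable_const measurable_UP_component) auto
  have hb: "norm (h p q t) \<le> real n ^ length a" for p q t
    unfolding h_def norm_mult prod_norm[symmetric] using norm_dsum_le[OF zc_torus] by (simp add: norm_power_int)
  have hu: "h p q (t(i := x)) = h p q t" for p q t x
  proof -
    have "zc (t(i := x)) = (zc t)(i := cis x)" by auto
    then show ?thesis unfolding h_def by (simp add: dsum_upd)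
  qed
  have eq: "zc t i powi m * dsum n (zc t) a {i} * (of_int m * (Vdm n (zc t) * cnj (Vdm n (zc t))) + dVsq n (zc t) i)
    = (\<Sum>p | p permutes {0..<n}. \<Sum>q | q permutes {0..<n}. of_int (e p q) * (signof p * signof q) * (cis (t i) powi e p q * h p q t))" for t
  proof -
    have sp: "(\<Prod>j<n. zc t j powi (int (p j) - int (q j))) = cis (t i) powi (int (p i) - int (q i)) * (\<Prod>j\<in>{..<n} - {i}. zc t j powi (int (p j) - int (q j)))" for p q :: "nat \<Rightarrow> nat"
      using i by (intro prod.remove) auto
    have "cis (t i) powi e p q = cis (t i) powi m * cis (t i) powi (int (p i) - int (q i))" for p q
      unfolding e_def by (simp add: power_int_add)
    then show ?thesis
      unfolding VV_expand[OF zc_torus] sum_distrib_left sum.distrib[symmetric] h_def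
      by (intro sum.cong refl) (simp add: sp e_def algebra_simps)
  qed
  have int: "integrable (UP n) (\<lambda>t. cis (t i) powi e p q * h p q t)" for p q
    using i hm hb by (intro integrable_UP_bounded[of _ _ "real n ^ length a"]) (auto simp: norm_mult cis_power_int intro!: borel_measurable_times)
  have z: "of_int (e p q) * c * (\<integral>t. cis (t i) powi e p q * h p q t \<partial>UP n) = 0" for p q c
    using integral_UP_0[OF i _ hm hb hu, of "e p q"] by (cases "e p q = 0") auto
  show "integrable (UP n) (\<lambda>t. zc t i powi m * dsum n (zc t) a {i} * (of_int m * (Vdm n (zc t) * cnj (Vdm n (zc t))) + dVsq n (zc t) i))"
    unfolding eq by (intro Bochner_Integration.integrable_sum integrable_mult_right int)
  show "(\<integral>t. zc t i powi m * dsum n (zc t) a {i} * (of_int m * (Vdm n (zc t) * cnj (Vdm n (zc t))) + dVsq n (zc t) i) \<partial>UP n) = 0"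
    unfolding eq by (simp add: Bochner_Integration.integral_sum Bochner_Integration.integrable_sum integrable_mult_right int z)
qed

lemma measurable_VV: "(\<lambda>t. Vdm n (zc t) * cnj (Vdm n (zc t))) \<in> borel_measurable (UP n)"
  unfolding VV_expand(1)[OF zc_torus] cis_power_int
  by (intro borel_measurable_sum borel_measurable_times borel_measurable_prod borel_measurable_cis borel_measurable_const measurable_UP_component) auto

lemma bounded_VV: "\<exists>C. \<forall>t. norm (Vdm n (zc t) * cnj (Vdm n (zc t))) \<le> C"
proof (intro exI allI)
  fix t
  have sg: "norm (signof p :: complex) \<le> 1" for p :: "nat \<Rightarrow> nat" by (simp add: sign_def)
  show "norm (Vdm n (zc t) * cnj (Vdm n (zc t))) \<le> (\<Sum>p | p permutes {0..<n}. \<Sum>q | q permutes {0..<n}. 1)"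
    unfolding VV_expand(1)[OF zc_torus]
    by (intro sum_norm_le) (use sg in \<open>auto simp: norm_mult prod_norm[symmetric] norm_power_int intro!: mult_le_one\<close>)
qed

lemma integrable_dsum_VV: "integrable (UP n) (\<lambda>t. dsum n (zc t) b S * (Vdm n (zc t) * cnj (Vdm n (zc t))))"
proof -
  obtain C where C: "\<And>t. norm (Vdm n (zc t) * cnj (Vdm n (zc t))) \<le> C" using bounded_VV by blast
  show ?thesis
  proof (rule integrable_UP_bounded)
    show "(\<lambda>t. dsum n (zc t) b S * (Vdm n (zc t) * cnj (Vdm n (zc t)))) \<in> borel_measurable (UP n)"
      by (intro borel_measurable_times measurable_dsum_zc measurable_VV)
    show "norm (dsum n (zc t) b S * (Vdm n (zc t) * cnj (Vdm n (zc t)))) \<le> real n ^ length b * C" for t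
      unfolding norm_mult[of "dsum n (zc t) b S"] by (intro mult_mono norm_dsum_le zc_torus C) auto
  qed
qed

lemma sqz_rec_weight: "sqz_rec n (\<lambda>b. \<integral>t. dsum n (zc t) b {} * (Vdm n (zc t) * cnj (Vdm n (zc t))) \<partial>UP n)"
  unfolding sqz_rec_def
proof (intro allI impI)
  fix m :: int and a :: "int list" assume len: "Suc (length a) = n"
  let ?W = "\<lambda>t. Vdm n (zc t) * cnj (Vdm n (zc t))"
  let ?c = "\<lambda>b. \<integral>t. dsum n (zc t) b {} * ?W t \<partial>UP n"
  have hb: "has_bochner_integral (UP n) (\<lambda>t. dsum n (zc t) b {} * ?W t) (?c b)" for b
    using integrable_dsum_VV by (simp add: has_bochner_integral_integrable)
  have "has_bochner_integral (UP n) (\<lambda>t. of_int m * (dsum n (zc t) (m # a) {} * ?W t)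
      + (\<Sum>s<length a. sqz m (a ! s) (\<lambda>x y. dsum n (zc t) (x # y # remove_nth s a) {} * ?W t)))
     (of_int m * ?c (m # a) + (\<Sum>s<length a. sqz m (a ! s) (\<lambda>x y. ?c (x # y # remove_nth s a))))"
    by (intro has_bochner_integral_add has_bochner_integral_mult_right has_bochner_integral_sum has_bochner_integral_sqz hb)
  moreover have "of_int m * (dsum n (zc t) (m # a) {} * ?W t) + (\<Sum>s<length a. sqz m (a ! s) (\<lambda>x y. dsum n (zc t) (x # y # remove_nth s a) {} * ?W t))
     = (\<Sum>i<n. zc t i powi m * dsum n (zc t) a {i} * (of_int m * ?W t + dVsq n (zc t) i))" for t
    unfolding weighted_loop_identity[OF zc_torus len, symmetric] distrib_right sum_distrib_right sqz_mult by simp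
  moreover have "has_bochner_integral (UP n) (\<lambda>t. \<Sum>i<n. zc t i powi m * dsum n (zc t) a {i} * (of_int m * ?W t + dVsq n (zc t) i)) (\<Sum>i<n. 0)"
    using marked_weight_integral by (intro has_bochner_integral_sum) (auto simp: has_bochner_integral_iff)
  ultimately show "of_int m * ?c (m # a) + (\<Sum>s<length a. sqz m (a ! s) (\<lambda>x y. ?c (x # y # remove_nth s a))) = 0"
    using has_bochner_integral_eq by fastforce
qed

definition inj_lists :: "nat \<Rightarrow> nat \<Rightarrow> nat list set" where
  "inj_lists n r = {us. length us = r \<and> distinct us \<and> set us \<subseteq> {..<n}}"

lemma finite_inj_lists [simp]: "finite (inj_lists n r)"
  by (rule finite_subset[OF _ finite_lists_length_eq[of "{..<n}" r]]) (auto simp: inj_lists_def)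

lemma card_inj_lists_full: "card (inj_lists n n) = fact n"
proof -
  have "card (inj_lists n n) = \<Prod>{card {..<n} - n + 1..card {..<n}}"
    unfolding inj_lists_def by (rule card_lists_distinct_length_eq) auto
  then show ?thesis by (simp add: fact_prod)
qed

lemma dsum_lists:
  "dsum n z a S = (\<Sum>us | length us = length a \<and> distinct us \<and> set us \<subseteq> {..<n} - S. \<Prod>s<length a. z (us ! s) powi (a ! s))"
proof (induction a arbitrary: S)
  case Nil
  have "{us::nat list. length us = length ([] :: int list) \<and> distinct us \<and> set us \<subseteq> {..<n} - S} = {[]}" by auto
  then show ?case by simp
next
  case (Cons b a)
  let ?L = "\<lambda>S k. {us. length us = k \<and> distinct us \<and> set us \<subseteq> {..<n} - S}"
  let ?h = "\<lambda>a us. \<Prod>s<length a. z (us ! s) powi (a ! s)"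
  have fin: "finite (?L S k)" for S k
    by (rule finite_subset[OF _ finite_lists_length_eq[of "{..<n}" k]]) auto
  have "(\<Sum>us\<in>?L S (Suc (length a)). ?h (b # a) us) = (\<Sum>(j, us)\<in>(SIGMA j:{..<n} - S. ?L (insert j S) (length a)). ?h (b # a) (j # us))"
    by (rule sum.reindex_bij_witness[of _ "\<lambda>(j, us). j # us" "\<lambda>us. (hd us, tl us)"])
       (auto simp: length_Suc_conv)
  also have "\<dots> = (\<Sum>j\<in>{..<n} - S. \<Sum>us\<in>?L (insert j S) (length a). ?h (b # a) (j # us))"
    using fin by (subst sum.Sigma) auto
  also have "\<dots> = dsum n z (b # a) S"
    unfolding dsum.simps Cons sum_distrib_left by (intro sum.cong refl) (simp add: prod.lessThan_Suc_shift del: prod.lessThan_Suc)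
  finally show ?case by simp
qed

lemma dsum_inj_lists: "dsum n z a {} = (\<Sum>us\<in>inj_lists n (length a). \<Prod>s<length a. z (us ! s) powi (a ! s))"
  by (simp add: dsum_lists inj_lists_def)

text \<open>Trailing zero exponents only count the injective choices of the remaining indices; this
  relates moments with few exponents to those with \<open>n\<close> of them.\<close>

lemma dsum_zeros: "card ({..<n} - S) = length a + k \<Longrightarrow> dsum n z (a @ replicate k 0) S = fact k * dsum n z a S"
proof (induction a arbitrary: S)
  case Nil
  then show ?case
  proof (induction k arbitrary: S)
    case (Suc k)
    have "dsum n z (replicate k 0) (insert j S) = fact k" if "j \<in> {..<n} - S" for j
    proof -
      have "{..<n} - insert j S = ({..<n} - S) - {j}" by auto
      then have "card ({..<n} - insert j S) = k" using that Suc.prems by simp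
      then show ?thesis using Suc.IH[of "insert j S"] by simp
    qed
    then have "dsum n z (replicate (Suc k) 0) S = (\<Sum>j\<in>{..<n} - S. fact k)" by simp
    then show ?case using Suc.prems by simp
  qed simp
next
  case (Cons b a)
  have "dsum n z (a @ replicate k 0) (insert j S) = fact k * dsum n z a (insert j S)" if "j \<in> {..<n} - S" for j
  proof -
    have "{..<n} - insert j S = ({..<n} - S) - {j}" by auto
    then show ?thesis using that Cons.prems by (intro Cons.IH) simp
  qed
  then show ?case by (simp add: sum_distrib_left mult_ac)
qed

lemma Vdm_permute:
  assumes "p permutes {0..<n}"
  shows "Vdm n (\<lambda>i. z (p i)) = signof p * Vdm n z"
proof -
  have "mat n n (\<lambda>(i, j). z (p i) ^ j) = mat n n (\<lambda>(i, j). mat n n (\<lambda>(i, j). z i ^ j) $$ (p i, j))"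
    using permutes_in_image[OF assms] by (intro eq_matI) auto
  then show ?thesis unfolding Vdm_def by (subst det_permute_rows[symmetric, OF _ assms]) auto
qed

lemma VV_permute:
  assumes "p permutes {0..<n}"
  shows "Vdm n (\<lambda>i. z (p i)) * cnj (Vdm n (\<lambda>i. z (p i))) = Vdm n z * cnj (Vdm n z)"
  unfolding Vdm_permute[OF assms] by (auto simp: sign_def)

lemma integral_UP_permute:
  fixes f :: "(nat \<Rightarrow> real) \<Rightarrow> complex"
  assumes p: "p permutes {0..<n}" and f: "f \<in> borel_measurable (UP n)"
  shows "(\<integral>t. f (\<lambda>i\<in>{..<n}. t (p i)) \<partial>UP n) = (\<integral>t. f t \<partial>UP n)"
proof -
  have "p \<in> {..<n} \<rightarrow> {..<n}" using permutes_in_image[OF p] by (auto simp: lessThan_atLeast0)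
  moreover have "inj_on p {..<n}" using permutes_inj[OF p] by (meson inj_on_subset subset_UNIV)
  ultimately have d: "distr (UP n) (UP n) (\<lambda>t. \<lambda>i\<in>{..<n}. t (p i)) = UP n"
    unfolding UP_def using distr_PiM_reindex[of "{..<n}" "\<lambda>_. unif" p "{..<n}"] prob_space_unif by simp
  have m: "(\<lambda>t. \<lambda>i\<in>{..<n}. t (p i)) \<in> measurable (UP n) (UP n)"
    unfolding UP_def using \<open>p \<in> _\<close> by (intro measurable_restrict) (auto intro!: measurable_component_singleton)
  show ?thesis using integral_distr[OF m f] d by simp
qed

lemma measurable_monomial_VV:
  "(\<lambda>t. (\<Prod>i<n. zc t i powi b i) * (Vdm n (zc t) * cnj (Vdm n (zc t)))) \<in> borel_measurable (UP n)"
  unfolding cis_power_int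
  by (intro borel_measurable_times borel_measurable_prod measurable_VV borel_measurable_cis borel_measurable_const measurable_UP_component) auto

lemma integrable_monomial_VV:
  "integrable (UP n) (\<lambda>t. (\<Prod>s<n. zc t (u s) powi b s) * (Vdm n (zc t) * cnj (Vdm n (zc t))))"
  if "u \<in> {..<n} \<rightarrow> {..<n}"
proof -
  obtain C where C: "\<And>t. norm (Vdm n (zc t) * cnj (Vdm n (zc t))) \<le> C" using bounded_VV by blast
  show ?thesis
  proof (rule integrable_UP_bounded)
    show "(\<lambda>t. (\<Prod>s<n. zc t (u s) powi b s) * (Vdm n (zc t) * cnj (Vdm n (zc t)))) \<in> borel_measurable (UP n)"
      unfolding cis_power_int using that
      by (intro borel_measurable_times borel_measurable_prod measurable_VV borel_measurable_cis borel_measurable_const measurable_UP_component) auto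
    show "norm ((\<Prod>s<n. zc t (u s) powi b s) * (Vdm n (zc t) * cnj (Vdm n (zc t)))) \<le> C" for t
      unfolding norm_mult[of "prod _ _"] prod_norm[symmetric] using C by (simp add: norm_power_int)
  qed
qed

text \<open>With \<open>n\<close> exponents the tuples of distinct indices are the permutations, and
  the density is invariant under permuting the variables, so all \<open>fact n\<close> terms have
  the same integral.\<close>

lemma integral_dsum_VV:
  assumes len: "length b = n"
  shows "(\<integral>t. dsum n (zc t) b {} * (Vdm n (zc t) * cnj (Vdm n (zc t))) \<partial>UP n)
    = fact n * (\<integral>t. (\<Prod>i<n. zc t i powi (b ! i)) * (Vdm n (zc t) * cnj (Vdm n (zc t))) \<partial>UP n)"
proof -
  let ?W = "\<lambda>t. Vdm n (zc t) * cnj (Vdm n (zc t))"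
  let ?f = "\<lambda>t. (\<Prod>i<n. zc t i powi (b ! i)) * ?W t"
  have each: "(\<integral>t. (\<Prod>s<n. zc t (us ! s) powi (b ! s)) * ?W t \<partial>UP n) = (\<integral>t. ?f t \<partial>UP n)" if us: "us \<in> inj_lists n n" for us
  proof -
    define p where "p i = (if i < n then us ! i else i)" for i
    have sub: "us ! i < n" if "i < n" for i using us that by (auto simp: inj_lists_def dest!: nth_mem)
    have "bij_betw p {0..<n} {0..<n}"
    proof (rule bij_betw_imageI)
      show inj: "inj_on p {0..<n}" using us by (auto simp: inj_on_def p_def inj_lists_def nth_eq_iff_index_eq)
      have "p ` {0..<n} \<subseteq> {0..<n}" using sub by (auto simp: p_def)
      then show "p ` {0..<n} = {0..<n}" by (intro card_subset_eq) (simp_all add: card_image[OF inj])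
    qed
    then have p: "p permutes {0..<n}" by (rule bij_imp_permutes) (auto simp: p_def)
    have W: "?W (\<lambda>i\<in>{..<n}. t (p i)) = ?W t" for t
    proof -
      have "Vdm n (zc (\<lambda>i\<in>{..<n}. t (p i))) = Vdm n (\<lambda>i. zc t (p i))" by (intro Vdm_cong) auto
      then show ?thesis using VV_permute[OF p, of "zc t"] by simp
    qed
    have "?f (\<lambda>i\<in>{..<n}. t (p i)) = (\<Prod>s<n. zc t (us ! s) powi (b ! s)) * ?W t" for t
      unfolding W by (intro arg_cong2[of _ _ _ _ "(*)"] prod.cong refl) (auto simp: p_def)
    then show ?thesis using integral_UP_permute[OF p measurable_monomial_VV[where n = n and b = "\<lambda>i. b ! i"]] by simp
  qed
  have sub: "(!) us \<in> {..<n} \<rightarrow> {..<n}" if "us \<in> inj_lists n n" for us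
    using that by (auto simp: inj_lists_def dest!: nth_mem)
  have "(\<integral>t. dsum n (zc t) b {} * ?W t \<partial>UP n) = (\<Sum>us\<in>inj_lists n n. \<integral>t. (\<Prod>s<n. zc t (us ! s) powi (b ! s)) * ?W t \<partial>UP n)"
    unfolding dsum_inj_lists len sum_distrib_right using integrable_monomial_VV[OF sub] by (intro Bochner_Integration.integral_sum)
  also have "\<dots> = (\<Sum>us\<in>inj_lists n n. \<integral>t. ?f t \<partial>UP n)" by (intro sum.cong refl each)
  finally show ?thesis by (simp add: card_inj_lists_full)
qed

text \<open>Orthogonality of monomials leaves the diagonal terms \<open>q = p\<close>, each of which
  contributes 1.\<close>

lemma integral_VV: "(\<integral>t. Vdm n (zc t) * cnj (Vdm n (zc t)) \<partial>UP n) = fact n"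
proof -
  have int: "integrable (UP n) (\<lambda>t. \<Prod>j<n. cis (t j) powi (e j))" for e
    by (intro integrable_UP_bounded[of _ _ 1])
       (auto simp: cis_power_int prod_norm[symmetric] intro!: borel_measurable_prod borel_measurable_cis borel_measurable_times borel_measurable_const measurable_UP_component)
  have eq: "(\<forall>j<n. int (p j) - int (q j) = 0) \<longleftrightarrow> q = p" if "p permutes {0..<n}" "q permutes {0..<n}" for p q
  proof
    assume *: "\<forall>j<n. int (p j) - int (q j) = 0"
    show "q = p"
    proof
      fix j show "q j = p j" using * permutes_not_in[OF that(1), of j] permutes_not_in[OF that(2), of j] by (cases "j < n") auto
    qed
  qed auto
  have "(\<integral>t. Vdm n (zc t) * cnj (Vdm n (zc t)) \<partial>UP n)
    = (\<Sum>p | p permutes {0..<n}. \<Sum>q | q permutes {0..<n}. signof p * signof q * of_bool (\<forall>j<n. int (p j) - int (q j) = 0))"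
    unfolding VV_expand(1)[OF zc_torus] by (simp add: Bochner_Integration.integral_sum Bochner_Integration.integrable_sum int integral_UP_monomial integrable_mult_right)
  also have "\<dots> = (\<Sum>p | p permutes {0..<n}. \<Sum>q | q permutes {0..<n}. if q = p then 1 else 0)"
    using eq by (intro sum.cong refl) (auto simp: sign_def)
  also have "\<dots> = (\<Sum>p | p permutes {0..<n}. 1)" using finite_permutations[of "{0..<n}"] by (intro sum.cong refl) (auto simp: sum.delta')
  finally show ?thesis using card_permutations[of "{0..<n}" n] by simp
qed

text \<open>Both sides are symmetric in the exponents and solve the same recursion; dividing the
  weight by \<open>fact n\<close> makes them agree at the exponent list of zeros, where both are
  \<open>fact n\<close>.\<close>

theorem haar_dsum_full:
  assumes H: "normalized_haar n M" and len: "length b = n"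
  shows "(\<integral>U. dsum n (ev U) b {} \<partial>M) = (\<integral>t. (\<Prod>i<n. zc t i powi (b ! i)) * (Vdm n (zc t) * cnj (Vdm n (zc t))) \<partial>UP n)"
proof -
  interpret prob_space M using haarD[OF H] by simp
  let ?c = "\<lambda>b. \<integral>U. dsum n (ev U) b {} \<partial>M"
  let ?W = "\<lambda>b. \<integral>t. dsum n (zc t) b {} * (Vdm n (zc t) * cnj (Vdm n (zc t))) \<partial>UP n"
  have rec: "sqz_rec n (\<lambda>b. ?W b / fact n)"
  proof -
    have s: "sqz m c (\<lambda>x y. h x y / fact n) = sqz m c h / fact n" for m c h by (simp add: sqz_def sum_divide_distrib diff_divide_distrib)
    have "of_int m * (?W (m # a) / fact n) + (\<Sum>s<length a. sqz m (a ! s) (\<lambda>x y. ?W (x # y # remove_nth s a) / fact n))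
      = (of_int m * ?W (m # a) + (\<Sum>s<length a. sqz m (a ! s) (\<lambda>x y. ?W (x # y # remove_nth s a)))) / fact n" for m a
      unfolding s by (simp add: add_divide_distrib sum_divide_distrib)
    then show ?thesis using sqz_rec_weight[of n] unfolding sqz_rec_def by simp
  qed
  have z: "dsum n z (replicate n 0) {} = fact n" for z using dsum_zeros[of n "{}" "[]" n z] by simp
  have "?c b = ?W b / fact n"
  proof (rule sqz_rec_unique[OF sqz_rec_haar[OF H] rec _ _ _ len])
    show "?c (replicate n 0) = ?W (replicate n 0) / fact n" unfolding z using prob_space integral_VV[of n] by simp
  next
    fix a b :: "int list" assume m: "mset a = mset b"
    have e: "dsum n z a {} = dsum n z b {}" for z by (rule dsum_perm[OF m])
    show "?c a = ?c b" "?W a / fact n = ?W b / fact n" unfolding e by (rule refl)+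
  qed
  then show ?thesis unfolding integral_dsum_VV[OF len] by simp
qed

subsection \<open>Determinantal correlation functions\<close>

definition rho :: "nat \<Rightarrow> nat \<Rightarrow> (nat \<Rightarrow> complex) \<Rightarrow> complex" where
  "rho n r z = det (mat r r (\<lambda>(i, j). \<Sum>l<n. z i ^ l * cnj (z j) ^ l))"

definition inj_funs :: "nat \<Rightarrow> nat \<Rightarrow> (nat \<Rightarrow> nat) set" where
  "inj_funs n r = {l \<in> {0..<r} \<rightarrow>\<^sub>E {..<n}. inj_on l {0..<r}}"

lemma finite_inj_funs [simp]: "finite (inj_funs n r)"
  unfolding inj_funs_def by (rule finite_subset[OF _ finite_PiE[of "{0..<r}" "\<lambda>_. {..<n}"]]) auto

text \<open>Multilinearity in the rows selects one exponent \<open>l i\<close> per row. The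
  remaining determinant has two equal rows unless \<open>l\<close> is injective.\<close>

lemma rho_expand:
  assumes z: "z \<in> torus"
  shows "rho n r z = (\<Sum>l\<in>inj_funs n r. \<Sum>p | p permutes {0..<r}. signof p * (\<Prod>i<r. z i powi (int (l i) - int (l (p i)))))"
proof -
  let ?D = "\<lambda>l. mat r r (\<lambda>(i, j). cnj (z j) ^ l i)"
  have pim: "p i < r" if "p permutes {0..<r}" "i < r" for p i using permutes_in_image[OF that(1), of i] that by auto
  have "rho n r z = (\<Sum>p | p permutes {0..<r}. signof p * (\<Prod>i = 0..<r. \<Sum>l<n. z i ^ l * cnj (z (p i)) ^ l))"
    unfolding rho_def using pim by (subst det_def'[of _ r]) (auto intro!: sum.cong prod.cong)
  also have "\<dots> = (\<Sum>p | p permutes {0..<r}. \<Sum>l\<in>{0..<r} \<rightarrow>\<^sub>E {..<n}. (\<Prod>i = 0..<r. z i ^ l i) * (signof p * (\<Prod>i = 0..<r. cnj (z (p i)) ^ l i)))"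
    by (simp add: prod_sum_PiE sum_distrib_left prod.distrib mult_ac)
  also have "\<dots> = (\<Sum>l\<in>{0..<r} \<rightarrow>\<^sub>E {..<n}. (\<Prod>i = 0..<r. z i ^ l i) * det (?D l))"
    using pim by (subst sum.swap, subst det_def'[of _ r]) (auto simp: sum_distrib_left intro!: sum.cong prod.cong)
  also have "\<dots> = (\<Sum>l\<in>inj_funs n r. (\<Prod>i = 0..<r. z i ^ l i) * det (?D l))"
  proof (rule sum.mono_neutral_right)
    show "finite ({0..<r} \<rightarrow>\<^sub>E {..<n})" by (intro finite_PiE) auto
    show "inj_funs n r \<subseteq> {0..<r} \<rightarrow>\<^sub>E {..<n}" by (auto simp: inj_funs_def)
    show "\<forall>l\<in>({0..<r} \<rightarrow>\<^sub>E {..<n}) - inj_funs n r. (\<Prod>i = 0..<r. z i ^ l i) * det (?D l) = 0"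
    proof
      fix l assume "l \<in> ({0..<r} \<rightarrow>\<^sub>E {..<n}) - inj_funs n r"
      then obtain i k where ik: "i < r" "k < r" "i \<noteq> k" "l i = l k" by (auto simp: inj_funs_def inj_on_def)
      then have "det (?D l) = 0" by (intro det_identical_rows[of _ r i k]) (auto intro!: eq_vecI)
      then show "(\<Prod>i = 0..<r. z i ^ l i) * det (?D l) = 0" by simp
    qed
  qed
  also have "\<dots> = (\<Sum>l\<in>inj_funs n r. \<Sum>p | p permutes {0..<r}. signof p * (\<Prod>i<r. z i powi (int (l i) - int (l (p i)))))"
  proof (rule sum.cong[OF refl])
    fix l
    have c: "cnj (z j) ^ k = z j powi - int k" for j k
      using cnj_powi_unit[OF torus_norm[OF z], of j "int k"] by simp
    have "det (?D l) = (\<Sum>p | p permutes {0..<r}. signof p * (\<Prod>j<r. cnj (z j) ^ l (p j)))"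
      using pim by (subst det_col[of _ r]) (auto intro!: sum.cong prod.cong)
    then have "(\<Prod>i = 0..<r. z i ^ l i) * det (?D l) = (\<Sum>p | p permutes {0..<r}. signof p * ((\<Prod>i<r. z i ^ l i) * (\<Prod>j<r. cnj (z j) ^ l (p j))))"
      by (simp add: sum_distrib_left mult_ac lessThan_atLeast0)
    also have "\<dots> = (\<Sum>p | p permutes {0..<r}. signof p * (\<Prod>i<r. z i powi (int (l i) - int (l (p i)))))"
      unfolding c prod.distrib[symmetric]
      by (intro sum.cong refl arg_cong2[of _ _ _ _ "(*)"] prod.cong) (use torus_nz[OF z] in \<open>simp add: power_int_diff power_int_minus divide_inverse\<close>)
    finally show "(\<Prod>i = 0..<r. z i ^ l i) * det (?D l) = (\<Sum>p | p permutes {0..<r}. signof p * (\<Prod>i<r. z i powi (int (l i) - int (l (p i)))))" .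
  qed
  finally show ?thesis .
qed

lemma rho_full:
  assumes z: "z \<in> torus"
  shows "rho n n z = Vdm n z * cnj (Vdm n z)"
proof -
  let ?Z = "mat n n (\<lambda>(i, j). z i ^ j)" and ?C = "mat n n (\<lambda>(i, j). cnj (z j) ^ i)"
  have pim: "p i < n" if "p permutes {0..<n}" "i < n" for p i using permutes_in_image[OF that(1), of i] that by auto
  have sg: "cnj (signof q) = signof q" for q :: "nat \<Rightarrow> nat" by (simp add: sign_def)
  have "det ?C = (\<Sum>p | p permutes {0..<n}. signof p * (\<Prod>j<n. cnj (z j) ^ p j))"
    using pim by (subst det_col[of _ n]) (auto intro!: sum.cong prod.cong)
  also have "\<dots> = cnj (Vdm n z)" unfolding Vdm_expand by (simp add: sg lessThan_atLeast0)
  finally have C: "det ?C = cnj (Vdm n z)" .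
  have "mat n n (\<lambda>(i, j). \<Sum>l<n. z i ^ l * cnj (z j) ^ l) = ?Z * ?C"
    by (intro eq_matI) (auto simp: mult_mat_index[of _ n n _ n])
  then show ?thesis unfolding rho_def using det_mult[of ?Z n ?C] C by (simp add: Vdm_def)
qed

text \<open>A Fourier coefficient of \<open>rho n r\<close>, evaluated combinatorially:
  \<open>integral_monomial_rho\<close> identifies it with the integral of \<open>rho n r\<close>
  against the monomial with exponents \<open>a\<close>.\<close>

definition rho_coeff :: "nat \<Rightarrow> nat \<Rightarrow> (nat \<Rightarrow> int) \<Rightarrow> complex" where
  "rho_coeff n r a = (\<Sum>l\<in>inj_funs n r. \<Sum>p | p permutes {0..<r}. signof p * of_bool (\<forall>i<r. a i + (int (l i) - int (l (p i))) = 0))"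

lemma integral_monomial_rho:
  "(\<integral>t. (\<Prod>i<r. zc t i powi a i) * rho n r (zc t) \<partial>UP r) = rho_coeff n r a"
proof -
  have int: "integrable (UP r) (\<lambda>t. \<Prod>j<r. cis (t j) powi (e j))" for e
    by (intro integrable_UP_bounded[of _ _ 1])
       (auto simp: cis_power_int prod_norm[symmetric] intro!: borel_measurable_prod borel_measurable_cis borel_measurable_times borel_measurable_const measurable_UP_component)
  have "(\<Prod>i<r. zc t i powi a i) * rho n r (zc t) = (\<Sum>l\<in>inj_funs n r. \<Sum>p | p permutes {0..<r}. signof p * (\<Prod>i<r. cis (t i) powi (a i + (int (l i) - int (l (p i))))))" for t
    unfolding rho_expand[OF zc_torus] sum_distrib_left
    by (intro sum.cong refl) (simp add: power_int_add prod.distrib mult_ac)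
  then show ?thesis unfolding rho_coeff_def
    by (simp add: Bochner_Integration.integral_sum Bochner_Integration.integrable_sum int integral_UP_monomial integrable_mult_right)
qed

text \<open>Integrating out the last variable: the factor \<open>n - r\<close> counts the values left for the last index.\<close>

lemma rho_coeff_Suc:
  assumes "a r = 0"
  shows "rho_coeff n (Suc r) a = of_nat (n - r) * rho_coeff n r a"
proof -
  define G where "G l = (\<Sum>p | p permutes {0..<r}. signof p * of_bool (\<forall>i<r. a i + (int (l i) - int (l (p i))) = 0) :: complex)" for l :: "nat \<Rightarrow> nat"
  have perm: "{p. p permutes {0..<r}} = {p. p permutes {0..<Suc r} \<and> p r = r}"
  proof (intro equalityI subsetI)
    fix p assume "p \<in> {p. p permutes {0..<r}}"
    then show "p \<in> {p. p permutes {0..<Suc r} \<and> p r = r}"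
      using permutes_subset[of p "{0..<r}" "{0..<Suc r}"] permutes_not_in[of p "{0..<r}" r] by auto
  next
    fix p assume "p \<in> {p. p permutes {0..<Suc r} \<and> p r = r}"
    then show "p \<in> {p. p permutes {0..<r}}"
      using permutes_superset[of p "{0..<Suc r}" "{0..<r}"] by (auto simp: less_Suc_eq)
  qed
  have inner: "(\<Sum>p | p permutes {0..<Suc r}. signof p * of_bool (\<forall>i<Suc r. a i + (int (l i) - int (l (p i))) = 0)) = G l"
    if l: "l \<in> inj_funs n (Suc r)" for l
  proof -
    have pr: "p r = r" if "p permutes {0..<Suc r}" "\<forall>i<Suc r. a i + (int (l i) - int (l (p i))) = 0" for p
    proof -
      have "l (p r) = l r" using that(2)[rule_format, of r] assms by simp
      moreover have "p r \<in> {0..<Suc r}" using permutes_in_image[OF that(1), of r] by simp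
      ultimately show ?thesis using l by (auto simp: inj_funs_def inj_on_def)
    qed
    have "(\<Sum>p | p permutes {0..<Suc r}. signof p * of_bool (\<forall>i<Suc r. a i + (int (l i) - int (l (p i))) = 0))
      = (\<Sum>p | p permutes {0..<Suc r} \<and> p r = r. signof p * of_bool (\<forall>i<Suc r. a i + (int (l i) - int (l (p i))) = 0) :: complex)"
      using pr by (intro sum.mono_neutral_right) (auto simp: finite_permutations)
    also have "\<dots> = G l" unfolding G_def perm
      by (intro sum.cong refl) (use assms in \<open>auto simp: less_Suc_eq\<close>)
    finally show ?thesis .
  qed
  have Gr: "G (l'(r := x)) = G l'" for l' x
    unfolding G_def
  proof (intro sum.cong refl arg_cong2[of _ _ _ _ "(*)"] arg_cong[of _ _ of_bool] iff_allI imp_cong)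
    fix p i assume "p \<in> {p. p permutes {0..<r}}" "i < r"
    then have "p i < r" using permutes_in_image[of p "{0..<r}" i] by auto
    then show "(a i + (int ((l'(r := x)) i) - int ((l'(r := x)) (p i))) = 0) = (a i + (int (l' i) - int (l' (p i))) = 0)"
      using \<open>i < r\<close> by simp
  qed
  have "rho_coeff n (Suc r) a = (\<Sum>l\<in>inj_funs n (Suc r). G l)"
    unfolding rho_coeff_def by (intro sum.cong refl inner)
  also have "\<dots> = (\<Sum>(l', x)\<in>(SIGMA l':inj_funs n r. {..<n} - l' ` {0..<r}). G (l'(r := x)))"
  proof (rule sum.reindex_bij_witness[of _ "\<lambda>(l', x). l'(r := x)" "\<lambda>l. (restrict l {0..<r}, l r)"])
    fix l assume l: "l \<in> inj_funs n (Suc r)"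
    show eq: "(case (restrict l {0..<r}, l r) of (l', x) \<Rightarrow> l'(r := x)) = l"
      using l by (auto simp: inj_funs_def fun_eq_iff PiE_def extensional_def)
    show "(restrict l {0..<r}, l r) \<in> (SIGMA l':inj_funs n r. {..<n} - l' ` {0..<r})"
    proof -
      have "l r \<notin> l ` {0..<r}"
      proof
        assume "l r \<in> l ` {0..<r}"
        then obtain x where "x < r" "l r = l x" by auto
        then have "r = x" using l by (intro inj_onD[of l "{0..<Suc r}" r x]) (auto simp: inj_funs_def)
        with \<open>x < r\<close> show False by simp
      qed
      moreover have "restrict l {0..<r} ` {0..<r} = l ` {0..<r}" by auto
      moreover have "restrict l {0..<r} \<in> inj_funs n r" using l by (auto simp: inj_funs_def PiE_def Pi_def inj_on_def)
      moreover have "l r < n" using l by (auto simp: inj_funs_def)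
      ultimately show ?thesis by simp
    qed
    show "(case (restrict l {0..<r}, l r) of (l', x) \<Rightarrow> G (l'(r := x))) = G l" using eq by simp
  next
    fix b assume b: "b \<in> (SIGMA l':inj_funs n r. {..<n} - l' ` {0..<r})"
    obtain l' x where bx: "b = (l', x)" by (cases b)
    have l': "l' \<in> {0..<r} \<rightarrow>\<^sub>E {..<n}" "inj_on l' {0..<r}" and x: "x < n" "x \<notin> l' ` {0..<r}"
      using b by (simp_all add: bx inj_funs_def)
    have "restrict (l'(r := x)) {0..<r} = l'"
    proof
      fix i show "restrict (l'(r := x)) {0..<r} i = l' i" using PiE_arb[OF l'(1), of i] by (cases "i < r") auto
    qed
    then show "(restrict (case b of (l', x) \<Rightarrow> l'(r := x)) {0..<r}, (case b of (l', x) \<Rightarrow> l'(r := x)) r) = b"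
      by (simp add: bx)
    have S: "{0..<Suc r} = insert r {0..<r}" by auto
    have "l'(r := x) \<in> {0..<Suc r} \<rightarrow>\<^sub>E {..<n}" unfolding S using l'(1) x(1) by (simp add: PiE_fun_upd)
    moreover have "inj_on (l'(r := x)) {0..<Suc r}"
    proof -
      have "inj_on (l'(r := x)) {0..<r}" using l'(2) by (simp add: inj_on_def)
      moreover have "(l'(r := x)) ` {0..<r} = l' ` {0..<r}" by (intro image_cong) auto
      ultimately show ?thesis unfolding S inj_on_insert using x(2) by simp
    qed
    ultimately show "(case b of (l', x) \<Rightarrow> l'(r := x)) \<in> inj_funs n (Suc r)" by (simp add: bx inj_funs_def)
  qed
  also have "\<dots> = (\<Sum>l'\<in>inj_funs n r. \<Sum>x\<in>{..<n} - l' ` {0..<r}. G l')"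
    unfolding Gr by (subst sum.Sigma) auto
  also have "\<dots> = (\<Sum>l'\<in>inj_funs n r. of_nat (n - r) * G l')"
  proof (rule sum.cong[OF refl])
    fix l' assume "l' \<in> inj_funs n r"
    then have "card ({..<n} - l' ` {0..<r}) = n - r"
      by (subst card_Diff_subset) (auto simp: inj_funs_def card_image)
    then show "(\<Sum>x\<in>{..<n} - l' ` {0..<r}. G l') = of_nat (n - r) * G l'" by simp
  qed
  finally show ?thesis by (simp add: rho_coeff_def G_def sum_distrib_left)
qed

lemma rho_coeff_cong: "(\<And>i. i < r \<Longrightarrow> a i = b i) \<Longrightarrow> rho_coeff n r a = rho_coeff n r b"
  unfolding rho_coeff_def by (intro sum.cong refl arg_cong2[of _ _ _ _ "(*)"] arg_cong[of _ _ of_bool]) auto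

lemma rho_coeff_pad:
  assumes "\<And>i. i \<ge> r \<Longrightarrow> a i = 0"
  shows "r + k \<le> n \<Longrightarrow> fact (n - r - k) * rho_coeff n (r + k) a = fact (n - r) * rho_coeff n r a"
proof (induction k)
  case (Suc k)
  have f: "fact (n - r - k) = of_nat (n - (r + k)) * (fact (n - r - Suc k) :: complex)"
  proof -
    have "n - r - k = Suc (n - r - Suc k)" using Suc.prems by simp
    then show ?thesis by (metis diff_diff_left fact_Suc of_nat_mult of_nat_fact)
  qed
  have "fact (n - r - Suc k) * rho_coeff n (r + Suc k) a = fact (n - r - k) * rho_coeff n (r + k) a"
    using rho_coeff_Suc[of a "r + k" n] assms unfolding f by (simp add: mult_ac)
  then show ?case using Suc by simp
qed simp

text \<open>Padding the exponents with \<open>n - r\<close> zeros multiplies both sides by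
  \<open>fact (n - r)\<close>: on the left by \<open>dsum_zeros\<close>, on the right by integrating
  out the variables one at a time (\<open>rho_coeff_pad\<close>).\<close>

theorem haar_dsum:
  assumes H: "normalized_haar n M" and r: "length a = r" "r \<le> n"
  shows "(\<integral>U. dsum n (ev U) a {} \<partial>M) = (\<integral>t. (\<Prod>i<r. zc t i powi (a ! i)) * rho n r (zc t) \<partial>UP r)"
proof -
  define b where "b = a @ replicate (n - r) 0"
  define f where "f i = (if i < r then a ! i else 0)" for i
  have lb: "length b = n" and bn: "b ! i = f i" if "i < n" for i using r that by (auto simp: b_def nth_append f_def)
  have len: "length b = n" using r by (simp add: b_def)
  have "(\<integral>U. dsum n (ev U) b {} \<partial>M) = (\<integral>t. (\<Prod>i<n. zc t i powi (b ! i)) * rho n n (zc t) \<partial>UP n)"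
    using haar_dsum_full[OF H len] rho_full[OF zc_torus] by simp
  also have "\<dots> = rho_coeff n n (\<lambda>i. b ! i)" by (rule integral_monomial_rho)
  also have "\<dots> = rho_coeff n n f" using bn by (intro rho_coeff_cong)
  also have "\<dots> = fact (n - r) * rho_coeff n r f"
    using rho_coeff_pad[of r f "n - r" n] r by (simp add: f_def)
  also have "rho_coeff n r f = rho_coeff n r (\<lambda>i. a ! i)" by (intro rho_coeff_cong) (simp add: f_def)
  also have "\<dots> = (\<integral>t. (\<Prod>i<r. zc t i powi (a ! i)) * rho n r (zc t) \<partial>UP r)" by (rule integral_monomial_rho[symmetric])
  finally have "(\<integral>U. dsum n (ev U) b {} \<partial>M) = fact (n - r) * \<dots>" .
  moreover have "dsum n z b {} = fact (n - r) * dsum n z a {}" for z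
    unfolding b_def using r by (intro dsum_zeros) simp
  ultimately show ?thesis by simp
qed

section \<open>Correlation functions for Borel sets of angles\<close>

definition ang :: "complex mat \<Rightarrow> nat \<Rightarrow> real" where
  "ang U j = eigenangles U ! j"

lemma ev_ang: "ev U j = cis (ang U j)"
  by (simp add: ev_def ang_def)

lemma ang_range: "U \<in> unitary_group n \<Longrightarrow> j < n \<Longrightarrow> ang U j \<in> {0..<2*pi}"
  using eigenangles_props[of U n] nth_mem[of j "eigenangles U"] unfolding ang_def by blast

lemma measurable_rho: "(\<lambda>t. rho n r (zc t)) \<in> borel_measurable (UP r)"
  unfolding rho_expand[OF zc_torus] cis_power_int
  by (intro borel_measurable_sum borel_measurable_times borel_measurable_prod borel_measurable_cis borel_measurable_const measurable_UP_component) auto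

lemma bounded_rho: "\<exists>C. \<forall>t. norm (rho n r (zc t)) \<le> C"
proof (intro exI allI)
  fix t
  have sg: "norm (signof p :: complex) \<le> 1" for p :: "nat \<Rightarrow> nat" by (simp add: sign_def)
  show "norm (rho n r (zc t)) \<le> (\<Sum>l\<in>inj_funs n r. \<Sum>p | p permutes {0..<r}. 1)"
    unfolding rho_expand[OF zc_torus]
    by (intro sum_norm_le) (use sg in \<open>auto simp: norm_mult prod_norm[symmetric] norm_power_int\<close>)
qed

definition tuple_sum :: "nat \<Rightarrow> nat \<Rightarrow> complex mat \<Rightarrow> ((nat \<Rightarrow> real) \<Rightarrow> complex) \<Rightarrow> complex" where
  "tuple_sum n r U f = (\<Sum>us\<in>inj_lists n r. f (\<lambda>i\<in>{..<r}. ang U (us ! i)))"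

text \<open>The bounded test functions for which \<open>rho n r\<close> acts as the
  \<open>r\<close>-point correlation function. Measurability is part of the notion, so that the
  class is closed under linear combinations and bounded pointwise limits and can be enlarged from
  monomials to indicators of Borel sets.\<close>

definition corr_fun :: "nat \<Rightarrow> complex mat measure \<Rightarrow> nat \<Rightarrow> ((nat \<Rightarrow> real) \<Rightarrow> complex) \<Rightarrow> bool" where
  "corr_fun n M r f \<longleftrightarrow> f \<in> borel_measurable (UP r) \<and> (\<exists>B. \<forall>x. norm (f x) \<le> B) \<and> (\<lambda>U. tuple_sum n r U f) \<in> borel_measurable M \<and>
     (\<integral>U. tuple_sum n r U f \<partial>M) = (\<integral>t. f t * rho n r (zc t) \<partial>UP r)"

lemma norm_tuple_sum_le: "(\<And>x. norm (f x) \<le> B) \<Longrightarrow> norm (tuple_sum n r U f) \<le> real (card (inj_lists n r)) * B"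
  unfolding tuple_sum_def by (rule order_trans[OF norm_sum]) (rule sum_bounded_above, simp)

lemma corr_fun_integrable:
  assumes H: "normalized_haar n M" and c: "corr_fun n M r f"
  shows "integrable M (\<lambda>U. tuple_sum n r U f)" "integrable (UP r) (\<lambda>t. f t * rho n r (zc t))"
proof -
  interpret prob_space M using haarD[OF H] by simp
  obtain B where B: "\<And>x. norm (f x) \<le> B" using c by (auto simp: corr_fun_def)
  show "integrable M (\<lambda>U. tuple_sum n r U f)"
    using c by (intro integrable_const_bound[of _ "real (card (inj_lists n r)) * B"] AE_I2 norm_tuple_sum_le B) (auto simp: corr_fun_def)
  obtain C where C: "\<And>t. norm (rho n r (zc t)) \<le> C" using bounded_rho by blast
  show "integrable (UP r) (\<lambda>t. f t * rho n r (zc t))"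
  proof (rule integrable_UP_bounded)
    show "(\<lambda>t. f t * rho n r (zc t)) \<in> borel_measurable (UP r)"
      using c by (intro borel_measurable_times measurable_rho) (auto simp: corr_fun_def)
    show "norm (f t * rho n r (zc t)) \<le> B * C" for t
      unfolding norm_mult using B C by (intro mult_mono) (auto intro: order_trans[OF norm_ge_zero])
  qed
qed

lemma corr_fun_add:
  assumes H: "normalized_haar n M" and c: "corr_fun n M r f" "corr_fun n M r g"
  shows "corr_fun n M r (\<lambda>x. f x + g x)"
proof -
  obtain B B' where B: "\<And>x. norm (f x) \<le> B" "\<And>x. norm (g x) \<le> B'" using c by (auto simp: corr_fun_def)
  have t: "tuple_sum n r U (\<lambda>x. f x + g x) = tuple_sum n r U f + tuple_sum n r U g" for U
    by (simp add: tuple_sum_def sum.distrib)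
  have "norm (f x + g x) \<le> B + B'" for x using B by (intro norm_triangle_mono)
  then show ?thesis using c corr_fun_integrable[OF H c(1)] corr_fun_integrable[OF H c(2)]
    unfolding corr_fun_def t distrib_right by (auto intro!: borel_measurable_add)
qed

lemma corr_fun_scale:
  assumes H: "normalized_haar n M" and c: "corr_fun n M r f"
  shows "corr_fun n M r (\<lambda>x. k * f x)"
proof -
  obtain B where B: "\<And>x. norm (f x) \<le> B" using c by (auto simp: corr_fun_def)
  have t: "tuple_sum n r U (\<lambda>x. k * f x) = k * tuple_sum n r U f" for U
    by (simp add: tuple_sum_def sum_distrib_left)
  have "norm (k * f x) \<le> norm k * B" for x using B by (simp add: norm_mult mult_left_mono)
  then show ?thesis using c corr_fun_integrable[OF H c]
    unfolding corr_fun_def t mult.assoc by (auto intro!: borel_measurable_times)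
qed

lemma AE_UP: "AE t in UP r. \<forall>i<r. t i \<in> {0..<2*pi}"
proof -
  have "AE x in unif. x \<in> {0..<2*pi}"
    unfolding unif_def by (subst AE_density) (auto split: split_indicator)
  then have "\<forall>i\<in>{..<r}. AE t in UP r. t i \<in> {0..<2*pi}"
    unfolding UP_def using prob_space_unif by (intro ballI AE_PiM_component) auto
  then have "AE t in UP r. \<forall>i\<in>{..<r}. t i \<in> {0..<2*pi}" by (subst AE_finite_all) auto
  then show ?thesis by eventually_elim auto
qed

lemma corr_fun_cong:
  assumes H: "normalized_haar n M" and c: "corr_fun n M r f"
    and eq: "\<And>x. x \<in> extensional {..<r} \<Longrightarrow> (\<forall>i<r. x i \<in> {0..<2*pi}) \<Longrightarrow> f x = g x"
    and g: "g \<in> borel_measurable (UP r)" "\<And>x. norm (g x) \<le> B"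
  shows "corr_fun n M r g"
proof -
  have t: "tuple_sum n r U f = tuple_sum n r U g" if U: "U \<in> space M" for U
  proof -
    have "ang U (us ! i) \<in> {0..<2*pi}" if "us \<in> inj_lists n r" "i < r" for us i
    proof (rule ang_range[of _ n])
      show "U \<in> unitary_group n" using U haarD(2)[OF H] by simp
      have "us ! i \<in> set us" using that by (auto simp: inj_lists_def)
      moreover have "set us \<subseteq> {..<n}" using that by (simp add: inj_lists_def)
      ultimately show "us ! i < n" by blast
    qed
    then show ?thesis unfolding tuple_sum_def by (intro sum.cong refl eq) auto
  qed
  have ae: "AE t in UP r. f t * rho n r (zc t) = g t * rho n r (zc t)"
    using AE_UP AE_space
  proof eventually_elim
    case (elim t)
    then have "t \<in> extensional {..<r}" by (auto simp: UP_def space_PiM PiE_def)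
    then show ?case using eq elim by simp
  qed
  have "(\<integral>t. f t * rho n r (zc t) \<partial>UP r) = (\<integral>t. g t * rho n r (zc t) \<partial>UP r)"
    using c g by (intro integral_cong_AE ae borel_measurable_times measurable_rho) (auto simp: corr_fun_def)
  moreover have "(\<integral>U. tuple_sum n r U f \<partial>M) = (\<integral>U. tuple_sum n r U g \<partial>M)"
    using t by (intro Bochner_Integration.integral_cong) auto
  moreover have "(\<lambda>U. tuple_sum n r U g) \<in> borel_measurable M"
    using c t by (subst measurable_cong[where g = "\<lambda>U. tuple_sum n r U f"]) (auto simp: corr_fun_def)
  ultimately show ?thesis using c g unfolding corr_fun_def by auto
qed

lemma corr_fun_limit:
  assumes H: "normalized_haar n M" and c: "\<And>k. corr_fun n M r (F k)"
    and B: "\<And>k x. norm (F k x) \<le> B" and lim: "\<And>x. (\<lambda>k. F k x) \<longlonglongrightarrow> f x"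
  shows "corr_fun n M r f"
proof -
  interpret prob_space M using haarD[OF H] by simp
  interpret UP: prob_space "UP r" by (rule prob_space_UP)
  have fm: "f \<in> borel_measurable (UP r)"
    by (rule borel_measurable_LIMSEQ_metric[of F]) (use c lim in \<open>auto simp: corr_fun_def\<close>)
  have fB: "norm (f x) \<le> B" for x
    using tendsto_norm[OF lim[of x]] B by (intro LIMSEQ_le_const2[of "\<lambda>k. norm (F k x)"]) auto
  have tl: "(\<lambda>k. tuple_sum n r U (F k)) \<longlonglongrightarrow> tuple_sum n r U f" for U
    unfolding tuple_sum_def by (intro tendsto_sum lim)
  have tm: "(\<lambda>U. tuple_sum n r U f) \<in> borel_measurable M"
    by (rule borel_measurable_LIMSEQ_metric[of "\<lambda>k U. tuple_sum n r U (F k)"]) (use c tl in \<open>auto simp: corr_fun_def\<close>)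
  have l1: "(\<lambda>k. \<integral>U. tuple_sum n r U (F k) \<partial>M) \<longlonglongrightarrow> (\<integral>U. tuple_sum n r U f \<partial>M)"
    by (rule integral_dominated_convergence[where w = "\<lambda>_. real (card (inj_lists n r)) * B"])
       (use c tm tl norm_tuple_sum_le[OF B] in \<open>auto simp: corr_fun_def\<close>)
  obtain C where C: "\<And>t. norm (rho n r (zc t)) \<le> C" using bounded_rho by blast
  have l2: "(\<lambda>k. \<integral>t. F k t * rho n r (zc t) \<partial>UP r) \<longlonglongrightarrow> (\<integral>t. f t * rho n r (zc t) \<partial>UP r)"
  proof (rule integral_dominated_convergence[where w = "\<lambda>_. B * C"])
    show "AE x in UP r. norm (F k x * rho n r (zc x)) \<le> B * C" for k
      unfolding norm_mult using B C by (intro AE_I2 mult_mono) (auto intro: order_trans[OF norm_ge_zero])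
  qed (use c fm lim measurable_rho in \<open>auto simp: corr_fun_def intro!: borel_measurable_times tendsto_mult\<close>)
  have "(\<lambda>k. \<integral>U. tuple_sum n r U (F k) \<partial>M) = (\<lambda>k. \<integral>t. F k t * rho n r (zc t) \<partial>UP r)"
    using c by (auto simp: corr_fun_def)
  then have "(\<integral>U. tuple_sum n r U f \<partial>M) = (\<integral>t. f t * rho n r (zc t) \<partial>UP r)"
    using LIMSEQ_unique[OF l1] l2 by simp
  then show ?thesis using fm fB tm by (auto simp: corr_fun_def)
qed

lemma corr_fun_monomial:
  assumes H: "normalized_haar n M" and r: "r \<le> n"
  shows "corr_fun n M r (\<lambda>x. \<Prod>i<r. cis (x i) powi e i)"
proof -
  define a where "a = map e [0..<r]"
  have len: "length a = r" and ai: "i < r \<Longrightarrow> a ! i = e i" for i by (simp_all add: a_def)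
  have t: "tuple_sum n r U (\<lambda>x. \<Prod>i<r. cis (x i) powi e i) = dsum n (ev U) a {}" for U
    unfolding tuple_sum_def dsum_inj_lists len
    by (intro sum.cong prod.cong refl) (simp add: ai ev_ang)
  have "(\<lambda>x. \<Prod>i<r. cis (x i) powi e i) \<in> borel_measurable (UP r)"
    unfolding cis_power_int
    by (intro borel_measurable_prod borel_measurable_times borel_measurable_cis borel_measurable_const measurable_UP_component) auto
  moreover have "norm (\<Prod>i<r. cis (x i) powi e i) \<le> 1" for x :: "nat \<Rightarrow> real"
    unfolding prod_norm[symmetric] by (simp add: norm_power_int)
  moreover have "(\<Prod>i<r. zc t i powi (a ! i)) = (\<Prod>i<r. cis (t i) powi e i)" for t
    by (intro prod.cong refl) (simp add: ai)
  ultimately show ?thesis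
    using haar_dsum[OF H len r] integrable_dsum[OF H, of a] unfolding corr_fun_def t by auto
qed

inductive laurent :: "(complex \<Rightarrow> complex) \<Rightarrow> bool" where
  "laurent (\<lambda>z. c * z powi l)"
| "laurent f \<Longrightarrow> laurent g \<Longrightarrow> laurent (\<lambda>z. f z + g z)"

definition laurent_circle :: "(complex \<Rightarrow> complex) \<Rightarrow> bool" where
  "laurent_circle f \<longleftrightarrow> (\<exists>g. laurent g \<and> (\<forall>z. norm z = 1 \<longrightarrow> f z = g z))"

lemma laurent_circle_add: "laurent_circle f \<Longrightarrow> laurent_circle g \<Longrightarrow> laurent_circle (\<lambda>z. f z + g z)"
proof -
  assume "laurent_circle f" "laurent_circle g"
  then obtain f' g' where "laurent f'" "laurent g'" "\<forall>z. norm z = 1 \<longrightarrow> f z = f' z" "\<forall>z. norm z = 1 \<longrightarrow> g z = g' z"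
    by (auto simp: laurent_circle_def)
  then show ?thesis
    unfolding laurent_circle_def by (intro exI[of _ "\<lambda>z. f' z + g' z"]) (simp add: laurent.intros(2))
qed

lemma laurent_circle_mult:
  assumes "laurent_circle f" "laurent_circle g"
  shows "laurent_circle (\<lambda>z. f z * g z)"
proof -
  have 1: "laurent_circle (\<lambda>z. (c * z powi l) * g z)" if "laurent g" for c l g
    using that
  proof induction
    case (1 d m)
    show ?case unfolding laurent_circle_def
    proof (intro exI[of _ "\<lambda>z. (c * d) * z powi (l + m)"] conjI allI impI laurent.intros)
      fix z :: complex assume "norm z = 1"
      then have "z \<noteq> 0" by auto
      then show "c * z powi l * (d * z powi m) = c * d * z powi (l + m)" by (simp add: power_int_add)
    qed
  next
    case (2 f g)
    then show ?case using laurent_circle_add[OF 2(3,4)] by (simp add: distrib_left)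
  qed
  have 2: "laurent_circle (\<lambda>z. f z * g z)" if "laurent f" "laurent g" for f g
    using that(1)
  proof induction
    case (1 c l)
    then show ?case using 1 that(2) \<open>\<And>l g c. laurent g \<Longrightarrow> laurent_circle (\<lambda>z. c * z powi l * g z)\<close> by blast
  next
    case (2 f h)
    then show ?case using laurent_circle_add[OF 2(3,4)] by (simp add: distrib_right)
  qed
  from assms obtain f' g' where "laurent f'" "laurent g'" "\<forall>z. norm z = 1 \<longrightarrow> f z = f' z" "\<forall>z. norm z = 1 \<longrightarrow> g z = g' z"
    by (auto simp: laurent_circle_def)
  with 2[OF this(1,2)] show ?thesis by (auto simp: laurent_circle_def)
qed

lemma laurent_circle_cmult: "laurent_circle (\<lambda>z. c)" "laurent_circle (\<lambda>z. z)" "laurent_circle cnj"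
proof -
  show "laurent_circle (\<lambda>z. c)" unfolding laurent_circle_def using laurent.intros(1)[of c 0] by auto
  show "laurent_circle (\<lambda>z. z)" unfolding laurent_circle_def using laurent.intros(1)[of 1 1] by auto
  have "cnj z = 1 * z powi (-1)" if "norm z = 1" for z using cnj_powi_unit[OF that, of 1] by simp
  then show "laurent_circle cnj" unfolding laurent_circle_def using laurent.intros(1)[of 1 "-1"] by blast
qed

text \<open>A real linear functional on the plane is a complex combination of \<open>z\<close> and
  \<open>cnj z\<close>, and on the circle \<open>cnj z\<close> is the inverse of
  \<open>z\<close>.\<close>

lemma laurent_circle_real_polynomial:
  "real_polynomial_function p \<Longrightarrow> laurent_circle (\<lambda>z. of_real (p z))"
proof (induction rule: real_polynomial_function.induct)
  case (linear f)
  have "complex_of_real (f z) = of_real ((f 1)) * (1/2 * z + 1/2 * cnj z) + of_real (f \<i>) * (1/(2*\<i>) * z + (- (1/(2*\<i>))) * cnj z)" for z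
  proof -
    have "f z = f (Re z *\<^sub>R 1 + Im z *\<^sub>R \<i>)" by (rule arg_cong[of _ _ f]) (simp add: complex_eq_iff)
    also have "\<dots> = Re z * f 1 + Im z * f \<i>"
    proof -
      interpret bounded_linear f by fact
      show ?thesis by (simp only: add scaleR real_scaleR_def)
    qed
    finally have "complex_of_real (f z) = of_real (f 1) * of_real (Re z) + of_real (f \<i>) * of_real (Im z)" by simp
    moreover have "complex_of_real (Re z) = 1/2 * z + 1/2 * cnj z"
    proof -
      have "1/2 * z + 1/2 * cnj z = (z + cnj z) / 2" by (simp add: add_divide_distrib)
      then show ?thesis unfolding complex_add_cnj by simp
    qed
    moreover have "complex_of_real (Im z) = 1/(2*\<i>) * z + (- (1/(2*\<i>))) * cnj z"
    proof -
      have "k * z + (- k) * cnj z = k * (z - cnj z)" for k :: complex by (simp add: algebra_simps)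
      note this[of "1/(2*\<i>)" ]
      also have "1/(2*\<i>) * (z - cnj z) = complex_of_real (Im z)"
        unfolding complex_diff_cnj by (simp add: field_simps)
      finally show ?thesis by (rule sym)
    qed
    ultimately show ?thesis by (simp only:)
  qed
  then have "(\<lambda>z. complex_of_real (f z)) = (\<lambda>z. of_real ((f 1)) * (1/2 * z + 1/2 * cnj z) + of_real (f \<i>) * (1/(2*\<i>) * z + (- (1/(2*\<i>))) * cnj z))"
    by (intro ext)
  then show ?case by (rule ssubst) (intro laurent_circle_add laurent_circle_mult laurent_circle_cmult)
next
  case (const c) then show ?case by (rule laurent_circle_cmult)
next
  case (add f g) then show ?case using laurent_circle_add by simp
next
  case (mult f g) then show ?case using laurent_circle_mult by simp
qed

lemma sum_of_bool_disjoint: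
  assumes "disjoint_family A"
  shows "(\<Sum>i<(k::nat). of_bool (z \<in> A i)) = (of_bool (z \<in> (\<Union>i<k. A i)) :: complex)"
proof (induction k)
  case (Suc k)
  define X where "X = (\<Union>i<k. A i)"
  have e: "(\<Union>i<Suc k. A i) = X \<union> A k" unfolding X_def by (auto simp: less_Suc_eq)
  have "A i \<inter> A k = {}" if "i < k" for i using assms that unfolding disjoint_family_on_def by auto
  then have d: "z \<in> X \<Longrightarrow> z \<in> A k \<Longrightarrow> False" unfolding X_def by blast
  have "of_bool (z \<in> X) + of_bool (z \<in> A k) = (of_bool (z \<in> X \<union> A k) :: complex)"
    using d by (cases "z \<in> X"; cases "z \<in> A k") simp_all
  then show ?case unfolding e sum.lessThan_Suc Suc.IH X_def[symmetric] .
qed simp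

lemma LIMSEQ_of_bool_UN:
  "(\<lambda>k. of_bool (z \<in> (\<Union>i<k. A i))) \<longlonglongrightarrow> (of_bool (z \<in> \<Union> (range A)) :: complex)"
proof (cases "z \<in> \<Union> (range A)")
  case True
  then obtain i where i: "z \<in> A i" by auto
  have "eventually (\<lambda>k. of_bool (z \<in> (\<Union>i<k. A i)) = (of_bool (z \<in> \<Union> (range A)) :: complex)) sequentially"
    using i by (auto simp: eventually_sequentially intro!: exI[of _ "Suc i"])
  then show ?thesis by (rule tendsto_eventually)
next
  case False
  then show ?thesis by simp
qed

text \<open>A monotone class argument on the circle. Laurent polynomials approximate the continuous
  cutoffs \<open>h k\<close> uniformly by Stone-Weierstrass, the cutoffs increase to the indicator
  of an open set, and the open sets are an intersection-stable generator of the Borel sets.\<close>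

lemma borel_circle_class:
  fixes R :: "(complex \<Rightarrow> complex) \<Rightarrow> bool"
  assumes mono: "\<And>l. R (\<lambda>z. z powi l)"
    and add: "\<And>f g. R f \<Longrightarrow> R g \<Longrightarrow> R (\<lambda>z. f z + g z)" and scale: "\<And>f c. R f \<Longrightarrow> R (\<lambda>z. c * f z)"
    and lim: "\<And>F g B. (\<And>k. R (F k)) \<Longrightarrow> (\<And>k z. norm z = 1 \<Longrightarrow> norm (F k z) \<le> B) \<Longrightarrow>
        (\<And>z. norm z = 1 \<Longrightarrow> (\<lambda>k::nat. F k z) \<longlonglongrightarrow> g z) \<Longrightarrow> R g"
    and A: "A \<in> sets borel"
  shows "R (\<lambda>z. of_bool (z \<in> A))"
proof -
  have cong: "R g" if "R f" "\<And>z. norm z = 1 \<Longrightarrow> f z = g z" "\<And>z. norm z = 1 \<Longrightarrow> norm (f z) \<le> B" for f g B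
    using lim[of "\<lambda>_. f" B g] that by simp
  have lau: "R f" if "laurent f" for f using that by induction (auto intro: mono add scale)
  have open_case: "R (\<lambda>z. of_bool (z \<in> V))" if V: "open V" for V
  \<comment> \<open>The distance to an empty set is 0 by convention, so the cutoff
    \<open>h k\<close> would be 0 for the whole plane.\<close>
  proof (cases "V = UNIV")
    case True
    then show ?thesis using mono[of 0] by simp
  next
    case False
    define h where "h k z = min 1 (real k * infdist z (- V))" for k z
    have ex: "\<exists>g. laurent g \<and> (\<forall>z. norm z = 1 \<longrightarrow> norm (of_real (h k z) - g z) \<le> 1 / real (Suc k))" for k
    proof -
      have "continuous_on (sphere 0 1) (h k)" unfolding h_def by (intro continuous_intros)
      then obtain p where p: "real_polynomial_function p" "\<And>x. x \<in> sphere 0 1 \<Longrightarrow> \<bar>h k x - p x\<bar> < 1 / real (Suc k)"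
        using Stone_Weierstrass_real_polynomial_function[of "sphere 0 1" "h k" "1 / real (Suc k)"] by auto
      obtain g where g: "laurent g" "\<And>z. norm z = 1 \<Longrightarrow> of_real (p z) = g z"
        using laurent_circle_real_polynomial[OF p(1)] by (auto simp: laurent_circle_def)
      have "norm (of_real (h k z) - g z) \<le> 1 / real (Suc k)" if "norm z = 1" for z
      proof -
        have "norm (complex_of_real (h k z - p z)) < 1 / real (Suc k)" unfolding norm_of_real using p(2)[of z] that by simp
        then show ?thesis using g(2)[OF that] by simp
      qed
      then show ?thesis using g(1) by blast
    qed
    then obtain G where G: "\<And>k. laurent (G k)" "\<And>k z. norm z = 1 \<Longrightarrow> norm (of_real (h k z) - G k z) \<le> 1 / real (Suc k)"
      by metis
    have h01: "\<bar>h k z\<bar> \<le> 1" for k z by (simp add: h_def infdist_nonneg)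
    show ?thesis
    proof (rule lim[of G 2])
      fix k z assume z: "norm (z::complex) = 1"
      have "norm (G k z) \<le> norm (complex_of_real (h k z)) + norm (of_real (h k z) - G k z)"
        by (metis norm_triangle_sub norm_minus_commute add.commute)
      also have "\<dots> \<le> 1 + 1"
        using G(2)[OF z, of k] h01[of k z] by (intro add_mono) (auto intro: order_trans)
      finally show "norm (G k z) \<le> 2" by simp
    next
      fix z :: complex assume z: "norm z = 1"
      have hl: "(\<lambda>k. h k z) \<longlonglongrightarrow> of_bool (z \<in> V)"
      proof (cases "z \<in> V")
        case True
        have d: "infdist z (- V) > 0" using V False True by (subst infdist_pos_not_in_closed) (auto simp: closed_Compl)
        obtain K where K: "1 / infdist z (- V) < real K" using reals_Archimedean2 by blast
        have "h k z = 1" if "k \<ge> K" for k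
        proof -
          have "1 < real K * infdist z (- V)" using K d by (simp add: field_simps)
          also have "\<dots> \<le> real k * infdist z (- V)" using that d by (intro mult_right_mono) auto
          finally show ?thesis by (simp add: h_def)
        qed
        then have "eventually (\<lambda>k. h k z = of_bool (z \<in> V)) sequentially" using True by (auto simp: eventually_sequentially)
        then show ?thesis by (rule tendsto_eventually)
      next
        case F: False
        then show ?thesis by (simp add: h_def)
      qed
      have "(\<lambda>k. of_real (h k z) - G k z) \<longlonglongrightarrow> 0"
      proof (rule Lim_null_comparison)
        show "eventually (\<lambda>k. norm (of_real (h k z) - G k z) \<le> 1 / real (Suc k)) sequentially" using G(2)[OF z] by simp
        show "(\<lambda>k. 1 / real (Suc k)) \<longlonglongrightarrow> 0" using LIMSEQ_inverse_real_of_nat by (simp add: inverse_eq_divide)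
      qed
      from tendsto_diff[OF tendsto_of_real[OF hl] this] show "(\<lambda>k. G k z) \<longlonglongrightarrow> of_bool (z \<in> V)"
        by (cases "z \<in> V") simp_all
    qed (rule lau[OF G(1)])
  qed
  have "Int_stable {S :: complex set. open S}" "{S :: complex set. open S} \<subseteq> Pow UNIV" "A \<in> sigma_sets UNIV {S. open S}"
    using A by (auto simp: borel_def Int_stable_def)
  then show ?thesis
  proof (induction rule: sigma_sets_induct_disjoint)
    case (basic A) then show ?case using open_case by simp
  next
    case empty then show ?case using open_case[of "{}"] by simp
  next
    case (compl A)
    have "R (\<lambda>z. z powi 0 + (-1) * of_bool (z \<in> A))" by (intro add scale mono compl)
    then show ?case by (rule cong[where B = 2]) (auto simp: of_bool_def)
  next
    case (union A)
    show ?case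
    proof (rule lim[of "\<lambda>k z. \<Sum>i<k. of_bool (z \<in> A i)" 1])
      fix k
      show "R (\<lambda>z. \<Sum>i<k. of_bool (z \<in> A i))"
      proof (induction k)
        case 0 show ?case using open_case[of "{}"] by simp
      next
        case (Suc k) show ?case unfolding sum.lessThan_Suc by (intro add Suc union)
      qed
      show "norm (\<Sum>i<k. of_bool (z \<in> A i) :: complex) \<le> 1" for z
        unfolding sum_of_bool_disjoint[OF union(1)] by simp
    next
      show "(\<lambda>k. \<Sum>i<k. of_bool (z \<in> A i)) \<longlonglongrightarrow> (of_bool (z \<in> \<Union> (range A)) :: complex)" for z
        unfolding sum_of_bool_disjoint[OF union(1)] by (rule LIMSEQ_of_bool_UN)
    qed
  qed
qed

lemma Arg2pi_borel: "Arg2pi \<in> borel_measurable borel"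
proof -
  let ?A = "{z. Im z = 0} \<inter> {z. 0 \<le> Re z}"
  have c: "closed ?A" by (intro closed_Int closed_Collect_eq closed_Collect_le continuous_intros)
  have "(\<lambda>z. if z \<in> ?A then 0 else Arg2pi z) \<in> borel_measurable borel"
  proof (rule borel_measurable_continuous_on_if)
    show "?A \<in> sets borel" using c by simp
    show "continuous_on (- ?A) Arg2pi"
      by (intro continuous_at_imp_continuous_on ballI continuous_at_Arg2pi) (auto simp: complex_nonneg_Reals_iff)
  qed simp
  moreover have "(\<lambda>z. if z \<in> ?A then 0 else Arg2pi z) = Arg2pi"
    by (auto simp: fun_eq_iff Arg2pi_eq_0 complex_is_Real_iff)
  ultimately show ?thesis by simp
qed

lemma Arg2pi_cis: "t \<in> {0..<2*pi} \<Longrightarrow> Arg2pi (cis t) = t"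
  by (rule Arg2pi_unique[of 1]) (auto simp: cis_conv_exp)

text \<open>The coordinates are converted one at a time: the first \<open>k\<close> carry indicators
  and the others monomials with arbitrary exponents, which leaves room to treat coordinate
  \<open>k\<close> by \<open>borel_circle_class\<close>.\<close>

lemma corr_fun_box:
  assumes H: "normalized_haar n M" and r: "r \<le> n" and B: "\<And>i. i < r \<Longrightarrow> B i \<in> sets (borel :: complex measure)"
  shows "corr_fun n M r (\<lambda>x. \<Prod>i<r. of_bool (cis (x i) \<in> B i))"
proof -
  have "k \<le> r \<Longrightarrow> corr_fun n M r (\<lambda>x. (\<Prod>i<k. of_bool (cis (x i) \<in> B i)) * (\<Prod>i\<in>{k..<r}. cis (x i) powi e i))" for k e
  proof (induction k arbitrary: e)
    case 0
    then show ?case using corr_fun_monomial[OF H r, of e] by (simp add: lessThan_atLeast0)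
  next
    case (Suc k)
    let ?T = "\<lambda>x. (\<Prod>i<k. of_bool (cis (x i) \<in> B i)) * (\<Prod>i\<in>{Suc k..<r}. cis (x i) powi e i)"
    let ?R = "\<lambda>g. corr_fun n M r (\<lambda>x. g (cis (x k)) * ?T x)"
    have T1: "norm (?T x) \<le> 1" for x
      unfolding norm_mult prod_norm[symmetric] by (intro mult_le_one prod_le_1) (auto simp: norm_power_int prod_nonneg)
    have "?R (\<lambda>z. of_bool (z \<in> B k))"
    proof (rule borel_circle_class)
      fix l
      have "(\<Prod>i\<in>{k..<r}. cis (x i) powi (e(k := l)) i) = cis (x k) powi l * (\<Prod>i\<in>{Suc k..<r}. cis (x i) powi e i)" for x
        using Suc.prems by (subst prod.atLeast_Suc_lessThan) auto
      then show "?R (\<lambda>z. z powi l)" using Suc.IH[of "e(k := l)"] Suc.prems by (simp add: mult_ac)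
    next
      fix f g assume "?R f" "?R g"
      from corr_fun_add[OF H this] show "?R (\<lambda>z. f z + g z)" by (simp add: distrib_right)
    next
      fix f c assume "?R f"
      from corr_fun_scale[OF H this, of c] show "?R (\<lambda>z. c * f z)" by (simp add: mult.assoc)
    next
      fix F :: "nat \<Rightarrow> complex \<Rightarrow> complex" and g C assume F: "\<And>j. ?R (F j)" and C: "\<And>k z. norm z = 1 \<Longrightarrow> norm (F k z) \<le> C"
        and l: "\<And>z. norm z = 1 \<Longrightarrow> (\<lambda>k. F k z) \<longlonglongrightarrow> g z"
      show "?R g"
      proof (rule corr_fun_limit[OF H F])
        fix j x
        have "norm (F j (cis (x k)) * ?T x) \<le> C * 1"
          unfolding norm_mult[of "F j _"] using C[of "cis (x k)" j] T1 by (intro mult_mono) (auto intro: order_trans[OF norm_ge_zero])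
        then show "norm (F j (cis (x k)) * ?T x) \<le> C" by simp
        show "(\<lambda>j. F j (cis (x k)) * ?T x) \<longlonglongrightarrow> g (cis (x k)) * ?T x" by (intro tendsto_mult_right l) simp
      qed
    next
      show "B k \<in> sets borel" using B Suc.prems by simp
    qed
    then show ?case by (simp add: mult_ac)
  qed
  from this[of r "\<lambda>_. 0"] show ?thesis by simp
qed

lemma measurable_of_bool_UP:
  "A \<in> sets (UP r) \<Longrightarrow> (\<lambda>x. of_bool (x \<in> A) :: complex) \<in> borel_measurable (UP r)"
proof -
  assume "A \<in> sets (UP r)"
  then have "(\<lambda>x. indicator A x :: complex) \<in> borel_measurable (UP r)" by measurable
  moreover have "(\<lambda>x. indicator A x :: complex) = (\<lambda>x. of_bool (x \<in> A))" by (auto simp: indicator_def)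
  ultimately show ?thesis by simp
qed

text \<open>Dynkin's theorem over boxes. A box of angles becomes a product of Borel sets of the
  circle through \<open>Arg2pi\<close>, which inverts \<open>cis\<close> on the range of the angles;
  the two indicators agree where all coordinates are in that range.\<close>

lemma corr_fun_borel:
  assumes H: "normalized_haar n M" and r: "r \<le> n" and A: "A \<in> sets (UP r)"
  shows "corr_fun n M r (\<lambda>x. of_bool (x \<in> A))"
proof -
  let ?P = "prod_algebra {..<r} (\<lambda>_. borel :: real measure)"
  let ?sp = "\<Pi>\<^sub>E i\<in>{..<r}. space (borel :: real measure)"
  have sets: "sets (UP r) = sigma_sets ?sp ?P" unfolding sets_UP sets_PiM ..
  have "Int_stable ?P" "?P \<subseteq> Pow ?sp" "A \<in> sigma_sets ?sp ?P"
    using A unfolding sets by (auto simp: Int_stable_prod_algebra dest: prod_algebra_sets_into_space[THEN subsetD])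
  then show ?thesis
  proof (induction rule: sigma_sets_induct_disjoint)
    case (basic A)
    then obtain X where X: "A = (\<Pi>\<^sub>E i\<in>{..<r}. X i)" "X \<in> {..<r} \<rightarrow> sets borel"
      unfolding prod_algebra_eq_finite[OF finite_lessThan] by auto
    define B where "B i = Arg2pi -` X i" for i
    have B: "B i \<in> sets borel" if "i < r" for i
      using measurable_sets[OF Arg2pi_borel, of "X i"] X that by (auto simp: B_def)
    show ?case
    proof (rule corr_fun_cong[OF H corr_fun_box[OF H r B]])
      fix x :: "nat \<Rightarrow> real" assume x: "x \<in> extensional {..<r}" "\<forall>i<r. x i \<in> {0..<2*pi}"
      have "cis (x i) \<in> B i \<longleftrightarrow> x i \<in> X i" if "i < r" for i using x(2) Arg2pi_cis that by (simp add: B_def)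
      moreover have "(\<Prod>i<r. of_bool (Q i)) = (of_bool (\<forall>i<r. Q i) :: complex)" for Q by (induction r) (auto simp: less_Suc_eq)
      ultimately show "(\<Prod>i<r. of_bool (cis (x i) \<in> B i)) = (of_bool (x \<in> A) :: complex)"
        using x(1) by (simp add: X(1) PiE_def Pi_def)
    next
      show "(\<lambda>x. of_bool (x \<in> A) :: complex) \<in> borel_measurable (UP r)" by (rule measurable_of_bool_UP) (use basic in \<open>simp only: sets sigma_sets.Basic\<close>)
      show "norm (of_bool (x \<in> A) :: complex) \<le> 1" for x by simp
    qed auto
  next
    case empty
    show ?case using corr_fun_scale[OF H corr_fun_monomial[OF H r, of "\<lambda>_. 0"], of 0] by simp
  next
    case (compl A)
    have c: "corr_fun n M r (\<lambda>x. (\<Prod>i<r. cis (x i) powi 0) + (-1) * of_bool (x \<in> A))"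
      by (intro corr_fun_add[OF H] corr_fun_scale[OF H] compl corr_fun_monomial[OF H r])
    show ?case
    proof (rule corr_fun_cong[OF H c])
      show "(\<lambda>x. of_bool (x \<in> ?sp - A) :: complex) \<in> borel_measurable (UP r)"
        by (rule measurable_of_bool_UP) (use compl(1) in \<open>simp only: sets sigma_sets.Compl\<close>)
      show "norm (of_bool (x \<in> ?sp - A) :: complex) \<le> 1" for x by simp
    qed (auto simp: of_bool_def PiE_def)
  next
    case (union A)
    have s: "corr_fun n M r (\<lambda>x. \<Sum>i<k. of_bool (x \<in> A i))" for k
    proof (induction k)
      case 0
      show ?case using corr_fun_scale[OF H corr_fun_monomial[OF H r, of "\<lambda>_. 0"], of 0] by simp
    next
      case (Suc k)
      show ?case unfolding sum.lessThan_Suc by (intro corr_fun_add[OF H] Suc union)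
    qed
    show ?case
    proof (rule corr_fun_limit[OF H s])
      show "norm (\<Sum>i<k. of_bool (x \<in> A i) :: complex) \<le> 1" for k x
        unfolding sum_of_bool_disjoint[OF union(1)] by simp
      show "(\<lambda>k. \<Sum>i<k. of_bool (x \<in> A i)) \<longlonglongrightarrow> (of_bool (x \<in> \<Union> (range A)) :: complex)" for x
        unfolding sum_of_bool_disjoint[OF union(1)] by (rule LIMSEQ_of_bool_UN)
    qed
  qed
qed

definition tuple_count :: "nat \<Rightarrow> nat \<Rightarrow> (nat \<Rightarrow> real) set \<Rightarrow> complex mat \<Rightarrow> real" where
  "tuple_count n r A U = real (card {us \<in> inj_lists n r. (\<lambda>i\<in>{..<r}. ang U (us ! i)) \<in> A})"

theorem haar_correlation:
  assumes H: "normalized_haar n M" and r: "r \<le> n" and A: "A \<in> sets (UP r)"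
  shows "integrable M (tuple_count n r A)"
    and "(\<integral>U. tuple_count n r A U \<partial>M) = (\<integral>t. indicator A t * Re (rho n r (zc t)) \<partial>UP r)"
    and "integrable (UP r) (\<lambda>t. indicator A t * Re (rho n r (zc t)))"
proof -
  note c = corr_fun_borel[OF H r A]
  note i = corr_fun_integrable[OF H c]
  have t: "tuple_sum n r U (\<lambda>x. of_bool (x \<in> A)) = of_real (tuple_count n r A U)" for U
  proof -
    have "(\<Sum>us\<in>inj_lists n r. of_bool ((\<lambda>i\<in>{..<r}. ang U (us ! i)) \<in> A)) = (of_nat (card {us \<in> inj_lists n r. (\<lambda>i\<in>{..<r}. ang U (us ! i)) \<in> A}) :: complex)"
      by (simp add: sum_of_bool_eq Int_def)
    then show ?thesis by (simp add: tuple_sum_def tuple_count_def)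
  qed
  have e: "Re (of_bool (t \<in> A) * w) = indicator A t * Re w" for t w by (simp add: indicator_def)
  show "integrable M (tuple_count n r A)" using integrable_Re[OF i(1)] unfolding t by simp
  show "integrable (UP r) (\<lambda>t. indicator A t * Re (rho n r (zc t)))" using integrable_Re[OF i(2)] unfolding e .
  have "(\<integral>U. tuple_count n r A U \<partial>M) = Re (\<integral>U. tuple_sum n r U (\<lambda>x. of_bool (x \<in> A)) \<partial>M)"
    unfolding t by simp
  also have "\<dots> = Re (\<integral>t. of_bool (t \<in> A) * rho n r (zc t) \<partial>UP r)" using c by (simp add: corr_fun_def)
  also have "\<dots> = (\<integral>t. indicator A t * Re (rho n r (zc t)) \<partial>UP r)" unfolding integral_Re[OF i(2), symmetric] e ..
  finally show "(\<integral>U. tuple_count n r A U \<partial>M) = (\<integral>t. indicator A t * Re (rho n r (zc t)) \<partial>UP r)" .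
qed

subsection \<open>Bounds for the correlation determinants\<close>

lemma norm_cis_diff_le: "norm (cis a - cis b) \<le> \<bar>a - b\<bar>"
proof -
  have "cis a - cis b = cis b * (cis (a - b) - 1)" by (simp add: right_diff_distrib cis_mult)
  then have "norm (cis a - cis b) = norm (exp (\<i> * of_real (a - b)) - 1)" by (simp add: norm_mult cis_conv_exp)
  also have "\<dots> = 2 * \<bar>sin ((a - b) / 2)\<bar>" by (rule dist_exp_i_1)
  also have "\<dots> \<le> \<bar>a - b\<bar>" using abs_sin_x_le_abs_x[of "(a - b) / 2"] by simp
  finally show ?thesis .
qed

definition gram :: "nat \<Rightarrow> nat \<Rightarrow> (nat \<Rightarrow> nat \<Rightarrow> complex) \<Rightarrow> complex mat" where
  "gram n r \<phi> = mat r r (\<lambda>(i, j). \<Sum>l<n. \<phi> i l * cnj (\<phi> j l))"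

lemma rho_gram: "rho n r z = det (gram n r (\<lambda>i l. z i ^ l))"
  by (simp add: rho_def gram_def)

definition shear :: "(nat \<Rightarrow> nat option) \<Rightarrow> (nat \<Rightarrow> nat \<Rightarrow> complex) \<Rightarrow> nat \<Rightarrow> nat \<Rightarrow> complex" where
  "shear par \<phi> i l = (case par i of None \<Rightarrow> \<phi> i l | Some p \<Rightarrow> \<phi> i l - \<phi> p l)"

text \<open>Subtracting from each vector its parent is a unitriangular change of basis.\<close>

lemma det_gram_shear:
  assumes par: "\<And>i p. i < r \<Longrightarrow> par i = Some p \<Longrightarrow> p < i"
  shows "det (gram n r (shear par \<phi>)) = det (gram n r \<phi>)"
proof -
  define T :: "complex mat" where "T = mat r r (\<lambda>(i, j). of_bool (i = j) - of_bool (par i = Some j))"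
  have Tc: "T \<in> carrier_mat r r" by (simp add: T_def)
  have sh: "shear par \<phi> i l = (\<Sum>j<r. T $$ (i, j) * \<phi> j l)" if "i < r" for i l
  proof -
    have "(\<Sum>j<r. T $$ (i, j) * \<phi> j l) = (\<Sum>j<r. of_bool (i = j) * \<phi> j l) - (\<Sum>j<r. of_bool (par i = Some j) * \<phi> j l)"
      unfolding sum_subtractf[symmetric] by (intro sum.cong refl) (use that in \<open>auto simp: T_def left_diff_distrib\<close>)
    also have "(\<Sum>j<r. of_bool (i = j) * \<phi> j l) = \<phi> i l" using sum_of_bool_mult(1)[OF that] .
    also have "(\<Sum>j<r. of_bool (par i = Some j) * \<phi> j l) = (case par i of None \<Rightarrow> 0 | Some p \<Rightarrow> \<phi> p l)"
    proof (cases "par i")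
      case (Some p)
      then have "p < r" using par[OF that Some] that by simp
      then show ?thesis using sum_of_bool_mult(1)[of p r "\<lambda>j. \<phi> j l"] Some by simp
    qed simp
    finally show ?thesis by (simp add: shear_def split: option.split)
  qed
  define TH :: "complex mat" where "TH = mat r r (\<lambda>(i, j). cnj (T $$ (j, i)))"
  have THc: "TH \<in> carrier_mat r r" by (simp add: TH_def)
  have Gc: "gram n r \<psi> \<in> carrier_mat r r" for \<psi> by (simp add: gram_def)
  have "gram n r (shear par \<phi>) = T * (gram n r \<phi> * TH)"
  proof (rule eq_matI)
    fix i j assume "i < dim_row (T * (gram n r \<phi> * TH))" "j < dim_col (T * (gram n r \<phi> * TH))"
    then have ij: "i < r" "j < r" by (simp_all add: T_def TH_def gram_def)
    have "(T * (gram n r \<phi> * TH)) $$ (i, j) = (\<Sum>k<r. T $$ (i, k) * (\<Sum>m<r. (\<Sum>l<n. \<phi> k l * cnj (\<phi> m l)) * cnj (T $$ (j, m))))"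
      using ij Tc THc Gc mult_carrier_mat[OF Gc THc]
      by (simp add: mult_mat_index[of _ r r _ r]) (simp add: gram_def TH_def)
    also have "\<dots> = (\<Sum>k<r. \<Sum>m<r. \<Sum>l<n. (T $$ (i, k) * \<phi> k l) * cnj (T $$ (j, m) * \<phi> m l))"
      by (simp add: sum_distrib_left sum_distrib_right mult_ac)
    also have "\<dots> = (\<Sum>k<r. \<Sum>l<n. \<Sum>m<r. (T $$ (i, k) * \<phi> k l) * cnj (T $$ (j, m) * \<phi> m l))"
      by (rule sum.cong[OF refl], rule sum.swap)
    also have "\<dots> = (\<Sum>l<n. \<Sum>k<r. \<Sum>m<r. (T $$ (i, k) * \<phi> k l) * cnj (T $$ (j, m) * \<phi> m l))"
      by (rule sum.swap)
    also have "\<dots> = (\<Sum>l<n. shear par \<phi> i l * cnj (shear par \<phi> j l))"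
      unfolding sh[OF ij(1)] sh[OF ij(2)] cnj_sum sum_product ..
    finally show "gram n r (shear par \<phi>) $$ (i, j) = (T * (gram n r \<phi> * TH)) $$ (i, j)" using ij by (simp add: gram_def)
  qed (simp_all add: gram_def T_def TH_def)
  moreover have "det T = 1"
  proof -
    have "det T = prod_list (diag_mat T)"
    proof (rule det_lower_triangular[OF _ Tc])
      fix i j assume "i < j" "j < r"
      then show "T $$ (i, j) = 0" using par[of i j] by (auto simp: T_def)
    qed
    also have "diag_mat T = map (\<lambda>_. 1) [0..<r]"
    proof -
      have "T $$ (i, i) = 1" if "i < r" for i using par[OF that, of i] that by (auto simp: T_def)
      moreover have "dim_row T = r" by (simp add: T_def)
      ultimately show ?thesis unfolding diag_mat_def by (intro map_cong) auto
    qed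
    also have "prod_list (map (\<lambda>_. 1 :: complex) [0..<r]) = 1" by (simp add: map_replicate_const)
    finally show ?thesis .
  qed
  moreover have "det TH = 1"
  proof -
    have "det TH = det (transpose_mat TH)" using det_transpose[OF THc] by simp
    also have "\<dots> = prod_list (diag_mat (transpose_mat TH))"
    proof (rule det_lower_triangular)
      fix i j assume "i < j" "j < r"
      then show "transpose_mat TH $$ (i, j) = 0" using par[of i j] by (auto simp: TH_def T_def)
    qed (simp add: TH_def)
    also have "diag_mat (transpose_mat TH) = map (\<lambda>_. 1) [0..<r]"
    proof -
      have "TH $$ (i, i) = 1" if "i < r" for i using par[OF that, of i] that by (auto simp: TH_def T_def)
      moreover have "dim_row (transpose_mat TH) = r" "dim_col TH = r" "dim_row TH = r" by (simp_all add: TH_def)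
      ultimately show ?thesis unfolding diag_mat_def by (intro map_cong) auto
    qed
    also have "prod_list (map (\<lambda>_. 1 :: complex) [0..<r]) = 1" by (simp add: map_replicate_const)
    finally show ?thesis .
  qed
  ultimately show ?thesis
    using det_mult[OF Tc mult_carrier_mat[OF Gc THc]] det_mult[OF Gc THc] by simp
qed

text \<open>An upper bound for all entries of the sheared vector \<open>i\<close>
  (\<open>shear_le_wt\<close>): the \<open>l\<close>-th powers of two points differ by at most
  \<open>l < n\<close> times the difference of their angles.\<close>

definition wt :: "nat \<Rightarrow> (nat \<Rightarrow> nat option) \<Rightarrow> (nat \<Rightarrow> real) \<Rightarrow> nat \<Rightarrow> real" where
  "wt n par t i = (case par i of None \<Rightarrow> 1 | Some p \<Rightarrow> real n * \<bar>t i - t p\<bar>)"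

lemma wt_nonneg: "wt n par t i \<ge> 0"
  by (simp add: wt_def split: option.split)

lemma shear_le_wt:
  assumes "l < n"
  shows "norm (shear par (\<lambda>i l. zc t i ^ l) i l) \<le> wt n par t i"
proof (cases "par i")
  case None
  then show ?thesis by (simp add: shear_def wt_def norm_power)
next
  case (Some p)
  have "norm (zc t i ^ l - zc t p ^ l) \<le> \<bar>real l * t i - real l * t p\<bar>"
    unfolding Complex.DeMoivre by (rule norm_cis_diff_le)
  also have "\<dots> = real l * \<bar>t i - t p\<bar>" by (simp add: abs_mult flip: right_diff_distrib)
  also have "\<dots> \<le> real n * \<bar>t i - t p\<bar>" using assms by (intro mult_right_mono) auto
  finally show ?thesis using Some by (simp add: shear_def wt_def)
qed

lemma prod_permute_weights:
  fixes r :: nat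
  assumes "p permutes {0..<r}"
  shows "(\<Prod>i = 0..<r. w i * w (p i)) = (\<Prod>i<r. (w i)\<^sup>2 :: real)"
proof -
  have "(\<Prod>i = 0..<r. w (p i)) = (\<Prod>i = 0..<r. w i)" using prod.permute[OF assms, of w] by (simp add: o_def)
  then show ?thesis unfolding power2_eq_square prod.distrib lessThan_atLeast0 by (simp only:)
qed

lemma gram_entry_le:
  assumes "\<And>l. l < n \<Longrightarrow> norm (\<phi> i l) \<le> w i" "\<And>l. l < n \<Longrightarrow> norm (\<phi> j l) \<le> w j" "i < r" "j < r"
  shows "norm (gram n r \<phi> $$ (i, j)) \<le> real n * (w i * w j)"
proof -
  have "norm (\<Sum>l<n. \<phi> i l * cnj (\<phi> j l)) \<le> (\<Sum>l<n. w i * w j)"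
    using assms by (intro sum_norm_le) (auto simp: norm_mult intro!: mult_mono intro: order_trans[OF norm_ge_zero])
  then show ?thesis using assms by (simp add: gram_def)
qed

text \<open>Each term of the Leibniz formula uses every row and every column once, so the weights
  always multiply to the same product of squares.\<close>

lemma norm_det_le:
  fixes A :: "complex mat"
  assumes A: "A \<in> carrier_mat r r" and X: "X \<ge> 0" and w: "\<And>i. w i \<ge> 0"
    and le: "\<And>i j. i < r \<Longrightarrow> j < r \<Longrightarrow> norm (A $$ (i, j)) \<le> X * (w i * w j)"
  shows "norm (det A) \<le> fact r * (X ^ r * (\<Prod>i<r. (w i)\<^sup>2))"
proof -
  have "norm (det A) \<le> (\<Sum>p | p permutes {0..<r}. X ^ r * (\<Prod>i<r. (w i)\<^sup>2))"
    unfolding det_def'[OF A]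
  proof (rule sum_norm_le)
    fix p assume "p \<in> {p. p permutes {0..<r}}"
    then have p: "p permutes {0..<r}" by simp
    have "norm (signof p * (\<Prod>i = 0..<r. A $$ (i, p i))) = (\<Prod>i = 0..<r. norm (A $$ (i, p i)))"
      by (simp add: norm_mult prod_norm sign_def)
    also have "\<dots> \<le> (\<Prod>i = 0..<r. X * (w i * w (p i)))"
      using permutes_in_image[OF p] by (intro prod_mono conjI le) auto
    also have "\<dots> = X ^ r * (\<Prod>i<r. (w i)\<^sup>2)" by (simp add: prod.distrib[of "\<lambda>_. X"] prod_permute_weights[OF p])
    finally show "norm (signof p * (\<Prod>i = 0..<r. A $$ (i, p i))) \<le> X ^ r * (\<Prod>i<r. (w i)\<^sup>2)" .
  qed
  then show ?thesis using card_permutations[of "{0..<r}" r] by simp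
qed

text \<open>The clustering estimate: subtracting its parent makes a vector of size
  \<open>wt n par t i\<close>, and that size enters the Gram determinant twice, through a row and
  through a column.\<close>

theorem rho_bound:
  assumes par: "\<And>i p. i < r \<Longrightarrow> par i = Some p \<Longrightarrow> p < i"
  shows "norm (rho n r (zc t)) \<le> fact r * (real n ^ r * (\<Prod>i<r. (wt n par t i)\<^sup>2))"
proof -
  have "norm (det (gram n r (shear par (\<lambda>i l. zc t i ^ l)))) \<le> fact r * (real n ^ r * (\<Prod>i<r. (wt n par t i)\<^sup>2))"
  proof (rule norm_det_le)
    show "gram n r (shear par (\<lambda>i l. zc t i ^ l)) \<in> carrier_mat r r" by (simp add: gram_def)
    show "norm (gram n r (shear par (\<lambda>i l. zc t i ^ l)) $$ (i, j)) \<le> real n * (wt n par t i * wt n par t j)" if "i < r" "j < r" for i j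
      using that by (intro gram_entry_le shear_le_wt)
  qed (simp_all add: wt_nonneg)
  then show ?thesis unfolding rho_gram by (subst (asm) det_gram_shear[OF par])
qed

text \<open>A permutation that does not preserve the blocks leaves both of them, so it picks up two small entries.\<close>

lemma permutes_leaves_blocks:
  fixes m r :: nat
  assumes p: "p permutes {0..<m}" and i: "i < m" "(i < r) \<noteq> (p i < r)"
  shows "\<exists>j<m. j \<noteq> i \<and> (j < r) \<noteq> (p j < r)"
proof (rule ccontr)
  assume "\<not> ?thesis"
  then have j: "(j < r) = (p j < r)" if "j < m" "j \<noteq> i" for j using that by blast
  have inj: "inj_on p {0..<m}" using permutes_inj[OF p] by (rule inj_on_subset) auto
  have img: "p ` {0..<m} = {0..<m}" by (rule permutes_image[OF p])
  define B where "B = {j \<in> {0..<m}. j < r}"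
  define B' where "B' = {j \<in> {0..<m}. p j < r}"
  have "p ` B' = B" using img unfolding B_def B'_def by force
  moreover have "inj_on p B'" using inj by (rule inj_on_subset) (auto simp: B'_def)
  ultimately have c: "card B = card B'" using card_image by fastforce
  show False
  proof (cases "i < r")
    case True
    then have "B = insert i B'" using i j by (auto simp: B_def B'_def)
    moreover have "i \<notin> B'" "finite B'" using True i by (auto simp: B'_def)
    ultimately show False using c by simp
  next
    case False
    then have "B' = insert i B" using i j by (auto simp: B_def B'_def)
    moreover have "i \<notin> B" "finite B" using False by (auto simp: B_def)
    ultimately show False using c by simp
  qed
qed

text \<open>Passing to the block diagonal part discards only permutations that mix the blocks, and
  each of these uses an off-block entry in both directions. Hence the error is quadratic in
  \<open>e\<close>; this square is decisive for the final rate.\<close>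

lemma norm_det_block_diff:
  fixes A A0 :: "complex mat"
  assumes A: "A \<in> carrier_mat m m" "A0 \<in> carrier_mat m m" and X: "X \<ge> 0" and w: "\<And>i. w i \<ge> 0" and e: "0 \<le> e"
    and A0: "\<And>i j. i < m \<Longrightarrow> j < m \<Longrightarrow> A0 $$ (i, j) = (if (i < r) = (j < r) then A $$ (i, j) else 0)"
    and le: "\<And>i j. i < m \<Longrightarrow> j < m \<Longrightarrow> norm (A $$ (i, j)) \<le> X * (w i * w j)"
    and off: "\<And>i j. i < m \<Longrightarrow> j < m \<Longrightarrow> (i < r) \<noteq> (j < r) \<Longrightarrow> norm (A $$ (i, j)) \<le> e * (X * (w i * w j))"
  shows "norm (det A - det A0) \<le> fact m * (e\<^sup>2 * (X ^ m * (\<Prod>i<m. (w i)\<^sup>2)))"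
proof -
  let ?P = "X ^ m * (\<Prod>i<m. (w i)\<^sup>2)"
  have P0: "?P \<ge> 0" using X by (intro mult_nonneg_nonneg prod_nonneg) auto
  have "norm (det A - det A0) \<le> (\<Sum>p | p permutes {0..<m}. e\<^sup>2 * ?P)"
    unfolding det_def'[OF A(1)] det_def'[OF A(2)] sum_subtractf[symmetric]
  proof (rule sum_norm_le)
    fix p assume "p \<in> {p. p permutes {0..<m}}"
    then have p: "p permutes {0..<m}" by simp
    have pim: "p i < m" if "i < m" for i using permutes_in_image[OF p, of i] that by auto
    show "norm (signof p * (\<Prod>i = 0..<m. A $$ (i, p i)) - signof p * (\<Prod>i = 0..<m. A0 $$ (i, p i))) \<le> e\<^sup>2 * ?P"
    proof (cases "\<forall>i<m. (i < r) = (p i < r)")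
      case True
      then have "(\<Prod>i = 0..<m. A0 $$ (i, p i)) = (\<Prod>i = 0..<m. A $$ (i, p i))"
        using pim by (intro prod.cong refl) (auto simp: A0)
      then show ?thesis using P0 by simp
    next
      case False
      then obtain i where i: "i < m" "(i < r) \<noteq> (p i < r)" by auto
      obtain j where j: "j < m" "j \<noteq> i" "(j < r) \<noteq> (p j < r)" using permutes_leaves_blocks[OF p i] by auto
      have z: "(\<Prod>i = 0..<m. A0 $$ (i, p i)) = 0" using i pim by (intro prod_zero) (auto simp: A0 intro!: bexI[of _ i])
      have "norm (signof p * (\<Prod>i = 0..<m. A $$ (i, p i)) - signof p * (\<Prod>i = 0..<m. A0 $$ (i, p i))) = (\<Prod>i = 0..<m. norm (A $$ (i, p i)))"
        unfolding z by (simp add: norm_mult prod_norm sign_def)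
      also have "\<dots> \<le> (\<Prod>k = 0..<m. (if k = i then e else 1) * (if k = j then e else 1) * (X * (w k * w (p k))))"
        using i j pim le off by (intro prod_mono conjI) auto
      also have "\<dots> = (\<Prod>k = 0..<m. (if k = i then e else 1)) * (\<Prod>k = 0..<m. (if k = j then e else 1)) * (\<Prod>k = 0..<m. X * (w k * w (p k)))"
        by (simp only: prod.distrib)
      also have "\<dots> = e * e * (\<Prod>k = 0..<m. X * (w k * w (p k)))" using i j by (simp add: prod.delta)
      also have "\<dots> = e\<^sup>2 * ?P" by (simp add: prod.distrib[of "\<lambda>_. X"] prod_permute_weights[OF p] power2_eq_square)
      finally show ?thesis by simp
    qed
  qed
  then show ?thesis using card_permutations[of "{0..<m}" m] by simp
qed

section \<open>Decoupling of distant points\<close>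

lemma abel_geometric:
  fixes \<gamma> :: "nat \<Rightarrow> complex"
  assumes x: "norm x = 1" and B: "\<And>l. l < n \<Longrightarrow> norm (\<gamma> l) \<le> B" and V: "\<And>l. Suc l < n \<Longrightarrow> norm (\<gamma> (Suc l) - \<gamma> l) \<le> V / real n"
    and n: "n \<ge> 1" and V0: "V \<ge> 0"
  shows "norm (1 - x) * norm (\<Sum>l<n. x ^ l * \<gamma> l) \<le> 2 * B + V"
proof -
  obtain k where k: "n = Suc k" using n by (cases n) auto
  have id: "(1 - x) * (\<Sum>l<Suc k. x ^ l * \<gamma> l) = \<gamma> 0 - x ^ Suc k * \<gamma> k + (\<Sum>l<k. x ^ Suc l * (\<gamma> (Suc l) - \<gamma> l))" for k
  proof (induction k)
    case (Suc k)
    have "(1 - x) * (\<Sum>l<Suc (Suc k). x ^ l * \<gamma> l) = (1 - x) * (\<Sum>l<Suc k. x ^ l * \<gamma> l) + (1 - x) * (x ^ Suc k * \<gamma> (Suc k))"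
      by (simp only: sum.lessThan_Suc[of _ "Suc k"] distrib_left)
    also have "\<dots> = \<gamma> 0 - x ^ Suc k * \<gamma> k + (\<Sum>l<k. x ^ Suc l * (\<gamma> (Suc l) - \<gamma> l)) + (1 - x) * (x ^ Suc k * \<gamma> (Suc k))"
      by (simp only: Suc)
    also have "\<dots> = \<gamma> 0 - x ^ Suc (Suc k) * \<gamma> (Suc k) + (\<Sum>l<Suc k. x ^ Suc l * (\<gamma> (Suc l) - \<gamma> l))"
      by (simp add: algebra_simps)
    finally show ?case .
  qed (simp add: algebra_simps)
  have "norm (\<Sum>l<k. x ^ Suc l * (\<gamma> (Suc l) - \<gamma> l)) \<le> (\<Sum>l<k. V / real n)"
    using x V k by (intro sum_norm_le) (simp add: norm_mult norm_power)
  also have "\<dots> \<le> V" using V0 k by (simp add: field_simps)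
  finally have 1: "norm (\<Sum>l<k. x ^ Suc l * (\<gamma> (Suc l) - \<gamma> l)) \<le> V" .
  have "norm (\<gamma> 0 - x ^ Suc k * \<gamma> k) \<le> norm (\<gamma> 0) + norm (x ^ Suc k * \<gamma> k)" by (rule norm_triangle_ineq4)
  also have "\<dots> \<le> B + B" using B[of 0] B[of k] x k by (simp add: norm_mult norm_power)
  finally have 2: "norm (\<gamma> 0 - x ^ Suc k * \<gamma> k) \<le> 2 * B" by simp
  have "norm (1 - x) * norm (\<Sum>l<n. x ^ l * \<gamma> l) = norm (\<gamma> 0 - x ^ Suc k * \<gamma> k + (\<Sum>l<k. x ^ Suc l * (\<gamma> (Suc l) - \<gamma> l)))"
    unfolding k norm_mult[symmetric] id ..
  also have "\<dots> \<le> 2 * B + V" by (rule norm_triangle_mono[OF 2 1])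
  finally show ?thesis .
qed

text \<open>The point whose phase governs the oscillation of the sheared vector: the difference of
  two powers is the power of the parent times an amplitude that varies slowly in \<open>l\<close>
  (\<open>shear_factor\<close>).\<close>

definition anchor :: "(nat \<Rightarrow> nat option) \<Rightarrow> nat \<Rightarrow> nat" where
  "anchor par i = (case par i of None \<Rightarrow> i | Some p \<Rightarrow> p)"

lemma shear_factor:
  assumes "n \<ge> 1"
  obtains \<alpha> where "\<And>l. shear par (\<lambda>i l. zc t i ^ l) i l = zc t (anchor par i) ^ l * \<alpha> l"
    "\<And>l. norm (\<alpha> (Suc l) - \<alpha> l) \<le> (wt n par t i) / real n"
proof (cases "par i")
  case None
  show ?thesis
  proof (rule that[of "\<lambda>_. 1"])
    show "norm ((1::complex) - 1) \<le> wt n par t i / real n" using wt_nonneg[of n par t i] by simp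
  qed (simp add: shear_def anchor_def None)
next
  case (Some p)
  show ?thesis
  proof (rule that[of "\<lambda>l. cis (real l * (t i - t p)) - 1"])
    fix l
    show "shear par (\<lambda>i l. zc t i ^ l) i l = zc t (anchor par i) ^ l * (cis (real l * (t i - t p)) - 1)"
      by (simp add: shear_def anchor_def Some Complex.DeMoivre right_diff_distrib cis_mult)
    show "norm (cis (real (Suc l) * (t i - t p)) - 1 - (cis (real l * (t i - t p)) - 1)) \<le> wt n par t i / real n"
    proof -
      have "norm (cis (real (Suc l) * (t i - t p)) - cis (real l * (t i - t p))) \<le> \<bar>real (Suc l) * (t i - t p) - real l * (t i - t p)\<bar>"
        by (rule norm_cis_diff_le)
      also have "real (Suc l) * (t i - t p) - real l * (t i - t p) = t i - t p" by (simp add: algebra_simps)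
      finally show ?thesis using Some assms by (simp add: wt_def)
    qed
  qed
qed

text \<open>Summation by parts against the phase difference of the two anchors. The amplitudes are
  bounded by the product of the weights and have twice that total variation, so the constant is 2 +
  2 = 4.\<close>

lemma far_entry:
  assumes n: "n \<ge> 1" and d: "0 < \<delta>" "\<delta> \<le> norm (cis (t (anchor par i)) - cis (t (anchor par j)))"
  shows "norm (\<Sum>l<n. shear par (\<lambda>i l. zc t i ^ l) i l * cnj (shear par (\<lambda>i l. zc t i ^ l) j l)) \<le> 4 * (wt n par t i * wt n par t j) / \<delta>"
proof -
  let ?f = "\<lambda>i l. shear par (\<lambda>i l. zc t i ^ l) i l"
  let ?w = "wt n par t"
  obtain \<alpha> where a: "\<And>l. ?f i l = zc t (anchor par i) ^ l * \<alpha> l" "\<And>l. norm (\<alpha> (Suc l) - \<alpha> l) \<le> ?w i / real n"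
    by (rule shear_factor[OF n, of par t i]) blast
  obtain \<beta> where b: "\<And>l. ?f j l = zc t (anchor par j) ^ l * \<beta> l" "\<And>l. norm (\<beta> (Suc l) - \<beta> l) \<le> ?w j / real n"
    by (rule shear_factor[OF n, of par t j]) blast
  have na: "norm (\<alpha> l) \<le> ?w i" if "l < n" for l using shear_le_wt[OF that, of par t i] unfolding a by (simp add: norm_mult norm_power)
  have nb: "norm (\<beta> l) \<le> ?w j" if "l < n" for l using shear_le_wt[OF that, of par t j] unfolding b by (simp add: norm_mult norm_power)
  define x where "x = cis (t (anchor par i)) * cnj (cis (t (anchor par j)))"
  have x1: "norm x = 1" by (simp add: x_def norm_mult)
  have "norm (1 - x) = norm (cis (t (anchor par i)) - cis (t (anchor par j)))"
  proof -
    have "cis (t (anchor par i)) - cis (t (anchor par j)) = - cis (t (anchor par j)) * (1 - x)"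
      by (simp add: x_def right_diff_distrib cis_cnj cis_mult)
    then show ?thesis by (simp add: norm_mult)
  qed
  then have dx: "\<delta> \<le> norm (1 - x)" using d by simp
  have "norm (1 - x) * norm (\<Sum>l<n. x ^ l * (\<alpha> l * cnj (\<beta> l))) \<le> 2 * (?w i * ?w j) + 2 * (?w i * ?w j)"
  proof (rule abel_geometric[OF x1])
    show "norm (\<alpha> l * cnj (\<beta> l)) \<le> ?w i * ?w j" if "l < n" for l
      unfolding norm_mult complex_mod_cnj using na[OF that] nb[OF that] wt_nonneg by (intro mult_mono) auto
    show "norm (\<alpha> (Suc l) * cnj (\<beta> (Suc l)) - \<alpha> l * cnj (\<beta> l)) \<le> 2 * (?w i * ?w j) / real n" if l: "Suc l < n" for l
    proof -
      have "\<alpha> (Suc l) * cnj (\<beta> (Suc l)) - \<alpha> l * cnj (\<beta> l) = \<alpha> (Suc l) * cnj (\<beta> (Suc l) - \<beta> l) + (\<alpha> (Suc l) - \<alpha> l) * cnj (\<beta> l)"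
        by (simp add: algebra_simps)
      also have "norm \<dots> \<le> norm (\<alpha> (Suc l)) * norm (\<beta> (Suc l) - \<beta> l) + norm (\<alpha> (Suc l) - \<alpha> l) * norm (\<beta> l)"
        by (rule order_trans[OF norm_triangle_ineq]) (simp only: norm_mult complex_mod_cnj order_refl)
      also have "\<dots> \<le> ?w i * (?w j / real n) + ?w i / real n * ?w j"
        using na[OF l] nb[of l] a(2)[of l] b(2)[of l] l wt_nonneg by (intro add_mono mult_mono) auto
      finally show ?thesis by simp
    qed
  qed (use n wt_nonneg in auto)
  moreover have "(\<Sum>l<n. ?f i l * cnj (?f j l)) = (\<Sum>l<n. x ^ l * (\<alpha> l * cnj (\<beta> l)))"
    unfolding a b x_def by (intro sum.cong refl) (simp add: power_mult_distrib mult_ac)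
  ultimately have "norm (1 - x) * norm (\<Sum>l<n. ?f i l * cnj (?f j l)) \<le> 4 * (?w i * ?w j)" by simp
  moreover have "\<delta> * norm (\<Sum>l<n. ?f i l * cnj (?f j l)) \<le> norm (1 - x) * norm (\<Sum>l<n. ?f i l * cnj (?f j l))"
    using dx by (intro mult_right_mono) auto
  ultimately show ?thesis using d by (simp add: field_simps)
qed

text \<open>The last two points form a tree of their own. After shearing, every entry linking them
  to the others gains a factor \<open>4 / L\<close>, so the determinant is the product of the two
  block determinants up to the square of that factor.\<close>

theorem rho_split:
  assumes n: "n \<ge> 1" and L: "L > 0"
    and par: "\<And>i p. i < r \<Longrightarrow> par i = Some p \<Longrightarrow> p < i" "par r = None" "par (Suc r) = Some r"
    and far: "\<And>i. i < r \<Longrightarrow> L / real n \<le> norm (cis (t (anchor par i)) - cis (t r))"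
  shows "norm (rho n (Suc (Suc r)) (zc t) - rho n r (zc t) * rho n 2 (zc (\<lambda>i. t (r + i))))
    \<le> fact (Suc (Suc r)) * ((4 / L)\<^sup>2 * (real n ^ Suc (Suc r) * (\<Prod>i<Suc (Suc r). (wt n par t i)\<^sup>2)))"
proof -
  let ?m = "Suc (Suc r)"
  let ?f = "shear par (\<lambda>i l. zc t i ^ l)"
  have par': "p < i" if "i < ?m" "par i = Some p" for i p using par that by (auto simp: less_Suc_eq)
  define P where "P = gram n r ?f"
  define Q where "Q = gram n 2 (\<lambda>i. ?f (r + i))"
  define A where "A = gram n ?m ?f"
  define A0 where "A0 = four_block_mat P (0\<^sub>m r 2) (0\<^sub>m 2 r) Q"
  have carr: "P \<in> carrier_mat r r" "Q \<in> carrier_mat 2 2" "A \<in> carrier_mat ?m ?m"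
    by (simp_all add: P_def Q_def A_def gram_def)
  have A0c: "A0 \<in> carrier_mat ?m ?m" using four_block_carrier_mat[OF carr(1,2)] unfolding A0_def by simp
  have detA: "det A = rho n ?m (zc t)" unfolding A_def rho_gram by (rule det_gram_shear[OF par'])
  have detP: "det P = rho n r (zc t)" unfolding P_def rho_gram by (rule det_gram_shear[OF par(1)])
  have sh: "?f (r + i) l = shear (\<lambda>i. if i = 1 then Some 0 else None) (\<lambda>i l. zc t (r + i) ^ l) i l" if "i < 2" for i l
  proof -
    have "i = 0 \<or> i = 1" using that by auto
    then show ?thesis using par(2,3) by (elim disjE) (simp_all add: shear_def)
  qed
  have gQ: "gram n 2 (\<lambda>i. ?f (r + i)) = gram n 2 (shear (\<lambda>i. if i = 1 then Some 0 else None) (\<lambda>i l. zc t (r + i) ^ l))"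
    by (rule eq_matI) (simp_all add: gram_def sh)
  have detQ: "det Q = rho n 2 (zc (\<lambda>i. t (r + i)))"
    unfolding Q_def rho_gram gQ by (rule det_gram_shear) (simp split: if_splits)
  have detA0: "det A0 = rho n r (zc t) * rho n 2 (zc (\<lambda>i. t (r + i)))"
    unfolding A0_def detP[symmetric] detQ[symmetric] by (rule det_four_block_mat_lower_left_zero[OF carr(1) _ refl carr(2)]) simp
  have entry: "norm (A $$ (i, j)) \<le> (4 / L) * (real n * (wt n par t i * wt n par t j))"
    if ij: "i < ?m" "j < ?m" "i < r" "\<not> j < r" for i j
  proof -
    have "j = r \<or> j = Suc r" using ij by auto
    \<comment> \<open>Both new points have anchor \<open>r\<close>, so a single distance condition
      controls both of their columns.\<close>
    then have rj: "anchor par j = r" using par by (auto simp: anchor_def)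
    have Aij: "A $$ (i, j) = (\<Sum>l<n. ?f i l * cnj (?f j l))" using ij by (simp add: A_def gram_def)
    have "norm (A $$ (i, j)) \<le> 4 * (wt n par t i * wt n par t j) / (L / real n)"
      unfolding Aij by (rule far_entry[OF n]) (use L n far[OF ij(3)] rj in auto)
    then show ?thesis by (simp add: mult_ac)
  qed
  have sym: "norm (A $$ (i, j)) = norm (A $$ (j, i))" if "i < ?m" "j < ?m" for i j
  proof -
    have "A $$ (i, j) = (\<Sum>l<n. ?f i l * cnj (?f j l))" using that by (simp add: A_def gram_def)
    also have "\<dots> = cnj (\<Sum>l<n. ?f j l * cnj (?f i l))" unfolding cnj_sum by (rule sum.cong) (simp_all add: mult.commute)
    also have "(\<Sum>l<n. ?f j l * cnj (?f i l)) = A $$ (j, i)" using that by (simp add: A_def gram_def)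
    finally show ?thesis by (simp only: complex_mod_cnj)
  qed
  have "norm (det A - det A0) \<le> fact ?m * ((4 / L)\<^sup>2 * (real n ^ ?m * (\<Prod>i<?m. (wt n par t i)\<^sup>2)))"
  proof (rule norm_det_block_diff[where r = r, OF carr(3) A0c])
    fix i j assume ij: "i < ?m" "j < ?m"
    show "A0 $$ (i, j) = (if (i < r) = (j < r) then A $$ (i, j) else 0)"
      using ij by (auto simp: P_def Q_def gram_def A0_def A_def not_less)
    show "norm (A $$ (i, j)) \<le> real n * (wt n par t i * wt n par t j)"
      unfolding A_def using ij by (intro gram_entry_le shear_le_wt)
    assume "(i < r) \<noteq> (j < r)"
    then consider "i < r" "\<not> j < r" | "j < r" "\<not> i < r" by auto
    then show "norm (A $$ (i, j)) \<le> (4 / L) * (real n * (wt n par t i * wt n par t j))"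
    proof cases
      case 1
      then show ?thesis using entry[of i j] ij by simp
    next
      case 2
      then show ?thesis using entry[of j i] sym[OF ij] ij by (simp add: mult.commute[of "wt n par t j"])
    qed
  qed (use L wt_nonneg in auto)
  then show ?thesis unfolding detA detA0 .
qed

subsection \<open>Counting tuples of close pairs\<close>

datatype step = Pr | At nat

text \<open>A word (read from right to left) builds a tuple: \<open>Pr\<close> appends two new related entries,
  \<open>At p\<close> appends one new entry related to entry \<open>p\<close>.\<close>

fun wlen :: "step list \<Rightarrow> nat" where
  "wlen [] = 0"
| "wlen (Pr # w) = Suc (Suc (wlen w))"
| "wlen (At p # w) = Suc (wlen w)"

fun wrel :: "('v \<Rightarrow> 'v \<Rightarrow> bool) \<Rightarrow> step list \<Rightarrow> (nat \<Rightarrow> 'v) \<Rightarrow> bool" where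
  "wrel R [] f = True"
| "wrel R (Pr # w) f = (wrel R w f \<and> R (f (wlen w)) (f (Suc (wlen w))))"
| "wrel R (At p # w) f = (wrel R w f \<and> R (f p) (f (wlen w)))"

fun wvalid :: "step list \<Rightarrow> bool" where
  "wvalid [] = True"
| "wvalid (Pr # w) = wvalid w"
| "wvalid (At p # w) = (p < wlen w \<and> wvalid w)"

lemma wrel_cong: "wvalid w \<Longrightarrow> (\<And>i. i < wlen w \<Longrightarrow> f i = g i) \<Longrightarrow> wrel R w f = wrel R w g"
  by (induction w rule: wlen.induct) auto

definition wlists :: "nat \<Rightarrow> (nat \<Rightarrow> nat \<Rightarrow> bool) \<Rightarrow> step list \<Rightarrow> nat list set" where
  "wlists n R w = {us \<in> inj_lists n (wlen w). wrel R w (nth us)}"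

definition wcount :: "nat \<Rightarrow> (nat \<Rightarrow> nat \<Rightarrow> bool) \<Rightarrow> step list \<Rightarrow> real" where
  "wcount n R w = real (card (wlists n R w))"

definition opairs :: "nat \<Rightarrow> (nat \<Rightarrow> nat \<Rightarrow> bool) \<Rightarrow> (nat \<times> nat) set" where
  "opairs n R = {(i, j). i < n \<and> j < n \<and> i \<noteq> j \<and> R i j}"

lemma finite_wlists [simp]: "finite (wlists n R w)"
  unfolding wlists_def by (rule finite_subset[OF _ finite_inj_lists[of n "wlen w"]]) auto

lemma finite_opairs [simp]: "finite (opairs n R)"
  by (rule finite_subset[of _ "{..<n} \<times> {..<n}"]) (auto simp: opairs_def)

lemma wcount_nonneg [simp]: "wcount n R w \<ge> 0"
  by (simp add: wcount_def)

lemma card_opairs: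
  assumes sym: "\<And>i j. R i j \<Longrightarrow> R j i"
  shows "card (opairs n R) = 2 * card {{i, j} | i j. i < n \<and> j < n \<and> i \<noteq> j \<and> R i j}"
proof -
  let ?A = "{(i, j) \<in> opairs n R. i < j}" and ?B = "{(i, j) \<in> opairs n R. j < i}"
  have fin: "finite ?A" "finite ?B" by (auto intro: finite_subset[OF _ finite_opairs[of n R]])
  have un: "opairs n R = ?A \<union> ?B" by (auto simp: opairs_def)
  have "card (?A \<union> ?B) = card ?A + card ?B" using fin by (rule card_Un_disjoint) auto
  then have "card (opairs n R) = card ?A + card ?B" unfolding un[symmetric] .
  also have "card ?B = card ?A"
    by (rule bij_betw_same_card[of "\<lambda>(i, j). (j, i)"]) (rule bij_betwI[where g = "\<lambda>(i, j). (j, i)"], auto simp: opairs_def sym)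
  also have "card ?A = card {{i, j} | i j. i < n \<and> j < n \<and> i \<noteq> j \<and> R i j}"
  proof (rule bij_betw_same_card[of "\<lambda>(i, j). {i, j}"], rule bij_betw_imageI)
    show "inj_on (\<lambda>(i, j). {i, j}) ?A" by (auto simp: inj_on_def doubleton_eq_iff)
    show "(\<lambda>(i, j). {i, j}) ` ?A = {{i, j} | i j. i < n \<and> j < n \<and> i \<noteq> j \<and> R i j}"
    proof (intro equalityI subsetI)
      fix e assume "e \<in> {{i, j} | i j. i < n \<and> j < n \<and> i \<noteq> j \<and> R i j}"
      then obtain i j where e: "e = {i, j}" "i < n" "j < n" "i \<noteq> j" "R i j" by auto
      show "e \<in> (\<lambda>(i, j). {i, j}) ` ?A"
      proof (cases "i < j")
        case True
        then have "(i, j) \<in> ?A" using e by (simp add: opairs_def)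
        then show ?thesis using e(1) by (rule_tac rev_image_eqI) auto
      next
        case False
        then have "(j, i) \<in> ?A" using e sym[OF e(5)] by (simp add: opairs_def)
        then show ?thesis using e(1) by (rule_tac rev_image_eqI) auto
      qed
    qed (auto simp: opairs_def)
  qed
  finally show ?thesis by simp
qed

lemma wcount_Pr:
  assumes v: "wvalid w"
  shows "wcount n R (Pr # w) = (\<Sum>us\<in>wlists n R w. real (card {(i, j) \<in> opairs n R. i \<notin> set us \<and> j \<notin> set us}))"
proof -
  let ?S = "SIGMA us:wlists n R w. {(i, j) \<in> opairs n R. i \<notin> set us \<and> j \<notin> set us}"
  have "wlists n R (Pr # w) = (\<lambda>(us, (i, j)). us @ [i, j]) ` ?S"
  proof (intro equalityI subsetI)
    fix vs assume vs: "vs \<in> wlists n R (Pr # w)"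
    then have len: "length vs = Suc (Suc (wlen w))" by (simp add: wlists_def inj_lists_def)
    then obtain us i j where e: "vs = us @ [i, j]" "length us = wlen w"
      by (auto simp: length_Suc_conv_rev)
    have r: "wrel R w (nth vs) = wrel R w (nth us)" by (rule wrel_cong[OF v]) (simp add: e nth_append)
    have "us \<in> wlists n R w" "(i, j) \<in> opairs n R" "i \<notin> set us" "j \<notin> set us"
      using vs r e by (auto simp: wlists_def inj_lists_def opairs_def nth_append)
    then show "vs \<in> (\<lambda>(us, (i, j)). us @ [i, j]) ` ?S" unfolding e(1) by force
  next
    fix vs assume "vs \<in> (\<lambda>(us, (i, j)). us @ [i, j]) ` ?S"
    then obtain us i j where e: "vs = us @ [i, j]" "us \<in> wlists n R w" "(i, j) \<in> opairs n R" "i \<notin> set us" "j \<notin> set us" by auto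
    have len: "length us = wlen w" using e by (simp add: wlists_def inj_lists_def)
    have "wrel R w (nth vs) = wrel R w (nth us)" by (rule wrel_cong[OF v]) (simp add: e(1) nth_append len)
    then show "vs \<in> wlists n R (Pr # w)" using e len by (auto simp: wlists_def inj_lists_def opairs_def nth_append)
  qed
  moreover have "inj_on (\<lambda>(us, (i, j)). us @ [i, j]) ?S" by (auto simp: inj_on_def)
  ultimately have "card (wlists n R (Pr # w)) = card ?S" by (simp add: card_image)
  also have "\<dots> = (\<Sum>us\<in>wlists n R w. card {(i, j) \<in> opairs n R. i \<notin> set us \<and> j \<notin> set us})"
    by (rule card_SigmaI) (auto intro: finite_subset[OF _ finite_opairs[of n R]])
  finally show ?thesis by (simp add: wcount_def)
qed

lemma wcount_At:
  assumes v: "wvalid w" and p: "p < wlen w"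
  shows "wcount n R (At p # w) = (\<Sum>us\<in>wlists n R w. real (card {j. j < n \<and> j \<notin> set us \<and> R (us ! p) j}))"
proof -
  let ?S = "SIGMA us:wlists n R w. {j. j < n \<and> j \<notin> set us \<and> R (us ! p) j}"
  have "wlists n R (At p # w) = (\<lambda>(us, j). us @ [j]) ` ?S"
  proof (intro equalityI subsetI)
    fix vs assume vs: "vs \<in> wlists n R (At p # w)"
    then have len: "length vs = Suc (wlen w)" by (simp add: wlists_def inj_lists_def)
    then obtain us j where e: "vs = us @ [j]" "length us = wlen w" by (auto simp: length_Suc_conv_rev)
    have r: "wrel R w (nth vs) = wrel R w (nth us)" by (rule wrel_cong[OF v]) (simp add: e nth_append)
    have "us \<in> wlists n R w" "j < n" "j \<notin> set us" "R (us ! p) j"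
      using vs r e p by (auto simp: wlists_def inj_lists_def nth_append)
    then show "vs \<in> (\<lambda>(us, j). us @ [j]) ` ?S" unfolding e(1) by force
  next
    fix vs assume "vs \<in> (\<lambda>(us, j). us @ [j]) ` ?S"
    then obtain us j where e: "vs = us @ [j]" "us \<in> wlists n R w" "j < n" "j \<notin> set us" "R (us ! p) j" by auto
    have len: "length us = wlen w" using e by (simp add: wlists_def inj_lists_def)
    have "wrel R w (nth vs) = wrel R w (nth us)" by (rule wrel_cong[OF v]) (simp add: e(1) nth_append len)
    then show "vs \<in> wlists n R (At p # w)" using e len p by (auto simp: wlists_def inj_lists_def nth_append)
  qed
  moreover have "inj_on (\<lambda>(us, j). us @ [j]) ?S" by (auto simp: inj_on_def)
  ultimately have "card (wlists n R (At p # w)) = card ?S" by (simp add: card_image)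
  also have "\<dots> = (\<Sum>us\<in>wlists n R w. card {j. j < n \<and> j \<notin> set us \<and> R (us ! p) j})"
    by (rule card_SigmaI) auto
  finally show ?thesis by (simp add: wcount_def)
qed

text \<open>A related pair is disjoint from a given tuple, or meets it in one point, in one of two
  orders, and then extends the tuple by an \<open>At\<close> step, or lies inside the tuple, for
  which there are at most \<open>wlen w\<close> squared possibilities.\<close>

lemma opairs_wcount_le:
  assumes v: "wvalid w" and sym: "\<And>i j. R i j \<Longrightarrow> R j i"
  shows "real (card (opairs n R)) * wcount n R w \<le> wcount n R (Pr # w) + 2 * (\<Sum>p<wlen w. wcount n R (At p # w)) + (real (wlen w))\<^sup>2 * wcount n R w"
proof -
  have each: "real (card (opairs n R)) \<le> real (card {(i, j) \<in> opairs n R. i \<notin> set us \<and> j \<notin> set us})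
     + 2 * (\<Sum>p<wlen w. real (card {j. j < n \<and> j \<notin> set us \<and> R (us ! p) j})) + (real (wlen w))\<^sup>2" if us: "us \<in> wlists n R w" for us
  proof -
    have len: "length us = wlen w" using us by (simp add: wlists_def inj_lists_def)
    let ?O = "{(i, j) \<in> opairs n R. i \<notin> set us \<and> j \<notin> set us}"
    let ?D = "\<lambda>p. {j. j < n \<and> j \<notin> set us \<and> R (us ! p) j}"
    let ?X = "\<Union>p<wlen w. Pair (us ! p) ` ?D p" and ?Y = "\<Union>p<wlen w. (\<lambda>j. (j, us ! p)) ` ?D p"
    have "opairs n R \<subseteq> ?O \<union> ?X \<union> ?Y \<union> set us \<times> set us"
    proof
      fix e assume e: "e \<in> opairs n R"
      obtain i j where ij: "e = (i, j)" by (cases e)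
      show "e \<in> ?O \<union> ?X \<union> ?Y \<union> set us \<times> set us"
      proof (cases "i \<in> set us")
        case True
        then obtain p where "p < wlen w" "us ! p = i" using len by (auto simp: in_set_conv_nth)
        then show ?thesis using e ij by (cases "j \<in> set us") (auto simp: opairs_def True)
      next
        case F: False
        show ?thesis
        proof (cases "j \<in> set us")
          case True
          then obtain p where "p < wlen w" "us ! p = j" using len by (auto simp: in_set_conv_nth)
          then show ?thesis using e ij F sym[of i j] by (auto simp: opairs_def)
        qed (use e ij F in auto)
      qed
    qed
    then have "card (opairs n R) \<le> card (?O \<union> ?X \<union> ?Y \<union> set us \<times> set us)"
      by (intro card_mono) (auto intro: finite_subset[OF _ finite_opairs[of n R]])
    also have "\<dots> \<le> card ?O + card ?X + card ?Y + card (set us \<times> set us)"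
      by (meson card_Un_le add_le_mono le_trans order_refl)
    also have "\<dots> \<le> card ?O + (\<Sum>p<wlen w. card (?D p)) + (\<Sum>p<wlen w. card (?D p)) + wlen w * wlen w"
    proof (intro add_mono order_refl)
      show "card ?X \<le> (\<Sum>p<wlen w. card (?D p))"
        by (rule order_trans[OF card_UN_le]) (auto intro!: sum_mono card_image_le)
      show "card ?Y \<le> (\<Sum>p<wlen w. card (?D p))"
        by (rule order_trans[OF card_UN_le]) (auto intro!: sum_mono card_image_le)
      show "card (set us \<times> set us) \<le> wlen w * wlen w"
        unfolding card_cartesian_product using card_length[of us] len by (intro mult_mono) auto
    qed
    finally have "real (card (opairs n R)) \<le> real (card ?O + (\<Sum>p<wlen w. card (?D p)) + (\<Sum>p<wlen w. card (?D p)) + wlen w * wlen w)"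
      by (simp only: of_nat_le_iff)
    then show ?thesis by (simp add: power2_eq_square)
  qed
  have "real (card (opairs n R)) * wcount n R w = (\<Sum>us\<in>wlists n R w. real (card (opairs n R)))"
    by (simp add: wcount_def)
  also have "\<dots> \<le> (\<Sum>us\<in>wlists n R w. real (card {(i, j) \<in> opairs n R. i \<notin> set us \<and> j \<notin> set us})
     + 2 * (\<Sum>p<wlen w. real (card {j. j < n \<and> j \<notin> set us \<and> R (us ! p) j})) + (real (wlen w))\<^sup>2)"
    by (intro sum_mono each)
  also have "\<dots> = wcount n R (Pr # w) + 2 * (\<Sum>us\<in>wlists n R w. \<Sum>p<wlen w. real (card {j. j < n \<and> j \<notin> set us \<and> R (us ! p) j})) + (real (wlen w))\<^sup>2 * wcount n R w"
    unfolding wcount_Pr[OF v] sum.distrib sum_distrib_left[symmetric] by (simp add: wcount_def)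
  also have "(\<Sum>us\<in>wlists n R w. \<Sum>p<wlen w. real (card {j. j < n \<and> j \<notin> set us \<and> R (us ! p) j})) = (\<Sum>p<wlen w. wcount n R (At p # w))"
    by (subst sum.swap) (simp add: wcount_At[OF v])
  finally show ?thesis .
qed

lemma wlen_pairs [simp]: "wlen (replicate c Pr) = 2 * c" and wvalid_pairs [simp]: "wvalid (replicate c Pr)"
  by (induction c) auto

lemma wrel_pairs: "wrel R (replicate c Pr) f \<longleftrightarrow> (\<forall>l<c. R (f (2 * l)) (f (Suc (2 * l))))"
  by (induction c) (auto simp: less_Suc_eq)

definition partner :: "nat \<Rightarrow> nat" where
  "partner q = (if even q then Suc q else q - 1)"

lemma partner_less: "q < 2 * c \<Longrightarrow> partner q < 2 * c"
  by (auto simp: partner_def elim!: evenE)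

lemma pairs_partner:
  assumes sym: "\<And>i j. R i j \<Longrightarrow> R j i" and us: "us \<in> wlists n R (replicate c Pr)" and q: "q < 2 * c"
  shows "R (us ! partner q) (us ! q)"
proof -
  have r: "R (us ! (2 * l)) (us ! Suc (2 * l))" if "l < c" for l using us that by (simp add: wlists_def wrel_pairs)
  show ?thesis
  proof (cases "even q")
    case True
    then obtain l where "q = 2 * l" by (auto elim: evenE)
    then show ?thesis using sym[OF r[of l]] q by (simp add: partner_def)
  next
    case False
    then obtain l where "q = Suc (2 * l)" by (auto elim: oddE)
    then show ?thesis using r[of l] q by (simp add: partner_def)
  qed
qed

text \<open>Removing the pair containing position \<open>q\<close> leaves a path of length two and a shorter tuple of pairs.\<close>

lemma path_removal:
  assumes sym: "\<And>i j. R i j \<Longrightarrow> R j i" and q: "q < 2 * Suc c"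
  shows "(\<Sum>us\<in>wlists n R (replicate (Suc c) Pr). real (card {j. j < n \<and> j \<noteq> us ! q \<and> j \<noteq> us ! partner q \<and> R (us ! q) j}))
    \<le> wcount n R [At 1, Pr] * wcount n R (replicate c Pr)"
proof -
  let ?W = "wlists n R (replicate (Suc c) Pr)"
  let ?S = "SIGMA us:?W. {j. j < n \<and> j \<noteq> us ! q \<and> j \<noteq> us ! partner q \<and> R (us ! q) j}"
  define l where "l = q div 2"
  define rem where "rem us = take (2 * l) us @ drop (Suc (Suc (2 * l))) us" for us :: "nat list"
  have lc: "l < Suc c" using q by (auto simp: l_def)
  have ql: "(q = 2 * l \<and> partner q = Suc (2 * l)) \<or> (q = Suc (2 * l) \<and> partner q = 2 * l)"
    by (auto simp: l_def partner_def elim!: evenE oddE)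
  have usd: "us = take (2 * l) us @ [us ! (2 * l), us ! Suc (2 * l)] @ drop (Suc (Suc (2 * l))) us" if "us \<in> ?W" for us
  proof -
    have "length us = 2 * Suc c" using that by (simp add: wlists_def inj_lists_def)
    then show ?thesis using lc by (simp add: Cons_nth_drop_Suc)
  qed
  let ?f = "\<lambda>(us, j). ([us ! partner q, us ! q, j], rem us)"
  have "inj_on ?f ?S"
  proof (rule inj_onI)
    fix x y assume x: "x \<in> ?S" and y: "y \<in> ?S" and e: "?f x = ?f y"
    obtain us j where xd: "x = (us, j)" by (cases x)
    obtain vs k where yd: "y = (vs, k)" by (cases y)
    have len: "length us = 2 * Suc c" "length vs = 2 * Suc c" using x y by (simp_all add: xd yd wlists_def inj_lists_def)
    have r: "rem us = rem vs" "us ! partner q = vs ! partner q" "us ! q = vs ! q" "j = k" using e by (simp_all add: xd yd)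
    have "take (2 * l) us = take (2 * l) vs" "drop (Suc (Suc (2 * l))) us = drop (Suc (Suc (2 * l))) vs"
      using r(1) len lc by (auto simp: rem_def)
    moreover have "us ! (2 * l) = vs ! (2 * l)" "us ! Suc (2 * l) = vs ! Suc (2 * l)" using r ql by auto
    ultimately have "us = vs" using usd[of us] usd[of vs] x y by (simp add: xd yd)
    then show "x = y" using r by (simp add: xd yd)
  qed
  moreover have "?f ` ?S \<subseteq> wlists n R [At 1, Pr] \<times> wlists n R (replicate c Pr)"
  proof (rule image_subsetI)
    fix x assume x: "x \<in> ?S"
    obtain us j where xd: "x = (us, j)" by (cases x)
    have us: "us \<in> ?W" and j: "j < n" "j \<noteq> us ! q" "j \<noteq> us ! partner q" "R (us ! q) j" using x by (auto simp: xd)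
    have len: "length us = 2 * Suc c" "distinct us" "set us \<subseteq> {..<n}" using us by (auto simp: wlists_def inj_lists_def)
    have pq: "partner q < 2 * Suc c" "partner q \<noteq> q" using partner_less[OF q] ql by auto
    have "us ! q \<in> set us" "us ! partner q \<in> set us" using len(1) q pq by (simp_all add: nth_mem)
    then have mem: "us ! q < n" "us ! partner q < n" using len(3) by blast+
    have "us ! partner q \<noteq> us ! q" using len q pq by (simp add: nth_eq_iff_index_eq)
    then have 1: "[us ! partner q, us ! q, j] \<in> wlists n R [At 1, Pr]"
      using j mem pairs_partner[OF sym us q] by (auto simp: wlists_def inj_lists_def)
    have "distinct (take (2 * l) us @ [us ! (2 * l), us ! Suc (2 * l)] @ drop (Suc (Suc (2 * l))) us)"
      using len(2) arg_cong[OF usd[OF us], of distinct] by (rule iffD1[rotated])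
    then have d: "distinct (rem us)" unfolding rem_def distinct_append set_append by blast
    have s: "set (rem us) \<subseteq> {..<n}" using len(3) unfolding rem_def by (auto dest: in_set_takeD in_set_dropD)
    have lr: "length (rem us) = 2 * c" using len lc by (simp add: rem_def)
    have "R (rem us ! (2 * m)) (rem us ! Suc (2 * m))" if m: "m < c" for m
    proof (cases "m < l")
      case True
      then have "rem us ! (2 * m) = us ! (2 * m)" "rem us ! Suc (2 * m) = us ! Suc (2 * m)"
        using len lc by (auto simp: rem_def nth_append)
      then show ?thesis using us m by (simp add: wlists_def wrel_pairs)
    next
      case False
      have "length (take (2 * l) us) = 2 * l" using len lc by simp
      then have "rem us ! (2 * m) = us ! (2 * Suc m)" "rem us ! Suc (2 * m) = us ! Suc (2 * Suc m)"
        using False len lc m by (simp_all add: rem_def nth_append Suc_diff_le)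
      moreover have "\<forall>l<Suc c. R (us ! (2 * l)) (us ! Suc (2 * l))" using us unfolding wlists_def wrel_pairs by blast
      then have "R (us ! (2 * Suc m)) (us ! Suc (2 * Suc m))" using m by blast
      ultimately show ?thesis by simp
    qed
    then have "rem us \<in> wlists n R (replicate c Pr)" using d s lr by (simp add: wlists_def inj_lists_def wrel_pairs)
    with 1 show "?f x \<in> wlists n R [At 1, Pr] \<times> wlists n R (replicate c Pr)" by (simp add: xd)
  qed
  ultimately have "card ?S \<le> card (wlists n R [At 1, Pr] \<times> wlists n R (replicate c Pr))"
    by (rule card_inj_on_le) (intro finite_cartesian_product finite_wlists)
  moreover have "card ?S = (\<Sum>us\<in>?W. card {j. j < n \<and> j \<noteq> us ! q \<and> j \<noteq> us ! partner q \<and> R (us ! q) j})"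
    by (rule card_SigmaI) auto
  ultimately have "(\<Sum>us\<in>?W. card {j. j < n \<and> j \<noteq> us ! q \<and> j \<noteq> us ! partner q \<and> R (us ! q) j}) \<le> card (wlists n R [At 1, Pr]) * card (wlists n R (replicate c Pr))"
    by (simp add: card_cartesian_product)
  then have "real (\<Sum>us\<in>?W. card {j. j < n \<and> j \<noteq> us ! q \<and> j \<noteq> us ! partner q \<and> R (us ! q) j}) \<le> real (card (wlists n R [At 1, Pr]) * card (wlists n R (replicate c Pr)))"
    by (simp only: of_nat_le_iff)
  then show ?thesis by (simp add: wcount_def)
qed

subsection \<open>Moments of the Poisson distribution\<close>

text \<open>The Stirling recursion in a form that applies whenever multiplication sends
  \<open>a c\<close> to \<open>a (Suc c) + real c * a c\<close>: first for falling factorials, later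
  for rescaled counts of disjoint pairs.\<close>

lemma Stirling_sum_Suc:
  fixes a :: "nat \<Rightarrow> real"
  shows "(\<Sum>c\<le>Suc k. real (Stirling (Suc k) c) * a c) = (\<Sum>c\<le>k. real (Stirling k c) * (a (Suc c) + real c * a c))"
proof -
  \<comment> \<open>The added term is zero because \<open>Stirling k (Suc k)\<close> is.\<close>
  have "(\<Sum>c\<le>k. real (Stirling k c) * (real c * a c)) = (\<Sum>c\<le>Suc k. real (Stirling k c) * (real c * a c))" by simp
  also have "\<dots> = (\<Sum>c\<le>k. real (Stirling k (Suc c)) * (real (Suc c) * a (Suc c)))"
    unfolding sum.atMost_Suc_shift by simp
  finally have 1: "(\<Sum>c\<le>k. real (Stirling k c) * (real c * a c)) = (\<Sum>c\<le>k. real (Stirling k (Suc c)) * (real (Suc c) * a (Suc c)))" .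
  have "(\<Sum>c\<le>Suc k. real (Stirling (Suc k) c) * a c) = (\<Sum>c\<le>k. real (Stirling (Suc k) (Suc c)) * a (Suc c))"
    unfolding sum.atMost_Suc_shift by simp
  also have "\<dots> = (\<Sum>c\<le>k. real (Stirling k c) * a (Suc c)) + (\<Sum>c\<le>k. real (Stirling k (Suc c)) * (real (Suc c) * a (Suc c)))"
    unfolding sum.distrib[symmetric] by (rule sum.cong) (simp_all add: algebra_simps)
  finally show ?thesis unfolding 1[symmetric] sum.distrib[symmetric] by (simp add: distrib_left)
qed

lemma Stirling_ge_1: "1 \<le> c \<Longrightarrow> c \<le> k \<Longrightarrow> 1 \<le> Stirling k c"
proof (induction k arbitrary: c)
  case (Suc k)
  then obtain d where c: "c = Suc d" by (cases c) auto
  show ?case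
  proof (cases "c \<le> k")
    case True
    then have "1 \<le> Stirling k c" using Suc by simp
    then show ?thesis unfolding c by (simp add: trans_le_add1)
  next
    case False
    then have "c = Suc k" using Suc.prems by simp
    then show ?thesis by simp
  qed
qed simp

definition ffact :: "nat \<Rightarrow> nat \<Rightarrow> real" where
  "ffact c m = (\<Prod>i<c. real m - real i)"

lemma power_eq_sum_ffact: "real m ^ k = (\<Sum>c\<le>k. real (Stirling k c) * ffact c m)"
proof (induction k)
  case 0 show ?case by (simp add: ffact_def)
next
  case (Suc k)
  have "real m ^ Suc k = (\<Sum>c\<le>k. real (Stirling k c) * (real m * ffact c m))"
    unfolding power_Suc Suc sum_distrib_left by (rule sum.cong) (simp_all add: mult.left_commute)
  also have "\<dots> = (\<Sum>c\<le>k. real (Stirling k c) * (ffact (Suc c) m + real c * ffact c m))"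
    by (rule sum.cong) (simp_all add: ffact_def algebra_simps)
  finally show ?case unfolding Stirling_sum_Suc .
qed

text \<open>The factorial moments. The falling factorial of length \<open>Suc c\<close> vanishes at
  0, and shifting \<open>m\<close> by one cancels its leading factor against the factorial, at the
  price of one factor \<open>\<mu>\<close>.\<close>

lemma poisson_ffact_sums: "(\<lambda>m. ffact c m * (\<mu> ^ m / fact m * exp (-\<mu>))) sums \<mu> ^ c"
proof (induction c)
  case 0
  have "(\<lambda>m. \<mu> ^ m / fact m) sums exp \<mu>" using exp_converges[of \<mu>] by (simp add: field_simps)
  from sums_mult2[OF this, of "exp (-\<mu>)"] show ?case by (simp add: ffact_def exp_minus)
next
  case (Suc c)
  have s: "ffact (Suc c) (Suc m) * (\<mu> ^ Suc m / fact (Suc m) * exp (-\<mu>)) = \<mu> * (ffact c m * (\<mu> ^ m / fact m * exp (-\<mu>)))" for m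
  proof -
    have "ffact (Suc c) (Suc m) = real (Suc m) * ffact c m" unfolding ffact_def prod.lessThan_Suc_shift by simp
    then show ?thesis unfolding fact_Suc by (simp add: field_simps del: of_nat_Suc)
  qed
  have "(\<lambda>m. ffact (Suc c) (Suc m) * (\<mu> ^ Suc m / fact (Suc m) * exp (-\<mu>))) sums (\<mu> * \<mu> ^ c)"
    unfolding s by (rule sums_mult[OF Suc])
  then have "(\<lambda>m. ffact (Suc c) m * (\<mu> ^ m / fact m * exp (-\<mu>))) sums (\<mu> * \<mu> ^ c + ffact (Suc c) 0 * (\<mu> ^ 0 / fact 0 * exp (-\<mu>)))"
    by (rule sums_Suc)
  moreover have "ffact (Suc c) 0 = 0" unfolding ffact_def prod.lessThan_Suc_shift by simp
  ultimately show ?case by simp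
qed

lemma poisson_moment:
  assumes "\<mu> > 0"
  shows "measure_pmf.expectation (poisson_pmf \<mu>) (\<lambda>m. real m ^ k) = (\<Sum>c\<le>k. real (Stirling k c) * \<mu> ^ c)"
proof -
  let ?f = "\<lambda>m. real m ^ k * (\<mu> ^ m / fact m * exp (-\<mu>))"
  have "(\<lambda>m. \<Sum>c\<le>k. real (Stirling k c) * (ffact c m * (\<mu> ^ m / fact m * exp (-\<mu>)))) sums (\<Sum>c\<le>k. real (Stirling k c) * \<mu> ^ c)"
    by (intro sums_sum sums_mult poisson_ffact_sums)
  then have s: "?f sums (\<Sum>c\<le>k. real (Stirling k c) * \<mu> ^ c)"
    unfolding power_eq_sum_ffact sum_distrib_right mult.assoc .
  have "summable (\<lambda>m. norm (?f m))" using s assms by (simp add: sums_iff)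
  then have "integrable (count_space UNIV) ?f" by (simp only: integrable_count_space_nat_iff)
  then have "integral\<^sup>L (count_space UNIV) ?f = (\<Sum>c\<le>k. real (Stirling k c) * \<mu> ^ c)"
    using s by (simp add: integral_count_space_nat sums_iff)
  moreover have "measure_pmf.expectation (poisson_pmf \<mu>) (\<lambda>m. real m ^ k) = integral\<^sup>L (count_space UNIV) ?f"
    unfolding measure_pmf_eq_density
    by (subst integral_density) (simp_all add: assms less_imp_le mult.commute AE_count_space)
  ultimately show ?thesis by simp
qed

text \<open>This converts absolute into relative errors: an error that is bounded by powers of
  \<open>\<mu>\<close> with exponents from 1 to \<open>k\<close> is small relative to the moment,
  whatever the size of \<open>\<mu>\<close>.\<close>

lemma poisson_moment_ge:
  assumes "\<mu> > 0" "k \<ge> 1"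
  shows "(\<Sum>c=1..k. \<mu> ^ c) \<le> measure_pmf.expectation (poisson_pmf \<mu>) (\<lambda>m. real m ^ k)"
proof -
  have "(\<Sum>c=1..k. \<mu> ^ c) \<le> (\<Sum>c=1..k. real (Stirling k c) * \<mu> ^ c)"
  proof (intro sum_mono)
    fix c assume "c \<in> {1..k}"
    then have "1 \<le> Stirling k c" using Stirling_ge_1[of c k] by simp
    then have "1 * \<mu> ^ c \<le> real (Stirling k c) * \<mu> ^ c" using assms(1) by (intro mult_right_mono) auto
    then show "\<mu> ^ c \<le> real (Stirling k c) * \<mu> ^ c" by simp
  qed
  also have "\<dots> \<le> (\<Sum>c\<le>k. real (Stirling k c) * \<mu> ^ c)"
    using assms by (intro sum_mono2) auto
  finally show ?thesis unfolding poisson_moment[OF assms(1)] .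
qed

section \<open>Powers of the number of close pairs\<close>

lemma partner_partner [simp]: "partner (partner q) = q"
  by (auto simp: partner_def)

text \<open>A related ordered pair is disjoint from the tuple, or is one of its \<open>c\<close>
  pairs in one of two orders, or joins a point of the tuple to a point other than its partner. The
  last kind is counted from both of its ends, which gives the factor 2.\<close>

lemma touching_pairs:
  assumes sym: "\<And>i j. R i j \<Longrightarrow> R j i" and us: "us \<in> wlists n R (replicate c Pr)"
  defines "P \<equiv> {(i, j) \<in> opairs n R. i \<notin> set us \<and> j \<notin> set us}"
  defines "D \<equiv> \<lambda>q. {j. j < n \<and> j \<noteq> us ! q \<and> j \<noteq> us ! partner q \<and> R (us ! q) j}"
  shows "card P + 2 * c \<le> card (opairs n R)"
    and "card (opairs n R) \<le> card P + 2 * c + 2 * (\<Sum>q<2 * c. card (D q))"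
proof -
  have len: "length us = 2 * c" "distinct us" "set us \<subseteq> {..<n}" using us by (auto simp: wlists_def inj_lists_def)
  let ?m = "\<lambda>q. (us ! q, us ! partner q)"
  let ?M = "?m ` {..<2 * c}"
  have finP: "finite P" unfolding P_def by (rule finite_subset[OF _ finite_opairs[of n R]]) auto
  have "inj_on ?m {..<2 * c}" using len by (auto simp: inj_on_def nth_eq_iff_index_eq)
  then have cM: "card ?M = 2 * c" by (simp add: card_image)
  have mem: "us ! q < n" "us ! q \<in> set us" if "q < 2 * c" for q
  proof -
    show "us ! q \<in> set us" using that len(1) by (simp add: nth_mem)
    then show "us ! q < n" using len(3) by blast
  qed
  have ne: "us ! q \<noteq> us ! partner q" if "q < 2 * c" for q
  proof -
    have "q \<noteq> partner q" by (cases q) (auto simp: partner_def)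
    then show ?thesis using that partner_less[OF that] len by (simp add: nth_eq_iff_index_eq)
  qed
  have Msub: "?M \<subseteq> opairs n R"
  proof (rule image_subsetI)
    fix q assume "q \<in> {..<2 * c}"
    then have q: "q < 2 * c" by simp
    show "?m q \<in> opairs n R"
      using mem[OF q] mem[OF partner_less[OF q]] ne[OF q] sym[OF pairs_partner[OF sym us q]] by (simp add: opairs_def)
  qed
  have "P \<inter> ?M = {}" using mem by (auto simp: P_def)
  then have cPM: "card (P \<union> ?M) = card P + 2 * c" using finP cM by (subst card_Un_disjoint) auto
  have "P \<union> ?M \<subseteq> opairs n R" using Msub by (auto simp: P_def)
  from card_mono[OF finite_opairs this] show "card P + 2 * c \<le> card (opairs n R)" by (simp add: cPM)
  let ?X = "\<Union>q<2 * c. Pair (us ! q) ` D q" and ?Y = "\<Union>q<2 * c. (\<lambda>j. (j, us ! q)) ` D q"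
  have finD: "finite (D q)" for q by (simp add: D_def)
  have "opairs n R \<subseteq> P \<union> ?M \<union> ?X \<union> ?Y"
  proof
    fix e assume e: "e \<in> opairs n R"
    obtain i j where ij: "e = (i, j)" by (cases e)
    have r: "i < n" "j < n" "i \<noteq> j" "R i j" using e ij by (simp_all add: opairs_def)
    note r = r sym[OF r(4)]
    consider (a) "i \<in> set us" | (b) "j \<in> set us" | (c) "i \<notin> set us" "j \<notin> set us" by blast
    then show "e \<in> P \<union> ?M \<union> ?X \<union> ?Y"
    proof cases
      case a
      then obtain q where q: "q < 2 * c" "us ! q = i" using len by (auto simp: in_set_conv_nth)
      show ?thesis
      proof (cases "j = us ! partner q")
        case True
        then have "e = ?m q" using q ij by simp
        then show ?thesis using q by blast
      next
        case False
        then have "j \<in> D q" using r q by (auto simp: D_def)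
        then have "e \<in> Pair (us ! q) ` D q" using q ij by simp
        then show ?thesis using q by blast
      qed
    next
      case b
      then obtain q where q: "q < 2 * c" "us ! q = j" using len by (auto simp: in_set_conv_nth)
      show ?thesis
      proof (cases "i = us ! partner q")
        case True
        then have "e = ?m (partner q)" using q ij by simp
        then show ?thesis using partner_less[OF q(1)] by blast
      next
        case False
        then have "i \<in> D q" using r q by (auto simp: D_def)
        then have "e \<in> (\<lambda>j. (j, us ! q)) ` D q" using q ij by simp
        then show ?thesis using q by blast
      qed
    next
      case c
      then show ?thesis using e ij by (simp add: P_def)
    qed
  qed
  then have "card (opairs n R) \<le> card (P \<union> ?M \<union> ?X \<union> ?Y)"
    using finP finD by (intro card_mono) auto
  also have "\<dots> \<le> card (P \<union> ?M) + card ?X + card ?Y"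
    by (meson card_Un_le add_le_mono le_trans order_refl)
  also have "\<dots> \<le> card P + 2 * c + (\<Sum>q<2 * c. card (D q)) + (\<Sum>q<2 * c. card (D q))"
  proof (intro add_mono order_refl)
    show "card (P \<union> ?M) \<le> card P + 2 * c" by (simp add: cPM)
    show "card ?X \<le> (\<Sum>q<2 * c. card (D q))"
      by (rule order_trans[OF card_UN_le]) (auto intro!: sum_mono card_image_le finD)
    show "card ?Y \<le> (\<Sum>q<2 * c. card (D q))"
      by (rule order_trans[OF card_UN_le]) (auto intro!: sum_mono card_image_le finD)
  qed
  finally show "card (opairs n R) \<le> card P + 2 * c + 2 * (\<Sum>q<2 * c. card (D q))" by simp
qed

lemma pairs_mult_lower:
  assumes sym: "\<And>i j. R i j \<Longrightarrow> R j i"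
  shows "wcount n R (replicate (Suc c) Pr) + 2 * real c * wcount n R (replicate c Pr)
    \<le> real (card (opairs n R)) * wcount n R (replicate c Pr)"
proof -
  let ?W = "wlists n R (replicate c Pr)"
  have "wcount n R (replicate (Suc c) Pr) + 2 * real c * wcount n R (replicate c Pr)
    = (\<Sum>us\<in>?W. real (card {(i, j) \<in> opairs n R. i \<notin> set us \<and> j \<notin> set us} + 2 * c))"
    unfolding replicate_Suc wcount_Pr[OF wvalid_pairs] of_nat_add sum.distrib by (simp add: wcount_def)
  also have "\<dots> \<le> (\<Sum>us\<in>?W. real (card (opairs n R)))"
    by (intro sum_mono) (unfold of_nat_le_iff, rule touching_pairs(1)[of R, OF sym])
  finally show ?thesis by (simp add: wcount_def mult.commute)
qed

text \<open>The factor \<open>4 * real c\<close> is 2 orders times \<open>2 * c\<close> positions at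
  which the new pair can touch the tuple; \<open>path_removal\<close> bounds each of these
  contributions.\<close>

lemma pairs_mult_upper:
  assumes sym: "\<And>i j. R i j \<Longrightarrow> R j i"
  shows "real (card (opairs n R)) * wcount n R (replicate c Pr)
    \<le> wcount n R (replicate (Suc c) Pr) + 2 * real c * wcount n R (replicate c Pr)
      + 4 * real c * (wcount n R [At 1, Pr] * wcount n R (replicate (c - 1) Pr))"
proof -
  let ?W = "wlists n R (replicate c Pr)"
  let ?D = "\<lambda>us q. {j. j < n \<and> j \<noteq> us ! q \<and> j \<noteq> us ! partner q \<and> R (us ! q) j}"
  have "real (card (opairs n R)) * wcount n R (replicate c Pr) = (\<Sum>us\<in>?W. real (card (opairs n R)))"
    by (simp add: wcount_def)
  also have "\<dots> \<le> (\<Sum>us\<in>?W. real (card {(i, j) \<in> opairs n R. i \<notin> set us \<and> j \<notin> set us} + 2 * c + 2 * (\<Sum>q<2 * c. card (?D us q))))"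
    by (intro sum_mono) (unfold of_nat_le_iff, rule touching_pairs(2)[of R, OF sym])
  also have "\<dots> = wcount n R (replicate (Suc c) Pr) + 2 * real c * wcount n R (replicate c Pr)
     + 2 * (\<Sum>us\<in>?W. \<Sum>q<2 * c. real (card (?D us q)))"
    unfolding replicate_Suc wcount_Pr[OF wvalid_pairs] of_nat_add sum.distrib of_nat_mult of_nat_sum sum_distrib_left[symmetric]
    by (simp add: wcount_def)
  also have "(\<Sum>us\<in>?W. \<Sum>q<2 * c. real (card (?D us q))) = (\<Sum>q<2 * c. \<Sum>us\<in>?W. real (card (?D us q)))"
    by (rule sum.swap)
  also have "\<dots> \<le> (\<Sum>q<2 * c. wcount n R [At 1, Pr] * wcount n R (replicate (c - 1) Pr))"
  proof (intro sum_mono)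
    fix q assume q: "q \<in> {..<2 * c}"
    then obtain d where "c = Suc d" by (cases c) auto
    then show "(\<Sum>us\<in>?W. real (card (?D us q))) \<le> wcount n R [At 1, Pr] * wcount n R (replicate (c - 1) Pr)"
      using path_removal[of R q d n, OF sym] q by simp
  qed
  finally show ?thesis by simp
qed

lemma wcount_pairs_le_power:
  assumes sym: "\<And>i j. R i j \<Longrightarrow> R j i"
  shows "wcount n R (replicate c Pr) \<le> real (card (opairs n R)) ^ c"
proof (induction c)
  case 0
  have "wlists n R [] = {[]}" by (auto simp: wlists_def inj_lists_def)
  then show ?case by (simp add: wcount_def)
next
  case (Suc c)
  have "wcount n R (replicate (Suc c) Pr) \<le> real (card (opairs n R)) * wcount n R (replicate c Pr)"
  proof -
    have "0 \<le> 2 * real c * wcount n R (replicate c Pr)" by (intro mult_nonneg_nonneg) auto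
    then show ?thesis using pairs_mult_lower[of R n c, OF sym] by linarith
  qed
  also have "\<dots> \<le> real (card (opairs n R)) * real (card (opairs n R)) ^ c" using Suc by (intro mult_left_mono) auto
  finally show ?case by simp
qed

text \<open>The main term is the exact moment of a disjoint union of edges; the error counts tuples
  of edges two of which share exactly one vertex.\<close>

lemma opairs_power_stirling:
  "\<exists>C\<ge>0. \<forall>n R. (\<forall>i j. R i j \<longrightarrow> R j i) \<longrightarrow>
     (let x = real (card (opairs n R)); m = (\<Sum>c\<le>k. real (Stirling k c) * 2 ^ (k - c) * wcount n R (replicate c Pr))
      in m \<le> x ^ k \<and> x ^ k \<le> m + C * (\<Sum>i<k - 1. wcount n R [At 1, Pr] * x ^ i))"
proof (induction k)
  case 0
  have "wlists n R [] = {[]}" for n R by (auto simp: wlists_def inj_lists_def)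
  then show ?case by (intro exI[of _ 0]) (simp add: wcount_def)
next
  case (Suc k)
  then obtain C where C: "C \<ge> 0" and IH: "\<And>n R. (\<And>i j. R i j \<Longrightarrow> R j i) \<Longrightarrow>
    (\<Sum>c\<le>k. real (Stirling k c) * 2 ^ (k - c) * wcount n R (replicate c Pr)) \<le> real (card (opairs n R)) ^ k \<and>
    real (card (opairs n R)) ^ k \<le> (\<Sum>c\<le>k. real (Stirling k c) * 2 ^ (k - c) * wcount n R (replicate c Pr))
      + C * (\<Sum>i<k - 1. wcount n R [At 1, Pr] * real (card (opairs n R)) ^ i)" unfolding Let_def by blast
  define C' where "C' = (\<Sum>c\<le>k. real (Stirling k c) * 2 ^ (k - c) * (4 * real c))"
  have C': "C' \<ge> 0" unfolding C'_def by (intro sum_nonneg) auto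
  show ?case
  proof (intro exI[of _ "C + C'"] conjI allI impI)
    show "C + C' \<ge> 0" using C C' by simp
    fix n and R :: "nat \<Rightarrow> nat \<Rightarrow> bool" assume s: "\<forall>i j. R i j \<longrightarrow> R j i"
    then have sym: "\<And>i j. R i j \<Longrightarrow> R j i" by blast
    define x where "x = real (card (opairs n R))"
    define N where "N c = wcount n R (replicate c Pr)" for c
    define T where "T = wcount n R [At 1, Pr]"
    define S where "S c = real (Stirling k c) * 2 ^ (k - c)" for c
    define Z where "Z = (\<Sum>i<k. T * x ^ i)"
    have x0: "x \<ge> 0" and T0: "T \<ge> 0" and S0: "S c \<ge> 0" and N0: "N c \<ge> 0" for c
      by (simp_all add: x_def T_def S_def N_def)
    have lo: "N (Suc c) + 2 * real c * N c \<le> x * N c" for c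
      using pairs_mult_lower[of R, OF sym] unfolding N_def x_def by blast
    have up: "x * N c \<le> N (Suc c) + 2 * real c * N c + 4 * real c * (T * N (c - 1))" for c
      using pairs_mult_upper[of R, OF sym] unfolding N_def x_def T_def by blast
    have Nx: "N c \<le> x ^ c" for c using wcount_pairs_le_power[of R, OF sym] unfolding N_def x_def by blast
    have ih: "(\<Sum>c\<le>k. S c * N c) \<le> x ^ k" "x ^ k \<le> (\<Sum>c\<le>k. S c * N c) + C * (\<Sum>i<k - 1. T * x ^ i)"
      using IH[of R n, OF sym] unfolding S_def N_def T_def x_def by blast+
    \<comment> \<open>A pair of the tuple can be repeated in two orders, which yields
      \<open>2 * c\<close> in place of the \<open>c\<close> of the Stirling recursion; the weights
      \<open>2 ^ (k - c)\<close> absorb the extra 2.\<close>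
    have rec: "(\<Sum>c\<le>Suc k. real (Stirling (Suc k) c) * 2 ^ (Suc k - c) * N c) = (\<Sum>c\<le>k. S c * (N (Suc c) + 2 * real c * N c))"
      unfolding mult.assoc Stirling_sum_Suc
    proof (rule sum.cong)
      fix c assume "c \<in> {..k}"
      then have "Suc k - c = Suc (k - c)" by auto
      then show "real (Stirling k c) * (2 ^ (Suc k - Suc c) * N (Suc c) + real c * (2 ^ (Suc k - c) * N c)) = S c * (N (Suc c) + 2 * (real c * N c))"
        by (simp add: S_def algebra_simps)
    qed simp
    have "(\<Sum>c\<le>k. S c * (N (Suc c) + 2 * real c * N c)) \<le> (\<Sum>c\<le>k. S c * (x * N c))"
      by (intro sum_mono mult_left_mono lo S0)
    also have "\<dots> = x * (\<Sum>c\<le>k. S c * N c)" by (simp add: sum_distrib_left mult.left_commute)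
    also have "\<dots> \<le> x * x ^ k" by (intro mult_left_mono ih x0)
    finally have 1: "(\<Sum>c\<le>k. S c * (N (Suc c) + 2 * real c * N c)) \<le> x ^ Suc k" by simp
    have "x ^ Suc k \<le> x * ((\<Sum>c\<le>k. S c * N c) + C * (\<Sum>i<k - 1. T * x ^ i))"
      using mult_left_mono[OF ih(2) x0] by simp
    also have "\<dots> = (\<Sum>c\<le>k. S c * (x * N c)) + C * (\<Sum>i<k - 1. T * x ^ Suc i)"
      by (simp add: sum_distrib_left algebra_simps)
    also have "(\<Sum>c\<le>k. S c * (x * N c)) \<le> (\<Sum>c\<le>k. S c * (N (Suc c) + 2 * real c * N c) + S c * (4 * real c) * Z)"
    proof (intro sum_mono)
      fix c assume c: "c \<in> {..k}"
      have "real c * (T * N (c - 1)) \<le> real c * Z"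
      proof (cases c)
        case (Suc d)
        have "T * N (c - 1) \<le> T * x ^ d" using Nx[of d] T0 Suc by (intro mult_left_mono) auto
        also have "\<dots> \<le> Z" unfolding Z_def using c Suc x0 T0 by (intro member_le_sum) auto
        finally show ?thesis by (intro mult_left_mono) auto
      qed simp
      then have "x * N c \<le> N (Suc c) + 2 * real c * N c + 4 * real c * Z" using up[of c] by simp
      from mult_left_mono[OF this S0[of c]]
      show "S c * (x * N c) \<le> S c * (N (Suc c) + 2 * real c * N c) + S c * (4 * real c) * Z" by (simp add: algebra_simps)
    qed
    also have "\<dots> = (\<Sum>c\<le>k. S c * (N (Suc c) + 2 * real c * N c)) + C' * Z"
      unfolding sum.distrib C'_def S_def sum_distrib_right by simp
    also have "C * (\<Sum>i<k - 1. T * x ^ Suc i) \<le> C * Z"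
    proof (intro mult_left_mono C)
      have "(\<Sum>i<k - 1. T * x ^ Suc i) = (\<Sum>i\<in>Suc ` {..<k - 1}. T * x ^ i)" by (simp add: sum.reindex)
      also have "\<dots> \<le> Z" unfolding Z_def using x0 T0 by (intro sum_mono2) auto
      finally show "(\<Sum>i<k - 1. T * x ^ Suc i) \<le> Z" .
    qed
    finally have 2: "x ^ Suc k \<le> (\<Sum>c\<le>k. S c * (N (Suc c) + 2 * real c * N c)) + (C + C') * Z"
      by (simp add: algebra_simps)
    show "let x = real (card (opairs n R)); m = (\<Sum>c\<le>Suc k. real (Stirling (Suc k) c) * 2 ^ (Suc k - c) * wcount n R (replicate c Pr))
      in m \<le> x ^ Suc k \<and> x ^ Suc k \<le> m + (C + C') * (\<Sum>i<Suc k - 1. wcount n R [At 1, Pr] * x ^ i)"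
      using 1 2 rec unfolding Let_def x_def[symmetric] N_def[symmetric] T_def[symmetric] Z_def by simp
  qed
qed

subsection \<open>Integrals over the pairing window\<close>

declare measurable_UP_component [measurable del]

lemma sigma_finite_unif: "sigma_finite_measure unif"
  using prob_space_unif by (rule prob_space_imp_sigma_finite)

lemma nn_integral_unif_supp:
  assumes [measurable]: "f \<in> borel_measurable borel" and s: "\<And>x. x \<notin> {0..<2*pi} \<Longrightarrow> f x = 0"
  shows "(\<integral>\<^sup>+x. f x \<partial>unif) = ennreal (1 / (2*pi)) * (\<integral>\<^sup>+x. f x \<partial>lborel)"
proof -
  have "(\<integral>\<^sup>+x. f x \<partial>unif) = (\<integral>\<^sup>+x. ennreal (indicator {0..<2*pi} x / (2*pi)) * f x \<partial>lborel)"
    unfolding unif_def by (subst nn_integral_density) auto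
  also have "\<dots> = (\<integral>\<^sup>+x. ennreal (1 / (2*pi)) * f x \<partial>lborel)"
    by (rule nn_integral_cong) (use s in \<open>auto split: split_indicator\<close>)
  finally show ?thesis by (simp add: nn_integral_cmult)
qed

lemma nn_integral_unif_indicator_le:
  assumes [measurable]: "S \<in> sets borel"
  shows "(\<integral>\<^sup>+x. indicator S x \<partial>unif) \<le> ennreal (1 / (2*pi)) * emeasure lborel S"
proof -
  have "(\<integral>\<^sup>+x. indicator S x \<partial>unif) = (\<integral>\<^sup>+x. ennreal (indicator {0..<2*pi} x / (2*pi)) * indicator S x \<partial>lborel)"
    unfolding unif_def by (subst nn_integral_density) auto
  also have "\<dots> \<le> (\<integral>\<^sup>+x. ennreal (1 / (2*pi)) * indicator S x \<partial>lborel)"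
    by (rule nn_integral_mono) (auto split: split_indicator)
  finally show ?thesis by (simp add: nn_integral_cmult)
qed

lemma norm_cis_diff: "norm (cis a - cis b) = 2 * \<bar>sin ((a - b) / 2)\<bar>"
proof -
  have "(norm (cis a - cis b))\<^sup>2 = 2 - 2 * cos (a - b)"
    unfolding cmod_power2 cos_diff using sin_cos_squared_add[of a] sin_cos_squared_add[of b]
    by (simp add: power2_diff algebra_simps)
  also have "\<dots> = (2 * \<bar>sin ((a - b) / 2)\<bar>)\<^sup>2"
  proof -
    have "2 * ((a - b) / 2) = a - b" by simp
    from cos_double_sin[of "(a - b) / 2", unfolded this] show ?thesis by (simp add: power_mult_distrib)
  qed
  finally show ?thesis by (rule power2_eq_imp_eq) auto
qed

text \<open>Here \<open>\<bar>u\<bar>\<close> is below 2, so the cubic Taylor remainder takes away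
  at most two thirds of the linear term.\<close>

lemma abs_sin_ge:
  assumes "\<bar>u\<bar> \<le> pi / 2"
  shows "\<bar>u\<bar> / 3 \<le> \<bar>sin u\<bar>"
proof -
  have "\<bar>sin u - (\<Sum>m<3. sin_coeff m * u ^ m)\<bar> \<le> inverse (fact 3) * \<bar>u\<bar> ^ 3" by (rule Maclaurin_sin_bound)
  then have 1: "\<bar>sin u - u\<bar> \<le> \<bar>u\<bar> ^ 3 / 6"
    by (simp add: sin_coeff_def eval_nat_numeral lessThan_Suc field_simps)
  have "\<bar>u\<bar> * \<bar>u\<bar> \<le> 2 * 2" using assms pi_less_4 by (intro mult_mono) auto
  then have "\<bar>u\<bar> * (\<bar>u\<bar> * \<bar>u\<bar>) \<le> \<bar>u\<bar> * 4" by (intro mult_left_mono) auto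
  then have "\<bar>u\<bar> ^ 3 / 6 \<le> \<bar>u\<bar> * (2/3)" by (simp add: power3_eq_cube)
  then show ?thesis using 1 by linarith
qed

text \<open>In angle coordinates a short arc may wrap around at 0. The constant is crude: intervals
  of total length \<open>12 * \<delta>\<close> with density \<open>1 / (2 * pi)\<close>, and
  \<open>pi > 3\<close>.\<close>

lemma arc_measure_le:
  assumes c: "norm c = 1" and \<delta>: "\<delta> > 0"
  shows "(\<integral>\<^sup>+x. indicator {x. norm (cis x - c) < \<delta>} x \<partial>unif) \<le> ennreal (2 * \<delta>)"
proof -
  define a where "a = Arg2pi c"
  have a: "0 \<le> a" "a < 2 * pi" "c = cis a"
    using Arg2pi_ge_0[of c] Arg2pi_lt_2pi[of c] Arg2pi_eq[of c] c by (auto simp: a_def cis_conv_exp)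
  have aux: "\<bar>A\<bar> / 3 \<le> S \<Longrightarrow> 2 * S < \<delta> \<Longrightarrow> A < 3 / 2 * \<delta>" for A S by linarith
  \<comment> \<open>The radius \<open>3 * \<delta>\<close> combines a chord of length twice the sine
    of the half angle with \<open>abs_sin_ge\<close>; the last two intervals cover the arc beyond
    the cut.\<close>
  let ?T = "{a - 3 * \<delta>..a + 3 * \<delta>} \<union> {0..3 * \<delta>} \<union> {2 * pi - 3 * \<delta>..2 * pi}"
  have sub: "x \<in> ?T" if x: "x \<in> {0..<2*pi}" "norm (cis x - c) < \<delta>" for x
  proof -
    have s: "2 * \<bar>sin ((x - a) / 2)\<bar> < \<delta>" using x(2) by (simp add: a(3) norm_cis_diff)
    consider "\<bar>x - a\<bar> \<le> pi" | "x - a > pi" | "x - a < - pi" by linarith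
    then show ?thesis
    proof cases
      case 1
      then show ?thesis using abs_sin_ge[of "(x - a) / 2"] s by auto
    next
      case 2
      have "sin (pi - (x - a) / 2) = sin ((x - a) / 2)" by (rule sin_pi_minus)
      moreover have "\<bar>pi - (x - a) / 2\<bar> \<le> pi / 2" using 2 x(1) a by auto
      ultimately have "\<bar>pi - (x - a) / 2\<bar> / 3 \<le> \<bar>sin ((x - a) / 2)\<bar>" using abs_sin_ge[of "pi - (x - a) / 2"] by simp
      from aux[OF this s] have "pi - (x - a) / 2 < 3 / 2 * \<delta>" .
      then have "2 * pi - 3 * \<delta> \<le> x" using a(1) by (simp add: field_simps)
      then show ?thesis using x(1) by simp
    next
      case 3
      have "sin (pi - (a - x) / 2) = sin ((a - x) / 2)" by (rule sin_pi_minus)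
      also have "sin ((a - x) / 2) = sin (- ((x - a) / 2))" by (rule arg_cong[of _ _ sin]) (simp add: field_simps)
      also have "\<dots> = - sin ((x - a) / 2)" by (rule sin_minus)
      finally have "sin (pi - (a - x) / 2) = - sin ((x - a) / 2)" .
      moreover have "\<bar>pi - (a - x) / 2\<bar> \<le> pi / 2" using 3 x(1) a by auto
      ultimately have "\<bar>pi - (a - x) / 2\<bar> / 3 \<le> \<bar>sin ((x - a) / 2)\<bar>" using abs_sin_ge[of "pi - (a - x) / 2"] by simp
      from aux[OF this s] have "pi - (a - x) / 2 < 3 / 2 * \<delta>" .
      then have "x \<le> 3 * \<delta>" using a(2) by (simp add: field_simps)
      then show ?thesis using x(1) by simp
    qed
  qed
  have "(\<integral>\<^sup>+x. indicator {x. norm (cis x - c) < \<delta>} x \<partial>unif) \<le> (\<integral>\<^sup>+x. indicator ?T x \<partial>unif)"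
  proof (rule nn_integral_mono_AE)
    have "AE x in unif. x \<in> {0..<2*pi}"
      unfolding unif_def by (subst AE_density) (auto split: split_indicator)
    then show "AE x in unif. (indicator {x. norm (cis x - c) < \<delta>} x :: ennreal) \<le> indicator ?T x"
    proof eventually_elim
      case (elim x)
      then show ?case using sub[of x] by (cases "norm (cis x - c) < \<delta>") (auto split: split_indicator)
    qed
  qed
  also have "\<dots> \<le> ennreal (1 / (2*pi)) * emeasure lborel ?T" by (rule nn_integral_unif_indicator_le) auto
  also have "emeasure lborel ?T \<le> emeasure lborel ({a - 3 * \<delta>..a + 3 * \<delta>} \<union> {0..3 * \<delta>}) + emeasure lborel {2 * pi - 3 * \<delta>..2 * pi}"
    by (rule emeasure_subadditive) auto
  also have "\<dots> \<le> (emeasure lborel {a - 3 * \<delta>..a + 3 * \<delta>} + emeasure lborel {0..3 * \<delta>}) + emeasure lborel {2 * pi - 3 * \<delta>..2 * pi}"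
    by (intro add_right_mono emeasure_subadditive) auto
  also have "\<dots> = ennreal (12 * \<delta>)" using \<delta> by (simp add: ennreal_plus[symmetric] del: ennreal_plus)
  finally have "(\<integral>\<^sup>+x. indicator {x. norm (cis x - c) < \<delta>} x \<partial>unif) \<le> ennreal (1 / (2*pi)) * ennreal (12 * \<delta>)"
    by (simp add: mult_left_mono)
  also have "\<dots> = ennreal (1 / (2*pi) * (12 * \<delta>))" using \<delta> by (simp add: ennreal_mult[symmetric])
  also have "\<dots> \<le> ennreal (2 * \<delta>)"
    using \<delta> pi_gt3 by (intro ennreal_leI) (simp add: field_simps)
  finally show ?thesis .
qed

lemma UP_Suc_insert: "UP (Suc r) = PiM (insert r {..<r}) (\<lambda>_. unif)"
  by (simp add: UP_def lessThan_Suc)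

lemma measurable_UP_upd:
  assumes f: "f \<in> measurable (UP (Suc r)) N"
  shows "(\<lambda>(t, y). f (t(r := y))) \<in> measurable (UP r \<Otimes>\<^sub>M unif) N"
proof -
  have "(\<lambda>(t, y). t(r := y)) \<in> measurable (UP r \<Otimes>\<^sub>M unif) (UP (Suc r))"
    unfolding UP_Suc_insert unfolding UP_def by (rule measurable_add_dim)
  from measurable_compose[OF this f] show ?thesis by (simp add: case_prod_unfold)
qed

lemma nn_integral_UP_Suc:
  assumes f: "f \<in> borel_measurable (UP (Suc r))"
  shows "(\<integral>\<^sup>+t. f t \<partial>UP (Suc r)) = (\<integral>\<^sup>+t. (\<integral>\<^sup>+y. f (t(r := y)) \<partial>unif) \<partial>UP r)"
    and "(\<lambda>t. \<integral>\<^sup>+y. f (t(r := y)) \<partial>unif) \<in> borel_measurable (UP r)"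
proof -
  interpret product_sigma_finite "\<lambda>_::nat. unif" by (rule product_sigma_finite_unif)
  interpret u: prob_space unif by (rule prob_space_unif)
  show "(\<integral>\<^sup>+t. f t \<partial>UP (Suc r)) = (\<integral>\<^sup>+t. (\<integral>\<^sup>+y. f (t(r := y)) \<partial>unif) \<partial>UP r)"
    unfolding UP_Suc_insert unfolding UP_def using f unfolding UP_Suc_insert by (intro product_nn_integral_insert) auto
  show "(\<lambda>t. \<integral>\<^sup>+y. f (t(r := y)) \<partial>unif) \<in> borel_measurable (UP r)"
    using measurable_UP_upd[OF f] by (rule sigma_finite_measure.borel_measurable_nn_integral[OF sigma_finite_unif])
qed

lemma nn_integral_UP_pair_le:
  assumes H: "H \<in> borel_measurable (UP (Suc (Suc r)))" and F: "F \<in> borel_measurable (UP r)"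
    and G: "\<And>t. (\<lambda>(x, y). G t x y) \<in> borel_measurable (borel \<Otimes>\<^sub>M borel)"
    and eq: "\<And>t x y. H (t(r := x, Suc r := y)) = F t * G t x y"
    and B: "\<And>t. (\<integral>\<^sup>+x. \<integral>\<^sup>+y. G t x y \<partial>unif \<partial>unif) \<le> B"
  shows "(\<integral>\<^sup>+t. H t \<partial>UP (Suc (Suc r))) \<le> (\<integral>\<^sup>+t. F t \<partial>UP r) * (B :: ennreal)"
proof -
  interpret u: prob_space unif by (rule prob_space_unif)
  have G': "case_prod (G t) \<in> borel_measurable (unif \<Otimes>\<^sub>M unif)" for t
    using G[of t] by (simp cong: measurable_cong_sets add: sets_pair_measure_cong[OF sets_unif sets_unif])
  have "(\<integral>\<^sup>+t. H t \<partial>UP (Suc (Suc r))) = (\<integral>\<^sup>+t. (\<integral>\<^sup>+x. (\<integral>\<^sup>+y. H (t(r := x, Suc r := y)) \<partial>unif) \<partial>unif) \<partial>UP r)"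
    unfolding nn_integral_UP_Suc(1)[OF H] by (rule nn_integral_UP_Suc(1)[OF nn_integral_UP_Suc(2)[OF H]])
  also have "\<dots> = (\<integral>\<^sup>+t. F t * (\<integral>\<^sup>+x. (\<integral>\<^sup>+y. G t x y \<partial>unif) \<partial>unif) \<partial>UP r)"
  proof (rule nn_integral_cong)
    fix t
    have "(\<lambda>y. G t x y) \<in> borel_measurable unif" for x
      using measurable_compose[OF measurable_Pair1'[of x unif unif] G'[of t]] by simp
    moreover have "(\<lambda>x. \<integral>\<^sup>+y. G t x y \<partial>unif) \<in> borel_measurable unif"
      using G'[of t] by (rule sigma_finite_measure.borel_measurable_nn_integral[OF sigma_finite_unif])
    ultimately show "(\<integral>\<^sup>+x. (\<integral>\<^sup>+y. H (t(r := x, Suc r := y)) \<partial>unif) \<partial>unif) = F t * (\<integral>\<^sup>+x. (\<integral>\<^sup>+y. G t x y \<partial>unif) \<partial>unif)"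
      unfolding eq by (simp add: nn_integral_cmult)
  qed
  also have "\<dots> \<le> (\<integral>\<^sup>+t. F t * B \<partial>UP r)" by (intro nn_integral_mono mult_left_mono B) auto
  also have "\<dots> = (\<integral>\<^sup>+t. F t \<partial>UP r) * B" using F by (rule nn_integral_multc)
  finally show ?thesis .
qed

lemma nn_integral_UP_single_le:
  assumes H: "H \<in> borel_measurable (UP (Suc r))" and F: "F \<in> borel_measurable (UP r)"
    and G: "\<And>t. (\<lambda>y. G t y) \<in> borel_measurable borel"
    and eq: "\<And>t y. H (t(r := y)) = F t * G t y"
    and B: "\<And>t. (\<integral>\<^sup>+y. G t y \<partial>unif) \<le> B"
  shows "(\<integral>\<^sup>+t. H t \<partial>UP (Suc r)) \<le> (\<integral>\<^sup>+t. F t \<partial>UP r) * (B :: ennreal)"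
proof -
  have "(\<integral>\<^sup>+t. H t \<partial>UP (Suc r)) = (\<integral>\<^sup>+t. F t * (\<integral>\<^sup>+y. G t y \<partial>unif) \<partial>UP r)"
    unfolding nn_integral_UP_Suc(1)[OF H] eq
    by (rule nn_integral_cong, rule nn_integral_cmult) (use G in \<open>simp cong: measurable_cong_sets\<close>)
  also have "\<dots> \<le> (\<integral>\<^sup>+t. F t * B \<partial>UP r)" by (intro nn_integral_mono mult_left_mono B) auto
  also have "\<dots> = (\<integral>\<^sup>+t. F t \<partial>UP r) * B" using F by (rule nn_integral_multc)
  finally show ?thesis .
qed

lemma integral_UP_Suc:
  fixes f :: "(nat \<Rightarrow> real) \<Rightarrow> real"
  assumes f: "f \<in> borel_measurable (UP (Suc r))" and B: "\<And>t. norm (f t) \<le> B"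
  shows "(\<integral>t. f t \<partial>UP (Suc r)) = (\<integral>t. (\<integral>y. f (t(r := y)) \<partial>unif) \<partial>UP r)"
proof -
  interpret product_sigma_finite "\<lambda>_::nat. unif" by (rule product_sigma_finite_unif)
  interpret U: prob_space "UP (Suc r)" by (rule prob_space_UP)
  have i: "integrable (UP (Suc r)) f" using B by (intro U.integrable_const_bound[of _ B] f) auto
  then show ?thesis
    unfolding UP_Suc_insert unfolding UP_def using i[unfolded UP_Suc_insert] by (intro product_integral_insert) auto
qed

lemma integral_UP_pair:
  fixes f :: "(nat \<Rightarrow> real) \<Rightarrow> real"
  assumes f: "f \<in> borel_measurable (UP (Suc (Suc r)))" and B: "\<And>t. norm (f t) \<le> B"
    and eq: "\<And>t x y. f (t(r := x, Suc r := y)) = F t * G x y"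
  shows "(\<integral>t. f t \<partial>UP (Suc (Suc r))) = (\<integral>t. F t \<partial>UP r) * (\<integral>x. \<integral>y. G x y \<partial>unif \<partial>unif)"
proof -
  interpret u: prob_space unif by (rule prob_space_unif)
  have m: "(\<lambda>t. \<integral>y. f (t(Suc r := y)) \<partial>unif) \<in> borel_measurable (UP (Suc r))"
    using u.borel_measurable_lebesgue_integral[OF measurable_UP_upd[OF f]] by simp
  have b: "norm (\<integral>y. f (t(Suc r := y)) \<partial>unif) \<le> B" for t
  proof -
    have "0 \<le> B" by (rule order_trans[OF norm_ge_zero B])
    show ?thesis
    proof (cases "integrable unif (\<lambda>y. f (t(Suc r := y)))")
      case True
      then have "(\<integral>y. norm (f (t(Suc r := y))) \<partial>unif) \<le> B" using B by (intro u.integral_le_const integrable_norm) auto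
      then show ?thesis by (rule order_trans[OF integral_norm_bound])
    qed (simp add: not_integrable_integral_eq \<open>0 \<le> B\<close>)
  qed
  have "(\<integral>t. f t \<partial>UP (Suc (Suc r))) = (\<integral>t. (\<integral>x. (\<integral>y. f (t(r := x, Suc r := y)) \<partial>unif) \<partial>unif) \<partial>UP r)"
    unfolding integral_UP_Suc[OF f B] by (rule integral_UP_Suc[OF m b])
  then show ?thesis unfolding eq by simp
qed

text \<open>The range conditions hold for eigenangles. They confine the relation to the support of
  \<open>unif\<close>, so that integrals over it can be taken with respect to Lebesgue measure and
  substituted freely.\<close>

definition wnd :: "real set \<Rightarrow> real \<Rightarrow> real \<Rightarrow> real \<Rightarrow> bool" where
  "wnd I \<gamma> x y \<longleftrightarrow> (x + y) / 2 \<in> I \<and> \<bar>x - y\<bar> \<le> \<gamma> \<and> x \<in> {0..<2*pi} \<and> y \<in> {0..<2*pi}"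

locale window =
  fixes I :: "real set" and \<gamma> :: real
  assumes interval: "is_interval I" and sub: "I \<subseteq> {0..<2*pi}" and \<gamma>_pos: "\<gamma> > 0"
begin

abbreviation "h \<equiv> wnd I \<gamma>"
abbreviation "len \<equiv> measure lborel I"

lemma I_borel [measurable]: "I \<in> sets borel"
  by (rule real_interval_borel_measurable[OF interval])

lemma emeasure_I: "emeasure lborel I = ennreal len"
proof -
  have "emeasure lborel I \<le> emeasure lborel {0..2*pi}" using sub by (intro emeasure_mono) auto
  also have "\<dots> < \<infinity>" by simp
  finally show ?thesis by (simp add: emeasure_eq_ennreal_measure less_top)
qed

lemma measurable_wnd [measurable (raw)]:
  assumes [measurable]: "f \<in> borel_measurable N" "g \<in> borel_measurable N"
  shows "Measurable.pred N (\<lambda>t. h (f t) (g t))"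
  unfolding wnd_def by measurable

lemma emeasure_translate_I: "emeasure lborel {x. x + a \<in> I} = ennreal len"
proof -
  have m: "{x. x + a \<in> I} \<in> sets lborel" by measurable
  have "emeasure lborel I = (\<integral>\<^sup>+x. indicator I x \<partial>lborel)" by simp
  also have "\<dots> = ennreal \<bar>1\<bar> * (\<integral>\<^sup>+x. indicator I (a + 1 * x) \<partial>lborel)" by (rule nn_integral_real_affine) auto
  also have "(\<integral>\<^sup>+x. indicator I (a + 1 * x) \<partial>lborel) = (\<integral>\<^sup>+x. indicator {x. x + a \<in> I} x \<partial>lborel)"
    by (rule nn_integral_cong) (auto split: split_indicator simp: add.commute)
  also have "\<dots> = emeasure lborel {x. x + a \<in> I}" using m by simp
  finally show ?thesis by (simp add: emeasure_I)
qed

text \<open>Substitution of the difference \<open>d\<close> for \<open>y\<close>, then Fubini; the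
  factor is the squared density of \<open>unif\<close>. What remains to be estimated is, for fixed
  \<open>d\<close>, the measure of the admissible positions \<open>x\<close>.\<close>

lemma wnd_integral:
  assumes [measurable]: "g \<in> borel_measurable borel"
  shows "(\<integral>\<^sup>+x. \<integral>\<^sup>+y. (if h x y then g (x - y) else 0) \<partial>unif \<partial>unif)
    = ennreal (1 / (4 * pi\<^sup>2)) * (\<integral>\<^sup>+d. g d * emeasure lborel {x. h x (x - d)} \<partial>lborel)"
proof -
  have inner: "(\<integral>\<^sup>+y. (if h x y then g (x - y) else 0) \<partial>unif) = ennreal (1 / (2*pi)) * (\<integral>\<^sup>+d. (if h x (x - d) then g d else 0) \<partial>lborel)" for x
  proof -
    have "(\<integral>\<^sup>+y. (if h x y then g (x - y) else 0) \<partial>unif) = ennreal (1 / (2*pi)) * (\<integral>\<^sup>+y. (if h x y then g (x - y) else 0) \<partial>lborel)"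
      by (rule nn_integral_unif_supp) (auto simp: wnd_def)
    also have "(\<integral>\<^sup>+y. (if h x y then g (x - y) else 0) \<partial>lborel) = ennreal \<bar>-1\<bar> * (\<integral>\<^sup>+d. (if h x (x + (-1) * d) then g (x - (x + (-1) * d)) else 0) \<partial>lborel)"
      by (rule nn_integral_real_affine) auto
    finally show ?thesis by (simp cong: if_cong)
  qed
  have "(\<integral>\<^sup>+x. ennreal (1 / (2*pi)) * (\<integral>\<^sup>+d. (if h x (x - d) then g d else 0) \<partial>lborel) \<partial>unif)
      = ennreal (1 / (2*pi)) * (\<integral>\<^sup>+x. ennreal (1 / (2*pi)) * (\<integral>\<^sup>+d. (if h x (x - d) then g d else 0) \<partial>lborel) \<partial>lborel)"
    by (rule nn_integral_unif_supp) (auto simp: wnd_def)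
  also have "(\<integral>\<^sup>+x. ennreal (1 / (2*pi)) * (\<integral>\<^sup>+d. (if h x (x - d) then g d else 0) \<partial>lborel) \<partial>lborel)
      = ennreal (1 / (2*pi)) * (\<integral>\<^sup>+x. \<integral>\<^sup>+d. (if h x (x - d) then g d else 0) \<partial>lborel \<partial>lborel)"
    by (rule nn_integral_cmult) measurable
  also have "(\<integral>\<^sup>+x. \<integral>\<^sup>+d. (if h x (x - d) then g d else 0) \<partial>lborel \<partial>lborel) = (\<integral>\<^sup>+d. \<integral>\<^sup>+x. (if h x (x - d) then g d else 0) \<partial>lborel \<partial>lborel)"
    by (rule lborel_pair.Fubini') measurable
  also have "\<dots> = (\<integral>\<^sup>+d. g d * emeasure lborel {x. h x (x - d)} \<partial>lborel)"
  proof (rule nn_integral_cong)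
    fix d
    have "(\<integral>\<^sup>+x. (if h x (x - d) then g d else 0) \<partial>lborel) = (\<integral>\<^sup>+x. g d * indicator {x. h x (x - d)} x \<partial>lborel)"
      by (rule nn_integral_cong) (auto split: split_indicator)
    also have "\<dots> = g d * emeasure lborel {x. h x (x - d)}" by (rule nn_integral_cmult_indicator) measurable
    finally show "(\<integral>\<^sup>+x. (if h x (x - d) then g d else 0) \<partial>lborel) = g d * emeasure lborel {x. h x (x - d)}" .
  qed
  finally show ?thesis
    unfolding inner by (simp add: mult.assoc[symmetric] ennreal_mult[symmetric] power2_eq_square)
qed

lemma wnd_integral_le:
  assumes [measurable]: "g \<in> borel_measurable borel"
  shows "(\<integral>\<^sup>+x. \<integral>\<^sup>+y. (if h x y then g (x - y) else 0) \<partial>unif \<partial>unif) \<le> ennreal (len / (4 * pi\<^sup>2)) * (\<integral>\<^sup>+d. indicator {-\<gamma>..\<gamma>} d * g d \<partial>lborel)"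
proof -
  have "(\<integral>\<^sup>+d. g d * emeasure lborel {x. h x (x - d)} \<partial>lborel) \<le> (\<integral>\<^sup>+d. ennreal len * (indicator {-\<gamma>..\<gamma>} d * g d) \<partial>lborel)"
  proof (rule nn_integral_mono)
    fix d
    show "g d * emeasure lborel {x. h x (x - d)} \<le> ennreal len * (indicator {-\<gamma>..\<gamma>} d * g d)"
    proof (cases "\<bar>d\<bar> \<le> \<gamma>")
      case True
      have "emeasure lborel {x. h x (x - d)} \<le> emeasure lborel {x. x + (- (d / 2)) \<in> I}"
        by (intro emeasure_mono) (auto simp: wnd_def field_simps)
      then have "g d * emeasure lborel {x. h x (x - d)} \<le> g d * ennreal len" unfolding emeasure_translate_I by (rule mult_left_mono) simp
      then show ?thesis using True by (simp add: abs_le_iff mult.commute indicator_def)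
    next
      case False
      then have "{x. h x (x - d)} = {}" by (auto simp: wnd_def)
      then show ?thesis by simp
    qed
  qed
  also have "\<dots> = ennreal len * (\<integral>\<^sup>+d. indicator {-\<gamma>..\<gamma>} d * g d \<partial>lborel)" by (rule nn_integral_cmult) measurable
  finally have "(\<integral>\<^sup>+x. \<integral>\<^sup>+y. (if h x y then g (x - y) else 0) \<partial>unif \<partial>unif) \<le> ennreal (1 / (4 * pi\<^sup>2)) * (ennreal len * (\<integral>\<^sup>+d. indicator {-\<gamma>..\<gamma>} d * g d \<partial>lborel))"
    unfolding wnd_integral[OF assms] by (rule mult_left_mono) simp
  then show ?thesis by (simp add: mult.assoc[symmetric] ennreal_mult[symmetric])
qed

text \<open>A midpoint in \<open>I\<close> is lost only if one of the two points leaves the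
  fundamental interval, which requires the midpoint to be within \<open>\<gamma> / 2\<close> of an
  end. The two strips have total length \<open>\<gamma>\<close>.\<close>

lemma emeasure_wnd_ge:
  assumes d: "\<bar>d\<bar> \<le> \<gamma>"
  shows "ennreal (len - \<gamma>) \<le> emeasure lborel {x. h x (x - d)}"
proof -
  let ?S = "{x. h x (x - d)}" and ?A = "{d/2..d/2 + \<gamma>/2}" and ?B = "{2*pi - \<gamma>/2 + d/2..2*pi + d/2}"
  have "ennreal len = emeasure lborel {x. x + (- (d / 2)) \<in> I}" by (simp only: emeasure_translate_I)
  also have "\<dots> \<le> emeasure lborel ((?S \<union> ?A) \<union> ?B)"
  proof (rule emeasure_mono)
    show "{x. x + (- (d / 2)) \<in> I} \<subseteq> (?S \<union> ?A) \<union> ?B"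
    proof
      fix x assume "x \<in> {x. x + (- (d / 2)) \<in> I}"
      then have xI: "x - d / 2 \<in> I" by simp
      then have r: "0 \<le> x - d / 2" "x - d / 2 < 2 * pi" using sub by auto
      show "x \<in> (?S \<union> ?A) \<union> ?B"
      proof (cases "x \<in> {0..<2*pi} \<and> x - d \<in> {0..<2*pi}")
        case True
        have "(x + (x - d)) / 2 = x - d / 2" by simp
        then have "(x + (x - d)) / 2 \<in> I" using xI by (simp only:)
        then show ?thesis using True d by (simp add: wnd_def)
      next
        case False
        then show ?thesis using r d by (auto simp: abs_le_iff)
      qed
    qed
  qed measurable
  also have "\<dots> \<le> emeasure lborel (?S \<union> ?A) + emeasure lborel ?B" by (rule emeasure_subadditive) measurable
  also have "\<dots> \<le> (emeasure lborel ?S + emeasure lborel ?A) + emeasure lborel ?B"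
    by (intro add_right_mono emeasure_subadditive) measurable
  also have "\<dots> = emeasure lborel ?S + ennreal \<gamma>" using \<gamma>_pos by (simp add: add.assoc ennreal_plus[symmetric] del: ennreal_plus)
  finally have "ennreal len - ennreal \<gamma> \<le> emeasure lborel ?S"
    by (simp add: ennreal_minus_le_iff add.commute)
  then show ?thesis using \<gamma>_pos by (simp add: ennreal_minus)
qed

lemma wnd_integral_ge:
  assumes [measurable]: "g \<in> borel_measurable borel"
  shows "ennreal ((len - \<gamma>) / (4 * pi\<^sup>2)) * (\<integral>\<^sup>+d. indicator {-\<gamma>..\<gamma>} d * g d \<partial>lborel) \<le> (\<integral>\<^sup>+x. \<integral>\<^sup>+y. (if h x y then g (x - y) else 0) \<partial>unif \<partial>unif)"
proof -
  have "ennreal (len - \<gamma>) * (\<integral>\<^sup>+d. indicator {-\<gamma>..\<gamma>} d * g d \<partial>lborel) = (\<integral>\<^sup>+d. ennreal (len - \<gamma>) * (indicator {-\<gamma>..\<gamma>} d * g d) \<partial>lborel)"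
    by (rule nn_integral_cmult[symmetric]) measurable
  also have "\<dots> \<le> (\<integral>\<^sup>+d. g d * emeasure lborel {x. h x (x - d)} \<partial>lborel)"
  proof (rule nn_integral_mono)
    fix d
    show "ennreal (len - \<gamma>) * (indicator {-\<gamma>..\<gamma>} d * g d) \<le> g d * emeasure lborel {x. h x (x - d)}"
    proof (cases "\<bar>d\<bar> \<le> \<gamma>")
      case True
      then show ?thesis using mult_left_mono[OF emeasure_wnd_ge[OF True], of "g d"]
        by (simp add: abs_le_iff mult.commute indicator_def)
    qed (auto simp: indicator_def)
  qed
  finally have "ennreal (1 / (4 * pi\<^sup>2)) * (ennreal (len - \<gamma>) * (\<integral>\<^sup>+d. indicator {-\<gamma>..\<gamma>} d * g d \<partial>lborel)) \<le> (\<integral>\<^sup>+x. \<integral>\<^sup>+y. (if h x y then g (x - y) else 0) \<partial>unif \<partial>unif)"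
    unfolding wnd_integral[OF assms] by (rule mult_left_mono) simp
  then show ?thesis by (simp add: mult.assoc[symmetric] ennreal_mult'[symmetric])
qed

lemma even_power_integral:
  assumes "c \<ge> 0"
  shows "(\<integral>\<^sup>+d. indicator {-\<gamma>..\<gamma>} d * ennreal (c * d ^ (2 * k)) \<partial>lborel) = ennreal (c * (2 * \<gamma> ^ Suc (2 * k) / real (Suc (2 * k))))"
proof -
  let ?F = "\<lambda>d::real. c * (d ^ Suc (2 * k) / real (Suc (2 * k)))"
  have "(\<integral>\<^sup>+d. ennreal (c * d ^ (2 * k)) * indicator {-\<gamma>..\<gamma>} d \<partial>lborel) = ennreal (?F \<gamma> - ?F (-\<gamma>))"
  proof (rule nn_integral_FTC_Icc)
    show "(?F has_real_derivative c * x ^ (2 * k)) (at x)" for x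
    proof -
      have "(?F has_real_derivative c * (real (Suc (2 * k)) * x ^ (Suc (2 * k) - Suc 0) / real (Suc (2 * k)))) (at x)"
        by (intro DERIV_cmult DERIV_cdivide DERIV_pow)
      then show ?thesis by (simp del: of_nat_Suc)
    qed
    show "0 \<le> c * x ^ (2 * k)" for x using assms by (simp add: power_mult)
  qed (use \<gamma>_pos in auto)
  also have "?F \<gamma> - ?F (-\<gamma>) = c * (2 * \<gamma> ^ Suc (2 * k) / real (Suc (2 * k)))"
  proof -
    have "?F (-\<gamma>) = - ?F \<gamma>" by simp
    then show ?thesis by simp
  qed
  finally show ?thesis by (simp add: mult.commute)
qed

text \<open>For \<open>K = real n\<close> this is the squared weight of an edge in the clustering
  estimate, restricted to the window.\<close>

definition phi :: "real \<Rightarrow> real \<Rightarrow> real \<Rightarrow> real" where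
  "phi K x y = (if h x y then (K * (y - x))\<^sup>2 else 0)"

lemma phi_nonneg: "phi K x y \<ge> 0"
  by (simp add: phi_def)

lemma phi_measurable [measurable (raw)]:
  assumes [measurable]: "f \<in> borel_measurable N" "g \<in> borel_measurable N"
  shows "(\<lambda>t. phi K (f t) (g t)) \<in> borel_measurable N"
  unfolding phi_def by measurable

lemma phi_pair_integral:
  "(\<integral>\<^sup>+x. \<integral>\<^sup>+y. ennreal (phi K x y) \<partial>unif \<partial>unif) \<le> ennreal (len * \<gamma> ^ 3 * K\<^sup>2 / (6 * pi\<^sup>2))"
proof -
  have "(\<integral>\<^sup>+x. \<integral>\<^sup>+y. ennreal (phi K x y) \<partial>unif \<partial>unif) = (\<integral>\<^sup>+x. \<integral>\<^sup>+y. (if h x y then ennreal (K\<^sup>2 * (x - y) ^ (2 * 1)) else 0) \<partial>unif \<partial>unif)"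
    by (intro nn_integral_cong) (auto simp: phi_def power_mult_distrib power2_commute)
  also have "\<dots> \<le> ennreal (len / (4 * pi\<^sup>2)) * (\<integral>\<^sup>+d. indicator {-\<gamma>..\<gamma>} d * ennreal (K\<^sup>2 * d ^ (2 * 1)) \<partial>lborel)"
    by (rule wnd_integral_le) measurable
  also have "\<dots> = ennreal (len / (4 * pi\<^sup>2)) * ennreal (K\<^sup>2 * (2 * \<gamma> ^ Suc (2 * 1) / real (Suc (2 * 1))))"
    by (subst even_power_integral) auto
  also have "\<dots> = ennreal (len / (4 * pi\<^sup>2) * (K\<^sup>2 * (2 * \<gamma> ^ Suc (2 * 1) / real (Suc (2 * 1)))))"
    by (rule ennreal_mult'[symmetric]) auto
  also have "len / (4 * pi\<^sup>2) * (K\<^sup>2 * (2 * \<gamma> ^ Suc (2 * 1) / real (Suc (2 * 1)))) = len * \<gamma> ^ 3 * K\<^sup>2 / (6 * pi\<^sup>2)"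
    by (simp add: field_simps eval_nat_numeral)
  finally show ?thesis .
qed

text \<open>For fixed \<open>x\<close> the point \<open>y\<close> is confined to an interval of
  length \<open>2 * \<gamma>\<close> by the difference and to a set of measure
  \<open>2 * len\<close> by the midpoint. Both bounds are kept, since either may be the smaller one;
  the factor 2 is absorbed by the density.\<close>

lemma phi_row_integral:
  "(\<integral>\<^sup>+y. ennreal (phi K x y) \<partial>unif) \<le> ennreal ((K * \<gamma>)\<^sup>2 * min \<gamma> len)"
proof -
  let ?T = "{x - \<gamma>..x + \<gamma>} \<inter> {y. (x + y) / 2 \<in> I}"
  have "{y. (x + y) / 2 \<in> I} \<in> sets borel" by measurable
  then have [measurable]: "?T \<in> sets borel" by (intro sets.Int) auto
  have "(\<integral>\<^sup>+y. ennreal (phi K x y) \<partial>unif) \<le> (\<integral>\<^sup>+y. ennreal ((K * \<gamma>)\<^sup>2) * indicator ?T y \<partial>unif)"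
  proof (rule nn_integral_mono)
    fix y
    show "ennreal (phi K x y) \<le> ennreal ((K * \<gamma>)\<^sup>2) * indicator ?T y"
    proof (cases "h x y")
      case True
      then have "\<bar>y - x\<bar> \<le> \<gamma>" "y \<in> ?T" by (auto simp: wnd_def)
      then have "(y - x)\<^sup>2 \<le> \<gamma>\<^sup>2" using \<gamma>_pos by (simp add: abs_le_square_iff[symmetric])
      then have "(K * (y - x))\<^sup>2 \<le> (K * \<gamma>)\<^sup>2" unfolding power_mult_distrib by (rule mult_left_mono) simp
      then show ?thesis using True \<open>y \<in> ?T\<close> by (simp add: phi_def ennreal_leI)
    qed (simp add: phi_def)
  qed
  also have "\<dots> = ennreal ((K * \<gamma>)\<^sup>2) * (\<integral>\<^sup>+y. indicator ?T y \<partial>unif)"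
    by (rule nn_integral_cmult) measurable
  also have "(\<integral>\<^sup>+y. indicator ?T y \<partial>unif) \<le> ennreal (1 / (2*pi)) * emeasure lborel ?T"
    by (rule nn_integral_unif_indicator_le) measurable
  also have "emeasure lborel ?T \<le> ennreal (2 * min \<gamma> len)"
  proof -
    have "emeasure lborel ?T \<le> emeasure lborel {x - \<gamma>..x + \<gamma>}" by (intro emeasure_mono) auto
    also have "\<dots> = ennreal (2 * \<gamma>)" using \<gamma>_pos by simp
    finally have 1: "emeasure lborel ?T \<le> ennreal (2 * \<gamma>)" .
    have "emeasure lborel ?T \<le> emeasure lborel {y. (x + y) / 2 \<in> I}" by (intro emeasure_mono) auto
    also have "\<dots> = ennreal (2 * len)"
    proof -
      have m: "{y. (x + y) / 2 \<in> I} \<in> sets lborel" by measurable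
      have "emeasure lborel {y. (x + y) / 2 \<in> I} = (\<integral>\<^sup>+y. indicator {y. (x + y) / 2 \<in> I} y \<partial>lborel)" using m by simp
      also have "\<dots> = ennreal \<bar>2\<bar> * (\<integral>\<^sup>+u. indicator {y. (x + y) / 2 \<in> I} (- x + 2 * u) \<partial>lborel)"
        by (rule nn_integral_real_affine) (use m in auto)
      also have "(\<integral>\<^sup>+u. indicator {y. (x + y) / 2 \<in> I} (- x + 2 * u) \<partial>lborel) = (\<integral>\<^sup>+u. indicator I u \<partial>lborel)"
        by (rule nn_integral_cong) (auto split: split_indicator)
      finally show ?thesis by (simp add: emeasure_I ennreal_mult')
    qed
    finally show ?thesis using 1 by (auto simp: min_def)
  qed
  finally have "(\<integral>\<^sup>+y. ennreal (phi K x y) \<partial>unif) \<le> ennreal ((K * \<gamma>)\<^sup>2) * (ennreal (1 / (2*pi)) * ennreal (2 * min \<gamma> len))"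
    by (simp add: mult_left_mono)
  also have "\<dots> = ennreal ((K * \<gamma>)\<^sup>2 * (1 / (2*pi) * (2 * min \<gamma> len)))"
  proof -
    have 0: "0 \<le> 1 / (2 * pi)" "0 \<le> 2 * min \<gamma> len" "0 \<le> (K * \<gamma>)\<^sup>2" using \<gamma>_pos by auto
    show ?thesis by (simp only: ennreal_mult[OF 0(3) mult_nonneg_nonneg[OF 0(1,2)]] ennreal_mult[OF 0(1,2)])
  qed
  also have "\<dots> \<le> ennreal ((K * \<gamma>)\<^sup>2 * min \<gamma> len)"
  proof (intro ennreal_leI mult_left_mono)
    have div_pi: "1 / (2*pi) * (2 * m) \<le> m" if "0 \<le> m" for m
      using that pi_gt3 mult_left_mono[of 1 pi m] by (simp add: field_simps)
    show "1 / (2*pi) * (2 * min \<gamma> len) \<le> min \<gamma> len" by (rule div_pi) (use \<gamma>_pos in simp)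
  qed simp
  finally show ?thesis .
qed

lemma phi_near_integral:
  assumes c: "norm c = 1" and \<delta>: "\<delta> > 0"
  shows "(\<integral>\<^sup>+x. \<integral>\<^sup>+y. ennreal (phi K x y) * indicator {x. norm (cis x - c) < \<delta>} x \<partial>unif \<partial>unif) \<le> ennreal ((K * \<gamma>)\<^sup>2 * min \<gamma> len * (2 * \<delta>))"
proof -
  have m: "{x. norm (cis x - c) < \<delta>} \<in> sets borel"
    by (rule borel_open) (intro open_Collect_less continuous_intros)
  have "(\<integral>\<^sup>+x. \<integral>\<^sup>+y. ennreal (phi K x y) * indicator {x. norm (cis x - c) < \<delta>} x \<partial>unif \<partial>unif)
     \<le> (\<integral>\<^sup>+x. ennreal ((K * \<gamma>)\<^sup>2 * min \<gamma> len) * indicator {x. norm (cis x - c) < \<delta>} x \<partial>unif)"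
  proof (rule nn_integral_mono)
    fix x
    have "(\<integral>\<^sup>+y. ennreal (phi K x y) * indicator {x. norm (cis x - c) < \<delta>} x \<partial>unif) = (\<integral>\<^sup>+y. ennreal (phi K x y) \<partial>unif) * indicator {x. norm (cis x - c) < \<delta>} x"
      by (rule nn_integral_multc) measurable
    also have "\<dots> \<le> ennreal ((K * \<gamma>)\<^sup>2 * min \<gamma> len) * indicator {x. norm (cis x - c) < \<delta>} x"
      by (intro mult_right_mono phi_row_integral) simp
    finally show "(\<integral>\<^sup>+y. ennreal (phi K x y) * indicator {x. norm (cis x - c) < \<delta>} x \<partial>unif) \<le> \<dots>" .
  qed
  also have "\<dots> = ennreal ((K * \<gamma>)\<^sup>2 * min \<gamma> len) * (\<integral>\<^sup>+x. indicator {x. norm (cis x - c) < \<delta>} x \<partial>unif)"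
    by (rule nn_integral_cmult) (use m in auto)
  also have "\<dots> \<le> ennreal ((K * \<gamma>)\<^sup>2 * min \<gamma> len) * ennreal (2 * \<delta>)"
    by (intro mult_left_mono arc_measure_le c \<delta>) simp
  finally show ?thesis using \<delta> \<gamma>_pos by (simp add: ennreal_mult)
qed

end

subsection \<open>Expected tuple counts\<close>

fun wpar :: "step list \<Rightarrow> nat \<Rightarrow> nat option" where
  "wpar [] = (\<lambda>_. None)"
| "wpar (Pr # w) = (wpar w)(Suc (wlen w) := Some (wlen w))"
| "wpar (At p # w) = (wpar w)(wlen w := Some p)"

fun prs :: "step list \<Rightarrow> nat" where
  "prs [] = 0"
| "prs (Pr # w) = Suc (prs w)"
| "prs (At p # w) = prs w"

fun ats :: "step list \<Rightarrow> nat" where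
  "ats [] = 0"
| "ats (Pr # w) = ats w"
| "ats (At p # w) = Suc (ats w)"

lemma wlen_prs_ats: "wlen w = 2 * prs w + ats w"
  by (induction w rule: wlen.induct) auto

lemma wpar_None: "wlen w \<le> i \<Longrightarrow> wpar w i = None"
  by (induction w rule: wlen.induct) auto

lemma wpar_less: "wvalid w \<Longrightarrow> wpar w i = Some p \<Longrightarrow> p < i"
  by (induction w rule: wlen.induct) (auto split: if_splits)

lemma wrel_compose: "wrel (\<lambda>i j. R (g i) (g j)) w f = wrel R w (\<lambda>i. g (f i))"
  by (induction w rule: wlen.induct) auto

lemma wt_cong: "par i = par' i \<Longrightarrow> wt n par t i = wt n par' t i"
  by (simp add: wt_def)

context window
begin

text \<open>The product of squared weights in the clustering estimate for the parents
  \<open>wpar w\<close>, cut off to the window (\<open>wwt_eq\<close>). The recursion mirrors the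
  order in which variables are integrated out.\<close>

fun wwt :: "real \<Rightarrow> step list \<Rightarrow> (nat \<Rightarrow> real) \<Rightarrow> real" where
  "wwt K [] t = 1"
| "wwt K (Pr # w) t = wwt K w t * phi K (t (wlen w)) (t (Suc (wlen w)))"
| "wwt K (At p # w) t = wwt K w t * phi K (t p) (t (wlen w))"

lemma wwt_nonneg: "wwt K w t \<ge> 0"
  by (induction K w t rule: wwt.induct) (auto simp: phi_nonneg)

lemma wwt_upd: "wvalid w \<Longrightarrow> wlen w \<le> i \<Longrightarrow> wwt K w (t(i := x)) = wwt K w t"
  by (induction w rule: wlen.induct) auto

lemma wwt_eq:
  "wvalid w \<Longrightarrow> wwt (real n) w t = (if wrel h w t then (\<Prod>i<wlen w. (wt n (wpar w) t i)\<^sup>2) else 0)"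
proof (induction w rule: wlen.induct)
  case (2 w)
  have "(\<Prod>i<wlen w. (wt n (wpar (Pr # w)) t i)\<^sup>2) = (\<Prod>i<wlen w. (wt n (wpar w) t i)\<^sup>2)"
    by (intro prod.cong refl arg_cong[of _ _ "\<lambda>x. x\<^sup>2"] wt_cong) auto
  moreover have "wt n (wpar (Pr # w)) t (wlen w) = 1" by (simp add: wt_def wpar_None)
  moreover have "(wt n (wpar (Pr # w)) t (Suc (wlen w)))\<^sup>2 = (real n * (t (Suc (wlen w)) - t (wlen w)))\<^sup>2"
    by (simp add: wt_def power_mult_distrib)
  ultimately show ?case using 2 by (simp add: phi_def del: wpar.simps)
next
  case (3 p w)
  have "(\<Prod>i<wlen w. (wt n (wpar (At p # w)) t i)\<^sup>2) = (\<Prod>i<wlen w. (wt n (wpar w) t i)\<^sup>2)"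
    by (intro prod.cong refl arg_cong[of _ _ "\<lambda>x. x\<^sup>2"] wt_cong) auto
  moreover have "(wt n (wpar (At p # w)) t (wlen w))\<^sup>2 = (real n * (t (wlen w) - t p))\<^sup>2"
    by (simp add: wt_def power_mult_distrib)
  ultimately show ?case using 3 by (simp add: phi_def del: wpar.simps)
qed simp

lemma measurable_wwt: "wvalid w \<Longrightarrow> wlen w \<le> r \<Longrightarrow> wwt K w \<in> borel_measurable (UP r)"
proof (induction w rule: wlen.induct)
  case (2 w)
  have "(\<lambda>t. phi K (t (wlen w)) (t (Suc (wlen w)))) \<in> borel_measurable (UP r)"
    by (rule phi_measurable; rule measurable_UP_component) (use 2 in auto)
  moreover have "wwt K w \<in> borel_measurable (UP r)" using 2 by simp
  moreover have "wwt K (Pr # w) = (\<lambda>t. wwt K w t * phi K (t (wlen w)) (t (Suc (wlen w))))" by (rule ext) simp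
  ultimately show ?case by (simp only: borel_measurable_times)
next
  case (3 p w)
  have "(\<lambda>t. phi K (t p) (t (wlen w))) \<in> borel_measurable (UP r)"
    by (rule phi_measurable; rule measurable_UP_component) (use 3 in auto)
  moreover have "wwt K w \<in> borel_measurable (UP r)" using 3 by simp
  moreover have "wwt K (At p # w) = (\<lambda>t. wwt K w t * phi K (t p) (t (wlen w)))" by (rule ext) simp
  ultimately show ?case by (simp only: borel_measurable_times)
next
  case 1
  have "wwt K [] = (\<lambda>t. 1)" by (rule ext) simp
  then show ?case by simp
qed

lemma measurable_wrel: "wvalid w \<Longrightarrow> wlen w \<le> r \<Longrightarrow> Measurable.pred (UP r) (wrel h w)"
proof (induction w rule: wlen.induct)
  case (2 w)
  have "Measurable.pred (UP r) (\<lambda>t. h (t (wlen w)) (t (Suc (wlen w))))"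
    by (rule measurable_wnd; rule measurable_UP_component) (use 2 in auto)
  moreover have "Measurable.pred (UP r) (wrel h w)" using 2 by simp
  moreover have "wrel h (Pr # w) = (\<lambda>t. wrel h w t \<and> h (t (wlen w)) (t (Suc (wlen w))))" by (rule ext) simp
  ultimately show ?case by (simp only: pred_intros_logic)
next
  case (3 p w)
  have "Measurable.pred (UP r) (\<lambda>t. h (t p) (t (wlen w)))"
    by (rule measurable_wnd; rule measurable_UP_component) (use 3 in auto)
  moreover have "Measurable.pred (UP r) (wrel h w)" using 3 by simp
  moreover have "wrel h (At p # w) = (\<lambda>t. wrel h w t \<and> h (t p) (t (wlen w)))" by (rule ext) simp
  ultimately show ?case by (simp only: pred_intros_logic)
next
  case 1
  have "wrel h [] = (\<lambda>t. True)" by (rule ext) simp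
  then show ?case by simp
qed

lemma measurable_wwt_ennreal: "wvalid w \<Longrightarrow> wlen w \<le> r \<Longrightarrow> (\<lambda>t. ennreal (wwt K w t)) \<in> borel_measurable (UP r)"
  by (rule measurable_compose[OF measurable_wwt measurable_ennreal])

text \<open>\<open>cA\<close> bounds the integral over the two variables of a \<open>Pr\<close>
  step, \<open>cB\<close> the integral over the single variable of an \<open>At\<close>
  step.\<close>

definition cA :: "real \<Rightarrow> real" where "cA K = len * \<gamma> ^ 3 * K\<^sup>2 / (6 * pi\<^sup>2)"
definition cB :: "real \<Rightarrow> real" where "cB K = (K * \<gamma>)\<^sup>2 * min \<gamma> len"

lemma cA_nonneg: "cA K \<ge> 0" and cB_nonneg: "cB K \<ge> 0"
  using \<gamma>_pos by (simp_all add: cA_def cB_def)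

lemma nn_integral_wwt:
  "wvalid w \<Longrightarrow> (\<integral>\<^sup>+t. ennreal (wwt K w t) \<partial>UP (wlen w)) \<le> ennreal (cA K ^ prs w * cB K ^ ats w)"
proof (induction w rule: wlen.induct)
  case 1
  interpret prob_space "UP 0" by (rule prob_space_UP)
  show ?case by (simp add: emeasure_space_1)
next
  case (2 w)
  then have v: "wvalid w" by simp
  let ?r = "wlen w"
  have "(\<integral>\<^sup>+t. ennreal (wwt K (Pr # w) t) \<partial>UP (Suc (Suc ?r))) \<le> (\<integral>\<^sup>+t. ennreal (wwt K w t) \<partial>UP ?r) * ennreal (cA K)"
  proof (rule nn_integral_UP_pair_le[where G = "\<lambda>t x y. ennreal (phi K x y)"])
    show "(\<lambda>t. ennreal (wwt K (Pr # w) t)) \<in> borel_measurable (UP (Suc (Suc ?r)))"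
      by (rule measurable_wwt_ennreal) (use v in simp_all)
    show "(\<lambda>t. ennreal (wwt K w t)) \<in> borel_measurable (UP ?r)" by (rule measurable_wwt_ennreal[OF v order_refl])
    show "(\<lambda>(x, y). ennreal (phi K x y)) \<in> borel_measurable (borel \<Otimes>\<^sub>M borel)" by measurable
    show "ennreal (wwt K (Pr # w) (t(?r := x, Suc ?r := y))) = ennreal (wwt K w t) * ennreal (phi K x y)" for t x y
      by (simp add: wwt_upd[OF v] ennreal_mult wwt_nonneg phi_nonneg)
    show "(\<integral>\<^sup>+x. \<integral>\<^sup>+y. ennreal (phi K x y) \<partial>unif \<partial>unif) \<le> ennreal (cA K)"
      unfolding cA_def by (rule phi_pair_integral)
  qed
  also have "\<dots> \<le> ennreal (cA K ^ prs w * cB K ^ ats w) * ennreal (cA K)" by (intro mult_right_mono 2(1) v) simp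
  also have "\<dots> = ennreal (cA K ^ prs w * cB K ^ ats w * cA K)"
    by (rule ennreal_mult[symmetric]) (simp_all add: cA_nonneg cB_nonneg)
  finally show ?case by (simp add: mult_ac)
next
  case (3 p w)
  then have v: "wvalid w" and p: "p < wlen w" by simp_all
  let ?r = "wlen w"
  have "(\<integral>\<^sup>+t. ennreal (wwt K (At p # w) t) \<partial>UP (Suc ?r)) \<le> (\<integral>\<^sup>+t. ennreal (wwt K w t) \<partial>UP ?r) * ennreal (cB K)"
  proof (rule nn_integral_UP_single_le[where G = "\<lambda>t y. ennreal (phi K (t p) y)"])
    show "(\<lambda>t. ennreal (wwt K (At p # w) t)) \<in> borel_measurable (UP (Suc ?r))"
      by (rule measurable_wwt_ennreal) (use v p in simp_all)
    show "(\<lambda>t. ennreal (wwt K w t)) \<in> borel_measurable (UP ?r)" by (rule measurable_wwt_ennreal[OF v order_refl])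
    show "(\<lambda>y. ennreal (phi K (t p) y)) \<in> borel_measurable borel" for t by measurable
    show "ennreal (wwt K (At p # w) (t(?r := y))) = ennreal (wwt K w t) * ennreal (phi K (t p) y)" for t y
      using p by (simp add: wwt_upd[OF v] ennreal_mult wwt_nonneg phi_nonneg)
    show "(\<integral>\<^sup>+y. ennreal (phi K (t p) y) \<partial>unif) \<le> ennreal (cB K)" for t
      unfolding cB_def by (rule phi_row_integral)
  qed
  also have "\<dots> \<le> ennreal (cA K ^ prs w * cB K ^ ats w) * ennreal (cB K)" by (intro mult_right_mono 3(1) v) simp
  also have "\<dots> = ennreal (cA K ^ prs w * cB K ^ ats w * cB K)"
    by (rule ennreal_mult[symmetric]) (simp_all add: cA_nonneg cB_nonneg)
  finally show ?case by (simp add: mult_ac)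
qed

end

lemma abs_integral_le:
  fixes f :: "'a \<Rightarrow> real"
  assumes "integrable N f" "\<And>t. t \<in> space N \<Longrightarrow> \<bar>f t\<bar> \<le> g t" "(\<integral>\<^sup>+t. ennreal (g t) \<partial>N) \<le> ennreal C" "0 \<le> C"
  shows "\<bar>\<integral>t. f t \<partial>N\<bar> \<le> C"
proof -
  have "ennreal (norm (\<integral>t. f t \<partial>N)) \<le> (\<integral>\<^sup>+t. ennreal (norm (f t)) \<partial>N)" by (rule integral_norm_bound_ennreal[OF assms(1)])
  also have "\<dots> \<le> (\<integral>\<^sup>+t. ennreal (g t) \<partial>N)" using assms(2) by (intro nn_integral_mono ennreal_leI) simp
  also have "\<dots> \<le> ennreal C" by (rule assms(3))
  finally show ?thesis using assms(4) by simp
qed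

lemma nn_integral2_add:
  assumes f: "(\<lambda>(x, y). f x y) \<in> borel_measurable (borel \<Otimes>\<^sub>M borel)" and g: "(\<lambda>(x, y). g x y) \<in> borel_measurable (borel \<Otimes>\<^sub>M borel)"
  shows "(\<integral>\<^sup>+x. \<integral>\<^sup>+y. f x y + g x y \<partial>unif \<partial>unif) = (\<integral>\<^sup>+x. \<integral>\<^sup>+y. f x y \<partial>unif \<partial>unif) + (\<integral>\<^sup>+x. \<integral>\<^sup>+y. g x y \<partial>unif \<partial>unif)"
proof -
  have m: "(\<lambda>y. u x y) \<in> borel_measurable unif" "(\<lambda>x. \<integral>\<^sup>+y. u x y \<partial>unif) \<in> borel_measurable unif"
    if u: "(\<lambda>(x, y). u x y) \<in> borel_measurable (borel \<Otimes>\<^sub>M borel)" for u :: "real \<Rightarrow> real \<Rightarrow> ennreal" and x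
  proof -
    have U: "case_prod u \<in> borel_measurable (unif \<Otimes>\<^sub>M unif)"
      using u by (simp cong: measurable_cong_sets add: sets_pair_measure_cong[OF sets_unif sets_unif])
    show "(\<lambda>y. u x y) \<in> borel_measurable unif" using measurable_compose[OF measurable_Pair1'[of x unif unif] U] by simp
    show "(\<lambda>x. \<integral>\<^sup>+y. u x y \<partial>unif) \<in> borel_measurable unif"
      using U by (rule sigma_finite_measure.borel_measurable_nn_integral[OF sigma_finite_unif])
  qed
  show ?thesis by (simp add: nn_integral_add m[OF f] m[OF g])
qed

lemma measurable_rho_le: "r \<le> s \<Longrightarrow> (\<lambda>t. rho n r (zc t)) \<in> borel_measurable (UP s)"
  unfolding rho_expand[OF zc_torus] cis_power_int
  by (intro borel_measurable_sum borel_measurable_times borel_measurable_prod borel_measurable_cis borel_measurable_const measurable_UP_component) auto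

lemma rho_cong: "(\<And>i. i < r \<Longrightarrow> z i = z' i) \<Longrightarrow> rho n r z = rho n r z'"
  unfolding rho_def by (intro arg_cong[of _ _ det] eq_matI) auto

section \<open>The two point function\<close>

lemma det_2x2:
  fixes A :: "'a :: comm_ring_1 mat"
  assumes A: "A \<in> carrier_mat 2 2"
  shows "det A = A $$ (0, 0) * A $$ (1, 1) - A $$ (0, 1) * A $$ (1, 0)"
proof -
  have d: "dim_row A = 2" "dim_col A = 2" using A by auto
  have s: "det (mat_delete A i 0) = A $$ (1 - i, 1)" if "i < 2" for i
  proof -
    have "mat_delete A i 0 \<in> carrier_mat 1 1" using mat_delete_carrier[OF A] by simp
    from det_single[OF this] show ?thesis using that d by (cases i) (auto simp: mat_delete_def)
  qed
  have "det A = (\<Sum>i<2. A $$ (i, 0) * cofactor A i 0)" by (rule laplace_expansion_column[OF A]) simp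
  also have "\<dots> = A $$ (0, 0) * A $$ (1, 1) - A $$ (1, 0) * A $$ (0, 1)"
    by (simp add: numeral_2_eq_2 cofactor_def s)
  finally show ?thesis by (simp add: mult.commute)
qed

text \<open>The square of \<open>n\<close> minus the squared modulus of the geometric sum of
  \<open>cis (real l * d)\<close>, written with the cosines that survive the symmetrization in
  \<open>l\<close> and \<open>m\<close>.\<close>

definition pair_corr :: "nat \<Rightarrow> real \<Rightarrow> real" where
  "pair_corr n d = (\<Sum>l<n. \<Sum>m<n. 1 - cos ((real l - real m) * d))"

lemma rho_2: "rho n 2 (zc t) = of_real (pair_corr n (t 0 - t 1))"
proof -
  define d where "d = t 0 - t 1"
  have e: "cis (t 0) ^ l * cnj (cis (t 1)) ^ l = cis (real l * d)" "cis (t 1) ^ l * cnj (cis (t 0)) ^ l = cnj (cis (real l * d))" for l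
  proof -
    have "cis a ^ l * cnj (cis b) ^ l = cis (real l * (a - b))" for a b
    proof -
      have "cis a ^ l * cnj (cis b) ^ l = (cis a * cnj (cis b)) ^ l" by (simp only: power_mult_distrib)
      also have "cis a * cnj (cis b) = cis (a - b)" by (simp add: cis_cnj cis_mult)
      also have "cis (a - b) ^ l = cis (real l * (a - b))" by (rule Complex.DeMoivre)
      finally show ?thesis .
    qed
    from this[of "t 0" "t 1"] this[of "t 1" "t 0"]
    show "cis (t 0) ^ l * cnj (cis (t 1)) ^ l = cis (real l * d)" "cis (t 1) ^ l * cnj (cis (t 0)) ^ l = cnj (cis (real l * d))"
      unfolding d_def cis_cnj by (simp_all add: algebra_simps)
  qed
  have o: "cis x ^ l * cnj (cis x) ^ l = 1" for x l
    by (simp add: power_mult_distrib[symmetric] cis_cnj cis_mult)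
  define S where "S = (\<Sum>l<n. cis (real l * d))"
  have "rho n 2 (zc t) = of_nat n * of_nat n - S * cnj S"
    unfolding rho_def by (subst det_2x2) (simp_all add: e[unfolded One_nat_def] o S_def)
  also have "S * cnj S = (\<Sum>l<n. \<Sum>m<n. cis ((real l - real m) * d))"
    unfolding S_def cnj_sum sum_product by (simp add: cis_cnj cis_mult algebra_simps)
  also have "\<dots> = of_real (\<Sum>l<n. \<Sum>m<n. cos ((real l - real m) * d))"
  proof -
    have "(\<Sum>l<n. \<Sum>m<n. sin ((real l - real m) * d)) = (\<Sum>l<n. \<Sum>m<n. sin ((real m - real l) * d))" by (rule sum.swap)
    also have "\<dots> = - (\<Sum>l<n. \<Sum>m<n. sin ((real l - real m) * d))"
      unfolding sum_negf[symmetric] sin_minus[symmetric] by (simp add: algebra_simps)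
    finally have "(\<Sum>l<n. \<Sum>m<n. sin ((real l - real m) * d)) = 0" by simp
    then show ?thesis by (simp add: complex_eq_iff)
  qed
  finally show ?thesis unfolding d_def[symmetric] pair_corr_def by (simp add: sum_subtractf)
qed

lemma pair_corr_measurable [measurable]: "pair_corr n \<in> borel_measurable borel"
  unfolding pair_corr_def by measurable

lemma pair_corr_nonneg: "pair_corr n d \<ge> 0"
  unfolding pair_corr_def by (intro sum_nonneg) simp

lemma sum_diff_squares: "(\<Sum>l<n. \<Sum>m<n. (real l - real m)\<^sup>2) = (real n)\<^sup>2 * ((real n)\<^sup>2 - 1) / 6"
proof -
  have 1: "(\<Sum>l<n. real l) = real n * (real n - 1) / 2" by (induction n) (auto simp: field_simps)
  have 2: "(\<Sum>l<n. (real l)\<^sup>2) = real n * (real n - 1) * (2 * real n - 1) / 6"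
    by (induction n) (auto simp: field_simps power2_eq_square)
  have "(\<Sum>l<n. \<Sum>m<n. (real l - real m)\<^sup>2) = (\<Sum>l<n. real n * (real l)\<^sup>2 + (\<Sum>m<n. (real m)\<^sup>2) - 2 * real l * (\<Sum>m<n. real m))"
    by (intro sum.cong refl) (simp add: power2_diff sum.distrib sum_subtractf sum_distrib_left)
  also have "\<dots> = 2 * real n * (\<Sum>l<n. (real l)\<^sup>2) - 2 * ((\<Sum>m<n. real m) * (\<Sum>m<n. real m))"
    by (simp add: sum.distrib sum_subtractf sum_distrib_left[symmetric] sum_distrib_right[symmetric])
  also have "\<dots> = (real n)\<^sup>2 * ((real n)\<^sup>2 - 1) / 6"
    unfolding 1 2 by (simp add: field_simps power2_eq_square)
  finally show ?thesis .
qed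

lemma one_minus_cos_bounds:
  fixes u :: real
  shows "1 - cos u \<le> u\<^sup>2 / 2" and "u\<^sup>2 / 2 - u ^ 4 / 24 \<le> 1 - cos u"
proof -
  have c: "cos u = 1 - 2 * (sin (u / 2))\<^sup>2" using cos_double_sin[of "u / 2"] by simp
  have "(sin (u / 2))\<^sup>2 \<le> (u / 2)\<^sup>2" using abs_sin_x_le_abs_x[of "u / 2"] by (simp only: abs_le_square_iff)
  then show "1 - cos u \<le> u\<^sup>2 / 2" unfolding c by (simp add: power_divide)
  obtain t where "cos u = (\<Sum>m<4. cos_coeff m * u ^ m) + cos (t + 1/2 * real (4::nat) * pi) / fact 4 * u ^ 4"
    using Maclaurin_cos_expansion[of u 4] by blast
  moreover have "(\<Sum>m<4. cos_coeff m * u ^ m) = 1 - u\<^sup>2 / 2"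
    by (simp add: cos_coeff_def eval_nat_numeral lessThan_Suc) presburger
  moreover have "cos (t + 1/2 * real (4::nat) * pi) / fact 4 * u ^ 4 \<le> 1 / 24 * u ^ 4"
    by (intro mult_right_mono) (simp_all add: fact_numeral field_simps)
  ultimately show "u\<^sup>2 / 2 - u ^ 4 / 24 \<le> 1 - cos u" by simp
qed

lemma pair_corr_upper: "pair_corr n d \<le> (real n)\<^sup>2 * ((real n)\<^sup>2 - 1) / 12 * d\<^sup>2"
proof -
  have "pair_corr n d \<le> (\<Sum>l<n. \<Sum>m<n. ((real l - real m) * d)\<^sup>2 / 2)"
    unfolding pair_corr_def by (intro sum_mono one_minus_cos_bounds)
  also have "\<dots> = (\<Sum>l<n. \<Sum>m<n. (real l - real m)\<^sup>2) * (d\<^sup>2 / 2)"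
    unfolding sum_distrib_right by (simp add: power_mult_distrib)
  finally show ?thesis unfolding sum_diff_squares by simp
qed

text \<open>The quartic Taylor term is estimated by
  \<open>\<bar>real l - real m\<bar> \<le> real n\<close> in each of the \<open>n\<close> squared
  summands; its relative size is of order \<open>(n * d)\<^sup>2\<close>.\<close>

lemma pair_corr_lower: "(real n)\<^sup>2 * ((real n)\<^sup>2 - 1) / 12 * d\<^sup>2 \<le> pair_corr n d + real n ^ 6 / 24 * d ^ 4"
proof -
  have "(\<Sum>l<n. \<Sum>m<n. ((real l - real m) * d)\<^sup>2 / 2 - real n ^ 4 * d ^ 4 / 24) \<le> pair_corr n d"
    unfolding pair_corr_def
  proof (intro sum_mono)
    fix l m assume "l \<in> {..<n}" "m \<in> {..<n}"
    then have "\<bar>real l - real m\<bar> \<le> real n" by auto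
    then have "\<bar>real l - real m\<bar> ^ 4 \<le> real n ^ 4" by (intro power_mono) auto
    then have "(real l - real m) ^ 4 \<le> real n ^ 4" by simp
    then have "((real l - real m) * d) ^ 4 \<le> real n ^ 4 * d ^ 4" unfolding power_mult_distrib by (intro mult_right_mono) auto
    then show "((real l - real m) * d)\<^sup>2 / 2 - real n ^ 4 * d ^ 4 / 24 \<le> 1 - cos ((real l - real m) * d)"
      using one_minus_cos_bounds(2)[of "(real l - real m) * d"] by simp
  qed
  moreover have n6: "real n ^ 6 = real n * (real n * real n ^ 4)" by (simp add: eval_nat_numeral)
  have "(\<Sum>l<n. \<Sum>m<n. ((real l - real m) * d)\<^sup>2 / 2 - real n ^ 4 * d ^ 4 / 24)
    = (\<Sum>l<n. \<Sum>m<n. (real l - real m)\<^sup>2) * (d\<^sup>2 / 2) - real n ^ 6 / 24 * d ^ 4"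
    unfolding sum_subtractf sum_distrib_right n6 by (simp add: power_mult_distrib)
  ultimately show ?thesis unfolding sum_diff_squares by (simp add: field_simps)
qed

section \<open>Expected counts of eigenvalue tuples in the window\<close>

locale haar_window = window +
  fixes n :: nat and M :: "complex mat measure"
  assumes H: "normalized_haar n M" and n_pos: "n \<ge> 1" and len_pos: "measure lborel I > 0"
begin

definition rel :: "complex mat \<Rightarrow> nat \<Rightarrow> nat \<Rightarrow> bool" where
  "rel U i j = h (ang U i) (ang U j)"

lemma rel_sym: "rel U i j \<Longrightarrow> rel U j i"
  by (simp add: rel_def wnd_def add.commute abs_minus_commute)

lemma space_M: "space M = unitary_group n" and prob_space_M: "prob_space M"
  using haarD[OF H] by auto

lemma close_pairs_eq:
  assumes "U \<in> unitary_group n"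
  shows "2 * real (close_pairs I \<gamma> U) = real (card (opairs n (rel U)))"
proof -
  have "ang U i \<in> {0..<2*pi}" if "i < n" for i using ang_range[OF assms that] .
  then have "close_pairs I \<gamma> U = card {{i, j} | i j. i < n \<and> j < n \<and> i \<noteq> j \<and> rel U i j}"
    unfolding close_pairs_def Let_def eigenangles_props(1)[OF assms] rel_def wnd_def ang_def
    by (intro arg_cong[of _ _ card] Collect_cong ex_cong1) auto
  then show ?thesis using card_opairs[of "rel U" n, OF rel_sym] by simp
qed

definition wset :: "step list \<Rightarrow> (nat \<Rightarrow> real) set" where
  "wset w = {t \<in> space (UP (wlen w)). wrel h w t}"

lemma wset_sets: "wvalid w \<Longrightarrow> wset w \<in> sets (UP (wlen w))"
  unfolding wset_def using measurable_wrel[of w "wlen w"] by (simp add: pred_def)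

lemma wcount_tuple_count:
  assumes "wvalid w"
  shows "wcount n (rel U) w = tuple_count n (wlen w) (wset w) U"
proof -
  have "wrel (rel U) w (nth us) \<longleftrightarrow> (\<lambda>i\<in>{..<wlen w}. ang U (us ! i)) \<in> wset w" for us
  proof -
    have "wrel (rel U) w (nth us) = wrel h w (\<lambda>i. ang U (us ! i))"
      unfolding rel_def by (rule wrel_compose)
    also have "\<dots> = wrel h w (\<lambda>i\<in>{..<wlen w}. ang U (us ! i))" by (rule wrel_cong[OF assms]) simp
    finally show ?thesis by (auto simp: wset_def UP_def space_PiM)
  qed
  then show ?thesis by (simp add: wcount_def wlists_def tuple_count_def)
qed

definition EN :: "step list \<Rightarrow> real" where
  "EN w = (\<integral>U. wcount n (rel U) w \<partial>M)"

lemma EN_integrable: "wvalid w \<Longrightarrow> wlen w \<le> n \<Longrightarrow> integrable M (\<lambda>U. wcount n (rel U) w)"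
  unfolding wcount_tuple_count using haar_correlation(1)[OF H _ wset_sets] .

lemma EN_eq:
  assumes "wvalid w" "wlen w \<le> n"
  shows "EN w = (\<integral>t. (if wrel h w t then Re (rho n (wlen w) (zc t)) else 0) \<partial>UP (wlen w))"
    and "integrable (UP (wlen w)) (\<lambda>t. if wrel h w t then Re (rho n (wlen w) (zc t)) else 0)"
proof -
  have e: "indicator (wset w) t * Re (rho n (wlen w) (zc t)) = (if wrel h w t then Re (rho n (wlen w) (zc t)) else 0)"
    if "t \<in> space (UP (wlen w))" for t using that by (simp add: wset_def)
  note c = haar_correlation[OF H assms(2) wset_sets[OF assms(1)]]
  show "EN w = (\<integral>t. (if wrel h w t then Re (rho n (wlen w) (zc t)) else 0) \<partial>UP (wlen w))"
    unfolding EN_def wcount_tuple_count[OF assms(1)] c(2) by (rule Bochner_Integration.integral_cong[OF refl e])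
  show "integrable (UP (wlen w)) (\<lambda>t. if wrel h w t then Re (rho n (wlen w) (zc t)) else 0)"
    by (rule iffD1[OF Bochner_Integration.integrable_cong[OF refl e] c(3)])
qed

lemma rho_wwt_le:
  assumes "wvalid w" "wrel h w t"
  shows "norm (rho n (wlen w) (zc t)) \<le> fact (wlen w) * real n ^ wlen w * wwt (real n) w t"
  using rho_bound[of "wlen w" "wpar w" n t] wpar_less[OF assms(1)] assms by (simp add: wwt_eq mult.assoc)

lemma EN_le:
  assumes "wvalid w" "wlen w \<le> n"
  shows "\<bar>EN w\<bar> \<le> fact (wlen w) * real n ^ wlen w * (cA (real n) ^ prs w * cB (real n) ^ ats w)"
  unfolding EN_eq(1)[OF assms]
proof (rule abs_integral_le[OF EN_eq(2)[OF assms]])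
  let ?c = "fact (wlen w) * real n ^ wlen w :: real"
  show "\<bar>if wrel h w t then Re (rho n (wlen w) (zc t)) else 0\<bar> \<le> ?c * wwt (real n) w t" for t
    using order_trans[OF abs_Re_le_cmod rho_wwt_le[OF assms(1), of t]] wwt_nonneg by simp
  have "(\<integral>\<^sup>+t. ennreal (?c * wwt (real n) w t) \<partial>UP (wlen w)) = ennreal ?c * (\<integral>\<^sup>+t. ennreal (wwt (real n) w t) \<partial>UP (wlen w))"
    using measurable_wwt[OF assms(1) order_refl, of "real n"] by (subst nn_integral_cmult[symmetric]) (simp_all add: ennreal_mult wwt_nonneg)
  also have "\<dots> \<le> ennreal ?c * ennreal (cA (real n) ^ prs w * cB (real n) ^ ats w)"
    by (intro mult_left_mono nn_integral_wwt assms(1)) simp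
  also have "\<dots> = ennreal (?c * (cA (real n) ^ prs w * cB (real n) ^ ats w))"
    by (rule ennreal_mult[symmetric]) (simp_all add: cA_nonneg cB_nonneg)
  finally show "(\<integral>\<^sup>+t. ennreal (?c * wwt (real n) w t) \<partial>UP (wlen w)) \<le> ennreal (?c * (cA (real n) ^ prs w * cB (real n) ^ ats w))" .
qed (simp add: cA_nonneg cB_nonneg)

end

context haar_window
begin

definition mu :: real where "mu = len * \<gamma> ^ 3 * real n ^ 4 / (144 * pi\<^sup>2)"
definition sc :: real where "sc = \<gamma> * real n"
definition Nn :: real where "Nn = real n * len"

lemma mu_pos: "mu > 0" and sc_pos: "sc > 0" and Nn_pos: "Nn > 0"
  using \<gamma>_pos n_pos len_pos by (simp_all add: mu_def sc_def Nn_def)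

text \<open>The clustering bound lacks the factor 1/12 of the exact two point function, so 24
  appears here in place of the 2 in \<open>EN_Pr_upper\<close>.\<close>

lemma cA_mu: "(real n)\<^sup>2 * cA (real n) = 24 * mu"
  by (simp add: cA_def mu_def field_simps eval_nat_numeral)

lemma cB_eq: "real n * cB (real n) = sc\<^sup>2 * min sc Nn"
proof -
  have "real n * min \<gamma> len = min sc Nn" by (simp add: sc_def Nn_def min_mult_distrib_left mult.commute)
  then show ?thesis unfolding cB_def sc_def by (simp add: mult_ac)
qed

lemma sc_cube: "sc ^ 3 * Nn = 144 * pi\<^sup>2 * mu"
  by (simp add: sc_def Nn_def mu_def field_simps eval_nat_numeral)

lemma pi_sq_le: "pi\<^sup>2 \<le> 16"
proof -
  have "pi\<^sup>2 \<le> 4\<^sup>2" using pi_less_4 by (intro power_mono) auto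
  then show ?thesis by simp
qed

lemma pair_corr_le: "pair_corr n d \<le> 2 * (real n)\<^sup>2"
proof -
  have "1 - cos x \<le> 2" for x :: real using cos_ge_minus_one[of x] by linarith
  then have "pair_corr n d \<le> (\<Sum>l<n. \<Sum>m<n. 2)" unfolding pair_corr_def by (intro sum_mono)
  then show ?thesis by (simp add: power2_eq_square)
qed

definition gg :: "real \<Rightarrow> real \<Rightarrow> real" where
  "gg x y = (if h x y then pair_corr n (x - y) else 0)"

lemma gg_measurable [measurable (raw)]:
  assumes [measurable]: "f \<in> borel_measurable N" "g \<in> borel_measurable N"
  shows "(\<lambda>t. gg (f t) (g t)) \<in> borel_measurable N"
  unfolding gg_def by measurable

lemma gg_nonneg: "gg x y \<ge> 0" and gg_le: "gg x y \<le> 2 * (real n)\<^sup>2"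
  using pair_corr_nonneg pair_corr_le by (auto simp: gg_def)

lemma gg_le_phi: "gg x y \<le> (real n)\<^sup>2 * phi (real n) x y"
proof (cases "h x y")
  case True
  have "(real n)\<^sup>2 * ((real n)\<^sup>2 - 1) / 12 * (x - y)\<^sup>2 \<le> (real n)\<^sup>2 * (real n * (y - x))\<^sup>2"
  proof -
    have "(real n)\<^sup>2 * ((real n)\<^sup>2 - 1) / 12 \<le> (real n)\<^sup>2 * (real n)\<^sup>2"
      using mult_left_mono[of "((real n)\<^sup>2 - 1) / 12" "(real n)\<^sup>2" "(real n)\<^sup>2"] by (simp add: field_simps)
    from mult_right_mono[OF this, of "(x - y)\<^sup>2"] show ?thesis by (simp add: power_mult_distrib power2_commute[of x y] mult.assoc)
  qed
  then show ?thesis using True order_trans[OF pair_corr_upper] by (simp add: gg_def phi_def)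
qed (simp add: gg_def phi_def)

lemma EN_Pr_eq:
  assumes "2 \<le> n"
  shows "EN [Pr] = (\<integral>t. gg (t 0) (t (Suc 0)) \<partial>UP (Suc (Suc 0)))" "integrable (UP (Suc (Suc 0))) (\<lambda>t. gg (t 0) (t (Suc 0)))"
proof -
  have e: "(if wrel h [Pr] t then Re (rho n (wlen [Pr]) (zc t)) else 0) = gg (t 0) (t (Suc 0))" for t
    using rho_2[of n t] by (simp add: gg_def numeral_2_eq_2)
  have "wlen [Pr] \<le> n" "wvalid [Pr]" "wlen [Pr] = Suc (Suc 0)" using assms by simp_all
  then show "EN [Pr] = (\<integral>t. gg (t 0) (t (Suc 0)) \<partial>UP (Suc (Suc 0)))" "integrable (UP (Suc (Suc 0))) (\<lambda>t. gg (t 0) (t (Suc 0)))"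
    using EN_eq[of "[Pr]"] unfolding e by auto
qed

lemma measurable_gg_UP: "Suc r < s \<Longrightarrow> (\<lambda>t. gg (t r) (t (Suc r))) \<in> borel_measurable (UP s)"
  by (rule gg_measurable) (rule measurable_UP_component, simp)+

lemma EN_Pr_integral:
  assumes "2 \<le> n"
  shows "EN [Pr] = (\<integral>x. \<integral>y. gg x y \<partial>unif \<partial>unif)"
proof -
  interpret prob_space "UP 0" by (rule prob_space_UP)
  have "EN [Pr] = (\<integral>t. 1 \<partial>UP 0) * (\<integral>x. \<integral>y. gg x y \<partial>unif \<partial>unif)"
    unfolding EN_Pr_eq(1)[OF assms]
    by (rule integral_UP_pair[OF measurable_gg_UP, where B = "2 * (real n)\<^sup>2"]) (use gg_nonneg gg_le in auto)
  then show ?thesis by (simp add: prob_space)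
qed

lemma EN_Pr_nn:
  assumes "2 \<le> n"
  shows "ennreal (EN [Pr]) = (\<integral>\<^sup>+x. \<integral>\<^sup>+y. ennreal (gg x y) \<partial>unif \<partial>unif)"
proof -
  interpret prob_space "UP 0" by (rule prob_space_UP)
  have m: "(\<lambda>t. ennreal (gg (t 0) (t (Suc 0)))) \<in> borel_measurable (UP (Suc (Suc 0)))"
    using measurable_gg_UP[of 0 "Suc (Suc 0)"] by simp
  have "ennreal (EN [Pr]) = (\<integral>\<^sup>+t. ennreal (gg (t 0) (t (Suc 0))) \<partial>UP (Suc (Suc 0)))"
    unfolding EN_Pr_eq(1)[OF assms] by (rule nn_integral_eq_integral[symmetric, OF EN_Pr_eq(2)[OF assms]]) (simp add: gg_nonneg)
  also have "\<dots> = (\<integral>\<^sup>+t. (\<integral>\<^sup>+x. \<integral>\<^sup>+y. ennreal (gg ((t(0 := x, Suc 0 := y)) 0) ((t(0 := x, Suc 0 := y)) (Suc 0))) \<partial>unif \<partial>unif) \<partial>UP 0)"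
    unfolding nn_integral_UP_Suc(1)[OF m] by (rule nn_integral_UP_Suc(1)[OF nn_integral_UP_Suc(2)[OF m]])
  also have "\<dots> = (\<integral>\<^sup>+x. \<integral>\<^sup>+y. ennreal (gg x y) \<partial>unif \<partial>unif)" by (simp add: emeasure_space_1)
  finally show ?thesis .
qed

lemma EN_nonneg: "EN w \<ge> 0"
  unfolding EN_def by (rule Bochner_Integration.integral_nonneg) simp

text \<open>The quadratic Taylor bound integrates to \<open>len / (4 * pi\<^sup>2)\<close> times
  \<open>real n ^ 4 / 12\<close> times \<open>2 * \<gamma> ^ 3 / 3\<close>. This is twice
  \<open>mu\<close> because pairs are ordered.\<close>

lemma EN_Pr_upper:
  assumes "2 \<le> n"
  shows "EN [Pr] \<le> 2 * mu"
proof -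
  let ?a = "real n ^ 4 / 12"
  have "ennreal (EN [Pr]) \<le> (\<integral>\<^sup>+x. \<integral>\<^sup>+y. (if h x y then ennreal (?a * (x - y) ^ (2 * 1)) else 0) \<partial>unif \<partial>unif)"
    unfolding EN_Pr_nn[OF assms]
  proof (intro nn_integral_mono)
    fix x y
    have "(real n)\<^sup>2 * ((real n)\<^sup>2 - 1) / 12 \<le> ?a" by (simp add: field_simps eval_nat_numeral)
    then have "(real n)\<^sup>2 * ((real n)\<^sup>2 - 1) / 12 * (x - y)\<^sup>2 \<le> ?a * (x - y)\<^sup>2"
      by (rule mult_right_mono) simp
    then have "pair_corr n (x - y) \<le> ?a * (x - y) ^ (2 * 1)" using pair_corr_upper[of n "x - y"] by simp
    then show "ennreal (gg x y) \<le> (if h x y then ennreal (?a * (x - y) ^ (2 * 1)) else 0)"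
      by (simp add: gg_def ennreal_leI)
  qed
  also have "\<dots> \<le> ennreal (len / (4 * pi\<^sup>2)) * (\<integral>\<^sup>+d. indicator {-\<gamma>..\<gamma>} d * ennreal (?a * d ^ (2 * 1)) \<partial>lborel)"
    by (rule wnd_integral_le) measurable
  also have "\<dots> = ennreal (len / (4 * pi\<^sup>2)) * ennreal (?a * (2 * \<gamma> ^ Suc (2 * 1) / real (Suc (2 * 1))))"
    by (subst even_power_integral) auto
  also have "\<dots> = ennreal (len / (4 * pi\<^sup>2) * (?a * (2 * \<gamma> ^ Suc (2 * 1) / real (Suc (2 * 1)))))"
    by (rule ennreal_mult'[symmetric]) auto
  also have "len / (4 * pi\<^sup>2) * (?a * (2 * \<gamma> ^ Suc (2 * 1) / real (Suc (2 * 1)))) = 2 * mu"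
    by (simp add: mu_def field_simps eval_nat_numeral)
  finally show ?thesis using mu_pos by simp
qed

text \<open>There are three relative losses: replacing \<open>n\<^sup>2 - 1\<close> by
  \<open>n\<^sup>2\<close> costs at most \<open>1 / n\<close>, the quartic Taylor term at most
  \<open>sc\<^sup>2\<close>, and the strips of \<open>emeasure_wnd_ge\<close> cost
  \<open>\<gamma> / len\<close>, which is \<open>sc / Nn\<close>.\<close>

lemma EN_Pr_lower:
  assumes "2 \<le> n"
  shows "2 * mu - 2 * mu * (1 / real n + sc\<^sup>2 + sc / Nn) \<le> EN [Pr]"
proof -
  let ?a = "(real n)\<^sup>2 * ((real n)\<^sup>2 - 1) / 12" and ?b = "real n ^ 6 / 24"
  let ?X = "(?a * (2 * \<gamma> ^ Suc (2 * 1) / real (Suc (2 * 1)))) * ((len - \<gamma>) / (4 * pi\<^sup>2))"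
  let ?Y = "len / (4 * pi\<^sup>2) * (?b * (2 * \<gamma> ^ Suc (2 * 2) / real (Suc (2 * 2))))"
  have n1: "1 \<le> (real n)\<^sup>2" using n_pos by simp
  have a0: "?a \<ge> 0" using n1 by (intro divide_nonneg_pos mult_nonneg_nonneg) auto
  have Y0: "?Y \<ge> 0" using \<gamma>_pos by simp
  have "ennreal ?X = ennreal (?a * (2 * \<gamma> ^ Suc (2 * 1) / real (Suc (2 * 1)))) * ennreal ((len - \<gamma>) / (4 * pi\<^sup>2))"
    by (rule ennreal_mult'[OF mult_nonneg_nonneg[OF a0]]) (use \<gamma>_pos in simp)
  also have "\<dots> = ennreal ((len - \<gamma>) / (4 * pi\<^sup>2)) * (\<integral>\<^sup>+d. indicator {-\<gamma>..\<gamma>} d * ennreal (?a * d ^ (2 * 1)) \<partial>lborel)"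
    unfolding even_power_integral[OF a0] by (rule mult.commute)
  also have "\<dots> \<le> (\<integral>\<^sup>+x. \<integral>\<^sup>+y. (if h x y then ennreal (?a * (x - y) ^ (2 * 1)) else 0) \<partial>unif \<partial>unif)"
    by (rule wnd_integral_ge) measurable
  also have "\<dots> \<le> (\<integral>\<^sup>+x. \<integral>\<^sup>+y. ennreal (gg x y) + (if h x y then ennreal (?b * (x - y) ^ (2 * 2)) else 0) \<partial>unif \<partial>unif)"
  proof (intro nn_integral_mono)
    fix x y
    have "?a * (x - y) ^ (2 * 1) \<le> pair_corr n (x - y) + ?b * (x - y) ^ (2 * 2)" using pair_corr_lower[of n "x - y"] by simp
    then have "ennreal (?a * (x - y) ^ (2 * 1)) \<le> ennreal (pair_corr n (x - y) + ?b * (x - y) ^ (2 * 2))" by (rule ennreal_leI)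
    also have "\<dots> = ennreal (pair_corr n (x - y)) + ennreal (?b * (x - y) ^ (2 * 2))"
      by (rule ennreal_plus[OF pair_corr_nonneg]) simp
    finally have "ennreal (?a * (x - y) ^ (2 * 1)) \<le> ennreal (pair_corr n (x - y)) + ennreal (?b * (x - y) ^ (2 * 2))" .
    then show "(if h x y then ennreal (?a * (x - y) ^ (2 * 1)) else 0) \<le> ennreal (gg x y) + (if h x y then ennreal (?b * (x - y) ^ (2 * 2)) else 0)"
      by (simp add: gg_def)
  qed
  also have "\<dots> = (\<integral>\<^sup>+x. \<integral>\<^sup>+y. ennreal (gg x y) \<partial>unif \<partial>unif) + (\<integral>\<^sup>+x. \<integral>\<^sup>+y. (if h x y then ennreal (?b * (x - y) ^ (2 * 2)) else 0) \<partial>unif \<partial>unif)"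
    by (rule nn_integral2_add) measurable
  also have "\<dots> \<le> ennreal (EN [Pr]) + ennreal (len / (4 * pi\<^sup>2)) * (\<integral>\<^sup>+d. indicator {-\<gamma>..\<gamma>} d * ennreal (?b * d ^ (2 * 2)) \<partial>lborel)"
    unfolding EN_Pr_nn[OF assms] by (intro add_left_mono wnd_integral_le) measurable
  also have "\<dots> = ennreal (EN [Pr]) + ennreal ?Y"
    by (subst even_power_integral) (simp_all add: ennreal_mult'[symmetric] del: power_Suc of_nat_Suc)
  also have "\<dots> = ennreal (EN [Pr] + ?Y)" using EN_nonneg Y0 by (rule ennreal_plus[symmetric])
  finally have "?X \<le> EN [Pr] + ?Y" using EN_nonneg[of "[Pr]"] Y0 by (subst (asm) ennreal_le_iff) auto
  moreover have "?Y \<le> 2 * mu * sc\<^sup>2"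
  proof -
    \<comment> \<open>The exact ratio is 72 / 240, from the integral of the fourth power compared
      with that of the square.\<close>
    have "?Y = 2 * mu * sc\<^sup>2 * (3 / 10)" by (simp add: mu_def sc_def field_simps eval_nat_numeral)
    also have "\<dots> \<le> 2 * mu * sc\<^sup>2 * 1" using mu_pos by (intro mult_left_mono) auto
    finally show ?thesis by simp
  qed
  moreover have "2 * mu - 2 * mu * (1 / real n + sc / Nn) \<le> ?X"
  proof -
    have g: "sc / Nn = \<gamma> / len" using n_pos len_pos by (simp add: sc_def Nn_def)
    have "?X = 2 * mu * ((1 - 1 / (real n)\<^sup>2) * (1 - \<gamma> / len))"
      using n_pos len_pos by (simp add: mu_def field_simps eval_nat_numeral)
    moreover have "1 - 1 / real n - \<gamma> / len \<le> (1 - 1 / (real n)\<^sup>2) * (1 - \<gamma> / len)"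
    proof -
      have "1 / (real n)\<^sup>2 \<le> 1 / real n" using n_pos by (intro divide_left_mono) (auto simp: power2_eq_square)
      moreover have "0 \<le> 1 / (real n)\<^sup>2 * (\<gamma> / len)" using \<gamma>_pos len_pos by simp
      moreover have "1 - z - v \<le> (1 - u) * (1 - v)" if "u \<le> z" "0 \<le> u * v" for u v z :: real
        using that by (simp add: algebra_simps)
      ultimately show ?thesis by blast
    qed
    ultimately have "2 * mu * (1 - 1 / real n - \<gamma> / len) \<le> ?X" using mu_pos by (simp add: mult_left_mono)
    then show ?thesis unfolding g by (simp add: algebra_simps)
  qed
  ultimately show ?thesis by (simp add: algebra_simps)
qed

section \<open>The decoupling error of one more pair\<close>

definition nr :: "real \<Rightarrow> complex \<Rightarrow> real \<Rightarrow> real" where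
  "nr \<delta> c x = indicator {x. norm (cis x - c) < \<delta>} x"

lemma nr_measurable:
  assumes "i < s" "j < s"
  shows "(\<lambda>t. nr \<delta> (cis (t j)) (t i)) \<in> borel_measurable (UP s)"
proof -
  have [measurable]: "(\<lambda>t. cis (t i)) \<in> borel_measurable (UP s)" "(\<lambda>t. cis (t j)) \<in> borel_measurable (UP s)"
    by (intro borel_measurable_cis measurable_UP_component assms)+
  have "(\<lambda>t. nr \<delta> (cis (t j)) (t i)) = (\<lambda>t. if norm (cis (t i) - cis (t j)) < \<delta> then 1 else 0)"
    by (auto simp: nr_def fun_eq_iff)
  then show ?thesis by simp
qed

lemma nr_borel [measurable (raw)]:
  assumes [measurable]: "f \<in> borel_measurable N"
  shows "(\<lambda>t. nr \<delta> c (f t)) \<in> borel_measurable N"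
proof -
  have "(\<lambda>t. nr \<delta> c (f t)) = (\<lambda>t. if norm (cis (f t) - c) < \<delta> then 1 else 0)" by (auto simp: nr_def fun_eq_iff)
  then show ?thesis by simp
qed

lemma nr_nonneg: "nr \<delta> c x \<ge> 0"
  by (simp add: nr_def)

text \<open>A bound for the relative decoupling error in terms of the first new point
  \<open>x\<close>: the constant \<open>e\<close> is the far contribution, and each anchor within
  distance \<open>\<delta>\<close> adds 3, enough to cover a trivial bound.\<close>

definition kernel :: "real \<Rightarrow> real \<Rightarrow> nat \<Rightarrow> (nat \<Rightarrow> complex) \<Rightarrow> real \<Rightarrow> real" where
  "kernel e \<delta> r c x = e + (\<Sum>i<r. 3 * nr \<delta> (c i) x)"

lemma kernel_nonneg: "e \<ge> 0 \<Longrightarrow> kernel e \<delta> r c x \<ge> 0"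
  unfolding kernel_def by (intro add_nonneg_nonneg sum_nonneg) (auto simp: nr_nonneg)

lemma kernel_cong: "(\<And>i. i < r \<Longrightarrow> c i = c' i) \<Longrightarrow> kernel e \<delta> r c x = kernel e \<delta> r c' x"
  by (simp add: kernel_def)

lemma kernel_borel: "(\<lambda>(x, y). ennreal (phi K x y * kernel e \<delta> r c x)) \<in> borel_measurable (borel \<Otimes>\<^sub>M borel)"
  unfolding kernel_def by measurable

lemma kernel_integral:
  assumes c: "\<And>i. norm (c i) = 1" and \<delta>: "\<delta> > 0" and e: "e \<ge> 0"
  shows "(\<integral>\<^sup>+x. \<integral>\<^sup>+y. ennreal (phi K x y * kernel e \<delta> r c x) \<partial>unif \<partial>unif) \<le> ennreal (e * cA K + real r * (3 * (cB K * (2 * \<delta>))))"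
proof (induction r)
  case 0
  have "(\<integral>\<^sup>+x. \<integral>\<^sup>+y. ennreal (phi K x y * kernel e \<delta> 0 c x) \<partial>unif \<partial>unif) = ennreal e * (\<integral>\<^sup>+x. \<integral>\<^sup>+y. ennreal (phi K x y) \<partial>unif \<partial>unif)"
  proof -
    interpret sigma_finite_measure unif by (rule sigma_finite_unif)
    have "(\<integral>\<^sup>+x. \<integral>\<^sup>+y. ennreal (phi K x y * kernel e \<delta> 0 c x) \<partial>unif \<partial>unif) = (\<integral>\<^sup>+x. \<integral>\<^sup>+y. ennreal e * ennreal (phi K x y) \<partial>unif \<partial>unif)"
      by (intro nn_integral_cong) (simp add: kernel_def ennreal_mult phi_nonneg e mult.commute)
    also have "\<dots> = (\<integral>\<^sup>+x. ennreal e * (\<integral>\<^sup>+y. ennreal (phi K x y) \<partial>unif) \<partial>unif)"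
      by (intro nn_integral_cong nn_integral_cmult) measurable
    also have "\<dots> = ennreal e * (\<integral>\<^sup>+x. \<integral>\<^sup>+y. ennreal (phi K x y) \<partial>unif \<partial>unif)"
      by (rule nn_integral_cmult) measurable
    finally show ?thesis .
  qed
  also have "\<dots> \<le> ennreal e * ennreal (cA K)" unfolding cA_def by (intro mult_left_mono phi_pair_integral) simp
  also have "\<dots> = ennreal (e * cA K)" using e cA_nonneg by (rule ennreal_mult[symmetric])
  finally show ?case by simp
next
  case (Suc r)
  let ?X = "3 * (cB K * (2 * \<delta>))"
  have X: "?X \<ge> 0" using \<delta> cB_nonneg by simp
  have "(\<integral>\<^sup>+x. \<integral>\<^sup>+y. ennreal (phi K x y * kernel e \<delta> (Suc r) c x) \<partial>unif \<partial>unif)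
     = (\<integral>\<^sup>+x. \<integral>\<^sup>+y. ennreal (phi K x y * kernel e \<delta> r c x) + ennreal 3 * (ennreal (phi K x y) * indicator {x. norm (cis x - c r) < \<delta>} x) \<partial>unif \<partial>unif)"
  proof (intro nn_integral_cong)
    fix x y
    have "phi K x y * kernel e \<delta> (Suc r) c x = phi K x y * kernel e \<delta> r c x + 3 * (phi K x y * nr \<delta> (c r) x)"
      by (simp add: kernel_def algebra_simps)
    also have "ennreal \<dots> = ennreal (phi K x y * kernel e \<delta> r c x) + ennreal (3 * (phi K x y * nr \<delta> (c r) x))"
      by (rule ennreal_plus) (auto intro!: mult_nonneg_nonneg phi_nonneg kernel_nonneg nr_nonneg e)
    also have "ennreal (3 * (phi K x y * nr \<delta> (c r) x)) = ennreal 3 * (ennreal (phi K x y) * ennreal (nr \<delta> (c r) x))"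
      by (subst ennreal_mult) (auto simp: ennreal_mult phi_nonneg nr_nonneg)
    also have "ennreal (nr \<delta> (c r) x) = indicator {x. norm (cis x - c r) < \<delta>} x" by (simp add: nr_def ennreal_indicator)
    finally show "ennreal (phi K x y * kernel e \<delta> (Suc r) c x) = ennreal (phi K x y * kernel e \<delta> r c x) + ennreal 3 * (ennreal (phi K x y) * indicator {x. norm (cis x - c r) < \<delta>} x)" .
  qed
  also have "\<dots> = (\<integral>\<^sup>+x. \<integral>\<^sup>+y. ennreal (phi K x y * kernel e \<delta> r c x) \<partial>unif \<partial>unif)
     + (\<integral>\<^sup>+x. \<integral>\<^sup>+y. ennreal 3 * (ennreal (phi K x y) * indicator {x. norm (cis x - c r) < \<delta>} x) \<partial>unif \<partial>unif)"
  proof (rule nn_integral2_add[OF kernel_borel])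
    have "{x. norm (cis x - c r) < \<delta>} \<in> sets borel" by (rule borel_open) (intro open_Collect_less continuous_intros)
    then have [measurable]: "(\<lambda>x. indicator {x. norm (cis x - c r) < \<delta>} x :: ennreal) \<in> borel_measurable borel" by simp
    show "(\<lambda>(x, y). ennreal 3 * (ennreal (phi K x y) * indicator {x. norm (cis x - c r) < \<delta>} x)) \<in> borel_measurable (borel \<Otimes>\<^sub>M borel)"
      by measurable
  qed
  also have "(\<integral>\<^sup>+x. \<integral>\<^sup>+y. ennreal 3 * (ennreal (phi K x y) * indicator {x. norm (cis x - c r) < \<delta>} x) \<partial>unif \<partial>unif) \<le> ennreal ?X"
  proof -
    interpret sigma_finite_measure unif by (rule sigma_finite_unif)
    have "{x. norm (cis x - c r) < \<delta>} \<in> sets borel" by (rule borel_open) (intro open_Collect_less continuous_intros)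
    then have [measurable]: "(\<lambda>x. indicator {x. norm (cis x - c r) < \<delta>} x :: ennreal) \<in> borel_measurable borel" by simp
    have "(\<integral>\<^sup>+x. \<integral>\<^sup>+y. ennreal 3 * (ennreal (phi K x y) * indicator {x. norm (cis x - c r) < \<delta>} x) \<partial>unif \<partial>unif)
       = (\<integral>\<^sup>+x. ennreal 3 * (\<integral>\<^sup>+y. ennreal (phi K x y) * indicator {x. norm (cis x - c r) < \<delta>} x \<partial>unif) \<partial>unif)"
      by (intro nn_integral_cong nn_integral_cmult) measurable
    also have "\<dots> = ennreal 3 * (\<integral>\<^sup>+x. \<integral>\<^sup>+y. ennreal (phi K x y) * indicator {x. norm (cis x - c r) < \<delta>} x \<partial>unif \<partial>unif)"
      by (rule nn_integral_cmult) measurable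
    also have "\<dots> \<le> ennreal 3 * ennreal (cB K * (2 * \<delta>))"
      unfolding cB_def by (intro mult_left_mono phi_near_integral c \<delta>) simp
    also have "\<dots> = ennreal ?X" using \<delta> cB_nonneg by (intro ennreal_mult[symmetric]) auto
    finally show ?thesis .
  qed
  also have "(\<integral>\<^sup>+x. \<integral>\<^sup>+y. ennreal (phi K x y * kernel e \<delta> r c x) \<partial>unif \<partial>unif) + ennreal ?X \<le> ennreal (e * cA K + real r * ?X) + ennreal ?X"
    by (rule add_right_mono[OF Suc.IH])
  also have "\<dots> = ennreal (e * cA K + real r * ?X + ?X)"
    by (rule ennreal_plus[symmetric]) (use X e cA_nonneg in \<open>auto intro!: add_nonneg_nonneg\<close>)
  also have "e * cA K + real r * ?X + ?X = e * cA K + real (Suc r) * ?X" by (simp add: algebra_simps)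
  finally show ?case by (simp add: add_mono)
qed

lemma anchor_less: "wvalid w \<Longrightarrow> i < wlen w \<Longrightarrow> anchor (wpar (Pr # w)) i < wlen w"
  using wpar_less[of w i] by (auto simp: anchor_def split: option.splits intro: less_trans)

text \<open>If all anchors are far from the new pair, \<open>rho_split\<close> applies with relative
  error \<open>(4 / L)\<^sup>2\<close>. Otherwise the difference is bounded without any
  cancellation, and the smallness comes later from the measure of near positions.\<close>

lemma split_pointwise:
  assumes v: "wvalid w" and L: "L > 0" and rel: "wrel h (Pr # w) t"
  defines "r \<equiv> wlen w"
  shows "\<bar>Re (rho n (Suc (Suc r)) (zc t)) - Re (rho n r (zc t)) * gg (t r) (t (Suc r))\<bar>
    \<le> fact (Suc (Suc r)) * real n ^ Suc (Suc r) * (wwt (real n) (Pr # w) t * kernel (16 / L\<^sup>2) (L / real n) r (\<lambda>i. cis (t (anchor (wpar (Pr # w)) i))) (t r))"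
proof -
  let ?par = "wpar (Pr # w)"
  let ?W = "wwt (real n) (Pr # w) t"
  let ?K = "fact (Suc (Suc r)) * real n ^ Suc (Suc r) :: real"
  let ?S = "\<Sum>i<r. 3 * nr (L / real n) (cis (t (anchor ?par i))) (t r)"
  have v': "wvalid (Pr # w)" using v by simp
  have relw: "wrel h w t" and hh: "h (t r) (t (Suc r))" using rel by (simp_all add: r_def)
  have W0: "?W \<ge> 0" by (rule wwt_nonneg)
  note nr0 = nr_nonneg
  have S0: "?S \<ge> 0" by (intro sum_nonneg) (simp add: nr0)
  have ggr: "gg (t r) (t (Suc r)) = Re (rho n 2 (zc (\<lambda>i. t (r + i))))" and gi: "Im (rho n 2 (zc (\<lambda>i. t (r + i)))) = 0"
    unfolding rho_2 using hh by (simp_all add: gg_def)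
  show ?thesis
  proof (cases "\<forall>i<r. L / real n \<le> norm (cis (t (anchor ?par i)) - cis (t r))")
    case True
    have "\<bar>Re (rho n (Suc (Suc r)) (zc t)) - Re (rho n r (zc t)) * gg (t r) (t (Suc r))\<bar>
       = \<bar>Re (rho n (Suc (Suc r)) (zc t) - rho n r (zc t) * rho n 2 (zc (\<lambda>i. t (r + i))))\<bar>"
      by (simp add: ggr gi)
    also have "\<dots> \<le> norm (rho n (Suc (Suc r)) (zc t) - rho n r (zc t) * rho n 2 (zc (\<lambda>i. t (r + i))))" by (rule abs_Re_le_cmod)
    also have "\<dots> \<le> fact (Suc (Suc r)) * ((4 / L)\<^sup>2 * (real n ^ Suc (Suc r) * (\<Prod>i<Suc (Suc r). (wt n ?par t i)\<^sup>2)))"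
    proof (rule rho_split[OF n_pos L])
      show "p < i" if "i < r" "?par i = Some p" for i p using wpar_less[OF v' that(2)] .
      show "?par r = None" "?par (Suc r) = Some r" by (simp_all add: r_def wpar_None)
    qed (use True in blast)
    also have "(\<Prod>i<Suc (Suc r). (wt n ?par t i)\<^sup>2) = ?W" using wwt_eq[OF v', of n t] rel by (simp add: r_def)
    also have "fact (Suc (Suc r)) * ((4 / L)\<^sup>2 * (real n ^ Suc (Suc r) * ?W)) = ?K * (?W * (16 / L\<^sup>2))"
      by (simp add: power_divide mult_ac)
    also have "\<dots> \<le> ?K * (?W * (16 / L\<^sup>2 + ?S))" using W0 S0 by (intro mult_left_mono) auto
    finally show ?thesis unfolding kernel_def .
  next
    case False
    \<comment> \<open>Near an anchor both terms are bounded separately by clustering. Their sum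
      costs 2, which the near part of \<open>kernel\<close>, at least 3 here, dominates.\<close>
    then obtain i where i: "i < r" "norm (cis (t r) - cis (t (anchor ?par i))) < L / real n" by (auto simp: norm_minus_commute not_le)
    have "3 * nr (L / real n) (cis (t (anchor ?par i))) (t r) \<le> ?S"
      by (rule member_le_sum) (use i nr0 in auto)
    then have S3: "3 \<le> ?S" using i(2) by (simp add: nr_def)
    have 1: "\<bar>Re (rho n (Suc (Suc r)) (zc t))\<bar> \<le> ?K * ?W"
      using order_trans[OF abs_Re_le_cmod rho_wwt_le[OF v' rel]] by (simp add: r_def)
    have "\<bar>Re (rho n r (zc t)) * gg (t r) (t (Suc r))\<bar> = \<bar>Re (rho n r (zc t))\<bar> * gg (t r) (t (Suc r))"
      using gg_nonneg by (simp add: abs_mult)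
    also have "\<dots> \<le> (fact r * real n ^ r * wwt (real n) w t) * ((real n)\<^sup>2 * phi (real n) (t r) (t (Suc r)))"
      using order_trans[OF abs_Re_le_cmod rho_wwt_le[OF v relw]] gg_le_phi gg_nonneg unfolding r_def
      by (intro mult_mono mult_nonneg_nonneg) (auto simp: wwt_nonneg)
    also have "\<dots> = fact r * real n ^ Suc (Suc r) * ?W" by (simp add: r_def power2_eq_square mult_ac)
    also have "\<dots> \<le> ?K * ?W"
      using W0 fact_mono[of r "Suc (Suc r)", where ?'a = real] by (intro mult_right_mono) auto
    finally have "\<bar>Re (rho n r (zc t)) * gg (t r) (t (Suc r))\<bar> \<le> ?K * ?W" .
    then have "\<bar>Re (rho n (Suc (Suc r)) (zc t)) - Re (rho n r (zc t)) * gg (t r) (t (Suc r))\<bar> \<le> ?K * ?W + ?K * ?W"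
      using 1 by linarith
    also have "\<dots> = ?K * (?W * 2)" by simp
    also have "\<dots> \<le> ?K * (?W * (16 / L\<^sup>2 + ?S))"
    proof -
      have "2 \<le> 16 / L\<^sup>2 + ?S" using S3 zero_le_divide_iff[of 16 "L\<^sup>2"] by (simp add: add_increasing)
      then show ?thesis using W0 by (intro mult_left_mono) auto
    qed
    finally show ?thesis unfolding kernel_def .
  qed
qed

text \<open>The product of expectations is an integral over the same variables, since the tuple and
  the new pair factorize there. The pointwise error is integrated over the new pair first, uniformly
  in the anchors, and then over the old tuple by the clustering bound.\<close>

lemma EN_split:
  assumes v: "wvalid w" and L: "L > 0" and len: "Suc (Suc (wlen w)) \<le> n"
  shows "\<bar>EN (Pr # w) - EN w * EN [Pr]\<bar> \<le> fact (Suc (Suc (wlen w))) * real n ^ Suc (Suc (wlen w)) *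
     (cA (real n) ^ prs w * cB (real n) ^ ats w * (16 / L\<^sup>2 * cA (real n) + real (wlen w) * (3 * (cB (real n) * (2 * (L / real n))))))"
proof -
  define r where "r = wlen w"
  have v': "wvalid (Pr # w)" and l': "wlen (Pr # w) \<le> n" using v len by simp_all
  let ?M = "UP (Suc (Suc r))"
  interpret U: prob_space ?M by (rule prob_space_UP)
  define f1 where "f1 t = (if wrel h (Pr # w) t then Re (rho n (Suc (Suc r)) (zc t)) else 0)" for t
  define F where "F t = (if wrel h w t then Re (rho n r (zc t)) else 0)" for t
  define f2 where "f2 t = F t * gg (t r) (t (Suc r))" for t
  have e1: "EN (Pr # w) = (\<integral>t. f1 t \<partial>?M)" and i1: "integrable ?M f1"
    using EN_eq[OF v' l'] unfolding f1_def[abs_def] r_def by (simp_all only: wlen.simps)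
  obtain C where C: "\<And>t. norm (rho n r (zc t)) \<le> C" using bounded_rho by blast
  have C0: "0 \<le> C" by (rule order_trans[OF norm_ge_zero C])
  have b2: "norm (f2 t) \<le> C * (2 * (real n)\<^sup>2)" for t
  proof -
    have "\<bar>F t\<bar> \<le> C" using order_trans[OF abs_Re_le_cmod C] C0 by (simp add: F_def)
    then show ?thesis unfolding f2_def real_norm_def abs_mult using gg_nonneg gg_le C0 by (intro mult_mono) auto
  qed
  have "(\<lambda>t. Re (rho n r (zc t))) \<in> borel_measurable ?M" using measurable_rho_le[of r "Suc (Suc r)" n] by simp
  moreover have "Measurable.pred ?M (wrel h w)" using measurable_wrel[OF v] by (simp add: r_def)
  ultimately have "F \<in> borel_measurable ?M" unfolding F_def by (intro measurable_If) (auto simp: pred_def)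
  then have m2: "f2 \<in> borel_measurable ?M" unfolding f2_def by (intro borel_measurable_times measurable_gg_UP) auto
  have "(\<integral>t. f2 t \<partial>?M) = (\<integral>t. F t \<partial>UP r) * (\<integral>x. \<integral>y. gg x y \<partial>unif \<partial>unif)"
  proof (rule integral_UP_pair[OF m2 b2])
    fix t x y
    have "wrel h w (t(r := x, Suc r := y)) = wrel h w t" by (rule wrel_cong[OF v]) (simp add: r_def)
    moreover have "rho n r (zc (t(r := x, Suc r := y))) = rho n r (zc t)" by (rule rho_cong) simp
    ultimately show "f2 (t(r := x, Suc r := y)) = F t * gg x y" by (simp add: f2_def F_def)
  qed
  also have "(\<integral>t. F t \<partial>UP r) = EN w" using EN_eq(1)[OF v] len unfolding F_def r_def by simp
  also have "(\<integral>x. \<integral>y. gg x y \<partial>unif \<partial>unif) = EN [Pr]" using EN_Pr_integral len by simp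
  finally have e2: "EN w * EN [Pr] = (\<integral>t. f2 t \<partial>?M)" by simp
  have i2: "integrable ?M f2" using b2 by (intro U.integrable_const_bound[OF _ m2]) auto
  let ?K = "fact (Suc (Suc r)) * real n ^ Suc (Suc r) :: real"
  let ?d = "L / real n"
  let ?c = "\<lambda>t i. cis (t (anchor (wpar (Pr # w)) i))"
  let ?e = "16 / L\<^sup>2"
  let ?g = "\<lambda>t. ?K * (wwt (real n) (Pr # w) t * kernel ?e ?d r (?c t) (t r))"
  let ?B = "16 / L\<^sup>2 * cA (real n) + real r * (3 * (cB (real n) * (2 * ?d)))"
  let ?Q = "cA (real n) ^ prs w * cB (real n) ^ ats w"
  have d: "?d > 0" using L n_pos by simp
  have e0: "?e \<ge> 0" by simp
  have rl: "anchor (wpar (Pr # w)) i < r" if "i < r" for i using anchor_less[OF v] that by (simp add: r_def)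
  have B0: "?B \<ge> 0" using d by (intro add_nonneg_nonneg mult_nonneg_nonneg cA_nonneg cB_nonneg) auto
  have "\<bar>\<integral>t. f1 t - f2 t \<partial>?M\<bar> \<le> ?K * ?Q * ?B"
  proof (rule abs_integral_le[of _ _ ?g])
    show "integrable ?M (\<lambda>t. f1 t - f2 t)" using i1 i2 by (rule Bochner_Integration.integrable_diff)
    show "\<bar>f1 t - f2 t\<bar> \<le> ?g t" for t
    proof (cases "wrel h (Pr # w) t")
      case True
      then show ?thesis using split_pointwise[OF v L True] by (simp add: f1_def f2_def F_def r_def)
    next
      case False
      then have "f2 t = 0" by (auto simp: f2_def F_def gg_def r_def)
      moreover have "f1 t = 0" using False by (simp only: f1_def if_False)
      ultimately have "\<bar>f1 t - f2 t\<bar> = 0" by simp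
      also have "0 \<le> ?g t" by (intro mult_nonneg_nonneg wwt_nonneg kernel_nonneg e0) auto
      finally show ?thesis .
    qed
    have "(\<integral>\<^sup>+t. ennreal (?g t) \<partial>?M) \<le> (\<integral>\<^sup>+t. ennreal (?K * wwt (real n) w t) \<partial>UP r) * ennreal ?B"
    proof (rule nn_integral_UP_pair_le[where G = "\<lambda>t x y. ennreal (phi (real n) x y * kernel ?e ?d r (?c t) x)"])
      have 1: "wwt (real n) (Pr # w) \<in> borel_measurable ?M" using measurable_wwt[OF v', of "Suc (Suc r)"] by (simp add: r_def)
      have "(\<lambda>t. nr ?d (?c t i) (t r)) \<in> borel_measurable ?M" if "i < r" for i
        by (rule nr_measurable) (use rl[OF that] in auto)
      then have "(\<lambda>t. kernel ?e ?d r (?c t) (t r)) \<in> borel_measurable ?M"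
        unfolding kernel_def by (intro borel_measurable_add borel_measurable_sum borel_measurable_times borel_measurable_const) auto
      with 1 have "?g \<in> borel_measurable ?M" by (intro borel_measurable_times borel_measurable_const)
      then show "(\<lambda>t. ennreal (?g t)) \<in> borel_measurable ?M" by (rule measurable_compose[OF _ measurable_ennreal])
      have "(\<lambda>t. ?K * wwt (real n) w t) \<in> borel_measurable (UP r)"
        using measurable_wwt[OF v, of r "real n"] by (intro borel_measurable_times borel_measurable_const) (simp add: r_def)
      then show "(\<lambda>t. ennreal (?K * wwt (real n) w t)) \<in> borel_measurable (UP r)" by (rule measurable_compose[OF _ measurable_ennreal])
      show "(\<lambda>(x, y). ennreal (phi (real n) x y * kernel ?e ?d r (?c t) x)) \<in> borel_measurable (borel \<Otimes>\<^sub>M borel)" for t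
        by (rule kernel_borel)
      show "ennreal (?g (t(r := x, Suc r := y))) = ennreal (?K * wwt (real n) w t) * ennreal (phi (real n) x y * kernel ?e ?d r (?c t) x)" for t x y
      proof -
        have "wwt (real n) (Pr # w) (t(r := x, Suc r := y)) = wwt (real n) w t * phi (real n) x y"
          by (simp add: r_def wwt_upd[OF v])
        moreover have "kernel ?e ?d r (?c (t(r := x, Suc r := y))) ((t(r := x, Suc r := y)) r) = kernel ?e ?d r (?c t) x"
        proof -
          have "?c (t(r := x, Suc r := y)) i = ?c t i" if "i < r" for i using rl[OF that] by (simp del: wpar.simps)
          then have "kernel ?e ?d r (?c (t(r := x, Suc r := y))) x = kernel ?e ?d r (?c t) x" by (rule kernel_cong)
          moreover have "(t(r := x, Suc r := y)) r = x" by simp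
          ultimately show ?thesis by (simp only:)
        qed
        ultimately have "?g (t(r := x, Suc r := y)) = (?K * wwt (real n) w t) * (phi (real n) x y * kernel ?e ?d r (?c t) x)"
          by (simp only: mult.assoc)
        then show ?thesis
          by (simp only:) (rule ennreal_mult, auto intro!: mult_nonneg_nonneg wwt_nonneg phi_nonneg kernel_nonneg)
      qed
      show "(\<integral>\<^sup>+x. \<integral>\<^sup>+y. ennreal (phi (real n) x y * kernel ?e ?d r (?c t) x) \<partial>unif \<partial>unif) \<le> ennreal ?B" for t
        by (rule kernel_integral) (use d in auto)
    qed
    also have "\<dots> \<le> ennreal ?K * ennreal ?Q * ennreal ?B"
    proof (rule mult_right_mono)
      have "(\<integral>\<^sup>+t. ennreal (?K * wwt (real n) w t) \<partial>UP r) = ennreal ?K * (\<integral>\<^sup>+t. ennreal (wwt (real n) w t) \<partial>UP r)"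
        using measurable_wwt[OF v, of r "real n"] by (subst nn_integral_cmult[symmetric]) (simp_all add: ennreal_mult wwt_nonneg r_def)
      also have "\<dots> \<le> ennreal ?K * ennreal ?Q" using nn_integral_wwt[OF v, of "real n"] unfolding r_def by (rule mult_left_mono) simp
      finally show "(\<integral>\<^sup>+t. ennreal (?K * wwt (real n) w t) \<partial>UP r) \<le> ennreal ?K * ennreal ?Q" .
    qed simp
    also have "\<dots> = ennreal (?K * ?Q * ?B)"
    proof -
      have 0: "0 \<le> ?K" "0 \<le> ?Q" by (simp_all add: cA_nonneg cB_nonneg)
      show ?thesis unfolding ennreal_mult[OF 0, symmetric] by (rule ennreal_mult[OF mult_nonneg_nonneg[OF 0] B0, symmetric])
    qed
    finally show "(\<integral>\<^sup>+t. ennreal (?g t) \<partial>?M) \<le> ennreal (?K * ?Q * ?B)" .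
    show "0 \<le> ?K * ?Q * ?B" using B0 by (intro mult_nonneg_nonneg) (auto simp: cA_nonneg cB_nonneg)
  qed
  also have "(\<integral>t. f1 t - f2 t \<partial>?M) = EN (Pr # w) - EN w * EN [Pr]"
    unfolding e1 e2 by (rule Bochner_Integration.integral_diff[OF i1 i2])
  finally show ?thesis by (simp add: r_def mult.assoc)
qed

end

text \<open>In \<open>EN_pairs_step\<close> the far contribution gives \<open>384 = 16 * 24\<close>
  and the near one \<open>27648 = 12 * 2304\<close>, where \<open>2304 = 144 * 16\<close> uses
  \<open>pi\<^sup>2 \<le> 16\<close>. The other factors are the clustering constants of the
  tuple.\<close>

definition split_const :: "nat \<Rightarrow> real" where
  "split_const c = fact (2 * c + 2) * 24 ^ c * (384 + 27648 * real c)"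

text \<open>The summands follow the telescoping in \<open>EN_pairs_close_aux\<close>: decoupling the
  last pair, replacing its expectation by \<open>2 * mu\<close>, and the error inherited from the
  shorter tuple.\<close>

fun pairs_const :: "nat \<Rightarrow> real" where
  "pairs_const 0 = 0"
| "pairs_const (Suc c) = split_const c + 2 * fact (2 * c) * 24 ^ c + 2 * pairs_const c"

text \<open>The factors come, in this order, from the determinant bound, the \<open>Pr\<close>
  steps, the \<open>At\<close> steps (\<open>attach_weight_le\<close>) and the mixed powers of the
  mean (\<open>mu_mixed_le\<close>).\<close>

definition attach_const :: "nat \<Rightarrow> real" where
  "attach_const k = fact (2 * k) * 24 ^ k * 2304 ^ k * 2 ^ k"

lemma split_const_nonneg: "split_const c \<ge> 0"
  by (simp add: split_const_def)

lemma pairs_const_nonneg: "pairs_const c \<ge> 0"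
  by (induction c) (auto simp: split_const_nonneg)

lemma attach_const_nonneg: "attach_const k \<ge> 0"
  by (simp add: attach_const_def)

lemma prs_pairs [simp]: "prs (replicate c Pr) = c" and ats_pairs [simp]: "ats (replicate c Pr) = 0"
  by (induction c) auto

lemma wcount_Nil [simp]: "wcount n R [] = 1"
proof -
  have "wlists n R [] = {[]}" by (auto simp: wlists_def inj_lists_def)
  then show ?thesis by (simp add: wcount_def)
qed

lemma wcount_single_Pr: "wcount n R [Pr] = real (card (opairs n R))"
proof -
  have "wlists n R [] = {[]}" by (auto simp: wlists_def inj_lists_def)
  then show ?thesis using wcount_Pr[of "[]" n R] by simp
qed

section \<open>Asymptotics of pair counts and moments\<close>

context haar_window
begin

definition eta :: real where "eta = Nn powr (-(2/3))"
definition eps :: real where "eps = 1 / real n + sc\<^sup>2 + (sc\<^sup>2) ^ 3 + eta"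

lemma eta_pos: "eta > 0"
  using Nn_pos by (simp add: eta_def)

lemma eps_ge: "1 / real n + sc\<^sup>2 + eta \<le> eps" "eta \<le> eps" "sc\<^sup>2 \<le> eps" "0 \<le> eps"
proof -
  have "0 \<le> (sc\<^sup>2) ^ 3" "0 \<le> 1 / real n" "0 \<le> sc\<^sup>2" by auto
  then show "1 / real n + sc\<^sup>2 + eta \<le> eps" "eta \<le> eps" "sc\<^sup>2 \<le> eps" "0 \<le> eps"
    using eta_pos unfolding eps_def by linarith+
qed

lemma pow_cA: "real n ^ (2 * c) * cA (real n) ^ c = (24 * mu) ^ c"
  unfolding power_mult power_mult_distrib[symmetric] cA_mu by simp

lemma EN_pairs_le: "2 * c \<le> n \<Longrightarrow> EN (replicate c Pr) \<le> fact (2 * c) * 24 ^ c * mu ^ c"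
  using EN_le[of "replicate c Pr"] pow_cA[of c] by (simp add: mult.assoc power_mult_distrib)

lemma EN_pairs_step:
  assumes c: "2 * Suc c \<le> n"
  shows "\<bar>EN (replicate (Suc c) Pr) - EN (replicate c Pr) * EN [Pr]\<bar> \<le> split_const c * eta * mu ^ Suc c"
proof -
  \<comment> \<open>With this cutoff the far error \<open>1 / L\<^sup>2\<close> and the near error
    \<open>L / Nn\<close> both equal \<open>eta\<close>.\<close>
  define L where "L = Nn powr (1/3)"
  have L: "L > 0" using Nn_pos by (simp add: L_def)
  have L2: "1 / L\<^sup>2 = eta"
    using Nn_pos by (simp add: L_def eta_def power2_eq_square powr_add[symmetric] powr_minus_divide)
  have "L * (real n * cB (real n)) \<le> 2304 * mu * eta"
  proof -
    have "sc\<^sup>2 * min sc Nn \<le> sc\<^sup>2 * sc" by (intro mult_left_mono) auto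
    also have "\<dots> = 144 * pi\<^sup>2 * mu / Nn" using sc_cube Nn_pos by (simp add: field_simps power2_eq_square power3_eq_cube)
    also have "\<dots> \<le> 2304 * mu / Nn" using mu_pos Nn_pos pi_sq_le by (intro divide_right_mono mult_right_mono) auto
    finally have "L * (real n * cB (real n)) \<le> L * (2304 * mu / Nn)" unfolding cB_eq using L by (intro mult_left_mono) auto
    also have "L * (2304 * mu / Nn) = 2304 * mu * (L / Nn)" by simp
    also have "L / Nn = eta"
    proof -
      have "Nn powr (-(2/3)) = Nn powr (1/3 - 1)" by simp
      also have "\<dots> = Nn powr (1/3) / Nn powr 1" by (rule powr_diff)
      finally show ?thesis using Nn_pos by (simp add: eta_def L_def)
    qed
    finally show ?thesis .
  qed
  then have B: "12 * real c * (L * (real n * cB (real n))) \<le> 12 * real c * (2304 * mu * eta)" by (intro mult_left_mono) auto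
  have "\<bar>EN (replicate (Suc c) Pr) - EN (replicate c Pr) * EN [Pr]\<bar>
     \<le> fact (Suc (Suc (2 * c))) * real n ^ Suc (Suc (2 * c)) * (cA (real n) ^ c * (16 / L\<^sup>2 * cA (real n) + real (2 * c) * (3 * (cB (real n) * (2 * (L / real n))))))"
    using EN_split[of "replicate c Pr" L] L c by simp
  also have "\<dots> = fact (2 * c + 2) * ((real n ^ (2 * c) * cA (real n) ^ c) * (16 * (1 / L\<^sup>2) * ((real n)\<^sup>2 * cA (real n)) + 12 * real c * (L * (real n * cB (real n)))))"
    using n_pos by (simp add: field_simps power2_eq_square del: fact_Suc)
  also have "\<dots> = fact (2 * c + 2) * ((24 * mu) ^ c * (16 * eta * (24 * mu) + 12 * real c * (L * (real n * cB (real n)))))"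
    unfolding pow_cA L2 cA_mu ..
  also have "\<dots> \<le> fact (2 * c + 2) * ((24 * mu) ^ c * (16 * eta * (24 * mu) + 12 * real c * (2304 * mu * eta)))"
    using mu_pos by (intro mult_left_mono add_left_mono B) auto
  also have "\<dots> = split_const c * eta * mu ^ Suc c" by (simp add: split_const_def power_mult_distrib algebra_simps del: fact_Suc)
  finally show ?thesis .
qed

text \<open>In the regime \<open>sc \<le> 1 \<le> Nn\<close> the boundary loss
  \<open>sc / Nn\<close> is at most \<open>1 / Nn\<close> and hence at most
  \<open>eta\<close>.\<close>

lemma EN_Pr_close:
  assumes "2 \<le> n" "1 \<le> Nn" "sc \<le> 1"
  shows "\<bar>EN [Pr] - 2 * mu\<bar> \<le> 2 * mu * eps"
proof -
  have "sc / Nn \<le> 1 / Nn" using assms by (intro divide_right_mono) auto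
  also have "\<dots> = Nn powr (-1)" using Nn_pos by (simp add: powr_minus_divide)
  also have "\<dots> \<le> eta" unfolding eta_def using assms by (intro powr_mono) auto
  finally have "1 / real n + sc\<^sup>2 + sc / Nn \<le> eps" using eps_ge(1) by linarith
  then have "2 * mu * (1 / real n + sc\<^sup>2 + sc / Nn) \<le> 2 * mu * eps" using mu_pos by (intro mult_left_mono) auto
  then show ?thesis using EN_Pr_lower[OF assms(1)] EN_Pr_upper[OF assms(1)] by linarith
qed

lemma EN_Nil: "EN [] = 1"
  using prob_space.prob_space[OF prob_space_M] by (simp add: EN_def)

text \<open>The pairs are split off one at a time, and each of the three errors made in a step is of
  size \<open>eps\<close> times the full power of \<open>mu\<close>.\<close>

lemma EN_pairs_close_aux:
  assumes "1 \<le> Nn" "sc \<le> 1"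
  shows "2 * c \<le> n \<Longrightarrow> \<bar>EN (replicate c Pr) - (2 * mu) ^ c\<bar> \<le> pairs_const c * eps * mu ^ c"
proof (induction c)
  case 0
  then show ?case by (simp add: EN_Nil)
next
  case (Suc c)
  let ?J = "EN (replicate c Pr)"
  have c: "2 * c \<le> n" "2 \<le> n" using Suc.prems by auto
  have a: "\<bar>EN (replicate (Suc c) Pr) - ?J * EN [Pr]\<bar> \<le> split_const c * eps * mu ^ Suc c"
    using EN_pairs_step[OF Suc.prems] mult_right_mono[OF mult_left_mono[OF eps_ge(2) split_const_nonneg[of c]], of "mu ^ Suc c"] mu_pos by simp
  have "\<bar>?J * (EN [Pr] - 2 * mu)\<bar> \<le> (fact (2 * c) * 24 ^ c * mu ^ c) * (2 * mu * eps)"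
    unfolding abs_mult using EN_pairs_le[OF c(1)] EN_nonneg EN_Pr_close[OF c(2) assms] mu_pos by (intro mult_mono) (auto simp: less_imp_le)
  then have b: "\<bar>?J * (EN [Pr] - 2 * mu)\<bar> \<le> 2 * fact (2 * c) * 24 ^ c * eps * mu ^ Suc c" by (simp add: mult_ac)
  have "\<bar>2 * mu * (?J - (2 * mu) ^ c)\<bar> \<le> 2 * mu * (pairs_const c * eps * mu ^ c)"
    unfolding abs_mult using Suc.IH[OF c(1)] mu_pos by (intro mult_mono) auto
  then have d: "\<bar>2 * mu * (?J - (2 * mu) ^ c)\<bar> \<le> 2 * pairs_const c * eps * mu ^ Suc c" by (simp add: mult_ac)
  have "EN (replicate (Suc c) Pr) - (2 * mu) ^ Suc c
     = (EN (replicate (Suc c) Pr) - ?J * EN [Pr]) + ?J * (EN [Pr] - 2 * mu) + 2 * mu * (?J - (2 * mu) ^ c)"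
    by (simp add: algebra_simps)
  then have "\<bar>EN (replicate (Suc c) Pr) - (2 * mu) ^ Suc c\<bar>
     \<le> \<bar>EN (replicate (Suc c) Pr) - ?J * EN [Pr]\<bar> + \<bar>?J * (EN [Pr] - 2 * mu)\<bar> + \<bar>2 * mu * (?J - (2 * mu) ^ c)\<bar>"
    by linarith
  also have "\<dots> \<le> split_const c * eps * mu ^ Suc c + 2 * fact (2 * c) * 24 ^ c * eps * mu ^ Suc c + 2 * pairs_const c * eps * mu ^ Suc c"
    by (intro add_mono a b d)
  also have "\<dots> = pairs_const (Suc c) * eps * mu ^ Suc c" by (simp only: pairs_const.simps distrib_right)
  finally show ?case .
qed

text \<open>Outside the regime \<open>sc \<le> 1 \<le> Nn\<close> one of \<open>eta\<close> and
  \<open>sc\<^sup>2\<close> is at least 1. Then \<open>eps \<ge> 1\<close>, and the claim follows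
  from the crude upper bounds for both terms.\<close>

lemma EN_pairs_close:
  assumes c: "2 * c \<le> n"
  shows "\<bar>EN (replicate c Pr) - (2 * mu) ^ c\<bar> \<le> (pairs_const c + fact (2 * c) * 24 ^ c + 2 ^ c) * eps * mu ^ c"
proof (cases "1 \<le> Nn \<and> sc \<le> 1")
  case True
  then have "\<bar>EN (replicate c Pr) - (2 * mu) ^ c\<bar> \<le> pairs_const c * eps * mu ^ c" using EN_pairs_close_aux c by blast
  also have "\<dots> \<le> (pairs_const c + fact (2 * c) * 24 ^ c + 2 ^ c) * eps * mu ^ c"
    using mu_pos eps_ge(4) by (intro mult_right_mono) auto
  finally show ?thesis .
next
  case False
  have e1: "1 \<le> eps"
  proof (cases "1 \<le> Nn")
    case True
    then have "1\<^sup>2 \<le> sc\<^sup>2" using False by (intro power_mono) auto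
    then show ?thesis using eps_ge(3) by simp
  next
    case False
    then have "Nn powr 0 \<le> eta" unfolding eta_def using Nn_pos by (intro powr_mono') auto
    then show ?thesis using eps_ge(2) Nn_pos by simp
  qed
  have m: "0 \<le> mu ^ c" using mu_pos by simp
  have "\<bar>EN (replicate c Pr) - (2 * mu) ^ c\<bar> \<le> EN (replicate c Pr) + (2 * mu) ^ c"
    using EN_nonneg[of "replicate c Pr"] mu_pos by (simp add: abs_le_iff)
  also have "\<dots> \<le> fact (2 * c) * 24 ^ c * mu ^ c + 2 ^ c * mu ^ c"
    using EN_pairs_le[OF c] by (simp add: power_mult_distrib)
  also have "\<dots> = (fact (2 * c) * 24 ^ c + 2 ^ c) * 1 * mu ^ c" by (simp add: distrib_right)
  also have "\<dots> \<le> (pairs_const c + fact (2 * c) * 24 ^ c + 2 ^ c) * eps * mu ^ c"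
    using e1 pairs_const_nonneg[of c] m by (intro mult_right_mono mult_mono) auto
  finally show ?thesis .
qed

definition musum :: "nat \<Rightarrow> real" where "musum k = (\<Sum>j=1..k. mu ^ j)"

lemma musum_nonneg: "musum k \<ge> 0"
  unfolding musum_def using mu_pos by (intro sum_nonneg) auto

text \<open>Depending on whether \<open>mu\<close> exceeds 1, the power of \<open>1 + mu\<close> is
  controlled by its constant or its leading term. The factor \<open>mu ^ p\<close> with
  \<open>p \<ge> 1\<close> keeps out a constant term, which \<open>musum\<close> does not
  contain.\<close>

lemma mu_mixed_le:
  assumes "1 \<le> p" "1 \<le> q" "p + q \<le> k"
  shows "mu ^ p * (1 + mu) ^ q \<le> 2 ^ k * musum k"
proof -
  have "(1 + mu) ^ q \<le> 2 ^ q * (1 + mu ^ q)"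
  proof (cases "mu \<le> 1")
    case True
    then have "(1 + mu) ^ q \<le> 2 ^ q" using mu_pos by (intro power_mono) auto
    also have "\<dots> \<le> 2 ^ q * (1 + mu ^ q)" using mu_pos by simp
    finally show ?thesis .
  next
    case False
    then have "(1 + mu) ^ q \<le> (2 * mu) ^ q" using mu_pos by (intro power_mono) auto
    also have "\<dots> \<le> 2 ^ q * (1 + mu ^ q)" by (simp add: power_mult_distrib)
    finally show ?thesis .
  qed
  then have "mu ^ p * (1 + mu) ^ q \<le> mu ^ p * (2 ^ q * (1 + mu ^ q))" using mu_pos by (intro mult_left_mono) auto
  also have "\<dots> = 2 ^ q * (\<Sum>j\<in>{p, p + q}. mu ^ j)" using assms by (simp add: power_add algebra_simps)
  also have "\<dots> \<le> 2 ^ k * musum k"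
  proof (rule mult_mono)
    show "(\<Sum>j\<in>{p, p + q}. mu ^ j) \<le> musum k" unfolding musum_def using assms mu_pos by (intro sum_mono2) auto
    show "(2::real) ^ q \<le> 2 ^ k" using assms by (intro power_increasing) auto
  qed (use mu_pos in \<open>auto intro!: sum_nonneg\<close>)
  finally show ?thesis .
qed

text \<open>One factor \<open>sc\<^sup>2\<close> is set aside as the gain from a shared point. The
  remaining factors \<open>min sc Nn\<close> and \<open>sc\<^sup>2 * min sc Nn\<close> are at most
  \<open>1 + sc ^ 3 * Nn\<close>, hence of order \<open>1 + mu\<close>; which side of the minimum
  serves depends on the sizes of \<open>sc\<close> and \<open>Nn\<close>.\<close>

lemma attach_weight_le:
  assumes "1 \<le> q"
  shows "(sc\<^sup>2 * min sc Nn) ^ q \<le> sc\<^sup>2 * (2304 ^ q * (1 + mu) ^ q)"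
proof -
  let ?T = "sc ^ 3 * Nn"
  let ?v = "min sc Nn"
  have T0: "0 \<le> ?T" and v0: "0 \<le> ?v" using sc_pos Nn_pos by auto
  have "?T \<le> 2304 * mu"
    unfolding sc_cube using mult_right_mono[OF pi_sq_le, of "144 * mu"] mu_pos by (simp add: mult_ac)
  then have T: "1 + ?T \<le> 2304 * (1 + mu)" by simp
  have v: "?v \<le> 1 + ?T"
  proof (cases "1 \<le> sc \<and> 1 \<le> Nn")
    case True
    have "sc * 1 \<le> sc * sc\<^sup>2" using True by (intro mult_left_mono) (auto simp: one_le_power)
    also have "\<dots> \<le> sc * sc\<^sup>2 * Nn" using mult_left_mono[of 1 Nn "sc * sc\<^sup>2"] True sc_pos by simp
    finally show ?thesis by (simp add: power3_eq_cube power2_eq_square)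
  next
    case False
    then show ?thesis using T0 by auto
  qed
  have sv: "sc\<^sup>2 * ?v \<le> 1 + ?T"
  proof (cases "sc \<le> 1")
    case True
    have "sc\<^sup>2 * ?v \<le> 1 * 1" using True sc_pos v0 by (intro mult_mono power_le_one) auto
    then show ?thesis using T0 by simp
  next
    case False
    have "sc\<^sup>2 * ?v \<le> sc\<^sup>2 * Nn" by (intro mult_left_mono) auto
    also have "\<dots> \<le> sc * (sc\<^sup>2 * Nn)" using False Nn_pos mult_right_mono[of 1 sc "sc\<^sup>2 * Nn"] by simp
    finally show ?thesis by (simp add: power3_eq_cube power2_eq_square)
  qed
  obtain p where q: "q = Suc p" using assms by (cases q) auto
  have "(sc\<^sup>2 * ?v) ^ q = sc\<^sup>2 * (?v * (sc\<^sup>2 * ?v) ^ p)" by (simp add: q)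
  also have "\<dots> \<le> sc\<^sup>2 * ((1 + ?T) * (1 + ?T) ^ p)"
    using v0 T0 by (intro mult_left_mono mult_mono v power_mono sv) auto
  also have "\<dots> = sc\<^sup>2 * (1 + ?T) ^ q" by (simp add: q)
  also have "\<dots> \<le> sc\<^sup>2 * (2304 * (1 + mu)) ^ q" using T T0 by (intro mult_left_mono power_mono) auto
  finally show ?thesis unfolding power_mult_distrib[of 2304 "1 + mu"] .
qed

lemma EN_attach_le:
  assumes "wvalid w" "1 \<le> prs w" "1 \<le> ats w" "prs w + ats w \<le> k" "2 * k \<le> n"
  shows "EN w \<le> attach_const k * sc\<^sup>2 * musum k"
proof -
  let ?p = "prs w" and ?q = "ats w"
  have wl: "wlen w \<le> 2 * k" using assms by (simp add: wlen_prs_ats)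
  have "EN w \<le> fact (wlen w) * real n ^ wlen w * (cA (real n) ^ ?p * cB (real n) ^ ?q)"
    using EN_le[OF assms(1)] wl assms(5) by simp
  also have "\<dots> = fact (wlen w) * ((real n ^ (2 * ?p) * cA (real n) ^ ?p) * (real n * cB (real n)) ^ ?q)"
    unfolding wlen_prs_ats power_add power_mult_distrib by (simp only: mult_ac)
  also have "\<dots> = fact (wlen w) * ((24 * mu) ^ ?p * (sc\<^sup>2 * min sc Nn) ^ ?q)" unfolding pow_cA cB_eq ..
  also have "\<dots> \<le> fact (wlen w) * ((24 * mu) ^ ?p * (sc\<^sup>2 * (2304 ^ ?q * (1 + mu) ^ ?q)))"
    using mu_pos by (intro mult_left_mono attach_weight_le assms) auto
  also have "\<dots> = fact (wlen w) * 24 ^ ?p * 2304 ^ ?q * sc\<^sup>2 * (mu ^ ?p * (1 + mu) ^ ?q)"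
    by (simp add: power_mult_distrib mult_ac)
  also have "\<dots> \<le> fact (2 * k) * 24 ^ k * 2304 ^ k * sc\<^sup>2 * (2 ^ k * musum k)"
  proof (rule mult_mono)
    show "fact (wlen w) * 24 ^ ?p * 2304 ^ ?q * sc\<^sup>2 \<le> fact (2 * k) * 24 ^ k * 2304 ^ k * sc\<^sup>2"
      using assms wl by (intro mult_right_mono mult_mono fact_mono power_increasing mult_nonneg_nonneg) auto
    show "mu ^ ?p * (1 + mu) ^ ?q \<le> 2 ^ k * musum k" by (rule mu_mixed_le[OF assms(2-4)])
  qed (use mu_pos in auto)
  finally show ?thesis by (simp add: attach_const_def mult_ac)
qed

lemma integrable_opairs_power:
  assumes "wvalid w" "wlen w \<le> n" "2 \<le> n"
  shows "integrable M (\<lambda>U. real (card (opairs n (rel U))) ^ i * wcount n (rel U) w)"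
proof -
  interpret prob_space M by (rule prob_space_M)
  have "(\<lambda>U. real (card (opairs n (rel U)))) \<in> borel_measurable M"
    unfolding wcount_single_Pr[symmetric] using EN_integrable[of "[Pr]"] assms by auto
  moreover have "(\<lambda>U. wcount n (rel U) w) \<in> borel_measurable M" using EN_integrable[OF assms(1,2)] by auto
  ultimately have m: "(\<lambda>U. real (card (opairs n (rel U))) ^ i * wcount n (rel U) w) \<in> borel_measurable M"
    by (intro borel_measurable_times borel_measurable_power)
  show ?thesis
  proof (rule integrable_const_bound[OF AE_I2 m])
    fix U
    have "card (opairs n (rel U)) \<le> card ({..<n} \<times> {..<n})" by (intro card_mono) (auto simp: opairs_def)
    then have "card (opairs n (rel U)) \<le> n * n" by simp
    then have 1: "real (card (opairs n (rel U))) ^ i \<le> real (n * n) ^ i" by (intro power_mono) (simp_all only: of_nat_le_iff of_nat_0_le_iff)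
    have "card (wlists n (rel U) w) \<le> card (inj_lists n (wlen w))"
      by (rule card_mono[OF finite_inj_lists]) (auto simp: wlists_def)
    then have 2: "wcount n (rel U) w \<le> real (card (inj_lists n (wlen w)))" by (simp add: wcount_def)
    show "norm (real (card (opairs n (rel U))) ^ i * wcount n (rel U) w) \<le> real (n * n) ^ i * real (card (inj_lists n (wlen w)))"
      using mult_mono[OF 1 2] by (simp add: abs_mult)
  qed
qed

text \<open>Each multiplication by the pair count is resolved by \<open>opairs_wcount_le\<close>
  into longer words and the word itself. The word still contains an \<open>At\<close> step, so the
  gain \<open>sc\<^sup>2\<close> persists. The coefficients add up to
  \<open>(1 + real (wlen w))\<^sup>2\<close>, and the budget \<open>k\<close> keeps all tuples at no
  more than \<open>n\<close> points.\<close>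

lemma attach_power_le:
  assumes n: "2 * k \<le> n"
  shows "wvalid w \<Longrightarrow> 1 \<le> prs w \<Longrightarrow> 1 \<le> ats w \<Longrightarrow> prs w + ats w + i \<le> k \<Longrightarrow>
    (\<integral>U. real (card (opairs n (rel U))) ^ i * wcount n (rel U) w \<partial>M) \<le> attach_const k * sc\<^sup>2 * musum k * ((1 + 2 * real k)\<^sup>2) ^ i"
proof (induction i arbitrary: w)
  case 0
  then show ?case using EN_attach_le[of w k] n by (simp add: EN_def)
next
  case (Suc i)
  let ?x = "\<lambda>U. real (card (opairs n (rel U)))" and ?l = "wlen w"
  let ?I = "\<lambda>w. \<integral>U. ?x U ^ i * wcount n (rel U) w \<partial>M"
  let ?B = "attach_const k * sc\<^sup>2 * musum k * ((1 + 2 * real k)\<^sup>2) ^ i"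
  have l: "?l \<le> 2 * k" "Suc (Suc ?l) \<le> 2 * k" using Suc.prems by (simp_all add: wlen_prs_ats)
  have int: "integrable M (\<lambda>U. ?x U ^ j * wcount n (rel U) v)" if "wvalid v" "wlen v \<le> Suc (Suc ?l)" for v j
    using that l n by (intro integrable_opairs_power) auto
  have B0: "?B \<ge> 0" using attach_const_nonneg musum_nonneg by (intro mult_nonneg_nonneg) auto
  have i0: "integrable M (\<lambda>U. ?x U ^ i * wcount n (rel U) (Pr # w))" "integrable M (\<lambda>U. ?x U ^ i * wcount n (rel U) w)"
    and i1: "\<And>p. p < ?l \<Longrightarrow> integrable M (\<lambda>U. ?x U ^ i * wcount n (rel U) (At p # w))"
    using Suc.prems(1) by (auto intro!: int)
  have "(\<integral>U. ?x U ^ Suc i * wcount n (rel U) w \<partial>M)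
    \<le> (\<integral>U. ?x U ^ i * wcount n (rel U) (Pr # w) + 2 * (\<Sum>p<?l. ?x U ^ i * wcount n (rel U) (At p # w)) + (real ?l)\<^sup>2 * (?x U ^ i * wcount n (rel U) w) \<partial>M)"
  proof (rule integral_mono)
    show "integrable M (\<lambda>U. ?x U ^ Suc i * wcount n (rel U) w)" using int[of w "Suc i"] Suc.prems by simp
    show "integrable M (\<lambda>U. ?x U ^ i * wcount n (rel U) (Pr # w) + 2 * (\<Sum>p<?l. ?x U ^ i * wcount n (rel U) (At p # w)) + (real ?l)\<^sup>2 * (?x U ^ i * wcount n (rel U) w))"
      by (intro Bochner_Integration.integrable_add Bochner_Integration.integrable_sum integrable_mult_right i0 i1) auto
    fix U
    have "?x U ^ i * (?x U * wcount n (rel U) w) \<le> ?x U ^ i * (wcount n (rel U) (Pr # w) + 2 * (\<Sum>p<?l. wcount n (rel U) (At p # w)) + (real ?l)\<^sup>2 * wcount n (rel U) w)"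
      by (intro mult_left_mono opairs_wcount_le[OF Suc.prems(1) rel_sym]) auto
    then show "?x U ^ Suc i * wcount n (rel U) w \<le> ?x U ^ i * wcount n (rel U) (Pr # w) + 2 * (\<Sum>p<?l. ?x U ^ i * wcount n (rel U) (At p # w)) + (real ?l)\<^sup>2 * (?x U ^ i * wcount n (rel U) w)"
      by (simp add: distrib_left sum_distrib_left mult_ac)
  qed
  also have "\<dots> = ?I (Pr # w) + 2 * (\<Sum>p<?l. ?I (At p # w)) + (real ?l)\<^sup>2 * ?I w"
  proof -
    have J: "integrable M (\<lambda>U. 2 * (\<Sum>p<?l. ?x U ^ i * wcount n (rel U) (At p # w)))"
      by (intro integrable_mult_right Bochner_Integration.integrable_sum i1) simp
    have K: "integrable M (\<lambda>U. (real ?l)\<^sup>2 * (?x U ^ i * wcount n (rel U) w))"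
      by (intro integrable_mult_right i0)
    have S: "(\<integral>U. (\<Sum>p<?l. ?x U ^ i * wcount n (rel U) (At p # w)) \<partial>M) = (\<Sum>p<?l. ?I (At p # w))"
      by (rule Bochner_Integration.integral_sum) (simp add: i1)
    show ?thesis
      unfolding Bochner_Integration.integral_add[OF Bochner_Integration.integrable_add[OF i0(1) J] K]
        Bochner_Integration.integral_add[OF i0(1) J] integral_mult_right_zero S ..
  qed
  also have "\<dots> \<le> ?B + 2 * (\<Sum>p<?l. ?B) + (real ?l)\<^sup>2 * ?B"
    using Suc.prems by (intro add_mono mult_left_mono sum_mono Suc.IH) auto
  also have "\<dots> = ?B * (1 + real ?l)\<^sup>2" by (simp add: power2_eq_square algebra_simps)
  also have "\<dots> \<le> ?B * (1 + 2 * real k)\<^sup>2" using l B0 by (intro mult_left_mono power_mono) auto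
  finally show ?case by (simp add: mult_ac)
qed

text \<open>The two-sided bound of \<open>opairs_power_stirling\<close> is integrated. By
  \<open>poisson_moment\<close> the Poisson side is the same Stirling combination with
  \<open>(2 * mu) ^ c\<close> in place of the expected counts, so main terms are compared one by
  one, and tuples with a shared point are charged to the summand \<open>sc\<^sup>2\<close> of
  \<open>eps\<close>.\<close>

lemma moment_close:
  assumes k: "k \<ge> 1" and n: "2 * k \<le> n" and C: "C \<ge> 0"
    and St: "\<And>n R. (\<And>i j. R i j \<Longrightarrow> R j i) \<Longrightarrow>
      (\<Sum>c\<le>k. real (Stirling k c) * 2 ^ (k - c) * wcount n R (replicate c Pr)) \<le> real (card (opairs n R)) ^ k \<and>
      real (card (opairs n R)) ^ k \<le> (\<Sum>c\<le>k. real (Stirling k c) * 2 ^ (k - c) * wcount n R (replicate c Pr))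
        + C * (\<Sum>i<k - 1. wcount n R [At 1, Pr] * real (card (opairs n R)) ^ i)"
  defines "D \<equiv> (\<Sum>c\<le>k. real (Stirling k c) * 2 ^ (k - c) * (pairs_const c + fact (2 * c) * 24 ^ c + 2 ^ c))
     + C * (\<Sum>i<k - 1. attach_const k * ((1 + 2 * real k)\<^sup>2) ^ i)"
  shows "\<bar>(\<integral>U. real (card (opairs n (rel U))) ^ k \<partial>M) - 2 ^ k * measure_pmf.expectation (poisson_pmf mu) (\<lambda>m. real m ^ k)\<bar> \<le> D * eps * musum k"
proof -
  let ?x = "\<lambda>U. real (card (opairs n (rel U)))"
  let ?S = "\<lambda>c. real (Stirling k c) * 2 ^ (k - c)"
  let ?m = "\<lambda>U. \<Sum>c\<le>k. ?S c * wcount n (rel U) (replicate c Pr)"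
  let ?e = "\<lambda>U. C * (\<Sum>i<k - 1. ?x U ^ i * wcount n (rel U) [At 1, Pr])"
  let ?K = "\<lambda>c. pairs_const c + fact (2 * c) * 24 ^ c + 2 ^ c"
  let ?D1 = "\<Sum>c\<le>k. ?S c * ?K c" and ?D2 = "C * (\<Sum>i<k - 1. attach_const k * ((1 + 2 * real k)\<^sup>2) ^ i)"
  have n2: "2 \<le> n" using k n by simp
  have ix: "integrable M (\<lambda>U. ?x U ^ k)" using integrable_opairs_power[of "[]" k] n2 by simp
  have im: "integrable M ?m" using n by (intro Bochner_Integration.integrable_sum integrable_mult_right EN_integrable) auto
  have iT: "integrable M (\<lambda>U. ?x U ^ i * wcount n (rel U) [At 1, Pr])" if "i < k - 1" for i
    using that n by (intro integrable_opairs_power) auto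
  have ie: "integrable M ?e" by (intro integrable_mult_right Bochner_Integration.integrable_sum iT) auto
  have sand: "?m U \<le> ?x U ^ k" "?x U ^ k \<le> ?m U + ?e U" for U
  proof -
    have com: "(\<Sum>i<k - 1. wcount n (rel U) [At 1, Pr] * ?x U ^ i) = (\<Sum>i<k - 1. ?x U ^ i * wcount n (rel U) [At 1, Pr])"
      by (rule sum.cong[OF refl mult.commute])
    show "?m U \<le> ?x U ^ k" "?x U ^ k \<le> ?m U + ?e U"
      using St[of "rel U" n, OF rel_sym] unfolding com by blast+
  qed
  have Em: "(\<integral>U. ?m U \<partial>M) = (\<Sum>c\<le>k. ?S c * EN (replicate c Pr))"
    using n by (subst Bochner_Integration.integral_sum) (auto simp: EN_def intro!: integrable_mult_right EN_integrable)
  have lo: "(\<integral>U. ?m U \<partial>M) \<le> (\<integral>U. ?x U ^ k \<partial>M)" by (rule integral_mono[OF im ix sand(1)])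
  have "(\<integral>U. ?x U ^ k \<partial>M) \<le> (\<integral>U. ?m U + ?e U \<partial>M)"
    by (rule integral_mono[OF ix Bochner_Integration.integrable_add[OF im ie] sand(2)])
  also have "\<dots> = (\<integral>U. ?m U \<partial>M) + (\<integral>U. ?e U \<partial>M)" by (rule Bochner_Integration.integral_add[OF im ie])
  finally have up: "(\<integral>U. ?x U ^ k \<partial>M) \<le> (\<integral>U. ?m U \<partial>M) + (\<integral>U. ?e U \<partial>M)" .
  have "(\<integral>U. ?e U \<partial>M) = C * (\<Sum>i<k - 1. \<integral>U. ?x U ^ i * wcount n (rel U) [At 1, Pr] \<partial>M)"
    using iT by (subst integral_mult_right_zero, subst Bochner_Integration.integral_sum) auto
  also have "\<dots> \<le> C * (\<Sum>i<k - 1. attach_const k * sc\<^sup>2 * musum k * ((1 + 2 * real k)\<^sup>2) ^ i)"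
    using C by (intro mult_left_mono sum_mono attach_power_le[OF n]) auto
  also have "\<dots> = ?D2 * sc\<^sup>2 * musum k" by (simp add: sum_distrib_left sum_distrib_right mult_ac)
  also have "\<dots> \<le> ?D2 * eps * musum k"
    using C attach_const_nonneg by (intro mult_right_mono mult_left_mono eps_ge musum_nonneg mult_nonneg_nonneg sum_nonneg) auto
  finally have Ee: "(\<integral>U. ?e U \<partial>M) \<le> ?D2 * eps * musum k" .
  have P: "2 ^ k * measure_pmf.expectation (poisson_pmf mu) (\<lambda>m. real m ^ k) = (\<Sum>c\<le>k. ?S c * (2 * mu) ^ c)"
    unfolding poisson_moment[OF mu_pos] sum_distrib_left
  proof (rule sum.cong)
    fix c assume "c \<in> {..k}"
    then have "(2::real) ^ k = 2 ^ (k - c) * 2 ^ c" by (simp add: power_add[symmetric])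
    then show "2 ^ k * (real (Stirling k c) * mu ^ c) = ?S c * (2 * mu) ^ c" by (simp add: power_mult_distrib)
  qed simp
  have "\<bar>(\<Sum>c\<le>k. ?S c * EN (replicate c Pr)) - (\<Sum>c\<le>k. ?S c * (2 * mu) ^ c)\<bar> = \<bar>\<Sum>c\<le>k. ?S c * (EN (replicate c Pr) - (2 * mu) ^ c)\<bar>"
    by (simp add: sum_subtractf right_diff_distrib)
  also have "\<dots> \<le> (\<Sum>c\<le>k. ?S c * ?K c * eps * musum k)"
  proof (rule order_trans[OF sum_abs], rule sum_mono)
    fix c assume c: "c \<in> {..k}"
    show "\<bar>?S c * (EN (replicate c Pr) - (2 * mu) ^ c)\<bar> \<le> ?S c * ?K c * eps * musum k"
    proof (cases "c = 0")
      \<comment> \<open>Here \<open>Stirling k 0 = 0\<close> since \<open>k \<ge> 1\<close>, so no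
        constant term arises.\<close>
      case True
      then show ?thesis using k by (cases k) auto
    next
      case False
      have "\<bar>EN (replicate c Pr) - (2 * mu) ^ c\<bar> \<le> ?K c * eps * mu ^ c" using c n by (intro EN_pairs_close) auto
      also have "\<dots> \<le> ?K c * eps * musum k"
      proof (intro mult_left_mono mult_nonneg_nonneg eps_ge)
        show "mu ^ c \<le> musum k" unfolding musum_def using False c mu_pos by (intro member_le_sum) auto
        show "0 \<le> ?K c" using pairs_const_nonneg[of c] by simp
      qed
      finally have "?S c * \<bar>EN (replicate c Pr) - (2 * mu) ^ c\<bar> \<le> ?S c * (?K c * eps * musum k)" by (intro mult_left_mono) auto
      then show ?thesis by (simp add: abs_mult mult.assoc)
    qed
  qed
  also have "\<dots> = ?D1 * eps * musum k" by (simp only: sum_distrib_right)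
  finally have main: "\<bar>(\<integral>U. ?m U \<partial>M) - 2 ^ k * measure_pmf.expectation (poisson_pmf mu) (\<lambda>m. real m ^ k)\<bar> \<le> ?D1 * eps * musum k"
    unfolding Em P .
  have "D * eps * musum k = ?D1 * eps * musum k + ?D2 * eps * musum k" unfolding D_def by (simp only: distrib_right)
  then show ?thesis using main lo up Ee by linarith
qed

text \<open>The pair count is twice the number of unordered pairs, so both moments carry the factor
  \<open>2 ^ k \<ge> 1\<close>. Division by the Poisson moment is controlled because it is at least
  \<open>musum k\<close>, which is positive.\<close>

lemma ratio_close:
  assumes k: "k \<ge> 1" and D: "D \<ge> 0"
    and bd: "\<bar>(\<integral>U. real (card (opairs n (rel U))) ^ k \<partial>M) - 2 ^ k * measure_pmf.expectation (poisson_pmf mu) (\<lambda>m. real m ^ k)\<bar> \<le> D * eps * musum k"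
  shows "\<exists>R. (\<integral>U. real (close_pairs I \<gamma> U) ^ k \<partial>M) = measure_pmf.expectation (poisson_pmf mu) (\<lambda>m. real m ^ k) * (1 + R) \<and> \<bar>R\<bar> \<le> D * eps"
proof -
  define P where "P = measure_pmf.expectation (poisson_pmf mu) (\<lambda>m. real m ^ k)"
  define G where "G = (\<integral>U. real (close_pairs I \<gamma> U) ^ k \<partial>M)"
  have "(\<integral>U. real (card (opairs n (rel U))) ^ k \<partial>M) = (\<integral>U. 2 ^ k * real (close_pairs I \<gamma> U) ^ k \<partial>M)"
    by (rule Bochner_Integration.integral_cong) (simp_all add: space_M close_pairs_eq[symmetric] power_mult_distrib)
  then have e: "(\<integral>U. real (card (opairs n (rel U))) ^ k \<partial>M) = 2 ^ k * G" by (simp add: G_def)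
  have Pm: "musum k \<le> P" unfolding P_def musum_def by (rule poisson_moment_ge[OF mu_pos k])
  have "mu ^ 1 \<le> musum k" unfolding musum_def using k mu_pos by (intro member_le_sum) auto
  then have P0: "P > 0" using Pm mu_pos by simp
  have "2 ^ k * \<bar>G - P\<bar> = \<bar>2 ^ k * G - 2 ^ k * P\<bar>" by (simp add: right_diff_distrib[symmetric] abs_mult)
  also have "\<dots> \<le> D * eps * musum k" using bd unfolding e P_def .
  also have "\<dots> \<le> D * eps * P" using D eps_ge(4) Pm by (intro mult_left_mono mult_nonneg_nonneg) auto
  finally have 1: "2 ^ k * \<bar>G - P\<bar> \<le> D * eps * P" .
  have "1 * \<bar>G - P\<bar> \<le> 2 ^ k * \<bar>G - P\<bar>" by (intro mult_right_mono) auto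
  then have "\<bar>G - P\<bar> \<le> D * eps * P" using 1 by simp
  then have "\<bar>(G - P) / P\<bar> \<le> D * eps" using P0 by (simp add: abs_divide field_simps)
  moreover have "G = P * (1 + (G - P) / P)" using P0 by (simp add: field_simps)
  ultimately show ?thesis unfolding G_def P_def by blast
qed

end

theorem mainTheorem5:
  fixes M :: "nat \<Rightarrow> complex mat measure" and k :: nat
  assumes "\<And>n. normalized_haar n (M n)"
    and "k \<ge> 1"
  shows "\<exists>C::real. \<forall>(\<gamma> :: nat \<Rightarrow> real) (I :: nat \<Rightarrow> real set) (\<mu> :: nat \<Rightarrow> real).
    (\<forall>n. \<gamma> n > 0) \<longrightarrow>
    (\<forall>n. is_interval (I n) \<and> I n \<subseteq> {0..<2 * pi} \<and> measure lborel (I n) > 0) \<longrightarrow>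
    (\<forall>n. \<mu> n = measure lborel (I n) * \<gamma> n ^ 3 * real n ^ 4 / (144 * pi\<^sup>2)) \<longrightarrow>
    (\<forall>\<^sub>F n in sequentially. \<exists>R::real.
       (\<integral>A. real (close_pairs (I n) (\<gamma> n) A) ^ k \<partial>M n)
         = measure_pmf.expectation (poisson_pmf (\<mu> n)) (\<lambda>m. real m ^ k) * (1 + R) \<and>
       \<bar>R\<bar> \<le> C * (1 / real n + (\<gamma> n)\<^sup>2 * (real n)\<^sup>2 + ((\<gamma> n)\<^sup>2 * (real n)\<^sup>2) ^ 3
                   + (real n * measure lborel (I n)) powr (- (2 / 3))))"
proof -
  obtain C where C: "C \<ge> 0" and St: "\<And>n R. (\<And>i j. R i j \<Longrightarrow> R j i) \<Longrightarrow>
      (\<Sum>c\<le>k. real (Stirling k c) * 2 ^ (k - c) * wcount n R (replicate c Pr)) \<le> real (card (opairs n R)) ^ k \<and>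
      real (card (opairs n R)) ^ k \<le> (\<Sum>c\<le>k. real (Stirling k c) * 2 ^ (k - c) * wcount n R (replicate c Pr))
        + C * (\<Sum>i<k - 1. wcount n R [At 1, Pr] * real (card (opairs n R)) ^ i)"
    using opairs_power_stirling[of k] unfolding Let_def by blast
  define D where "D = (\<Sum>c\<le>k. real (Stirling k c) * 2 ^ (k - c) * (pairs_const c + fact (2 * c) * 24 ^ c + 2 ^ c))
     + C * (\<Sum>i<k - 1. attach_const k * ((1 + 2 * real k)\<^sup>2) ^ i)"
  have D: "D \<ge> 0" unfolding D_def using C
    by (intro add_nonneg_nonneg sum_nonneg mult_nonneg_nonneg pairs_const_nonneg attach_const_nonneg) auto
  show ?thesis
  proof (intro exI[of _ D] allI impI)
    fix \<gamma> :: "nat \<Rightarrow> real" and I :: "nat \<Rightarrow> real set" and \<mu> :: "nat \<Rightarrow> real"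
    assume g: "\<forall>n. \<gamma> n > 0" and I: "\<forall>n. is_interval (I n) \<and> I n \<subseteq> {0..<2 * pi} \<and> measure lborel (I n) > 0"
      and m: "\<forall>n. \<mu> n = measure lborel (I n) * \<gamma> n ^ 3 * real n ^ 4 / (144 * pi\<^sup>2)"
    show "\<forall>\<^sub>F n in sequentially. \<exists>R::real.
       (\<integral>A. real (close_pairs (I n) (\<gamma> n) A) ^ k \<partial>M n)
         = measure_pmf.expectation (poisson_pmf (\<mu> n)) (\<lambda>m. real m ^ k) * (1 + R) \<and>
       \<bar>R\<bar> \<le> D * (1 / real n + (\<gamma> n)\<^sup>2 * (real n)\<^sup>2 + ((\<gamma> n)\<^sup>2 * (real n)\<^sup>2) ^ 3
                   + (real n * measure lborel (I n)) powr (- (2 / 3)))"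
      \<comment> \<open>The \<open>k\<close>-th moment involves tuples of up to \<open>2 * k\<close>
        distinct eigenvalues, and the correlation formula requires that there be so many.\<close>
      using eventually_ge_at_top[of "2 * k"]
    proof eventually_elim
      case (elim n)
      interpret haar_window "I n" "\<gamma> n" n "M n"
        using g I assms elim by unfold_locales auto
      have mu: "\<mu> n = mu" using m by (simp add: mu_def)
      have eps: "1 / real n + (\<gamma> n)\<^sup>2 * (real n)\<^sup>2 + ((\<gamma> n)\<^sup>2 * (real n)\<^sup>2) ^ 3 + (real n * measure lborel (I n)) powr (- (2 / 3)) = eps"
        by (simp add: eps_def eta_def sc_def Nn_def power_mult_distrib)
      show ?case unfolding mu eps
        using ratio_close[OF assms(2) D moment_close[OF assms(2) elim C St, folded D_def]] .
    qed
  qed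
qed

end
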